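(* Given an integer $d$ and a $d$-degenerate undirected graph $G$ with $n$ vertices and $m$ edges, its vertices can be output in a $d$-degenerate order using $m+3n+o(m+n)$ bits of working space and $O(m+n)$ time. The algorithm can also detect if the given graph is not $d$-degenerate.
   Context: A graph is $d$-degenerate if every induced subgraph has a vertex of degree at most $d$. A $d$-degenerate order is an ordering $v_1,\dots,v_n$ of the vertices such that for each $i$, $v_i$ has at most $d$ neighbours among $v_{i+1},\dots,v_n$. Model: the input graph is stored in read-only memory as a standard adjacency list, output goes to write-only memory, and only the additional random-access workspace is counted, in bits; the workspace is a word RAM with words of $\Omega(\lg n)$ bits. *)

theory Defs
  imports Complex_Main "HOL-Library.Landau_Symbols"
begin

unbundle bit_operations_syntax

section \<open>Degenerate graphs\<close>

definition simple_graph :: "'a set \<Rightarrow> 'a set set \<Rightarrow> bool" where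
  "simple_graph V E \<longleftrightarrow> finite V \<and> (\<forall>e\<in>E. e \<subseteq> V \<and> card e = 2)"

definition neighbours :: "'a set set \<Rightarrow> 'a \<Rightarrow> 'a set" where
  "neighbours E v = {u. {v, u} \<in> E \<and> u \<noteq> v}"

definition degree :: "'a set set \<Rightarrow> 'a \<Rightarrow> nat" where
  "degree E v = card (neighbours E v)"

definition induced_edges :: "'a set set \<Rightarrow> 'a set \<Rightarrow> 'a set set" where
  "induced_edges E U = {e \<in> E. e \<subseteq> U}"

definition degenerate :: "nat \<Rightarrow> 'a set \<Rightarrow> 'a set set \<Rightarrow> bool" where
  "degenerate d V E \<longleftrightarrow>
     (\<forall>U. U \<subseteq> V \<and> U \<noteq> {} \<longrightarrow> (\<exists>v\<in>U. degree (induced_edges E U) v \<le> d))"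

definition degenerate_order :: "nat \<Rightarrow> 'a set \<Rightarrow> 'a set set \<Rightarrow> 'a list \<Rightarrow> bool" where
  "degenerate_order d V E vs \<longleftrightarrow>
     distinct vs \<and> set vs = V \<and>
     (\<forall>i<length vs. card (neighbours E (vs ! i) \<inter> set (drop (Suc i) vs)) \<le> d)"

section \<open>The input: a graph stored as adjacency lists\<close>

text \<open>
  The read-only memory is a list of words. A list node at address \<open>p\<close> stores its value in cell
  \<open>p\<close> and the address of the next node in cell \<open>p + 1\<close>; address 0 is the null pointer.
  \<open>linked_list I p ps\<close> says that following the pointers from \<open>p\<close> visits the nodes \<open>ps\<close>.
\<close>

fun linked_list :: "nat list \<Rightarrow> nat \<Rightarrow> nat list \<Rightarrow> bool" where
  "linked_list I p [] \<longleftrightarrow> p = 0"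
| "linked_list I p (q # ps) \<longleftrightarrow>
     p = q \<and> 0 < q \<and> q + 1 < length I \<and> linked_list I (I ! (q + 1)) ps"

text \<open>
  Vertices are \<open>0, \<dots>, n - 1\<close>. Cell 0 holds \<open>n\<close>, cell 1 holds \<open>d\<close>, and cell \<open>2 + v\<close> points to the
  list of the neighbours of \<open>v\<close>. The nodes (those of \<open>v\<close> are \<open>A v\<close>) occupy pairwise disjoint cells
  outside this header. Nothing else is assumed about where they are placed or about the order
  within a list, and neither \<open>m\<close> nor the degrees are stored. Every cell and every input address fits
  into a word of \<open>w\<close> bits; since \<open>length I \<ge> n + 2 + 4 * m\<close>, this forces \<open>w \<ge> log 2 (n + 2 + 4 * m)\<close>.
\<close>

definition adjacency_list_input ::
    "nat \<Rightarrow> nat \<Rightarrow> nat \<Rightarrow> nat set set \<Rightarrow> nat list \<Rightarrow> bool" where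
  "adjacency_list_input w d n E I \<longleftrightarrow>
     length I \<le> 2 ^ w \<and> (\<forall>x\<in>set I. x < 2 ^ w) \<and>
     n + 2 \<le> length I \<and> I ! 0 = n \<and> I ! 1 = d \<and>
     (\<exists>A :: nat \<Rightarrow> nat list.
        distinct ([0..<n + 2] @ concat (map (\<lambda>p. [p, p + 1]) (concat (map A [0..<n])))) \<and>
        (\<forall>v<n. linked_list I (I ! (2 + v)) (A v) \<and>
               distinct (map ((!) I) (A v)) \<and>
               set (map ((!) I) (A v)) = neighbours E v))"

section \<open>The word RAM with read-only input and write-only output\<close>

text \<open>
  There are no registers outside the workspace: the operands of all instructions are addresses of
  workspace cells, so the whole state, apart from the program counter, is counted as space.
\<close>

datatype binop =
    Add | Sub | Mul | Div | Mod | BitAnd | BitOr | BitXor | ShiftL | ShiftR | Less | Equal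

datatype instr =
    Const nat nat             (* M[a] := k *)
  | WordSize nat              (* M[a] := w *)
  | Arith binop nat nat nat   (* M[a] := M[b] op M[c] *)
  | Load nat nat              (* M[a] := M[M[b]] *)
  | Store nat nat             (* M[M[a]] := M[b] *)
  | ReadInput nat nat         (* M[a] := I[M[b]] *)
  | WriteOutput nat           (* append M[a] to the output *)
  | Jump nat
  | JumpIfZero nat nat        (* if M[a] = 0 jump to l *)
  | Halt bool

text \<open>
  All results are reduced modulo \<open>2 ^ w\<close>; subtraction wraps around, and division by 0 follows
  the conventions of \<^term>\<open>(div)\<close> and \<^term>\<open>(mod)\<close>.
\<close>

fun binop_result :: "nat \<Rightarrow> binop \<Rightarrow> nat \<Rightarrow> nat \<Rightarrow> nat" where
  "binop_result w Add x y = (x + y) mod 2 ^ w"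
| "binop_result w Sub x y = nat ((int x - int y) mod 2 ^ w)"
| "binop_result w Mul x y = (x * y) mod 2 ^ w"
| "binop_result w Div x y = x div y"
| "binop_result w Mod x y = x mod y"
| "binop_result w BitAnd x y = x AND y"
| "binop_result w BitOr x y = x OR y"
| "binop_result w BitXor x y = x XOR y"
| "binop_result w ShiftL x y = (x * 2 ^ y) mod 2 ^ w"
| "binop_result w ShiftR x y = x div 2 ^ y"
| "binop_result w Less x y = of_bool (x < y) mod 2 ^ w"
| "binop_result w Equal x y = of_bool (x = y) mod 2 ^ w"

text \<open>
  One step, from program counter \<open>pc\<close> and workspace \<open>M\<close> to a new program counter, a new workspace
  of the same length, and the words appended to the output. An access outside the workspace or the
  input makes the machine get stuck, so a run that halts with a workspace of \<open>length M\<close>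
  words never touches any further cell.
\<close>

fun step :: "nat \<Rightarrow> nat list \<Rightarrow> instr \<Rightarrow> nat \<Rightarrow> nat list \<Rightarrow> (nat \<times> nat list \<times> nat list) option"
where
  "step w I (Const a k) pc M =
     (if a < length M then Some (Suc pc, M[a := k mod 2 ^ w], []) else None)"
| "step w I (WordSize a) pc M =
     (if a < length M then Some (Suc pc, M[a := w], []) else None)"
| "step w I (Arith f a b c) pc M =
     (if a < length M \<and> b < length M \<and> c < length M
      then Some (Suc pc, M[a := binop_result w f (M ! b) (M ! c)], []) else None)"
| "step w I (Load a b) pc M =
     (if a < length M \<and> b < length M \<and> M ! b < length M
      then Some (Suc pc, M[a := M ! (M ! b)], []) else None)"
| "step w I (Store a b) pc M =
     (if a < length M \<and> b < length M \<and> M ! a < length M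
      then Some (Suc pc, M[M ! a := M ! b], []) else None)"
| "step w I (ReadInput a b) pc M =
     (if a < length M \<and> b < length M \<and> M ! b < length I
      then Some (Suc pc, M[a := I ! (M ! b)], []) else None)"
| "step w I (WriteOutput a) pc M =
     (if a < length M then Some (Suc pc, M, [M ! a]) else None)"
| "step w I (Jump l) pc M = Some (l, M, [])"
| "step w I (JumpIfZero a l) pc M =
     (if a < length M then Some (if M ! a = 0 then l else Suc pc, M, []) else None)"
| "step w I (Halt b) pc M = None"

text \<open>
  \<open>halts_from P w I pc M t out b\<close>: started at program counter \<open>pc\<close> with workspace \<open>M\<close>, the program
  \<open>P\<close> executes exactly \<open>t\<close> instructions, outputs \<open>out\<close>, and stops with answer \<open>b\<close>.
\<close>

inductive halts_from ::
    "instr list \<Rightarrow> nat \<Rightarrow> nat list \<Rightarrow> nat \<Rightarrow> nat list \<Rightarrow> nat \<Rightarrow> nat list \<Rightarrow> bool \<Rightarrow> bool"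
  for P w I where
  halt: "pc < length P \<Longrightarrow> P ! pc = Halt b \<Longrightarrow> halts_from P w I pc M 1 [] b"
| exec: "pc < length P \<Longrightarrow> step w I (P ! pc) pc M = Some (pc', M', os) \<Longrightarrow>
         halts_from P w I pc' M' t out b \<Longrightarrow> halts_from P w I pc M (Suc t) (os @ out) b"

text \<open>A run on input \<open>I\<close> with a workspace of \<open>S\<close> words, that is, of \<open>S * w\<close> bits.\<close>

definition runs_in ::
    "instr list \<Rightarrow> nat \<Rightarrow> nat list \<Rightarrow> nat \<Rightarrow> nat \<Rightarrow> nat list \<Rightarrow> bool \<Rightarrow> bool" where
  "runs_in P w I S t out b \<longleftrightarrow> halts_from P w I 0 (replicate S 0) t out b"

lemma halts_from_deterministic:
  assumes "halts_from P w I pc M t out b" "halts_from P w I pc M t' out' b'"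
  shows "t' = t \<and> out' = out \<and> b' = b"
  using assms
proof (induction arbitrary: t' out' b' rule: halts_from.induct)
  case (halt pc b M)
  from halt.prems show ?case
    by (cases rule: halts_from.cases) (use halt.hyps in auto)
next
  case (exec pc M pc' M' os t out b)
  from exec.prems show ?case
  proof (cases rule: halts_from.cases)
    case halt
    then show ?thesis using exec.hyps by auto
  next
    case (exec pc2 M2 os2 t2 out2)
    then show ?thesis using exec.hyps exec.IH by auto
  qed
qed

end

theory Submission
  imports Defs
begin

text \<open>Vertices of current degree at most \<open>d\<close> are removed one after the other; the graph is degenerate iff
  this removes everything. Instead of the current degrees, the algorithm stores for each remaining vertex the
  number of edges it can lose while its degree stays above \<open>d\<close>, and of this number only the last
  \<open>L\<close> bits. Here \<open>L\<close> is common to a group of 256 consecutive vertices and is the bit length of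
  \<open>D div 1024\<close>, where \<open>D\<close> is the degree sum of the group; as \<open>256 * L \<le> D / 4\<close>, the counters take at most
  \<open>m / 2\<close> bits. Bit \<open>j\<close> of the counters of all groups with \<open>j < L\<close> is stored level by level, and a bit vector
  with rank support leads from a group on one level to the same group on the next. When a counter passes below
  zero, the current degree is recounted from the adjacency list, at cost \<open>O(D)\<close>; this happens once in
  \<open>2 ^ L > D / 1024\<close> decrements, so the total cost is linear. Two further bits per vertex record whether
  it has been removed and whether it waits for its removal. If words have fewer than 256 bits, then \<open>n\<close> is
  bounded and a naive algorithm suffices. Both are written in a small while language with packed
  arrays, which is compiled to the RAM.\<close>

section \<open>A while language with packed arrays and its compiler\<close>

text \<open>The bound allows o(m + n) bits of overhead and words have o(m + n) bits, so every fixed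
  number of words is free, even 2^255 of them. This is what makes a register file at a huge constant
  address affordable, and what reduces short words to a case of constant size. The obstacle behind
  the levels is that counters of different lengths have to be located without storing a pointer for
  each vertex. Sharing the length among 256 vertices leaves about n / 256 objects to index, so the
  index can spend a constant number of bits on each of its nodes. The divisor 1024 is then free to
  be large: it shrinks the counters and costs only a constant factor in time. Two bits per vertex
  and m / 2 bits of counters leave about n + m / 2 bits of slack, which absorb incompletely filled
  words and rank samples. The second obstacle is the set of pending vertices: a plain stack of them
  could need n entries of logarithmic size. It is kept as a bit vector with a sparse summary, and
  only the nonempty blocks of the summary are on a stack.\<close>

datatype exp = Var nat | Lit nat | Wsz | Bin binop exp exp | Get nat exp | Inp exp

datatype com = Skip | Asg nat exp | Put nat exp exp | Out exp | Seq com com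
  | Cond exp com com | While exp com

text \<open>Arithmetic on unbounded naturals, which agrees with the machine only where
  \<open>safe\<close> holds. Bitwise operations receive the default value 0 and are never
  \<open>safe\<close>, so source programs set and clear bits by addition and subtraction.\<close>

fun exact :: "binop \<Rightarrow> nat \<Rightarrow> nat \<Rightarrow> nat" where
  "exact Add x y = x + y"
| "exact Sub x y = x - y"
| "exact Mul x y = x * y"
| "exact Div x y = x div y"
| "exact Mod x y = x mod y"
| "exact ShiftL x y = x * 2 ^ y"
| "exact ShiftR x y = x div 2 ^ y"
| "exact Less x y = of_bool (x < y)"
| "exact Equal x y = of_bool (x = y)"
| "exact _ x y = 0"

fun safe :: "nat \<Rightarrow> binop \<Rightarrow> nat \<Rightarrow> nat \<Rightarrow> bool" where
  "safe w Add x y \<longleftrightarrow> x + y < 2 ^ w"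
| "safe w Sub x y \<longleftrightarrow> y \<le> x"
| "safe w Mul x y \<longleftrightarrow> x * y < 2 ^ w"
| "safe w Div x y \<longleftrightarrow> True"
| "safe w Mod x y \<longleftrightarrow> True"
| "safe w ShiftL x y \<longleftrightarrow> x * 2 ^ y < 2 ^ w"
| "safe w ShiftR x y \<longleftrightarrow> True"
| "safe w Less x y \<longleftrightarrow> True"
| "safe w Equal x y \<longleftrightarrow> True"
| "safe w _ x y \<longleftrightarrow> False"

lemma binop_result_exact:
  assumes "safe w f x y" "x < 2 ^ w" "y < 2 ^ w" "0 < w"
  shows "binop_result w f x y = exact f x y" "exact f x y < 2 ^ w"
proof -
  have 1: "1 < (2 :: nat) ^ w" using assms(4) by (intro one_less_power) auto
  have "x div z < 2 ^ w" "x mod z < 2 ^ w" for z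
    using assms(2) by (meson div_le_dividend mod_less_eq_dividend order.strict_trans1)+
  moreover have "(int x - int y) mod 2 ^ w = int x - int y" if "y \<le> x"
  proof (rule mod_pos_pos_trivial)
    have "int x < 2 ^ w" using assms(2) by (metis of_nat_less_iff of_nat_numeral of_nat_power)
    then show "int x - int y < 2 ^ w" by linarith
  qed (use that in simp)
  ultimately show "binop_result w f x y = exact f x y" "exact f x y < 2 ^ w"
    using assms 1 by (cases f; auto simp: of_bool_def nat_diff_distrib)+
qed

text \<open>Register addresses are constants of the program and cannot depend on \<open>w\<close>.
  If words have fewer than 256 bits, computed addresses never reach \<open>reg_base\<close>, so
  arrays can lie below it; otherwise the cells below \<open>reg_base\<close> take at most half of
  the address space and the arrays lie above the registers.\<close>

definition reg_base :: nat where "reg_base = 2 ^ 255"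

abbreviation reg :: "nat \<Rightarrow> nat" where "reg r \<equiv> reg_base + r"
abbreviation tmp :: "nat \<Rightarrow> nat" where "tmp t \<equiv> reg_base + (200 + t)"

text \<open>Height of the stack of temporaries: a right operand is evaluated one cell above the left
  one, and \<open>get_code\<close> works on three cells.\<close>

fun depth :: "exp \<Rightarrow> nat" where
  "depth (Bin f a b) = max (depth a) (Suc (depth b))"
| "depth (Get k e) = max (depth e) 3"
| "depth (Inp e) = depth e"
| "depth _ = 1"

text \<open>Cells \<open>reg (100 + 2 * k)\<close> and \<open>reg (101 + 2 * k)\<close> hold the first address of array \<open>k\<close> and the
  number of bits of its entries; no entry straddles two words.\<close>

definition get_code :: "nat \<Rightarrow> nat \<Rightarrow> instr list" where
  "get_code k t =
     [WordSize (tmp (t + 1)),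
      Arith Div (tmp (t + 1)) (tmp (t + 1)) (reg (101 + 2 * k)),
      Arith Div (tmp (t + 2)) (tmp t) (tmp (t + 1)),
      Arith Add (tmp (t + 2)) (tmp (t + 2)) (reg (100 + 2 * k)),
      Load (tmp (t + 2)) (tmp (t + 2)),
      Arith Mod (tmp (t + 1)) (tmp t) (tmp (t + 1)),
      Arith Mul (tmp (t + 1)) (tmp (t + 1)) (reg (101 + 2 * k)),
      Arith ShiftR (tmp (t + 2)) (tmp (t + 2)) (tmp (t + 1)),
      Const (tmp (t + 1)) 1,
      Arith ShiftL (tmp (t + 1)) (tmp (t + 1)) (reg (101 + 2 * k)),
      Arith Mod (tmp t) (tmp (t + 2)) (tmp (t + 1))]"

fun comp_exp :: "exp \<Rightarrow> nat \<Rightarrow> instr list" where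
  "comp_exp (Var r) t = [Arith BitOr (tmp t) (reg r) (reg r)]"
| "comp_exp (Lit k) t = [Const (tmp t) k]"
| "comp_exp Wsz t = [WordSize (tmp t)]"
| "comp_exp (Bin f a b) t =
     comp_exp a t @ comp_exp b (Suc t) @ [Arith f (tmp t) (tmp t) (tmp (Suc t))]"
| "comp_exp (Inp e) t = comp_exp e t @ [ReadInput (tmp t) (tmp t)]"
| "comp_exp (Get k e) t = comp_exp e t @ get_code k t"

text \<open>Index and value are expected in \<open>tmp 0\<close> and \<open>tmp 1\<close>. The old
  field is isolated, shifted back into place and subtracted; then the shifted new value is
  added.\<close>

definition put_code :: "nat \<Rightarrow> instr list" where
  "put_code k =
     [WordSize (tmp 2),
      Arith Div (tmp 2) (tmp 2) (reg (101 + 2 * k)),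
      Arith Div (tmp 3) (tmp 0) (tmp 2),
      Arith Add (tmp 3) (tmp 3) (reg (100 + 2 * k)),
      Arith Mod (tmp 4) (tmp 0) (tmp 2),
      Arith Mul (tmp 4) (tmp 4) (reg (101 + 2 * k)),
      Load (tmp 5) (tmp 3),
      Arith ShiftR (tmp 6) (tmp 5) (tmp 4),
      Const (tmp 7) 1,
      Arith ShiftL (tmp 7) (tmp 7) (reg (101 + 2 * k)),
      Arith Mod (tmp 6) (tmp 6) (tmp 7),
      Arith ShiftL (tmp 6) (tmp 6) (tmp 4),
      Arith Sub (tmp 5) (tmp 5) (tmp 6),
      Arith ShiftL (tmp 6) (tmp 1) (tmp 4),
      Arith Add (tmp 5) (tmp 5) (tmp 6),
      Store (tmp 3) (tmp 5)]"

fun shallow :: "com \<Rightarrow> bool" where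
  "shallow Skip \<longleftrightarrow> True"
| "shallow (Asg r e) \<longleftrightarrow> depth e \<le> 90"
| "shallow (Put k e1 e2) \<longleftrightarrow> depth e1 \<le> 90 \<and> depth e2 \<le> 90"
| "shallow (Out e) \<longleftrightarrow> depth e \<le> 90"
| "shallow (Seq c1 c2) \<longleftrightarrow> shallow c1 \<and> shallow c2"
| "shallow (Cond e c1 c2) \<longleftrightarrow> depth e \<le> 90 \<and> shallow c1 \<and> shallow c2"
| "shallow (While e c) \<longleftrightarrow> depth e \<le> 90 \<and> shallow c"

fun csize :: "com \<Rightarrow> nat" where
  "csize Skip = 0"
| "csize (Asg r e) = length (comp_exp e 0) + 1"
| "csize (Put k e1 e2) = length (comp_exp e1 0) + length (comp_exp e2 1) + length (put_code k)"
| "csize (Out e) = length (comp_exp e 0) + 1"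
| "csize (Seq c1 c2) = csize c1 + csize c2"
| "csize (Cond e c1 c2) = length (comp_exp e 0) + 2 + csize c1 + csize c2"
| "csize (While e c) = length (comp_exp e 0) + 2 + csize c"

fun comp :: "nat \<Rightarrow> com \<Rightarrow> instr list" where
  "comp pc Skip = []"
| "comp pc (Asg r e) = comp_exp e 0 @ [Arith BitOr (reg r) (tmp 0) (tmp 0)]"
| "comp pc (Put k e1 e2) = comp_exp e1 0 @ comp_exp e2 1 @ put_code k"
| "comp pc (Out e) = comp_exp e 0 @ [WriteOutput (tmp 0)]"
| "comp pc (Seq c1 c2) = comp pc c1 @ comp (pc + csize c1) c2"
| "comp pc (Cond e c1 c2) =
     (let a = length (comp_exp e 0) + 1 in
      comp_exp e 0 @ [JumpIfZero (tmp 0) (pc + a + csize c1 + 1)] @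
      comp (pc + a) c1 @ [Jump (pc + a + csize c1 + 1 + csize c2)] @
      comp (pc + a + csize c1 + 1) c2)"
| "comp pc (While e c) =
     (let a = length (comp_exp e 0) + 1 in
      comp_exp e 0 @ [JumpIfZero (tmp 0) (pc + a + csize c + 1)] @
      comp (pc + a) c @ [Jump pc])"

lemma length_comp: "length (comp pc c) = csize c"
  by (induction c arbitrary: pc) (auto simp: Let_def)

section \<open>Replacing one bit field of a word\<close>

definition field :: "nat \<Rightarrow> nat \<Rightarrow> nat \<Rightarrow> nat" where
  "field b j x = x div 2 ^ (j * b) mod 2 ^ b"

lemma field_less: "field b j x < 2 ^ b"
  by (simp add: field_def)

lemma field_le: "field b j x * 2 ^ (j * b) \<le> x"
proof -
  have "field b j x * 2 ^ (j * b) \<le> x div 2 ^ (j * b) * 2 ^ (j * b)"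
    unfolding field_def by (intro mult_right_mono) auto
  also have "\<dots> \<le> x" by simp
  finally show ?thesis .
qed

text \<open>Splitting \<open>x\<close> into a high part, field \<open>j\<close> and a low part shows
  that only the middle digit is exchanged. The auxiliary fact \<open>decomp\<close> reads every
  field off such a splitting and is applied to the old and to the new word.\<close>

lemma field_update:
  fixes x v b j :: nat
  assumes "v < 2 ^ b"
  defines "x' \<equiv> x - field b j x * 2 ^ (j * b) + v * 2 ^ (j * b)"
  shows "field b j' x' = (if j' = j then v else field b j' x)"
    and "x < 2 ^ (b * r) \<Longrightarrow> j < r \<Longrightarrow> x' < 2 ^ (b * r)"
proof -
  define hi where "hi = x div 2 ^ (j * b) div 2 ^ b"
  define lo where "lo = x mod 2 ^ (j * b)"
  have lo: "lo < 2 ^ (j * b)" by (simp add: lo_def)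
  have x: "x = (hi * 2 ^ b + field b j x) * 2 ^ (j * b) + lo"
    by (simp add: hi_def lo_def field_def div_mult_mod_eq)
  have x': "x' = (hi * 2 ^ b + v) * 2 ^ (j * b) + lo"
    unfolding x'_def by (subst (1) x) (simp add: algebra_simps)
  have decomp: "field b j' ((hi * 2 ^ b + u) * 2 ^ (j * b) + lo) =
     (if j' = j then u else if j' < j then field b j' lo else field b (j' - Suc j) hi)"
    if u: "u < 2 ^ b" for u
  proof -
    consider "j' = j" | "j' < j" | "j < j'" by linarith
    then show ?thesis
    proof cases
      case 1
      then show ?thesis using u lo by (simp add: field_def)
    next
      case 2
      then obtain k where k: "j = j' + Suc k" using less_imp_Suc_add by (metis add_Suc_right)
      have "(hi * 2 ^ b + u) * 2 ^ (j * b) + lo =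
            ((hi * 2 ^ b + u) * 2 ^ (k * b)) * 2 ^ b * 2 ^ (j' * b) + lo"
        by (simp add: k algebra_simps power_add)
      then have "((hi * 2 ^ b + u) * 2 ^ (j * b) + lo) div 2 ^ (j' * b) =
            ((hi * 2 ^ b + u) * 2 ^ (k * b)) * 2 ^ b + lo div 2 ^ (j' * b)"
        by (metis add.commute div_mult_self1 power_not_zero zero_neq_numeral)
      then show ?thesis using 2 by (simp add: field_def)
    next
      case 3
      then obtain k where k: "j' = j + Suc k" using less_imp_Suc_add by (metis add_Suc_right)
      have e: "(2 :: nat) ^ (j' * b) = 2 ^ (j * b) * (2 ^ b * 2 ^ (k * b))"
        by (simp add: k algebra_simps power_add)
      have "((hi * 2 ^ b + u) * 2 ^ (j * b) + lo) div 2 ^ (j' * b) = hi div 2 ^ (k * b)"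
        unfolding e div_mult2_eq using lo u by simp
      then show ?thesis using 3 by (simp add: field_def k)
    qed
  qed
  show "field b j' x' = (if j' = j then v else field b j' x)"
    unfolding x' decomp[OF assms(1)] by (subst x, subst decomp[OF field_less]) simp
  show "x' < 2 ^ (b * r)" if "x < 2 ^ (b * r)" "j < r"
  proof -
    obtain k where k: "r = j + Suc k" using \<open>j < r\<close> less_imp_Suc_add by (metis add_Suc_right)
    have e: "(2 :: nat) ^ (b * r) = 2 ^ (k * b) * 2 ^ b * 2 ^ (j * b)"
      by (simp add: k algebra_simps power_add)
    have "hi < 2 ^ (k * b)"
      using that(1) unfolding hi_def e by (simp add: less_mult_imp_div_less)
    then have "(hi + 1) * 2 ^ b \<le> 2 ^ (k * b) * 2 ^ b" by (intro mult_right_mono) auto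
    then have "hi * 2 ^ b + v + 1 \<le> 2 ^ (k * b) * 2 ^ b" using assms(1) by simp
    then have "(hi * 2 ^ b + v + 1) * 2 ^ (j * b) \<le> 2 ^ (b * r)"
      unfolding e by (intro mult_right_mono) auto
    then show ?thesis unfolding x' using lo by (simp add: algebra_simps)
  qed
qed

section \<open>Straight-line code and composable runs\<close>

fun exec_list :: "nat \<Rightarrow> nat list \<Rightarrow> instr list \<Rightarrow> nat list \<Rightarrow> nat list option" where
  "exec_list w I [] M = Some M"
| "exec_list w I (i # is) M =
     (case step w I i 0 M of None \<Rightarrow> None | Some (pc, M', os) \<Rightarrow> exec_list w I is M')"

fun straight :: "instr \<Rightarrow> bool" where
  "straight (WriteOutput a) = False"
| "straight (Jump l) = False"
| "straight (JumpIfZero a l) = False"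
| "straight (Halt b) = False"
| "straight _ = True"

lemma step_straight:
  assumes "straight i" "step w I i 0 M = Some (p, M', os)"
  shows "step w I i pc M = Some (Suc pc, M', [])"
  using assms by (cases i) (auto split: if_splits)

lemma straight_comp_exp: "i \<in> set (comp_exp e t) \<Longrightarrow> straight i"
  by (induction e arbitrary: t) (auto simp: get_code_def)

lemma straight_put_code: "i \<in> set (put_code k) \<Longrightarrow> straight i"
  by (auto simp: put_code_def)

lemma exec_list_append:
  "exec_list w I (xs @ ys) M =
   (case exec_list w I xs M of None \<Rightarrow> None | Some M' \<Rightarrow> exec_list w I ys M')"
  by (induction xs arbitrary: M) (auto split: option.splits)

text \<open>The relation \<open>halts_from\<close> describes complete runs only; the simulation
  proof has to concatenate fragments of runs together with their times and outputs.\<close>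

inductive reaches ::
    "instr list \<Rightarrow> nat \<Rightarrow> nat list \<Rightarrow> nat \<Rightarrow> nat list \<Rightarrow> nat \<Rightarrow> nat list \<Rightarrow> nat \<Rightarrow> nat list \<Rightarrow> bool"
  for P w I where
  refl: "reaches P w I pc M 0 [] pc M"
| step: "pc < length P \<Longrightarrow> step w I (P ! pc) pc M = Some (pc', M', os) \<Longrightarrow>
         reaches P w I pc' M' t os' pc'' M'' \<Longrightarrow> reaches P w I pc M (Suc t) (os @ os') pc'' M''"

lemma reaches_trans:
  assumes "reaches P w I pc M t os pc' M'" "reaches P w I pc' M' t' os' pc'' M''"
  shows "reaches P w I pc M (t + t') (os @ os') pc'' M''"
  using assms by (induction rule: reaches.induct) (auto intro: reaches.step)

lemma reaches_one:
  assumes "pc < length P" "step w I (P ! pc) pc M = Some (pc', M', os)"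
  shows "reaches P w I pc M 1 os pc' M'"
  using reaches.step[OF assms reaches.refl] by simp

lemma reaches_halts:
  assumes "reaches P w I pc M t os pc' M'" "halts_from P w I pc' M' t' out b"
  shows "halts_from P w I pc M (t + t') (os @ out) b"
  using assms by (induction rule: reaches.induct) (auto intro: halts_from.exec)

definition code_at :: "instr list \<Rightarrow> nat \<Rightarrow> instr list \<Rightarrow> bool" where
  "code_at P pc is \<longleftrightarrow> (\<exists>xs ys. P = xs @ is @ ys \<and> length xs = pc)"

lemma code_at_append:
  "code_at P pc (xs @ ys) \<Longrightarrow> code_at P pc xs"
  "code_at P pc (xs @ ys) \<Longrightarrow> code_at P (pc + length xs) ys"
  unfolding code_at_def by (metis append.assoc length_append)+

lemma code_at_Cons:
  assumes "code_at P pc (x # xs)"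
  shows "pc < length P" "P ! pc = x" "code_at P (Suc pc) xs"
proof -
  show "code_at P (Suc pc) xs" using code_at_append(2)[of P pc "[x]" xs] assms by simp
qed (use assms in \<open>auto simp: code_at_def nth_append\<close>)

lemma reaches_exec_list:
  assumes "code_at P pc is" "\<And>i. i \<in> set is \<Longrightarrow> straight i" "exec_list w I is M = Some M'"
  shows "reaches P w I pc M (length is) [] (pc + length is) M'"
  using assms
proof (induction "is" arbitrary: pc M)
  case Nil
  then show ?case by (simp add: reaches.refl)
next
  case (Cons i "is")
  from Cons.prems(3) obtain p M1 os where s: "step w I i 0 M = Some (p, M1, os)"
    and e: "exec_list w I is M1 = Some M'"
    by (auto split: option.splits)
  note c = code_at_Cons[OF Cons.prems(1)]
  have "step w I (P ! pc) pc M = Some (Suc pc, M1, [])"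
    using step_straight[OF _ s] Cons.prems(2) c(2) by simp
  from reaches.step[OF c(1) this Cons.IH[OF c(3) _ e]] Cons.prems(2)
  show ?case by simp
qed

section \<open>Semantics of the while language\<close>

locale machine =
  fixes w :: nat and I :: "nat list" and S :: nat
    and base width len :: "nat \<Rightarrow> nat"
begin

fun ev :: "exp \<Rightarrow> (nat \<Rightarrow> nat) \<Rightarrow> (nat \<Rightarrow> nat \<Rightarrow> nat) \<Rightarrow> nat" where
  "ev (Var r) \<sigma> \<alpha> = \<sigma> r"
| "ev (Lit k) \<sigma> \<alpha> = k"
| "ev Wsz \<sigma> \<alpha> = w"
| "ev (Bin f a b) \<sigma> \<alpha> = exact f (ev a \<sigma> \<alpha>) (ev b \<sigma> \<alpha>)"
| "ev (Get k e) \<sigma> \<alpha> = \<alpha> k (ev e \<sigma> \<alpha>)"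
| "ev (Inp e) \<sigma> \<alpha> = I ! ev e \<sigma> \<alpha>"

text \<open>Addresses and entry widths are computed at run time. An array may be accessed once its
  two registers hold the values that the layout prescribes; \<open>k < 50\<close> keeps these
  registers below 200.\<close>

definition array_ok :: "nat \<Rightarrow> (nat \<Rightarrow> nat) \<Rightarrow> bool" where
  "array_ok k \<sigma> \<longleftrightarrow> k < 50 \<and> \<sigma> (100 + 2 * k) = base k \<and> \<sigma> (101 + 2 * k) = width k"

text \<open>No intermediate result overflows and no access leaves its array or the input, which is
  why \<open>ev\<close> can work without reduction modulo \<open>2 ^ w\<close>.\<close>

fun ok :: "exp \<Rightarrow> (nat \<Rightarrow> nat) \<Rightarrow> (nat \<Rightarrow> nat \<Rightarrow> nat) \<Rightarrow> bool" where
  "ok (Var r) \<sigma> \<alpha> \<longleftrightarrow> r < 200"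
| "ok (Lit k) \<sigma> \<alpha> \<longleftrightarrow> k < 2 ^ w"
| "ok Wsz \<sigma> \<alpha> \<longleftrightarrow> True"
| "ok (Bin f a b) \<sigma> \<alpha> \<longleftrightarrow> ok a \<sigma> \<alpha> \<and> ok b \<sigma> \<alpha> \<and> safe w f (ev a \<sigma> \<alpha>) (ev b \<sigma> \<alpha>)"
| "ok (Get k e) \<sigma> \<alpha> \<longleftrightarrow> ok e \<sigma> \<alpha> \<and> ev e \<sigma> \<alpha> < len k \<and> array_ok k \<sigma>"
| "ok (Inp e) \<sigma> \<alpha> \<longleftrightarrow> ok e \<sigma> \<alpha> \<and> ev e \<sigma> \<alpha> < length I"

definition put :: "(nat \<Rightarrow> nat \<Rightarrow> nat) \<Rightarrow> nat \<Rightarrow> nat \<Rightarrow> nat \<Rightarrow> (nat \<Rightarrow> nat \<Rightarrow> nat)" where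
  "put \<alpha> k i v = \<alpha>(k := (\<alpha> k)(i := v))"

text \<open>The last argument of \<open>exec\<close> before and after counts executed commands and tests.\<close>

inductive exec ::
  "com \<Rightarrow> (nat \<Rightarrow> nat) \<Rightarrow> (nat \<Rightarrow> nat \<Rightarrow> nat) \<Rightarrow> nat list \<Rightarrow> nat \<Rightarrow>
   (nat \<Rightarrow> nat) \<Rightarrow> (nat \<Rightarrow> nat \<Rightarrow> nat) \<Rightarrow> nat list \<Rightarrow> nat \<Rightarrow> bool"
where
  Skip: "exec Skip \<sigma> \<alpha> os t \<sigma> \<alpha> os t"
| Asg: "ok e \<sigma> \<alpha> \<Longrightarrow> r < 200 \<Longrightarrow> exec (Asg r e) \<sigma> \<alpha> os t (\<sigma>(r := ev e \<sigma> \<alpha>)) \<alpha> os (Suc t)"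
| Put: "ok e1 \<sigma> \<alpha> \<Longrightarrow> ok e2 \<sigma> \<alpha> \<Longrightarrow> ev e1 \<sigma> \<alpha> < len k \<Longrightarrow> ev e2 \<sigma> \<alpha> < 2 ^ width k \<Longrightarrow>
     array_ok k \<sigma> \<Longrightarrow>
     exec (Put k e1 e2) \<sigma> \<alpha> os t \<sigma> (put \<alpha> k (ev e1 \<sigma> \<alpha>) (ev e2 \<sigma> \<alpha>)) os (Suc t)"
| Out: "ok e \<sigma> \<alpha> \<Longrightarrow> exec (Out e) \<sigma> \<alpha> os t \<sigma> \<alpha> (os @ [ev e \<sigma> \<alpha>]) (Suc t)"
| Seq: "exec c1 \<sigma> \<alpha> os t \<sigma>1 \<alpha>1 os1 t1 \<Longrightarrow> exec c2 \<sigma>1 \<alpha>1 os1 t1 \<sigma>2 \<alpha>2 os2 t2 \<Longrightarrow>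
     exec (Seq c1 c2) \<sigma> \<alpha> os t \<sigma>2 \<alpha>2 os2 t2"
| CondTrue: "ok e \<sigma> \<alpha> \<Longrightarrow> ev e \<sigma> \<alpha> \<noteq> 0 \<Longrightarrow> exec c1 \<sigma> \<alpha> os (Suc t) \<sigma>1 \<alpha>1 os1 t1 \<Longrightarrow>
     exec (Cond e c1 c2) \<sigma> \<alpha> os t \<sigma>1 \<alpha>1 os1 t1"
| CondFalse: "ok e \<sigma> \<alpha> \<Longrightarrow> ev e \<sigma> \<alpha> = 0 \<Longrightarrow> exec c2 \<sigma> \<alpha> os (Suc t) \<sigma>1 \<alpha>1 os1 t1 \<Longrightarrow>
     exec (Cond e c1 c2) \<sigma> \<alpha> os t \<sigma>1 \<alpha>1 os1 t1"
| WhileFalse: "ok e \<sigma> \<alpha> \<Longrightarrow> ev e \<sigma> \<alpha> = 0 \<Longrightarrow> exec (While e c) \<sigma> \<alpha> os t \<sigma> \<alpha> os (Suc t)"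
| WhileTrue: "ok e \<sigma> \<alpha> \<Longrightarrow> ev e \<sigma> \<alpha> \<noteq> 0 \<Longrightarrow> exec c \<sigma> \<alpha> os (Suc t) \<sigma>1 \<alpha>1 os1 t1 \<Longrightarrow>
     exec (While e c) \<sigma>1 \<alpha>1 os1 t1 \<sigma>2 \<alpha>2 os2 t2 \<Longrightarrow> exec (While e c) \<sigma> \<alpha> os t \<sigma>2 \<alpha>2 os2 t2"

lemma exec_time: "exec c \<sigma> \<alpha> os t \<sigma>' \<alpha>' os' t' \<Longrightarrow> t \<le> t'"
  by (induction rule: exec.induct) auto

text \<open>Demanding an execution makes this total correctness, including the absence of stuck
  accesses. As the clock is an argument of the postcondition, time bounds are proved like any other
  assertion.\<close>

definition wp ::
  "com \<Rightarrow> ((nat \<Rightarrow> nat) \<Rightarrow> (nat \<Rightarrow> nat \<Rightarrow> nat) \<Rightarrow> nat list \<Rightarrow> nat \<Rightarrow> bool) \<Rightarrow>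
   (nat \<Rightarrow> nat) \<Rightarrow> (nat \<Rightarrow> nat \<Rightarrow> nat) \<Rightarrow> nat list \<Rightarrow> nat \<Rightarrow> bool" where
  "wp c Q \<sigma> \<alpha> os t \<longleftrightarrow> (\<exists>\<sigma>' \<alpha>' os' t'. exec c \<sigma> \<alpha> os t \<sigma>' \<alpha>' os' t' \<and> Q \<sigma>' \<alpha>' os' t')"

inductive_cases exec_SkipE: "exec Skip \<sigma> \<alpha> os t \<sigma>' \<alpha>' os' t'"
inductive_cases exec_AsgE: "exec (Asg r e) \<sigma> \<alpha> os t \<sigma>' \<alpha>' os' t'"
inductive_cases exec_PutE: "exec (Put k e1 e2) \<sigma> \<alpha> os t \<sigma>' \<alpha>' os' t'"
inductive_cases exec_OutE: "exec (Out e) \<sigma> \<alpha> os t \<sigma>' \<alpha>' os' t'"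
inductive_cases exec_SeqE: "exec (Seq c1 c2) \<sigma> \<alpha> os t \<sigma>' \<alpha>' os' t'"
inductive_cases exec_CondE: "exec (Cond e c1 c2) \<sigma> \<alpha> os t \<sigma>' \<alpha>' os' t'"
inductive_cases exec_WhileE: "exec (While e c) \<sigma> \<alpha> os t \<sigma>' \<alpha>' os' t'"

lemma wp_Skip: "wp Skip Q \<sigma> \<alpha> os t \<longleftrightarrow> Q \<sigma> \<alpha> os t"
  unfolding wp_def by (blast intro: exec.Skip elim: exec_SkipE)

lemma wp_Asg:
  "wp (Asg r e) Q \<sigma> \<alpha> os t \<longleftrightarrow> ok e \<sigma> \<alpha> \<and> r < 200 \<and> Q (\<sigma>(r := ev e \<sigma> \<alpha>)) \<alpha> os (Suc t)"
  unfolding wp_def by (blast intro: exec.Asg elim: exec_AsgE)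

lemma wp_Put:
  "wp (Put k e1 e2) Q \<sigma> \<alpha> os t \<longleftrightarrow> ok e1 \<sigma> \<alpha> \<and> ok e2 \<sigma> \<alpha> \<and> ev e1 \<sigma> \<alpha> < len k \<and>
     ev e2 \<sigma> \<alpha> < 2 ^ width k \<and> array_ok k \<sigma> \<and>
     Q \<sigma> (put \<alpha> k (ev e1 \<sigma> \<alpha>) (ev e2 \<sigma> \<alpha>)) os (Suc t)"
  unfolding wp_def by (blast intro: exec.Put elim: exec_PutE)

lemma wp_Out:
  "wp (Out e) Q \<sigma> \<alpha> os t \<longleftrightarrow> ok e \<sigma> \<alpha> \<and> Q \<sigma> \<alpha> (os @ [ev e \<sigma> \<alpha>]) (Suc t)"
  unfolding wp_def by (blast intro: exec.Out elim: exec_OutE)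

lemma wp_Seq: "wp (Seq c1 c2) Q \<sigma> \<alpha> os t \<longleftrightarrow> wp c1 (wp c2 Q) \<sigma> \<alpha> os t"
  unfolding wp_def by (blast intro: exec.Seq elim: exec_SeqE)

lemma wp_Cond:
  "wp (Cond e c1 c2) Q \<sigma> \<alpha> os t \<longleftrightarrow>
     ok e \<sigma> \<alpha> \<and> (if ev e \<sigma> \<alpha> \<noteq> 0 then wp c1 Q \<sigma> \<alpha> os (Suc t) else wp c2 Q \<sigma> \<alpha> os (Suc t))"
  unfolding wp_def by (cases "ev e \<sigma> \<alpha> = 0") (auto elim!: exec_CondE, (blast intro: exec.CondTrue exec.CondFalse)+)

lemma wp_mono:
  "wp c Q \<sigma> \<alpha> os t \<Longrightarrow> (\<And>\<sigma>' \<alpha>' os' t'. Q \<sigma>' \<alpha>' os' t' \<Longrightarrow> Q' \<sigma>' \<alpha>' os' t') \<Longrightarrow> wp c Q' \<sigma> \<alpha> os t"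
  unfolding wp_def by blast

lemma wp_While:
  "wp (While e c) Q \<sigma> \<alpha> os t \<longleftrightarrow>
     ok e \<sigma> \<alpha> \<and> (if ev e \<sigma> \<alpha> \<noteq> 0 then wp c (wp (While e c) Q) \<sigma> \<alpha> os (Suc t) else Q \<sigma> \<alpha> os (Suc t))"
  (is "?L \<longleftrightarrow> ?R")
proof
  assume ?L
  then obtain \<sigma>' \<alpha>' os' t' where x: "exec (While e c) \<sigma> \<alpha> os t \<sigma>' \<alpha>' os' t'"
    and q: "Q \<sigma>' \<alpha>' os' t'"
    by (auto simp: wp_def)
  from x show ?R
  proof (rule exec_WhileE, goal_cases)
    case 1
    then show ?case using q by simp
  next
    case (2 \<sigma>1 \<alpha>1 os1 t1)
    then have "wp (While e c) Q \<sigma>1 \<alpha>1 os1 t1" using q unfolding wp_def by blast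
    then have "wp c (wp (While e c) Q) \<sigma> \<alpha> os (Suc t)" using 2(3) unfolding wp_def[of c] by blast
    then show ?case using 2 by simp
  qed
next
  assume R: ?R
  show ?L
  proof (cases "ev e \<sigma> \<alpha> = 0")
    case True
    then show ?thesis using R exec.WhileFalse unfolding wp_def by (simp, blast)
  next
    case False
    with R obtain \<sigma>1 \<alpha>1 os1 t1 where 1: "exec c \<sigma> \<alpha> os (Suc t) \<sigma>1 \<alpha>1 os1 t1"
      "wp (While e c) Q \<sigma>1 \<alpha>1 os1 t1"
      by (auto simp: wp_def[of c])
    from 1(2) obtain \<sigma>2 \<alpha>2 os2 t2 where 2: "exec (While e c) \<sigma>1 \<alpha>1 os1 t1 \<sigma>2 \<alpha>2 os2 t2" "Q \<sigma>2 \<alpha>2 os2 t2"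
      by (auto simp: wp_def)
    from exec.WhileTrue[OF _ False 1(1) 2(1)] R 2(2) show ?thesis by (auto simp: wp_def)
  qed
qed

text \<open>The bound \<open>T\<close> on the clock yields termination, since every iteration advances the clock.\<close>

lemma wp_While_invariant:
  assumes "J \<sigma> \<alpha> os t"
    and ok: "\<And>\<sigma> \<alpha> os t. J \<sigma> \<alpha> os t \<Longrightarrow> ok e \<sigma> \<alpha> \<and> t \<le> T"
    and body: "\<And>\<sigma> \<alpha> os t. J \<sigma> \<alpha> os t \<Longrightarrow> ev e \<sigma> \<alpha> \<noteq> 0 \<Longrightarrow> wp c J \<sigma> \<alpha> os (Suc t)"
    and exit: "\<And>\<sigma> \<alpha> os t. J \<sigma> \<alpha> os t \<Longrightarrow> ev e \<sigma> \<alpha> = 0 \<Longrightarrow> Q \<sigma> \<alpha> os (Suc t)"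
  shows "wp (While e c) Q \<sigma> \<alpha> os t"
  using assms(1)
proof (induction "T - t" arbitrary: \<sigma> \<alpha> os t rule: less_induct)
  case less
  show ?case
  proof (cases "ev e \<sigma> \<alpha> = 0")
    case True
    then show ?thesis using ok exit less.prems by (subst wp_While) simp
  next
    case False
    from body[OF less.prems False] obtain \<sigma>1 \<alpha>1 os1 t1
      where x: "exec c \<sigma> \<alpha> os (Suc t) \<sigma>1 \<alpha>1 os1 t1" and J: "J \<sigma>1 \<alpha>1 os1 t1"
      by (auto simp: wp_def)
    have "t < t1" "t1 \<le> T" using exec_time[OF x] ok[OF J] by auto
    then have "wp (While e c) Q \<sigma>1 \<alpha>1 os1 t1" using less.hyps[OF _ J] by simp
    then have "wp c (wp (While e c) Q) \<sigma> \<alpha> os (Suc t)" using x unfolding wp_def[of c] by blast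
    then show ?thesis using False ok[OF less.prems] by (subst wp_While) simp
  qed
qed

lemmas wp_simps = wp_Skip wp_Asg wp_Put wp_Out wp_Seq wp_Cond

section \<open>Representation of arrays in memory words\<close>

definition adr :: "nat \<Rightarrow> nat \<Rightarrow> nat" where
  "adr k i = base k + i div (w div width k)"

definition cell :: "nat list \<Rightarrow> nat \<Rightarrow> nat \<Rightarrow> nat" where
  "cell M k i = field (width k) (i mod (w div width k)) (M ! adr k i)"

text \<open>The temporaries \<open>reg 200\<close> to \<open>reg 299\<close> are left unconstrained,
  so evaluating an expression preserves the relation.\<close>

definition represents :: "nat list \<Rightarrow> (nat \<Rightarrow> nat) \<Rightarrow> (nat \<Rightarrow> nat \<Rightarrow> nat) \<Rightarrow> bool" where
  "represents M \<sigma> \<alpha> \<longleftrightarrow> length M = S \<and> (\<forall>a<S. M ! a < 2 ^ w) \<and> (\<forall>r<200. M ! reg r = \<sigma> r) \<and>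
     (\<forall>k i. i < len k \<longrightarrow> cell M k i = \<alpha> k i)"

end

section \<open>Correctness of the compiler\<close>

text \<open>The alternative in \<open>adr_regs\<close> covers both placements: below the registers
  for short words, above them for long words.\<close>

locale layout = machine +
  assumes w_pos: "0 < w"
    and input_bound: "\<forall>x\<in>set I. x < 2 ^ w"
    and regs_S: "reg_base + 300 \<le> S"
    and width: "0 < width k" "width k \<le> w"
    and adr_S: "i < len k \<Longrightarrow> adr k i < S"
    and adr_w: "i < len k \<Longrightarrow> adr k i < 2 ^ w"
    and adr_regs: "i < len k \<Longrightarrow> adr k i < reg_base \<or> reg_base + 300 \<le> adr k i"
    and adr_disjoint: "i < len k \<Longrightarrow> i' < len k' \<Longrightarrow> k \<noteq> k' \<Longrightarrow> adr k i \<noteq> adr k' i'"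
begin

lemma per_word: "0 < w div width k" "i mod (w div width k) * width k < w" "i mod (w div width k) < w div width k"
proof -
  show 1: "0 < w div width k" using width[of k] by (simp add: div_greater_zero_iff)
  then show 2: "i mod (w div width k) < w div width k" by simp
  then have "i mod (w div width k) * width k < (w div width k) * width k" using width[of k] by simp
  also have "\<dots> \<le> w" by simp
  finally show "i mod (w div width k) * width k < w" .
qed

lemma w_less: "w < 2 ^ w" by simp

lemma represents_cong:
  assumes "represents M \<sigma> \<alpha>" "length M' = S" "\<forall>a<S. M' ! a < 2 ^ w"
    and "\<And>a. a < S \<Longrightarrow> a < tmp 0 \<or> tmp 100 \<le> a \<Longrightarrow> M' ! a = M ! a"
  shows "represents M' \<sigma> \<alpha>"
proof -
  have "cell M' k i = cell M k i" if "i < len k" for k i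
    using adr_S[OF that] adr_regs[OF that] assms(4) by (auto simp: cell_def)
  moreover have "M' ! reg r = M ! reg r" if "r < 200" for r
    using regs_S that by (intro assms(4)) auto
  ultimately show ?thesis using assms(1-3) by (simp add: represents_def)
qed

text \<open>For \<open>b = w\<close> the shifted one wraps around to 0, and
  \<open>x mod 0 = x\<close> is then exactly the right result, so entries as wide as a word need no
  special code.\<close>

lemma mod_pow: "x < 2 ^ w \<Longrightarrow> b \<le> w \<Longrightarrow> x mod (2 ^ b mod 2 ^ w) = x mod (2 ^ b :: nat)"
  by (cases "b = w") auto

end

section \<open>Effect of single instructions\<close>

context layout begin

definition bounded :: "nat list \<Rightarrow> bool" where
  "bounded M \<longleftrightarrow> length M = S \<and> (\<forall>a<S. M ! a < 2 ^ w)"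

lemma cell_S: "j < 300 \<Longrightarrow> reg_base + j < S"
  using regs_S by simp

text \<open>The new memory gets a name and a lookup equation. This keeps the states of long
  instruction sequences flat instead of building nested list updates.\<close>

lemma bounded_update:
  assumes "bounded M" "v < 2 ^ w" "j < S"
  obtains M' where "M[j := v] = M'" "bounded M'" "\<And>a. M' ! a = (if a = j then v else M ! a)"
proof
  show "bounded (M[j := v])" using assms by (auto simp: bounded_def nth_list_update)
  show "M[j := v] ! a = (if a = j then v else M ! a)" for a
    using assms by (auto simp: bounded_def nth_list_update)
qed simp

lemma exec_Arith:
  assumes "bounded M" "a < 300" "b < S" "c < S" "safe w f (M ! b) (M ! c)"
  obtains M' where "\<And>is. exec_list w I (Arith f (reg_base + a) b c # is) M = exec_list w I is M'"
    "bounded M'" "\<And>i. M' ! i = (if i = reg_base + a then exact f (M ! b) (M ! c) else M ! i)"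
proof -
  have b: "M ! b < 2 ^ w" "M ! c < 2 ^ w" using assms by (auto simp: bounded_def)
  note r = binop_result_exact[OF assms(5) b w_pos]
  note v = r(2)
  obtain M' where M': "M[reg_base + a := exact f (M ! b) (M ! c)] = M'" "bounded M'" "\<And>i. M' ! i = (if i = reg_base + a then exact f (M ! b) (M ! c) else M ! i)"
    by (rule bounded_update[OF assms(1) v cell_S[OF assms(2)]], rule that)
  show thesis
  proof (rule that[OF _ M'(2,3)])
    show "exec_list w I (Arith f (reg_base + a) b c # is) M = exec_list w I is M'" for "is"
      using assms(1) assms(3,4) r(1) cell_S[OF assms(2)] by (simp add: M'(1) bounded_def)
  qed
qed

lemma exec_WordSize:
  assumes "bounded M" "a < 300"
  obtains M' where "\<And>is. exec_list w I (WordSize (reg_base + a) # is) M = exec_list w I is M'"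
    "bounded M'" "\<And>i. M' ! i = (if i = reg_base + a then w else M ! i)"
proof -
  note v = w_less
  obtain M' where M': "M[reg_base + a := w] = M'" "bounded M'" "\<And>i. M' ! i = (if i = reg_base + a then w else M ! i)"
    by (rule bounded_update[OF assms(1) v cell_S[OF assms(2)]], rule that)
  show thesis
  proof (rule that[OF _ M'(2,3)])
    show "exec_list w I (WordSize (reg_base + a) # is) M = exec_list w I is M'" for "is"
      using assms(1) cell_S[OF assms(2)] by (simp add: M'(1) bounded_def)
  qed
qed

lemma exec_Const:
  assumes "bounded M" "a < 300" "v < 2 ^ w"
  obtains M' where "\<And>is. exec_list w I (Const (reg_base + a) v # is) M = exec_list w I is M'"
    "bounded M'" "\<And>i. M' ! i = (if i = reg_base + a then v else M ! i)"
proof -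
  note v = assms(3)
  obtain M' where M': "M[reg_base + a := v] = M'" "bounded M'" "\<And>i. M' ! i = (if i = reg_base + a then v else M ! i)"
    by (rule bounded_update[OF assms(1) v cell_S[OF assms(2)]], rule that)
  show thesis
  proof (rule that[OF _ M'(2,3)])
    show "exec_list w I (Const (reg_base + a) v # is) M = exec_list w I is M'" for "is"
      using assms(1) assms(3) cell_S[OF assms(2)] by (simp add: M'(1) bounded_def)
  qed
qed

lemma exec_Load:
  assumes "bounded M" "a < 300" "b < S" "M ! b < S"
  obtains M' where "\<And>is. exec_list w I (Load (reg_base + a) b # is) M = exec_list w I is M'"
    "bounded M'" "\<And>i. M' ! i = (if i = reg_base + a then M ! (M ! b) else M ! i)"
proof -
  have v: "M ! (M ! b) < 2 ^ w" using assms by (simp add: bounded_def)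
  obtain M' where M': "M[reg_base + a := M ! (M ! b)] = M'" "bounded M'" "\<And>i. M' ! i = (if i = reg_base + a then M ! (M ! b) else M ! i)"
    by (rule bounded_update[OF assms(1) v cell_S[OF assms(2)]], rule that)
  show thesis
  proof (rule that[OF _ M'(2,3)])
    show "exec_list w I (Load (reg_base + a) b # is) M = exec_list w I is M'" for "is"
      using assms(1) assms(3,4) cell_S[OF assms(2)] by (simp add: M'(1) bounded_def)
  qed
qed

text \<open>Disjunction of a cell with itself serves as the copy instruction.\<close>

lemma exec_Move:
  assumes "bounded M" "a < 300" "b < S"
  obtains M' where "\<And>is. exec_list w I (Arith BitOr (reg_base + a) b b # is) M = exec_list w I is M'"
    "bounded M'" "\<And>i. M' ! i = (if i = reg_base + a then M ! b else M ! i)"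
proof -
  have v: "M ! b < 2 ^ w" using assms by (simp add: bounded_def)
  obtain M' where M': "M[reg_base + a := M ! b] = M'" "bounded M'" "\<And>i. M' ! i = (if i = reg_base + a then M ! b else M ! i)"
    by (rule bounded_update[OF assms(1) v cell_S[OF assms(2)]], rule that)
  show thesis
  proof (rule that[OF _ M'(2,3)])
    show "exec_list w I (Arith BitOr (reg_base + a) b b # is) M = exec_list w I is M'" for "is"
      using assms(1) assms(3) cell_S[OF assms(2)] by (simp add: M'(1) bounded_def)
  qed
qed

lemma exec_ReadInput:
  assumes "bounded M" "a < 300" "b < S" "M ! b < length I"
  obtains M' where "\<And>is. exec_list w I (ReadInput (reg_base + a) b # is) M = exec_list w I is M'"
    "bounded M'" "\<And>i. M' ! i = (if i = reg_base + a then I ! (M ! b) else M ! i)"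
proof -
  have v: "I ! (M ! b) < 2 ^ w" using assms input_bound by simp
  obtain M' where M': "M[reg_base + a := I ! (M ! b)] = M'" "bounded M'" "\<And>i. M' ! i = (if i = reg_base + a then I ! (M ! b) else M ! i)"
    by (rule bounded_update[OF assms(1) v cell_S[OF assms(2)]], rule that)
  show thesis
  proof (rule that[OF _ M'(2,3)])
    show "exec_list w I (ReadInput (reg_base + a) b # is) M = exec_list w I is M'" for "is"
      using assms(1) assms(3,4) cell_S[OF assms(2)] by (simp add: M'(1) bounded_def)
  qed
qed

lemma exec_Store:
  assumes "bounded M" "a < S" "b < S" "M ! a < S"
  obtains M' where "\<And>is. exec_list w I (Store a b # is) M = exec_list w I is M'"
    "bounded M'" "\<And>i. M' ! i = (if i = M ! a then M ! b else M ! i)"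
proof -
  have v: "M ! b < 2 ^ w" using assms by (simp add: bounded_def)
  obtain M' where M': "M[M ! a := M ! b] = M'" "bounded M'" "\<And>i. M' ! i = (if i = M ! a then M ! b else M ! i)"
    by (rule bounded_update[OF assms(1) v assms(4)], rule that)
  show thesis
  proof (rule that[OF _ M'(2,3)])
    show "exec_list w I (Store a b # is) M = exec_list w I is M'" for "is"
      using assms(1) assms(2-4) by (simp add: M'(1) bounded_def)
  qed
qed

lemma two_pow_width: "x < 2 ^ w \<Longrightarrow> x mod (2 ^ width k mod 2 ^ w) = x mod (2 ^ width k :: nat)"
  using mod_pow width by blast

text \<open>The shift may overflow to 0 for entries of full width, so it is not \<open>safe\<close>
  and falls outside \<open>exec_Arith\<close>; both instructions are treated as one unit.\<close>

lemma exec_mask: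
  assumes "bounded M" "a < 300" "b < 300" "a \<noteq> b" "M ! (reg_base + b) = width k"
  obtains M' where
    "\<And>is. exec_list w I (Const (reg_base + a) 1 # Arith ShiftL (reg_base + a) (reg_base + a) (reg_base + b) # is) M =
      exec_list w I is M'"
    "bounded M'" "\<And>i. M' ! i = (if i = reg_base + a then 2 ^ width k mod 2 ^ w else M ! i)"
proof -
  have 1: "1 < (2 :: nat) ^ w" using w_pos by (intro one_less_power) auto
  obtain M1 where
    M1: "\<And>is. exec_list w I (Const (reg_base + a) 1 # is) M = exec_list w I is M1"
    "bounded M1" "\<And>i. M1 ! i = (if i = reg_base + a then 1 else M ! i)"
    by (rule exec_Const[OF assms(1,2) 1], rule that)
  have v: "2 ^ width k mod 2 ^ w < (2 :: nat) ^ w" by simp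
  obtain M2 where
    M2: "M1[reg_base + a := 2 ^ width k mod 2 ^ w] = M2" "bounded M2"
    "\<And>i. M2 ! i = (if i = reg_base + a then 2 ^ width k mod 2 ^ w else M1 ! i)"
    by (rule bounded_update[OF M1(2) v cell_S[OF assms(2)]], rule that)
  show thesis
  proof (rule that[OF _ M2(2)])
    fix "is"
    have "step w I (Arith ShiftL (reg_base + a) (reg_base + a) (reg_base + b)) 0 M1 = Some (1, M2, [])"
      using M1(2) assms(4,5) cell_S[OF assms(2)] cell_S[OF assms(3)]
      by (simp add: M1(3) M2(1) bounded_def)
    then show "exec_list w I (Const (reg_base + a) 1 # Arith ShiftL (reg_base + a) (reg_base + a) (reg_base + b) # is) M =
      exec_list w I is M2"
      unfolding M1(1) by simp
  qed (simp add: M2(3) M1(3))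
qed

lemma exec_Get_code:
  assumes R: "represents M \<sigma> \<alpha>" and "array_ok k \<sigma>" and i: "i < len k" and Mi: "M ! tmp t = i"
    and t: "t + 3 \<le> 100"
  shows "\<exists>M'. exec_list w I (get_code k t) M = Some M' \<and>
     bounded M' \<and> M' ! tmp t = \<alpha> k i \<and>
     (\<forall>a<S. a < tmp t \<or> tmp 100 \<le> a \<longrightarrow> M' ! a = M ! a)"
proof -
  have k: "k < 50" "M ! reg (100 + 2 * k) = base k" "M ! reg (101 + 2 * k) = width k"
    using assms(1,2) by (auto simp: array_ok_def represents_def)
  have k': "101 + 2 * k < 200" using k by simp
  have b0: "bounded M" using R by (auto simp: represents_def bounded_def)
  have ad: "i div (w div width k) + base k < 2 ^ w" "i div (w div width k) + base k = adr k i" "adr k i < S"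
    using adr_w[OF i] adr_S[OF i] by (auto simp: adr_def add.commute)
  have sh: "i mod (w div width k) * width k < 2 ^ w"
    using per_word(2)[of i k] w_less by (rule less_trans)
  have ne: "adr k i \<noteq> reg_base + j" if "j < 300" for j
    using adr_regs[OF i] that by auto
  have v: "\<alpha> k i = M ! adr k i div 2 ^ (i mod (w div width k) * width k) mod 2 ^ width k"
    using R i by (auto simp: represents_def cell_def field_def)
  have vless: "M ! adr k i div 2 ^ (i mod (w div width k) * width k) < 2 ^ w"
    using b0 ad(3) by (meson div_le_dividend le_less_trans bounded_def)
  note S = cell_S[of "200 + t"] cell_S[of "200 + (t + 1)"] cell_S[of "200 + (t + 2)"]
    cell_S[of "100 + 2 * k"] cell_S[of "101 + 2 * k"]
  have le: "200 + (t + 1) < 300" "200 + (t + 2) < 300" "200 + t < 300" "101 + 2 * k < 300" "100 + 2 * k < 300"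
    using t k' by auto
  note ne' = ne[OF le(1)] ne[OF le(2)] ne[OF le(3)]
  obtain M1 where M1: "\<And>is. exec_list w I (WordSize (tmp (t + 1)) # is) M = exec_list w I is M1"
    "bounded M1" "\<And>i. M1 ! i = (if i = tmp (t + 1) then w else M ! i)"
    by (rule exec_WordSize[OF b0 le(1)], rule that)
  obtain M2 where M2: "\<And>is. exec_list w I (Arith Div (tmp (t + 1)) (tmp (t + 1)) (reg (101 + 2 * k)) # is) M1 = exec_list w I is M2"
    "bounded M2" "\<And>i. M2 ! i = (if i = tmp (t + 1) then w div width k else M1 ! i)"
    by (rule exec_Arith[OF M1(2) le(1), of "tmp (t + 1)" "reg (101 + 2 * k)" Div])
       (use S le k k' in \<open>auto simp: M1(3)\<close>)
  obtain M3 where M3: "\<And>is. exec_list w I (Arith Div (tmp (t + 2)) (tmp t) (tmp (t + 1)) # is) M2 = exec_list w I is M3"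
    "bounded M3" "\<And>j. M3 ! j = (if j = tmp (t + 2) then i div (w div width k) else M2 ! j)"
    by (rule exec_Arith[OF M2(2) le(2), of "tmp t" "tmp (t + 1)" Div])
       (use S le k k' Mi in \<open>auto simp: M1(3) M2(3)\<close>)
  obtain M4 where M4: "\<And>is. exec_list w I (Arith Add (tmp (t + 2)) (tmp (t + 2)) (reg (100 + 2 * k)) # is) M3 = exec_list w I is M4"
    "bounded M4" "\<And>j. M4 ! j = (if j = tmp (t + 2) then adr k i else M3 ! j)"
    by (rule exec_Arith[OF M3(2) le(2), of "tmp (t + 2)" "reg (100 + 2 * k)" Add])
       (use S le k k' Mi ad in \<open>auto simp: M1(3) M2(3) M3(3)\<close>)
  obtain M5 where M5: "\<And>is. exec_list w I (Load (tmp (t + 2)) (tmp (t + 2)) # is) M4 = exec_list w I is M5"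
    "bounded M5" "\<And>j. M5 ! j = (if j = tmp (t + 2) then M ! adr k i else M4 ! j)"
    by (rule exec_Load[OF M4(2) le(2), of "tmp (t + 2)"])
       (use S le ad ne' in \<open>auto simp: M1(3) M2(3) M3(3) M4(3)\<close>)
  obtain M6 where M6: "\<And>is. exec_list w I (Arith Mod (tmp (t + 1)) (tmp t) (tmp (t + 1)) # is) M5 = exec_list w I is M6"
    "bounded M6" "\<And>j. M6 ! j = (if j = tmp (t + 1) then i mod (w div width k) else M5 ! j)"
    by (rule exec_Arith[OF M5(2) le(1), of "tmp t" "tmp (t + 1)" Mod])
       (use S le Mi in \<open>auto simp: M1(3) M2(3) M3(3) M4(3) M5(3)\<close>)
  obtain M7 where M7: "\<And>is. exec_list w I (Arith Mul (tmp (t + 1)) (tmp (t + 1)) (reg (101 + 2 * k)) # is) M6 = exec_list w I is M7"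
    "bounded M7" "\<And>j. M7 ! j = (if j = tmp (t + 1) then i mod (w div width k) * width k else M6 ! j)"
    by (rule exec_Arith[OF M6(2) le(1), of "tmp (t + 1)" "reg (101 + 2 * k)" Mul])
       (use S le k k' Mi sh in \<open>auto simp: M1(3) M2(3) M3(3) M4(3) M5(3) M6(3)\<close>)
  obtain M8 where M8: "\<And>is. exec_list w I (Arith ShiftR (tmp (t + 2)) (tmp (t + 2)) (tmp (t + 1)) # is) M7 = exec_list w I is M8"
    "bounded M8" "\<And>j. M8 ! j = (if j = tmp (t + 2) then M ! adr k i div 2 ^ (i mod (w div width k) * width k) else M7 ! j)"
    by (rule exec_Arith[OF M7(2) le(2), of "tmp (t + 2)" "tmp (t + 1)" ShiftR])
       (use S le in \<open>auto simp: M4(3) M5(3) M6(3) M7(3)\<close>)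
  have w8: "M8 ! reg (101 + 2 * k) = width k"
    using k k' by (simp add: M1(3) M2(3) M3(3) M4(3) M5(3) M6(3) M7(3) M8(3))
  obtain M9 where M9: "\<And>is. exec_list w I (Const (tmp (t + 1)) 1 # Arith ShiftL (tmp (t + 1)) (tmp (t + 1)) (reg (101 + 2 * k)) # is) M8 = exec_list w I is M9"
    "bounded M9" "\<And>j. M9 ! j = (if j = tmp (t + 1) then 2 ^ width k mod 2 ^ w else M8 ! j)"
    by (rule exec_mask[OF M8(2) le(1,4) _ w8], use k' in simp, rule that)
  obtain M10 where M10: "\<And>is. exec_list w I (Arith Mod (tmp t) (tmp (t + 2)) (tmp (t + 1)) # is) M9 = exec_list w I is M10"
    "bounded M10" "\<And>j. M10 ! j = (if j = tmp t then \<alpha> k i else M9 ! j)"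
    by (rule exec_Arith[OF M9(2) le(3), of "tmp (t + 2)" "tmp (t + 1)" Mod])
       (use S le in \<open>auto simp: M8(3) M9(3) two_pow_width[OF vless] v\<close>)
  show ?thesis
    by (rule exI[of _ M10], unfold get_code_def M1(1) M2(1) M3(1) M4(1) M5(1) M6(1) M7(1) M8(1) M9(1) M10(1))
       (use t M10(2) in \<open>auto simp: M1(3) M2(3) M3(3) M4(3) M5(3) M6(3) M7(3) M8(3) M9(3) M10(3)\<close>)
qed

lemma exec_put_code:
  assumes R: "represents M \<sigma> \<alpha>" and "array_ok k \<sigma>" and i: "i < len k"
    and Mi: "M ! tmp 0 = i" and Mv: "M ! tmp 1 = v" and v: "v < 2 ^ width k"
  shows "\<exists>M'. exec_list w I (put_code k) M = Some M' \<and> represents M' \<sigma> (put \<alpha> k i v)"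
proof -
  define q j where "q = w div width k" and "j = i mod q"
  define x where "x = M ! adr k i"
  define x' where "x' = x - field (width k) j x * 2 ^ (j * width k) + v * 2 ^ (j * width k)"
  have k: "k < 50" "M ! reg (100 + 2 * k) = base k" "M ! reg (101 + 2 * k) = width k"
    using assms(1,2) by (auto simp: array_ok_def represents_def)
  have k': "101 + 2 * k < 200" using k by simp
  have b0: "bounded M" using R by (auto simp: represents_def bounded_def)
  have ad: "i div q + base k < 2 ^ w" "i div q + base k = adr k i" "adr k i < S"
    using adr_w[OF i] adr_S[OF i] by (auto simp: adr_def q_def add.commute)
  have sh: "j * width k < 2 ^ w" "j < q"
    using per_word(2)[of i k] per_word(3)[of i k] w_less unfolding q_def j_def by (auto intro: less_trans)
  have ne: "adr k i \<noteq> reg_base + j" if "j < 300" for j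
    using adr_regs[OF i] that by auto
  have x: "x < 2 ^ w" using b0 ad(3) by (auto simp: bounded_def x_def)
  have xs: "x div 2 ^ (j * width k) < 2 ^ w" using x by (meson div_le_dividend le_less_trans)
  have f: "field (width k) j x * 2 ^ (j * width k) \<le> x" by (rule field_le)
  have vs: "v * 2 ^ (j * width k) < 2 ^ w"
  proof -
    have "v * 2 ^ (j * width k) < 2 ^ width k * 2 ^ (j * width k)" using v by simp
    also have "\<dots> = 2 ^ (Suc j * width k)" by (simp add: power_add)
    also have "\<dots> \<le> 2 ^ (q * width k)" using sh(2) by (intro power_increasing mult_right_mono) auto
    also have "\<dots> \<le> 2 ^ w" by (intro power_increasing) (auto simp: q_def)
    finally show ?thesis .
  qed
  \<comment> \<open>The width need not divide \<open>w\<close>, so a word may have surplus bits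
    above its \<open>q\<close> fields. They form \<open>hi\<close>, which the update leaves alone,
    while \<open>field_update\<close> bounds the part \<open>lo\<close> that consists of whole
    fields.\<close>
  have x': "x' < 2 ^ w"
  proof -
    define hi where "hi = x div 2 ^ (q * width k)"
    define lo where "lo = x mod 2 ^ (q * width k)"
    have qw: "q * width k \<le> w" by (simp add: q_def)
    have e: "(2::nat) ^ (q * width k) = 2 ^ ((q - Suc j) * width k) * 2 ^ (Suc j * width k)"
    proof -
      have "q * width k = (q - Suc j) * width k + Suc j * width k"
        using sh(2) unfolding add_mult_distrib[symmetric] by simp
      then show ?thesis by (simp only: power_add)
    qed
    have fe: "field (width k) j x = field (width k) j lo"
    proof -
      have "x = hi * 2 ^ ((q - Suc j) * width k) * 2 ^ width k * 2 ^ (j * width k) + lo"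
      proof -
        have "x = hi * 2 ^ (q * width k) + lo" by (simp only: hi_def lo_def div_mult_mod_eq)
        also have "(2::nat) ^ (q * width k) = 2 ^ ((q - Suc j) * width k) * (2 ^ width k * 2 ^ (j * width k))"
          by (simp only: e mult_Suc power_add)
        finally show ?thesis by (simp only: mult.assoc)
      qed
      then have "x div 2 ^ (j * width k) = hi * 2 ^ ((q - Suc j) * width k) * 2 ^ width k + lo div 2 ^ (j * width k)"
        by simp
      then show ?thesis by (simp add: field_def)
    qed
    have "lo < 2 ^ (width k * q)" by (simp add: lo_def mult.commute)
    from field_update(2)[OF v this sh(2)]
    have l': "lo - field (width k) j lo * 2 ^ (j * width k) + v * 2 ^ (j * width k) < 2 ^ (q * width k)"
      by (simp add: mult.commute)
    have "x' = hi * 2 ^ (q * width k) + (lo - field (width k) j lo * 2 ^ (j * width k) + v * 2 ^ (j * width k))"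
      using div_mult_mod_eq[of x "2 ^ (q * width k)"] field_le[of "width k" j lo] unfolding x'_def fe
      by (simp add: hi_def lo_def)
    also have "\<dots> < (hi + 1) * 2 ^ (q * width k)" using l' by simp
    also have "\<dots> \<le> 2 ^ (w - q * width k) * 2 ^ (q * width k)"
    proof (intro mult_right_mono)
      have "x < 2 ^ (w - q * width k) * 2 ^ (q * width k)" using x qw by (simp flip: power_add)
      then have "hi < 2 ^ (w - q * width k)" unfolding hi_def by (simp add: less_mult_imp_div_less)
      then show "hi + 1 \<le> 2 ^ (w - q * width k)" by simp
    qed simp
    also have "\<dots> = 2 ^ w" using qw by (simp flip: power_add)
    finally show ?thesis .
  qed
  note S = cell_S[of 200] cell_S[of 201] cell_S[of 202] cell_S[of 203] cell_S[of 204] cell_S[of 205]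
    cell_S[of 206] cell_S[of 207] cell_S[of "100 + 2 * k"] cell_S[of "101 + 2 * k"]
  note ne' = ne[of 200] ne[of 201] ne[of 202] ne[of 203] ne[of 204] ne[of 205] ne[of 206] ne[of 207]
  have kk: "101 + 2 * k < 300" using k' by simp
  obtain M1 where M1: "\<And>is. exec_list w I (WordSize (tmp 2) # is) M = exec_list w I is M1"
    "bounded M1" "\<And>i. M1 ! i = (if i = tmp 2 then w else M ! i)"
    by (rule exec_WordSize[OF b0, of "200 + 2"], simp, rule that)
  obtain M2 where M2: "\<And>is. exec_list w I (Arith Div (tmp 2) (tmp 2) (reg (101 + 2 * k)) # is) M1 = exec_list w I is M2"
    "bounded M2" "\<And>i. M2 ! i = (if i = tmp 2 then q else M1 ! i)"
    by (rule exec_Arith[OF M1(2), of "200 + 2" "tmp 2" "reg (101 + 2 * k)" Div])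
       (use S k k' in \<open>auto simp: M1(3) q_def\<close>)
  obtain M3 where M3: "\<And>is. exec_list w I (Arith Div (tmp 3) (tmp 0) (tmp 2) # is) M2 = exec_list w I is M3"
    "bounded M3" "\<And>j. M3 ! j = (if j = tmp 3 then i div q else M2 ! j)"
    by (rule exec_Arith[OF M2(2), of "200 + 3" "tmp 0" "tmp 2" Div])
       (use S k k' Mi in \<open>auto simp: M1(3) M2(3)\<close>)
  obtain M4 where M4: "\<And>is. exec_list w I (Arith Add (tmp 3) (tmp 3) (reg (100 + 2 * k)) # is) M3 = exec_list w I is M4"
    "bounded M4" "\<And>j. M4 ! j = (if j = tmp 3 then adr k i else M3 ! j)"
    by (rule exec_Arith[OF M3(2), of "200 + 3" "tmp 3" "reg (100 + 2 * k)" Add])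
       (use S k k' ad in \<open>auto simp: M1(3) M2(3) M3(3)\<close>)
  obtain M5 where M5: "\<And>is. exec_list w I (Arith Mod (tmp 4) (tmp 0) (tmp 2) # is) M4 = exec_list w I is M5"
    "bounded M5" "\<And>a. M5 ! a = (if a = tmp 4 then j else M4 ! a)"
    by (rule exec_Arith[OF M4(2), of "200 + 4" "tmp 0" "tmp 2" Mod])
       (use S Mi in \<open>auto simp: M1(3) M2(3) M3(3) M4(3) j_def\<close>)
  obtain M6 where M6: "\<And>is. exec_list w I (Arith Mul (tmp 4) (tmp 4) (reg (101 + 2 * k)) # is) M5 = exec_list w I is M6"
    "bounded M6" "\<And>a. M6 ! a = (if a = tmp 4 then j * width k else M5 ! a)"
    by (rule exec_Arith[OF M5(2), of "200 + 4" "tmp 4" "reg (101 + 2 * k)" Mul])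
       (use S k k' sh in \<open>auto simp: M1(3) M2(3) M3(3) M4(3) M5(3)\<close>)
  obtain M7 where M7: "\<And>is. exec_list w I (Load (tmp 5) (tmp 3) # is) M6 = exec_list w I is M7"
    "bounded M7" "\<And>a. M7 ! a = (if a = tmp 5 then x else M6 ! a)"
    by (rule exec_Load[OF M6(2), of "200 + 5" "tmp 3"])
       (use S ad ne' in \<open>auto simp: M1(3) M2(3) M3(3) M4(3) M5(3) M6(3) x_def\<close>)
  obtain M8 where M8: "\<And>is. exec_list w I (Arith ShiftR (tmp 6) (tmp 5) (tmp 4) # is) M7 = exec_list w I is M8"
    "bounded M8" "\<And>a. M8 ! a = (if a = tmp 6 then x div 2 ^ (j * width k) else M7 ! a)"
    by (rule exec_Arith[OF M7(2), of "200 + 6" "tmp 5" "tmp 4" ShiftR])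
       (use S in \<open>auto simp: M6(3) M7(3)\<close>)
  have w8: "M8 ! reg (101 + 2 * k) = width k"
    using k k' by (simp add: M1(3) M2(3) M3(3) M4(3) M5(3) M6(3) M7(3) M8(3))
  obtain M9 where M9: "\<And>is. exec_list w I (Const (tmp 7) 1 # Arith ShiftL (tmp 7) (tmp 7) (reg (101 + 2 * k)) # is) M8 = exec_list w I is M9"
    "bounded M9" "\<And>a. M9 ! a = (if a = tmp 7 then 2 ^ width k mod 2 ^ w else M8 ! a)"
    by (rule exec_mask[OF M8(2) _ kk _ w8, of "200 + 7"], simp, use k' in simp, rule that)
  obtain M10 where M10: "\<And>is. exec_list w I (Arith Mod (tmp 6) (tmp 6) (tmp 7) # is) M9 = exec_list w I is M10"
    "bounded M10" "\<And>a. M10 ! a = (if a = tmp 6 then field (width k) j x else M9 ! a)"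
    by (rule exec_Arith[OF M9(2), of "200 + 6" "tmp 6" "tmp 7" Mod])
       (use S in \<open>auto simp: M8(3) M9(3) two_pow_width[OF xs] field_def\<close>)
  obtain M11 where M11: "\<And>is. exec_list w I (Arith ShiftL (tmp 6) (tmp 6) (tmp 4) # is) M10 = exec_list w I is M11"
    "bounded M11" "\<And>a. M11 ! a = (if a = tmp 6 then field (width k) j x * 2 ^ (j * width k) else M10 ! a)"
    by (rule exec_Arith[OF M10(2), of "200 + 6" "tmp 6" "tmp 4" ShiftL])
       (use S f x in \<open>auto simp: M6(3) M7(3) M8(3) M9(3) M10(3)\<close>)
  obtain M12 where M12: "\<And>is. exec_list w I (Arith Sub (tmp 5) (tmp 5) (tmp 6) # is) M11 = exec_list w I is M12"
    "bounded M12" "\<And>a. M12 ! a = (if a = tmp 5 then x - field (width k) j x * 2 ^ (j * width k) else M11 ! a)"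
    by (rule exec_Arith[OF M11(2), of "200 + 5" "tmp 5" "tmp 6" Sub])
       (use S f in \<open>auto simp: M7(3) M8(3) M9(3) M10(3) M11(3)\<close>)
  obtain M13 where M13: "\<And>is. exec_list w I (Arith ShiftL (tmp 6) (tmp 1) (tmp 4) # is) M12 = exec_list w I is M13"
    "bounded M13" "\<And>a. M13 ! a = (if a = tmp 6 then v * 2 ^ (j * width k) else M12 ! a)"
    by (rule exec_Arith[OF M12(2), of "200 + 6" "tmp 1" "tmp 4" ShiftL])
       (use S vs Mv in \<open>auto simp: M1(3) M2(3) M3(3) M4(3) M5(3) M6(3) M7(3) M8(3) M9(3) M10(3) M11(3) M12(3)\<close>)
  obtain M14 where M14: "\<And>is. exec_list w I (Arith Add (tmp 5) (tmp 5) (tmp 6) # is) M13 = exec_list w I is M14"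
    "bounded M14" "\<And>a. M14 ! a = (if a = tmp 5 then x' else M13 ! a)"
    by (rule exec_Arith[OF M13(2), of "200 + 5" "tmp 5" "tmp 6" Add])
       (use S x' in \<open>auto simp: M12(3) M13(3) x'_def\<close>)
  obtain M15 where M15: "\<And>is. exec_list w I (Store (tmp 3) (tmp 5) # is) M14 = exec_list w I is M15"
    "bounded M15" "\<And>a. M15 ! a = (if a = adr k i then x' else M14 ! a)"
    by (rule exec_Store[OF M14(2), of "tmp 3" "tmp 5"])
       (use S ad(3) in \<open>auto simp: M4(3) M5(3) M6(3) M7(3) M8(3) M9(3) M10(3) M11(3) M12(3) M13(3) M14(3)\<close>)
  \<comment> \<open>All writes before the final store go to temporaries, so outside of these only
    the addressed word differs.\<close>
  have M15_eq: "M15 ! a = (if a = adr k i then x' else M ! a)" if "a < tmp 0 \<or> tmp 100 \<le> a" for a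
    using that by (auto simp: M1(3) M2(3) M3(3) M4(3) M5(3) M6(3) M7(3) M8(3) M9(3) M10(3) M11(3) M12(3) M13(3) M14(3) M15(3))
  have "represents M15 \<sigma> (put \<alpha> k i v)"
    unfolding represents_def
  proof (intro conjI allI impI)
    show "length M15 = S" "\<And>a. a < S \<Longrightarrow> M15 ! a < 2 ^ w" using M15(2) by (auto simp: bounded_def)
    show "M15 ! reg r = \<sigma> r" if "r < 200" for r
      using R that ne[of r] by (subst M15_eq) (auto simp: represents_def)
    show "cell M15 k' i' = put \<alpha> k i v k' i'" if "i' < len k'" for k' i'
    proof -
      have a: "adr k' i' < tmp 0 \<or> tmp 100 \<le> adr k' i'" using adr_regs[OF that] by auto
      have c: "cell M k' i' = \<alpha> k' i'" using R that by (auto simp: represents_def)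
      show ?thesis
      proof (cases "k' = k")
        case False
        then show ?thesis using adr_disjoint[OF that i] c by (simp add: cell_def M15_eq[OF a] put_def)
      next
        case True
        show ?thesis
        proof (cases "i' div q = i div q")
          case False
          then have "adr k i' \<noteq> adr k i" by (simp add: adr_def q_def)
          then show ?thesis using c True False M15_eq[OF a] by (auto simp: cell_def put_def)
        next
          case d: True
          then have ae: "adr k i' = adr k i" by (simp add: adr_def q_def)
          have "i' = i \<longleftrightarrow> i' mod q = j" unfolding j_def using d by (metis div_mult_mod_eq)
          moreover have "field (width k) (i' mod q) x' = (if i' mod q = j then v else field (width k) (i' mod q) x)"
            unfolding x'_def by (rule field_update(1)[OF v])
          ultimately show ?thesis using c True M15_eq[OF a]
            by (auto simp: cell_def ae put_def x_def q_def)
        qed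
      qed
    qed
  qed
  then show ?thesis
    unfolding put_code_def
    by (intro exI[of _ M15], unfold M1(1) M2(1) M3(1) M4(1) M5(1) M6(1) M7(1) M8(1) M9(1) M10(1) M11(1) M12(1) M13(1) M14(1) M15(1)) simp
qed

section \<open>Simulation of expressions and commands\<close>

lemma depth_pos: "0 < depth e"
  by (induction e) auto

text \<open>The last clause confines all changes to \<open>tmp t\<close> up to
  \<open>tmp 99\<close>. It protects left operands that were already evaluated into lower cells,
  besides registers and arrays.\<close>

lemma comp_exp_correct:
  assumes "represents M \<sigma> \<alpha>" "ok e \<sigma> \<alpha>" "t + depth e \<le> 100"
  shows "\<exists>M'. exec_list w I (comp_exp e t) M = Some M' \<and> bounded M' \<and> M' ! tmp t = ev e \<sigma> \<alpha> \<and>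
    (\<forall>a<S. a < tmp t \<or> tmp 100 \<le> a \<longrightarrow> M' ! a = M ! a)"
  using assms
proof (induction e arbitrary: M t)
  case (Var r)
  then have b: "bounded M" by (auto simp: represents_def bounded_def)
  obtain M' where M': "\<And>is. exec_list w I (Arith BitOr (tmp t) (reg r) (reg r) # is) M = exec_list w I is M'"
    "bounded M'" "\<And>i. M' ! i = (if i = tmp t then M ! reg r else M ! i)"
    by (rule exec_Move[OF b, of "200 + t" "reg r"]) (use Var cell_S[of r] that in \<open>simp_all\<close>)
  show ?case
    by (rule exI[of _ M']) (use M' Var in \<open>auto simp: represents_def\<close>)
next
  case (Lit k)
  then have b: "bounded M" by (auto simp: represents_def bounded_def)
  obtain M' where M': "\<And>is. exec_list w I (Const (tmp t) k # is) M = exec_list w I is M'"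
    "bounded M'" "\<And>i. M' ! i = (if i = tmp t then k else M ! i)"
    by (rule exec_Const[OF b, of "200 + t" k]) (use Lit that in \<open>simp_all\<close>)
  show ?case
    by (rule exI[of _ M'], unfold comp_exp.simps M'(1)) (use M'(2,3) Lit in \<open>auto\<close>)
next
  case Wsz
  then have b: "bounded M" by (auto simp: represents_def bounded_def)
  obtain M' where M': "\<And>is. exec_list w I (WordSize (tmp t) # is) M = exec_list w I is M'"
    "bounded M'" "\<And>i. M' ! i = (if i = tmp t then w else M ! i)"
    by (rule exec_WordSize[OF b, of "200 + t"]) (use Wsz that in \<open>simp_all\<close>)
  show ?case
    by (rule exI[of _ M'], unfold comp_exp.simps M'(1)) (use M'(2,3) Wsz.prems(3) in \<open>auto\<close>)
next
  case (Bin f a b)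
  have dp: "t + depth a \<le> 100" "Suc t + depth b \<le> 100" and oks: "ok a \<sigma> \<alpha>" "ok b \<sigma> \<alpha>"
    using Bin.prems by auto
  from Bin.IH(1)[OF Bin.prems(1) oks(1) dp(1)] obtain M1 where
    M1: "exec_list w I (comp_exp a t) M = Some M1" "bounded M1" "M1 ! tmp t = ev a \<sigma> \<alpha>"
      "\<forall>i<S. i < tmp t \<or> tmp 100 \<le> i \<longrightarrow> M1 ! i = M ! i"
    by blast
  have "represents M1 \<sigma> \<alpha>"
    by (rule represents_cong[OF Bin.prems(1)]) (use M1(2,4) in \<open>auto simp: bounded_def\<close>)
  from Bin.IH(2)[OF this oks(2) dp(2)] obtain M2 where
    M2: "exec_list w I (comp_exp b (Suc t)) M1 = Some M2" "bounded M2" "M2 ! tmp (Suc t) = ev b \<sigma> \<alpha>"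
      "\<forall>i<S. i < tmp (Suc t) \<or> tmp 100 \<le> i \<longrightarrow> M2 ! i = M1 ! i"
    by blast
  have t: "200 + t < 300" "tmp t < S" "tmp (Suc t) < S"
    using Bin.prems(3) cell_S[of "200 + t"] cell_S[of "200 + Suc t"] depth_pos[of b] by auto
  have M2t: "M2 ! tmp t = ev a \<sigma> \<alpha>" using M2(4) M1(3) t by simp
  obtain M3 where M3: "\<And>is. exec_list w I (Arith f (tmp t) (tmp t) (tmp (Suc t)) # is) M2 = exec_list w I is M3"
    "bounded M3" "\<And>i. M3 ! i = (if i = tmp t then exact f (ev a \<sigma> \<alpha>) (ev b \<sigma> \<alpha>) else M2 ! i)"
    by (rule exec_Arith[OF M2(2) t(1) t(2) t(3), of f])
       (use Bin.prems(2) M2(3) M2t that in \<open>simp_all\<close>)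
  show ?case
    by (rule exI[of _ M3], unfold comp_exp.simps exec_list_append M1(1) M2(1) option.case M3(1))
       (use M3(2) M2(4) M1(4) t(1) in \<open>auto simp: M3(3)\<close>)
next
  case (Get k e)
  have dp: "t + depth e \<le> 100" "t + 3 \<le> 100" and oke: "ok e \<sigma> \<alpha>" "ev e \<sigma> \<alpha> < len k" "array_ok k \<sigma>"
    using Get.prems by auto
  from Get.IH[OF Get.prems(1) oke(1) dp(1)] obtain M1 where
    M1: "exec_list w I (comp_exp e t) M = Some M1" "bounded M1" "M1 ! tmp t = ev e \<sigma> \<alpha>"
      "\<forall>i<S. i < tmp t \<or> tmp 100 \<le> i \<longrightarrow> M1 ! i = M ! i"
    by blast
  have "represents M1 \<sigma> \<alpha>"
    by (rule represents_cong[OF Get.prems(1)]) (use M1(2,4) in \<open>auto simp: bounded_def\<close>)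
  from exec_Get_code[OF this oke(3,2) M1(3) dp(2)] obtain M2 where
    M2: "exec_list w I (get_code k t) M1 = Some M2"
    "bounded M2" "M2 ! tmp t = \<alpha> k (ev e \<sigma> \<alpha>)"
    "\<forall>a<S. a < tmp t \<or> tmp 100 \<le> a \<longrightarrow> M2 ! a = M1 ! a"
    by blast
  have "exec_list w I (comp_exp (Get k e) t) M = Some M2"
    using M1(1) M2(1) by (simp add: exec_list_append)
  then show ?case using M2(2-4) M1(4) by (intro exI[of _ M2]) auto
next
  case (Inp e)
  have dp: "t + depth e \<le> 100" and oke: "ok e \<sigma> \<alpha>"
    using Inp.prems by auto
  from Inp.IH[OF Inp.prems(1) oke dp] obtain M1 where
    M1: "exec_list w I (comp_exp e t) M = Some M1" "bounded M1" "M1 ! tmp t = ev e \<sigma> \<alpha>"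
      "\<forall>i<S. i < tmp t \<or> tmp 100 \<le> i \<longrightarrow> M1 ! i = M ! i"
    by blast
  have t: "200 + t < 300" "tmp t < S"
    using Inp.prems(3) cell_S[of "200 + t"] depth_pos[of e] by auto
  obtain M2 where M2: "\<And>is. exec_list w I (ReadInput (tmp t) (tmp t) # is) M1 = exec_list w I is M2"
    "bounded M2" "\<And>i. M2 ! i = (if i = tmp t then I ! ev e \<sigma> \<alpha> else M1 ! i)"
    by (rule exec_ReadInput[OF M1(2) t])
       (use Inp.prems(2) M1(3) that in \<open>simp_all\<close>)
  show ?case
    by (rule exI[of _ M2], unfold comp_exp.simps exec_list_append M1(1) option.case M2(1))
       (use M2(2) M1(4) t(1) in \<open>auto simp: M2(3)\<close>)
qed

lemma comp_exp_reaches: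
  assumes R: "represents M \<sigma> \<alpha>" and "ok e \<sigma> \<alpha>" "depth e \<le> 90" "t \<le> 1"
    and c: "code_at P pc (comp_exp e t)"
  obtains M' where "reaches P w I pc M (length (comp_exp e t)) [] (pc + length (comp_exp e t)) M'"
    "represents M' \<sigma> \<alpha>" "bounded M'" "M' ! tmp t = ev e \<sigma> \<alpha>"
    "\<And>a. a < S \<Longrightarrow> a < tmp t \<Longrightarrow> M' ! a = M ! a"
proof -
  from comp_exp_correct[OF R assms(2), of t] assms(3,4) obtain M' where
    M': "exec_list w I (comp_exp e t) M = Some M'" "bounded M'" "M' ! tmp t = ev e \<sigma> \<alpha>"
      "\<forall>i<S. i < tmp t \<or> tmp 100 \<le> i \<longrightarrow> M' ! i = M ! i"
    by auto
  have "represents M' \<sigma> \<alpha>"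
    by (rule represents_cong[OF R]) (use M'(2,4) in \<open>auto simp: bounded_def\<close>)
  from that[OF reaches_exec_list[OF c straight_comp_exp M'(1)] this M'(2,3)] M'(4) show thesis by simp
qed

text \<open>Every tick of the source clock is charged with the whole code of the command: no
  instruction is executed twice without a tick in between, since each test of a loop advances the
  clock. The bound is written additively to avoid truncated subtraction.\<close>

lemma comp_correct:
  assumes "exec c \<sigma> \<alpha> os k \<sigma>' \<alpha>' os' k'" "shallow c" "represents M \<sigma> \<alpha>" "code_at P pc (comp pc c)"
  shows "\<exists>M' t new. reaches P w I pc M t new (pc + csize c) M' \<and> represents M' \<sigma>' \<alpha>' \<and>
    os' = os @ new \<and> t + csize c * k \<le> csize c * k'"
  using assms
proof (induction arbitrary: M pc rule: exec.induct)
  case (Skip \<sigma> \<alpha> os t)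
  then show ?case using reaches.refl by fastforce
next
  case (Asg e \<sigma> \<alpha> r os t)
  from Asg.prems(3) have c: "code_at P pc (comp_exp e 0)"
    "code_at P (pc + length (comp_exp e 0)) [Arith BitOr (reg r) (tmp 0) (tmp 0)]"
    by (auto dest: code_at_append)
  from Asg.prems(1) have dp: "depth e \<le> 90" by simp
  from comp_exp_reaches[OF Asg.prems(2) Asg.hyps(1) dp _ c(1)] obtain M1 where
    M1: "reaches P w I pc M (length (comp_exp e 0)) [] (pc + length (comp_exp e 0)) M1"
    "represents M1 \<sigma> \<alpha>" "bounded M1" "M1 ! tmp 0 = ev e \<sigma> \<alpha>"
    by auto
  obtain M2 where M2: "\<And>is. exec_list w I (Arith BitOr (reg r) (tmp 0) (tmp 0) # is) M1 = exec_list w I is M2"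
    "bounded M2" "\<And>i. M2 ! i = (if i = reg r then ev e \<sigma> \<alpha> else M1 ! i)"
    by (rule exec_Move[OF M1(3), of r "tmp 0"])
       (use Asg.hyps(2) M1(4) cell_S[of 200] that in \<open>simp_all\<close>)
  have r2: "reaches P w I (pc + length (comp_exp e 0)) M1 1 [] (pc + length (comp_exp e 0) + 1) M2"
    using reaches_exec_list[OF c(2) _ M2(1)[of "[]", unfolded exec_list.simps(1)]] by simp
  have "represents M2 (\<sigma>(r := ev e \<sigma> \<alpha>)) \<alpha>"
    unfolding represents_def
  proof (intro conjI allI impI)
    show "cell M2 k i = \<alpha> k i" if "i < len k" for k i
      using M1(2) that adr_regs[OF that] Asg.hyps(2)
      by (auto simp: represents_def cell_def M2(3))
  qed (use M2(2) M1(2) in \<open>auto simp: bounded_def represents_def M2(3)\<close>)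
  then show ?case
    using reaches_trans[OF M1(1) r2]
    by (intro exI[of _ M2] exI[of _ "length (comp_exp e 0) + 1"] exI[of _ "[]"]) (auto simp: add.assoc fun_upd_def)
next
  case (Put e1 \<sigma> \<alpha> e2 k os t)
  let ?l1 = "length (comp_exp e1 0)" and ?l2 = "length (comp_exp e2 1)"
  from Put.prems(3) have c: "code_at P pc (comp_exp e1 0)" "code_at P (pc + ?l1) (comp_exp e2 1)"
    "code_at P (pc + ?l1 + ?l2) (put_code k)"
    using code_at_append[of P pc "comp_exp e1 0"] code_at_append[of P "pc + ?l1" "comp_exp e2 1"] by auto
  from Put.prems(1) have dp: "depth e1 \<le> 90" "depth e2 \<le> 90" by simp_all
  from comp_exp_reaches[OF Put.prems(2) Put.hyps(1) dp(1) _ c(1)] obtain M1 where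
    M1: "reaches P w I pc M ?l1 [] (pc + ?l1) M1"
    "represents M1 \<sigma> \<alpha>" "bounded M1" "M1 ! tmp 0 = ev e1 \<sigma> \<alpha>"
    by auto
  from comp_exp_reaches[OF M1(2) Put.hyps(2) dp(2) _ c(2)] obtain M2 where
    M2: "reaches P w I (pc + ?l1) M1 ?l2 [] (pc + ?l1 + ?l2) M2"
    "represents M2 \<sigma> \<alpha>" "M2 ! tmp 1 = ev e2 \<sigma> \<alpha>" "\<And>a. a < S \<Longrightarrow> a < tmp 1 \<Longrightarrow> M2 ! a = M1 ! a"
    by (metis order_refl)
  from exec_put_code[OF M2(2) Put.hyps(5,3) _ M2(3) Put.hyps(4)] M2(4)[of "tmp 0"] M1(4) cell_S[of 200] obtain M3 where
    M3: "exec_list w I (put_code k) M2 = Some M3" "represents M3 \<sigma> (put \<alpha> k (ev e1 \<sigma> \<alpha>) (ev e2 \<sigma> \<alpha>))"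
    by auto
  note r3 = reaches_exec_list[OF c(3) straight_put_code M3(1)]
  show ?case
    using reaches_trans[OF reaches_trans[OF M1(1) M2(1)] r3] M3(2)
    by (intro exI[of _ M3] exI[of _ "?l1 + ?l2 + length (put_code k)"] exI[of _ "[]"]) (auto simp: add.assoc algebra_simps)
next
  case (Out e \<sigma> \<alpha> os t)
  let ?l = "length (comp_exp e 0)"
  from Out.prems(3) have c: "code_at P pc (comp_exp e 0)" "code_at P (pc + ?l) [WriteOutput (tmp 0)]"
    by (auto dest: code_at_append)
  from Out.prems(1) have dp: "depth e \<le> 90" by simp
  from comp_exp_reaches[OF Out.prems(2) Out.hyps(1) dp _ c(1)] obtain M1 where
    M1: "reaches P w I pc M ?l [] (pc + ?l) M1"
    "represents M1 \<sigma> \<alpha>" "bounded M1" "M1 ! tmp 0 = ev e \<sigma> \<alpha>"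
    by auto
  have r2: "reaches P w I (pc + ?l) M1 1 [ev e \<sigma> \<alpha>] (Suc (pc + ?l)) M1"
    by (rule reaches_one) (use code_at_Cons[OF c(2)] M1(3,4) cell_S[of 200] in \<open>auto simp: bounded_def\<close>)
  show ?case
    using reaches_trans[OF M1(1) r2] M1(2) by (intro exI[of _ M1] exI[of _ "?l + 1"] exI[of _ "[ev e \<sigma> \<alpha>]"]) auto
next
  case (Seq c1 \<sigma> \<alpha> os t \<sigma>1 \<alpha>1 os1 t1 c2 \<sigma>2 \<alpha>2 os2 t2)
  from Seq.prems(3) have c: "code_at P pc (comp pc c1)" "code_at P (pc + csize c1) (comp (pc + csize c1) c2)"
    using code_at_append[of P pc "comp pc c1"] by (auto simp: length_comp)
  from Seq.IH(1)[OF _ Seq.prems(2) c(1)] Seq.prems(1) obtain M1 k1 n1 where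
    1: "reaches P w I pc M k1 n1 (pc + csize c1) M1" "represents M1 \<sigma>1 \<alpha>1" "os1 = os @ n1"
      "k1 + csize c1 * t \<le> csize c1 * t1"
    by auto
  from Seq.IH(2)[OF _ 1(2) c(2)] Seq.prems(1) obtain M2 k2 n2 where
    2: "reaches P w I (pc + csize c1) M1 k2 n2 (pc + csize c1 + csize c2) M2" "represents M2 \<sigma>2 \<alpha>2"
      "os2 = os1 @ n2" "k2 + csize c2 * t1 \<le> csize c2 * t2"
    by auto
  \<comment> \<open>The bounds of both parts are stretched to the common interval from
    \<open>t\<close> to \<open>t2\<close>, which is sound because the clock never runs
    backwards.\<close>
  have "csize c1 * t1 \<le> csize c1 * t2" "csize c2 * t \<le> csize c2 * t1"
    using exec_time[OF Seq.hyps(1)] exec_time[OF Seq.hyps(2)] by (auto intro: mult_le_mono2)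
  then have "k1 + k2 + csize (Seq c1 c2) * t \<le> csize (Seq c1 c2) * t2"
    using 1(4) 2(4) unfolding csize.simps distrib_right by linarith
  with reaches_trans[OF 1(1) 2(1)] 2(2,3) 1(3) show ?case
    by (intro exI[of _ M2] exI[of _ "k1 + k2"] exI[of _ "n1 @ n2"]) (auto simp: add.assoc)
next
  case (CondTrue e \<sigma> \<alpha> c1 os t \<sigma>1 \<alpha>1 os1 t1 c2)
  let ?l = "length (comp_exp e 0)"
  let ?rest = "comp (pc + ?l + 1) c1 @ [Jump (pc + (?l + 1) + csize c1 + 1 + csize c2)] @
      comp (pc + ?l + 1 + csize c1 + 1) c2"
  from CondTrue.prems(3) have c: "code_at P pc (comp_exp e 0)"
    "code_at P (pc + ?l) (JumpIfZero (tmp 0) (pc + (?l + 1) + csize c1 + 1) # ?rest)"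
    using code_at_append[of P pc "comp_exp e 0"] by (auto simp: Let_def add.assoc)
  from code_at_Cons(3)[OF c(2)] have c': "code_at P (pc + ?l + 1) (comp (pc + ?l + 1) c1)"
    "code_at P (pc + ?l + 1 + csize c1) (Jump (pc + (?l + 1) + csize c1 + 1 + csize c2) #
      comp (pc + ?l + 1 + csize c1 + 1) c2)"
    using code_at_append[of P "Suc (pc + ?l)" "comp (pc + ?l + 1) c1"] by (auto simp: length_comp)
  from CondTrue.prems(1) have dp: "depth e \<le> 90" by simp
  from comp_exp_reaches[OF CondTrue.prems(2) CondTrue.hyps(1) dp _ c(1)] obtain M1 where
    M1: "reaches P w I pc M ?l [] (pc + ?l) M1"
    "represents M1 \<sigma> \<alpha>" "bounded M1" "M1 ! tmp 0 = ev e \<sigma> \<alpha>"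
    by auto
  have r2: "reaches P w I (pc + ?l) M1 1 [] (pc + ?l + 1) M1"
    by (rule reaches_one) (use code_at_Cons[OF c(2)] CondTrue.hyps(2) M1(3,4) cell_S[of 200] in \<open>auto simp: bounded_def\<close>)
  from CondTrue.IH[OF _ M1(2) c'(1)] CondTrue.prems(1) obtain M2 k2 n2 where
    2: "reaches P w I (pc + ?l + 1) M1 k2 n2 (pc + ?l + 1 + csize c1) M2" "represents M2 \<sigma>1 \<alpha>1"
      "os1 = os @ n2" "k2 + csize c1 * Suc t \<le> csize c1 * t1"
    by auto
  have r3: "reaches P w I (pc + ?l + 1 + csize c1) M2 1 [] (pc + csize (Cond e c1 c2)) M2"
    by (rule reaches_one) (use code_at_Cons[OF c'(2)] in \<open>auto\<close>)
  have "Suc t \<le> t1" using exec_time[OF CondTrue.hyps(3)] .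
  \<comment> \<open>The tick of the test pays for the code of the test, the two jumps and the
    skipped branch.\<close>
  then have "(?l + 2 + csize c2) * Suc t \<le> (?l + 2 + csize c2) * t1" by (rule mult_le_mono2)
  then have "?l + 1 + k2 + 1 + csize (Cond e c1 c2) * t \<le> csize (Cond e c1 c2) * t1"
    using 2(4) unfolding csize.simps distrib_right mult_Suc_right by linarith
  with reaches_trans[OF reaches_trans[OF reaches_trans[OF M1(1) r2] 2(1)] r3] 2(2,3) show ?case
    by (intro exI[of _ M2] exI[of _ "?l + 1 + k2 + 1"] exI[of _ n2]) (auto simp: add.assoc)
next
  case (CondFalse e \<sigma> \<alpha> c2 os t \<sigma>1 \<alpha>1 os1 t1 c1)
  let ?l = "length (comp_exp e 0)"
  let ?rest = "comp (pc + ?l + 1) c1 @ [Jump (pc + (?l + 1) + csize c1 + 1 + csize c2)] @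
      comp (pc + ?l + 1 + csize c1 + 1) c2"
  from CondFalse.prems(3) have c: "code_at P pc (comp_exp e 0)"
    "code_at P (pc + ?l) (JumpIfZero (tmp 0) (pc + (?l + 1) + csize c1 + 1) # ?rest)"
    using code_at_append[of P pc "comp_exp e 0"] by (auto simp: Let_def add.assoc)
  from code_at_Cons(3)[OF c(2)] have "code_at P (pc + ?l + 1 + csize c1) (Jump (pc + (?l + 1) + csize c1 + 1 + csize c2) #
      comp (pc + ?l + 1 + csize c1 + 1) c2)"
    using code_at_append[of P "Suc (pc + ?l)" "comp (pc + ?l + 1) c1"] by (auto simp: length_comp)
  from code_at_Cons(3)[OF this]
  have c': "code_at P (pc + ?l + 1 + csize c1 + 1) (comp (pc + ?l + 1 + csize c1 + 1) c2)" by simp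
  from CondFalse.prems(1) have dp: "depth e \<le> 90" by simp
  from comp_exp_reaches[OF CondFalse.prems(2) CondFalse.hyps(1) dp _ c(1)] obtain M1 where
    M1: "reaches P w I pc M ?l [] (pc + ?l) M1"
    "represents M1 \<sigma> \<alpha>" "bounded M1" "M1 ! tmp 0 = ev e \<sigma> \<alpha>"
    by auto
  have r2: "reaches P w I (pc + ?l) M1 1 [] (pc + ?l + 1 + csize c1 + 1) M1"
    by (rule reaches_one) (use code_at_Cons[OF c(2)] CondFalse.hyps(2) M1(3,4) cell_S[of 200] in \<open>auto simp: bounded_def\<close>)
  from CondFalse.IH[OF _ M1(2) c'] CondFalse.prems(1) obtain M2 k2 n2 where
    2: "reaches P w I (pc + ?l + 1 + csize c1 + 1) M1 k2 n2 (pc + ?l + 1 + csize c1 + 1 + csize c2) M2"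
      "represents M2 \<sigma>1 \<alpha>1" "os1 = os @ n2" "k2 + csize c2 * Suc t \<le> csize c2 * t1"
    by auto
  have "Suc t \<le> t1" using exec_time[OF CondFalse.hyps(3)] .
  then have "(?l + 2 + csize c1) * Suc t \<le> (?l + 2 + csize c1) * t1" by (rule mult_le_mono2)
  then have "?l + 1 + k2 + csize (Cond e c1 c2) * t \<le> csize (Cond e c1 c2) * t1"
    using 2(4) unfolding csize.simps distrib_right mult_Suc_right by linarith
  with reaches_trans[OF reaches_trans[OF M1(1) r2] 2(1)] 2(2,3) show ?case
    by (intro exI[of _ M2] exI[of _ "?l + 1 + k2"] exI[of _ n2]) (auto simp: add.assoc)
next
  case (WhileFalse e \<sigma> \<alpha> c os t)
  let ?l = "length (comp_exp e 0)"
  from WhileFalse.prems(3) have c: "code_at P pc (comp_exp e 0)"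
    "code_at P (pc + ?l) (JumpIfZero (tmp 0) (pc + (?l + 1) + csize c + 1) # comp (pc + ?l + 1) c @ [Jump pc])"
    using code_at_append[of P pc "comp_exp e 0"] by (auto simp: Let_def add.assoc)
  from WhileFalse.prems(1) have dp: "depth e \<le> 90" by simp
  from comp_exp_reaches[OF WhileFalse.prems(2) WhileFalse.hyps(1) dp _ c(1)] obtain M1 where
    M1: "reaches P w I pc M ?l [] (pc + ?l) M1"
    "represents M1 \<sigma> \<alpha>" "bounded M1" "M1 ! tmp 0 = ev e \<sigma> \<alpha>"
    by auto
  have r2: "reaches P w I (pc + ?l) M1 1 [] (pc + csize (While e c)) M1"
    by (rule reaches_one) (use code_at_Cons[OF c(2)] WhileFalse.hyps(2) M1(3,4) cell_S[of 200] in \<open>auto simp: bounded_def\<close>)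
  show ?case
    using reaches_trans[OF M1(1) r2] M1(2)
    by (intro exI[of _ M1] exI[of _ "?l + 1"] exI[of _ "[]"]) (auto simp: algebra_simps)
next
  case (WhileTrue e \<sigma> \<alpha> c os t \<sigma>1 \<alpha>1 os1 t1 \<sigma>2 \<alpha>2 os2 t2)
  let ?l = "length (comp_exp e 0)"
  from WhileTrue.prems(3) have c: "code_at P pc (comp_exp e 0)"
    "code_at P (pc + ?l) (JumpIfZero (tmp 0) (pc + (?l + 1) + csize c + 1) # comp (pc + ?l + 1) c @ [Jump pc])"
    using code_at_append[of P pc "comp_exp e 0"] by (auto simp: Let_def add.assoc)
  from code_at_Cons(3)[OF c(2)] have c': "code_at P (pc + ?l + 1) (comp (pc + ?l + 1) c)"
    "code_at P (pc + ?l + 1 + csize c) [Jump pc]"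
    using code_at_append[of P "Suc (pc + ?l)" "comp (pc + ?l + 1) c"] by (auto simp: length_comp)
  from WhileTrue.prems(1) have dp: "depth e \<le> 90" by simp
  from comp_exp_reaches[OF WhileTrue.prems(2) WhileTrue.hyps(1) dp _ c(1)] obtain M1 where
    M1: "reaches P w I pc M ?l [] (pc + ?l) M1"
    "represents M1 \<sigma> \<alpha>" "bounded M1" "M1 ! tmp 0 = ev e \<sigma> \<alpha>"
    by auto
  have r2: "reaches P w I (pc + ?l) M1 1 [] (pc + ?l + 1) M1"
    by (rule reaches_one) (use code_at_Cons[OF c(2)] WhileTrue.hyps(2) M1(3,4) cell_S[of 200] in \<open>auto simp: bounded_def\<close>)
  from WhileTrue.IH(1)[OF _ M1(2) c'(1)] WhileTrue.prems(1) obtain M2 k2 n2 where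
    2: "reaches P w I (pc + ?l + 1) M1 k2 n2 (pc + ?l + 1 + csize c) M2" "represents M2 \<sigma>1 \<alpha>1"
      "os1 = os @ n2" "k2 + csize c * Suc t \<le> csize c * t1"
    by auto
  have r3: "reaches P w I (pc + ?l + 1 + csize c) M2 1 [] pc M2"
    by (rule reaches_one) (use code_at_Cons[OF c'(2)] in \<open>auto\<close>)
  from WhileTrue.IH(2)[OF WhileTrue.prems(1) 2(2) WhileTrue.prems(3)] obtain M4 k4 n4 where
    4: "reaches P w I pc M2 k4 n4 (pc + csize (While e c)) M4" "represents M4 \<sigma>2 \<alpha>2"
      "os2 = os1 @ n4" "k4 + csize (While e c) * t1 \<le> csize (While e c) * t2"
    by auto
  have "Suc t \<le> t1" using exec_time[OF WhileTrue.hyps(3)] .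
  then have "(?l + 2) * Suc t \<le> (?l + 2) * t1" by (rule mult_le_mono2)
  then have "?l + 1 + k2 + 1 + k4 + csize (While e c) * t \<le> csize (While e c) * t2"
    using 2(4) 4(4) unfolding csize.simps distrib_right mult_Suc_right by linarith
  with reaches_trans[OF reaches_trans[OF reaches_trans[OF reaches_trans[OF M1(1) r2] 2(1)] r3] 4(1)] 2(3) 4(2,3)
  show ?case
    by (intro exI[of _ M4] exI[of _ "?l + 1 + k2 + 1 + k4"] exI[of _ "n2 @ n4"]) (auto simp: add.assoc)
qed

theorem run_comp:
  assumes "wp c Q (\<lambda>_. 0) (\<lambda>_ _. 0) [] 0" "shallow c" "r < 200"
    and "\<And>\<sigma> \<alpha> os t. Q \<sigma> \<alpha> os t \<Longrightarrow> t \<le> T \<and> R os (\<sigma> r \<noteq> 0)"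
  defines "P \<equiv> comp 0 c @ [JumpIfZero (reg r) (csize c + 2), Halt True, Halt False]"
  shows "\<exists>t out b. runs_in P w I S t out b \<and> t \<le> csize c * T + 2 \<and> R out b"
proof -
  from assms(1) obtain \<sigma> \<alpha> os t where x: "exec c (\<lambda>_. 0) (\<lambda>_ _. 0) [] 0 \<sigma> \<alpha> os t" and q: "Q \<sigma> \<alpha> os t"
    by (auto simp: wp_def)
  have z: "represents (replicate S 0) (\<lambda>_. 0) (\<lambda>_ _. 0)"
    using regs_S adr_S by (auto simp: represents_def cell_def field_def)
  have c: "code_at P 0 (comp 0 c)" by (simp add: code_at_def P_def)
  from comp_correct[OF x assms(2) z c] obtain M k where
    M: "reaches P w I 0 (replicate S 0) k os (csize c) M" "represents M \<sigma> \<alpha>" "k \<le> csize c * t"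
    by auto
  have P: "csize c < length P" "P ! csize c = JumpIfZero (reg r) (csize c + 2)"
    "Suc (csize c) < length P" "P ! Suc (csize c) = Halt True"
    "csize c + 2 < length P" "P ! (csize c + 2) = Halt False"
    by (simp_all add: P_def nth_append length_comp)
  have r: "M ! reg r = \<sigma> r" "reg r < length M"
    using M(2) assms(3) cell_S[of r] by (auto simp: represents_def)
  have "halts_from P w I (csize c) M 2 [] (\<sigma> r \<noteq> 0)"
  proof (cases "\<sigma> r = 0")
    case True
    have "halts_from P w I (csize c) M (Suc 1) ([] @ []) False"
      by (rule halts_from.exec[OF P(1) _ halts_from.halt[OF P(5,6)]]) (use P r True in simp)
    then show ?thesis using True by (simp add: numeral_2_eq_2)
  next
    case False
    have "halts_from P w I (csize c) M (Suc 1) ([] @ []) True"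
      by (rule halts_from.exec[OF P(1) _ halts_from.halt[OF P(3,4)]]) (use P r False in simp)
    then show ?thesis using False by (simp add: numeral_2_eq_2)
  qed
  from reaches_halts[OF M(1) this] have "runs_in P w I S (k + 2) os (\<sigma> r \<noteq> 0)"
    by (simp add: runs_in_def)
  moreover have "k + 2 \<le> csize c * T + 2"
    using M(3) assms(4)[OF q] by (meson add_le_mono1 le_trans mult_le_mono2)
  ultimately show ?thesis using assms(4)[OF q] by blast
qed

end

section \<open>Peeling\<close>

text \<open>A degenerate order under construction: it refers to the vertices already removed instead
  of those still to come, so it makes sense for an incomplete list and can be extended at its
  end.\<close>

definition peel :: "nat \<Rightarrow> 'a set \<Rightarrow> 'a set set \<Rightarrow> 'a list \<Rightarrow> bool" where
  "peel d V E vs \<longleftrightarrow> distinct vs \<and> set vs \<subseteq> V \<and>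
     (\<forall>i<length vs. card (neighbours E (vs ! i) - set (take i vs)) \<le> d)"

lemma neighbours_subset: "simple_graph V E \<Longrightarrow> neighbours E v \<subseteq> V"
  by (auto simp: simple_graph_def neighbours_def)

lemma finite_neighbours: "simple_graph V E \<Longrightarrow> finite (neighbours E v)"
  using neighbours_subset finite_subset by (metis simple_graph_def)

lemma neighbours_sym: "u \<in> neighbours E v \<longleftrightarrow> v \<in> neighbours E u"
  by (auto simp: neighbours_def insert_commute)

lemma peel_Nil: "peel d V E []"
  by (simp add: peel_def)

lemma peel_snoc:
  assumes "peel d V E vs" "v \<in> V" "v \<notin> set vs" "card (neighbours E v - set vs) \<le> d"
  shows "peel d V E (vs @ [v])"
  using assms by (auto simp: peel_def nth_append less_Suc_eq)

lemma neighbours_induced: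
  "v \<in> U \<Longrightarrow> neighbours (induced_edges E U) v = neighbours E v \<inter> U"
  by (auto simp: neighbours_def induced_edges_def)

lemma peel_complete:
  assumes G: "simple_graph V E" and p: "peel d V E vs" and V: "set vs = V"
  shows "degenerate_order d V E vs" "degenerate d V E"
proof -
  show "degenerate_order d V E vs"
    unfolding degenerate_order_def
  proof (intro conjI allI impI)
    fix i assume i: "i < length vs"
    have "set (take i vs) \<inter> set (drop (Suc i) vs) = {}"
      using p by (intro set_take_disj_set_drop_if_distinct) (auto simp: peel_def)
    then have "card (neighbours E (vs ! i) \<inter> set (drop (Suc i) vs))
        \<le> card (neighbours E (vs ! i) - set (take i vs))"
      using finite_neighbours[OF G] by (intro card_mono) auto
    then show "card (neighbours E (vs ! i) \<inter> set (drop (Suc i) vs)) \<le> d"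
      using p i by (fastforce simp: peel_def)
  qed (use p V in \<open>auto simp: peel_def\<close>)
  show "degenerate d V E"
    unfolding degenerate_def
  proof (intro allI impI)
    fix U assume U: "U \<subseteq> V \<and> U \<noteq> {}"
    then have ex: "\<exists>i<length vs. vs ! i \<in> U" using V by (metis in_set_conv_nth subset_iff ex_in_conv)
    \<comment> \<open>The earliest vertex of \<open>U\<close> was removed while all of
      \<open>U\<close> was still present, so its neighbours in \<open>U\<close> are among those
      counted at that moment.\<close>
    define i where "i = (LEAST i. i < length vs \<and> vs ! i \<in> U)"
    have i: "i < length vs" "vs ! i \<in> U" using LeastI_ex[OF ex] by (auto simp: i_def)
    have "set (take i vs) \<inter> U = {}"
      using not_less_Least[of _ "\<lambda>i. i < length vs \<and> vs ! i \<in> U"] i(1)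
      by (auto simp: in_set_conv_nth i_def[symmetric])
    then have "card (neighbours E (vs ! i) \<inter> U) \<le> card (neighbours E (vs ! i) - set (take i vs))"
      using finite_neighbours[OF G] by (intro card_mono) auto
    then have "degree (induced_edges E U) (vs ! i) \<le> d"
      using p i by (fastforce simp: peel_def degree_def neighbours_induced)
    then show "\<exists>v\<in>U. degree (induced_edges E U) v \<le> d" using i(2) by blast
  qed
qed

text \<open>The vertices left over induce a nonempty subgraph whose degrees all exceed
  \<open>d\<close>. Hence greedy removal never has to backtrack, and getting stuck is a proof of the
  negative answer.\<close>

lemma peel_stuck:
  assumes G: "simple_graph V E" and "peel d V E vs" and "set vs \<noteq> V"
    and "\<And>u. u \<in> V \<Longrightarrow> u \<notin> set vs \<Longrightarrow> d < card (neighbours E u - set vs)"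
  shows "\<not> degenerate d V E"
proof
  assume "degenerate d V E"
  moreover have "V - set vs \<subseteq> V \<and> V - set vs \<noteq> {}" using assms by (auto simp: peel_def)
  ultimately obtain v where v: "v \<in> V - set vs" "degree (induced_edges E (V - set vs)) v \<le> d"
    unfolding degenerate_def by meson
  have "neighbours E v \<inter> (V - set vs) = neighbours E v - set vs"
    using neighbours_subset[OF G] by auto
  then show False using v assms(4)[of v] by (simp add: degree_def neighbours_induced)
qed

text \<open>Double counting of incidences; mapping \<open>u\<close> to the edge from
  \<open>v\<close> to \<open>u\<close> identifies neighbours with incident edges.\<close>

lemma sum_degrees:
  assumes G: "simple_graph V E"
  shows "(\<Sum>v\<in>V. degree E v) = 2 * card E"
proof -
  have fV: "finite V" and E: "\<And>e. e \<in> E \<Longrightarrow> e \<subseteq> V \<and> card e = 2" using G by (auto simp: simple_graph_def)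
  have fE: "finite E" using E fV by (meson finite_Pow_iff finite_subset PowI subsetI)
  have "degree E v = card {e \<in> E. v \<in> e}" for v
    unfolding degree_def
  proof (rule bij_betw_same_card[of "\<lambda>u. {v, u}"])
    show "bij_betw (\<lambda>u. {v, u}) (neighbours E v) {e \<in> E. v \<in> e}"
    proof (rule bij_betw_imageI)
      show "inj_on (\<lambda>u. {v, u}) (neighbours E v)"
        by (auto simp: inj_on_def doubleton_eq_iff)
      show "(\<lambda>u. {v, u}) ` neighbours E v = {e \<in> E. v \<in> e}"
      proof (intro equalityI subsetI)
        fix e assume e: "e \<in> {e \<in> E. v \<in> e}"
        then obtain a b where ab: "e = {a, b}" "a \<noteq> b" using E by (metis (lifting) card_2_iff mem_Collect_eq)
        then have "e = {v, if v = a then b else a}" "v \<noteq> (if v = a then b else a)" using e by auto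
        then show "e \<in> (\<lambda>u. {v, u}) ` neighbours E v" using e by (auto simp: neighbours_def image_iff)
      qed (auto simp: neighbours_def)
    qed
  qed
  then have "(\<Sum>v\<in>V. degree E v) = (\<Sum>v\<in>V. \<Sum>e\<in>E. of_bool (v \<in> e))"
    using fE by (simp add: sum.If_cases of_bool_def Int_def)
  also have "\<dots> = (\<Sum>e\<in>E. \<Sum>v\<in>V. of_bool (v \<in> e))" by (rule sum.swap)
  also have "\<dots> = (\<Sum>e\<in>E. card (V \<inter> e))" using fV by (simp add: of_bool_def sum.If_cases)
  also have "\<dots> = (\<Sum>e\<in>E. 2)" by (intro sum.cong refl) (use E in \<open>auto simp: Int_absorb1\<close>)
  finally show ?thesis by simp
qed

section \<open>Traversing an adjacency list\<close>

locale input =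
  fixes w d n m :: nat and E :: "nat set set" and I :: "nat list" and A :: "nat \<Rightarrow> nat list"
  assumes graph: "simple_graph {..<n} E"
    and m: "m = card E"
    and length_I: "length I \<le> 2 ^ w"
    and cells_I: "\<forall>x\<in>set I. x < 2 ^ w"
    and header: "n + 2 \<le> length I" "I ! 0 = n" "I ! 1 = d"
    and cells_disjoint: "distinct ([0..<n + 2] @ concat (map (\<lambda>p. [p, p + 1]) (concat (map A [0..<n]))))"
    and list_A: "v < n \<Longrightarrow> linked_list I (I ! (2 + v)) (A v)"
    and distinct_A: "v < n \<Longrightarrow> distinct (map ((!) I) (A v))"
    and set_A: "v < n \<Longrightarrow> set (map ((!) I) (A v)) = neighbours E v"
begin

definition deg :: "nat \<Rightarrow> nat" where "deg v = degree E v"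

lemma length_A: "v < n \<Longrightarrow> length (A v) = deg v"
  using distinct_card[OF distinct_A, of v] set_A by (simp add: deg_def degree_def)

lemma sum_deg: "(\<Sum>v<n. deg v) = 2 * m"
  using sum_degrees[OF graph] m by (simp add: deg_def)

lemma deg_le_n: "deg v \<le> n"
  using card_mono[OF _ neighbours_subset[OF graph, of v]] by (simp add: deg_def degree_def)

lemma linked_list_bound: "linked_list I p ps \<Longrightarrow> q \<in> set ps \<Longrightarrow> 0 < q \<and> q + 1 < length I"
  by (induction ps arbitrary: p) auto

text \<open>The header has \<open>n + 2\<close> cells and each of the \<open>2 * m\<close> list
  nodes has two; all of them are distinct addresses below \<open>length I\<close>. The overflow
  checks on quantities linear in \<open>n\<close> and \<open>m\<close> go back to this
  bound.\<close>

lemma size_bound: "n + 2 + 4 * m \<le> 2 ^ w"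
proof -
  let ?xs = "[0..<n + 2] @ concat (map (\<lambda>p. [p, p + 1]) (concat (map A [0..<n])))"
  have "set ?xs \<subseteq> {..<length I}"
    using header(1) linked_list_bound[OF list_A] by fastforce
  then have "card (set ?xs) \<le> length I" using card_mono[of "{..<length I}"] by fastforce
  then have "length ?xs \<le> length I" using distinct_card[OF cells_disjoint] by simp
  moreover have "length (concat (map (\<lambda>p. [p, p + 1]) ps)) = 2 * length ps" for ps :: "nat list"
    by (induction ps) auto
  moreover have "length (concat (map A [0..<k])) = (\<Sum>v<k. deg v)" if "k \<le> n" for k
    using that by (induction k) (auto simp: length_A)
  ultimately show ?thesis using length_I by (simp add: sum_deg del: length_concat upt_Suc)
qed

lemma w_positive: "0 < w"
  using size_bound by (cases w) auto

end

declare One_nat_def [simp del] add_2_eq_Suc [simp del] add_2_eq_Suc' [simp del]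

abbreviation add_exp (infixl "[+]" 65) where "a [+] b \<equiv> Bin Add a b"
abbreviation sub_exp (infixl "[-]" 65) where "a [-] b \<equiv> Bin Sub a b"
abbreviation mul_exp (infixl "[*]" 70) where "a [*] b \<equiv> Bin Mul a b"
abbreviation div_exp (infixl "[div]" 70) where "a [div] b \<equiv> Bin Div a b"
abbreviation mod_exp (infixl "[mod]" 70) where "a [mod] b \<equiv> Bin Mod a b"
abbreviation shl_exp (infixl "[<<]" 75) where "a [<<] b \<equiv> Bin ShiftL a b"
abbreviation shr_exp (infixl "[>>]" 75) where "a [>>] b \<equiv> Bin ShiftR a b"
abbreviation less_exp (infix "[<]" 60) where "a [<] b \<equiv> Bin Less a b"
abbreviation eq_exp (infix "[=]" 60) where "a [=] b \<equiv> Bin Equal a b"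
abbreviation assign (infix "::=" 54) where "r ::= e \<equiv> Asg r e"
abbreviation seq_com (infixr ";;" 52) where "a ;; b \<equiv> Seq a b"

abbreviation (input) "rn \<equiv> 2 :: nat"
abbreviation (input) "rd \<equiv> 3 :: nat"
abbreviation (input) "rm \<equiv> 4 :: nat"
abbreviation (input) "rl \<equiv> 5 :: nat"
abbreviation (input) "rs \<equiv> 6 :: nat"
abbreviation (input) "rv \<equiv> 7 :: nat"
abbreviation (input) "rx \<equiv> 8 :: nat"
abbreviation (input) "rp \<equiv> 9 :: nat"
abbreviation (input) "rg \<equiv> 10 :: nat"
abbreviation (input) "rnf \<equiv> 11 :: nat"
abbreviation (input) "rtop \<equiv> 12 :: nat"
abbreviation (input) "rX \<equiv> 13 :: nat"
abbreviation (input) "ri \<equiv> 14 :: nat"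
abbreviation (input) "rj \<equiv> 15 :: nat"
abbreviation (input) "ry \<equiv> 16 :: nat"
abbreviation (input) "rt \<equiv> 17 :: nat"
abbreviation (input) "racc \<equiv> 18 :: nat"
abbreviation (input) "rlim \<equiv> 19 :: nat"
abbreviation (input) "re \<equiv> 20 :: nat"
abbreviation (input) "rpp \<equiv> 21 :: nat"
abbreviation (input) "rbo \<equiv> 22 :: nat"
abbreviation (input) "rc \<equiv> 23 :: nat"
abbreviation (input) "ru \<equiv> 24 :: nat"
abbreviation (input) "rq \<equiv> 25 :: nat"
abbreviation (input) "rr \<equiv> 26 :: nat"
abbreviation (input) "rh \<equiv> 27 :: nat"
abbreviation (input) "rcnt \<equiv> 28 :: nat"
abbreviation (input) "rb \<equiv> 29 :: nat"
abbreviation (input) "rf \<equiv> 30 :: nat"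
abbreviation (input) "rz \<equiv> 31 :: nat"
abbreviation (input) "res \<equiv> 32 :: nat"

definition walk :: "nat \<Rightarrow> com \<Rightarrow> com" where
  "walk p body = While (Var p) (body ;; p ::= Inp (Var p [+] Lit 1))"

locale run = input w d n m E I A + layout w I S base width len
  for w d n m E I A S base width len
begin

text \<open>Induction over the list still to be visited gives termination. The invariant is indexed
  by this remainder, so it can reserve time for the nodes to come.\<close>

lemma wp_walk:
  assumes "J ps \<sigma> \<alpha> os t" "linked_list I (\<sigma> p) ps" "p < 200"
    and step: "\<And>q qs \<sigma> \<alpha> os t. J (q # qs) \<sigma> \<alpha> os t \<Longrightarrow> \<sigma> p = q \<Longrightarrow> q < length I \<Longrightarrow>
      q \<in> set ps \<Longrightarrow>
      wp body (\<lambda>\<sigma>' \<alpha>' os' t'. \<sigma>' p = q \<and> J qs (\<sigma>'(p := I ! (q + 1))) \<alpha>' os' (Suc t')) \<sigma> \<alpha> os (Suc t)"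
    and exit: "\<And>\<sigma> \<alpha> os t. J [] \<sigma> \<alpha> os t \<Longrightarrow> \<sigma> p = 0 \<Longrightarrow> Q \<sigma> \<alpha> os (Suc t)"
  shows "wp (walk p body) Q \<sigma> \<alpha> os t"
proof -
  have "set qs \<subseteq> set ps \<Longrightarrow> J qs \<sigma> \<alpha> os t \<Longrightarrow> linked_list I (\<sigma> p) qs \<Longrightarrow> wp (walk p body) Q \<sigma> \<alpha> os t"
    for qs \<sigma> \<alpha> os t
  proof (induction qs arbitrary: \<sigma> \<alpha> os t)
    case Nil
    then show ?case using exit assms(3) by (simp add: walk_def wp_While)
  next
    case (Cons q qs)
    have q: "\<sigma> p = q" "0 < q" "q + 1 < length I" "linked_list I (I ! (q + 1)) qs" "q \<in> set ps"
      using Cons.prems by auto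
    have lt: "q + 1 < 2 ^ w" "1 < (2 :: nat) ^ w" using q(2,3) length_I by linarith+
    have "wp body (\<lambda>\<sigma>' \<alpha>' os' t'. \<sigma>' p = q \<and> J qs (\<sigma>'(p := I ! (q + 1))) \<alpha>' os' (Suc t')) \<sigma> \<alpha> os (Suc t)"
      using step[OF Cons.prems(2) q(1) _ q(5)] q(3) by simp
    then have "wp body (wp (p ::= Inp (Var p [+] Lit 1)) (wp (walk p body) Q)) \<sigma> \<alpha> os (Suc t)"
    proof (rule wp_mono, goal_cases)
      case (1 \<sigma>' \<alpha>' os' t')
      have "wp (walk p body) Q (\<sigma>'(p := I ! (q + 1))) \<alpha>' os' (Suc t')"
        using 1 q(4) Cons.prems(1) by (intro Cons.IH) (auto simp: fun_upd_def)
      then show ?case using 1 q(3) lt assms(3) by (simp add: wp_Asg)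
    qed
    then show ?case
      unfolding walk_def by (subst wp_While) (use q assms(3) in \<open>simp add: wp_Seq walk_def\<close>)
  qed
  from this[OF order_refl assms(1,2)] show ?thesis .
qed

end

section \<open>Small words\<close>

text \<open>If \<open>w < 256\<close>, then array 10 occupies the first cells; a vertex is removed as soon as possible
  and the search for the next one restarts at vertex 0.\<close>

definition naive :: com where
  "naive =
    rn ::= Inp (Lit 0) ;; rd ::= Inp (Lit 1) ;;
    120 ::= Lit 0 ;; 121 ::= Lit 1 ;; rv ::= Lit 0 ;; rcnt ::= Lit 0 ;;
    While (Var rv [<] Var rn)
      (Cond (Get 10 (Var rv)) (rv ::= Var rv [+] Lit 1)
        (rr ::= Lit 0 ;; rp ::= Inp (Lit 2 [+] Var rv) ;;
         walk rp (Cond (Get 10 (Inp (Var rp))) Skip (rr ::= Var rr [+] Lit 1)) ;;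
         Cond (Var rd [<] Var rr) (rv ::= Var rv [+] Lit 1)
           (Out (Var rv) ;; Put 10 (Var rv) (Lit 1) ;; rcnt ::= Var rcnt [+] Lit 1 ;; rv ::= Lit 0))) ;;
    res ::= (Var rcnt [=] Var rn)"

context run
begin

lemma card_filter_A:
  assumes "v < n" "A v = ps @ qs"
  shows "length (filter (\<lambda>p. P (I ! p)) ps) \<le> deg v"
    and "length (filter (\<lambda>p. P (I ! p)) (A v)) = card {u \<in> neighbours E v. P u}"
proof -
  have "length (filter (\<lambda>p. P (I ! p)) ps) \<le> length (A v)"
    using length_filter_le[of "\<lambda>p. P (I ! p)" ps] unfolding assms(2) length_append by (rule trans_le_add1)
  then show "length (filter (\<lambda>p. P (I ! p)) ps) \<le> deg v" using length_A[OF assms(1)] by simp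
  have "distinct (filter P (map ((!) I) (A v)))" using distinct_A[OF assms(1)] by simp
  from distinct_card[OF this] have "card {u \<in> neighbours E v. P u} = length (filter P (map ((!) I) (A v)))"
    using set_A[OF assms(1)] by simp
  then show "length (filter (\<lambda>p. P (I ! p)) (A v)) = card {u \<in> neighbours E v. P u}"
    by (simp add: filter_map o_def)
qed

lemma vertex_A: "v < n \<Longrightarrow> q \<in> set (A v) \<Longrightarrow> I ! q < n"
  using set_A[of v] neighbours_subset[OF graph, of v] by fastforce

lemma wp_naive:
  assumes base: "base 10 = 0" "width 10 = 1" "len 10 = n" and "\<alpha>0 10 = (\<lambda>_. 0)"
  shows "wp naive (\<lambda>\<sigma> \<alpha> os t. t \<le> t0 + (4 * n + 20) * (n + 1) * (n + 1) + 20 \<and>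
     (\<sigma> res \<noteq> 0 \<longleftrightarrow> degenerate d {..<n} E) \<and> (\<sigma> res \<noteq> 0 \<longrightarrow> degenerate_order d {..<n} E os))
     \<sigma>0 \<alpha>0 [] t0"
proof -
  \<comment> \<open>The factor \<open>c\<close> bounds the ticks of one round. Progress is
    lexicographic and measured by \<open>length os * k + rv\<close>: a removal resets
    \<open>rv\<close>, which was at most \<open>n\<close>, but gains
    \<open>k = n + 1\<close>.\<close>
  define c k where "c = 4 * n + 20" and "k = n + 1"
  define J where "J = (\<lambda>(\<sigma> :: nat \<Rightarrow> nat) (\<alpha> :: nat \<Rightarrow> nat \<Rightarrow> nat) os t.
    \<sigma> rn = n \<and> \<sigma> rd = d \<and> array_ok 10 \<sigma> \<and> \<sigma> rv \<le> n \<and> (\<forall>u<n. \<alpha> 10 u = of_bool (u \<in> set os)) \<and>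
    peel d {..<n} E os \<and> \<sigma> rcnt = length os \<and>
    (\<forall>u<\<sigma> rv. u \<notin> set os \<longrightarrow> d < card (neighbours E u - set os)) \<and>
    t \<le> t0 + 6 + c * (length os * k + \<sigma> rv))"
  have len_os: "length os \<le> n" if "J \<sigma> \<alpha> os t" for \<sigma> \<alpha> os t
    using that card_mono[of "{..<n}" "set os"] by (auto simp: J_def peel_def distinct_card)
  have small: "n + 2 \<le> 2 ^ w" "1 < (2 :: nat) ^ w"
    using size_bound w_positive by (auto intro: one_less_power simp: le_trans)
  have wp_loop: "wp (While (Var rv [<] Var rn)
      (Cond (Get 10 (Var rv)) (rv ::= Var rv [+] Lit 1)
        (rr ::= Lit 0 ;; rp ::= Inp (Lit 2 [+] Var rv) ;;
         walk rp (Cond (Get 10 (Inp (Var rp))) Skip (rr ::= Var rr [+] Lit 1)) ;;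
         Cond (Var rd [<] Var rr) (rv ::= Var rv [+] Lit 1)
           (Out (Var rv) ;; Put 10 (Var rv) (Lit 1) ;; rcnt ::= Var rcnt [+] Lit 1 ;; rv ::= Lit 0))))
      (\<lambda>\<sigma> \<alpha> os t. J \<sigma> \<alpha> os (t - 1) \<and> 0 < t \<and> \<sigma> rv = n) \<sigma> \<alpha> os t" if "J \<sigma> \<alpha> os t" for \<sigma> \<alpha> os t
  proof (rule wp_While_invariant[where J = J and T = "t0 + 6 + c * (n * k + n)"], rule that, goal_cases)
    case (1 \<sigma> \<alpha> os t)
    from len_os[OF 1] have "length os * k + \<sigma> rv \<le> n * k + n"
      using 1 by (intro add_mono mult_right_mono) (auto simp: J_def)
    then have "c * (length os * k + \<sigma> rv) \<le> c * (n * k + n)"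
      by (rule mult_le_mono2)
    moreover have "t \<le> t0 + 6 + c * (length os * k + \<sigma> rv)" using 1 by (simp add: J_def)
    ultimately have "t \<le> t0 + 6 + c * (n * k + n)" by linarith
    then show ?case by simp
  next
    case (2 \<sigma> \<alpha> os t)
    define v where "v = \<sigma> rv"
    have v: "v < n" using 2 by (auto simp: v_def J_def)
    have four: "v + 2 < 2 ^ w" "2 < (2 :: nat) ^ w" "v + 1 < 2 ^ w" using small v by linarith+
    have lo: "length os \<le> n" using len_os 2(1) .
    have tb: "t \<le> t0 + 6 + c * (length os * k + v)" using 2 by (simp add: J_def v_def)
    have next_v: "c * (length os * k + (v + 1)) = c * (length os * k + v) + c"
      by (simp add: algebra_simps)
    have c_ge: "4 * deg v + 20 \<le> c" using deg_le_n[of v] by (simp add: c_def)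
    have less_Suc: "u < v + 1 \<longleftrightarrow> u < v \<or> u = v" for u by auto
    show ?case
    proof (cases "v \<in> set os")
      case True
      then show ?thesis using 2 v four tb next_v small(2) c_ge
        by (auto simp: J_def wp_simps base array_ok_def v_def[symmetric] less_Suc)
    next
      case False
      define r where "r = card (neighbours E v - set os)"
      have I2: "2 + v < length I" using header v by simp
      define K where "K t1 = (\<lambda>qs \<sigma>' \<alpha>' os' t'. \<exists>ps. A v = ps @ qs \<and> \<alpha>' = \<alpha> \<and> os' = os \<and>
         \<sigma>' = \<sigma>(rr := length (filter (\<lambda>p. I ! p \<notin> set os) ps), rp := \<sigma>' rp) \<and> t' + 4 * length qs \<le> t1 + 1 + 4 * deg v)" for t1
      have wp_r: "wp (walk rp (Cond (Get 10 (Inp (Var rp))) Skip (rr ::= Var rr [+] Lit 1)))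
        (\<lambda>\<sigma>' \<alpha>' os' t'. \<sigma>' = \<sigma>(rr := r, rp := 0) \<and> \<alpha>' = \<alpha> \<and> os' = os \<and> t' \<le> t1 + 2 + 4 * deg v)
        (\<sigma>(rr := 0, rp := I ! (2 + v))) \<alpha> os t1" for t1
      proof (rule wp_walk[where J = "K t1" and ps = "A v"], goal_cases)
        case 1
        show ?case using length_A[OF v] by (auto simp: K_def)
      next
        case 2
        show ?case using list_A[OF v] by simp
      next
        case 3
        show ?case by simp
      next
        case (4 q qs \<sigma>' \<alpha>' os' t')
        from 4(1) obtain ps where ps: "A v = ps @ q # qs" "\<alpha>' = \<alpha>" "os' = os"
          "\<sigma>' = \<sigma>(rr := length (filter (\<lambda>p. I ! p \<notin> set os) ps), rp := \<sigma>' rp)" "t' + 4 * length (q # qs) \<le> t1 + 1 + 4 * deg v"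
          by (auto simp: K_def)
        have u: "I ! q < n" using vertex_A[OF v 4(4)] .
        have a: "array_ok 10 \<sigma>" "\<alpha> 10 (I ! q) = of_bool (I ! q \<in> set os)" using \<open>J \<sigma> \<alpha> os t\<close> u by (auto simp: J_def)
        have g: "\<sigma>' z = (if z = rr then length (filter (\<lambda>p. I ! p \<notin> set os) ps) else \<sigma> z)" if "z \<noteq> rp" for z
          using fun_cong[OF ps(4), of z] that by (simp split: if_splits)
        have a': "array_ok 10 \<sigma>'" using a(1) by (simp add: array_ok_def g)
        have s: "\<sigma>' rr = length (filter (\<lambda>p. I ! p \<notin> set os) ps)" by (simp add: g)
        have "length (filter (\<lambda>p. I ! p \<notin> set os) ps) \<le> n"
          using card_filter_A(1)[OF v ps(1), of "\<lambda>u. u \<notin> set os"] deg_le_n[of v] by linarith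
        then have s2: "\<sigma>' rr + 1 < 2 ^ w" using s small(1) by linarith
        show ?case
        proof (cases "I ! q \<in> set os")
          case True
          then show ?thesis using 4 a a' ps u base(3)
            by (auto simp: wp_simps K_def intro!: exI[of _ "ps @ [q]"])
        next
          case False
          have "\<sigma>'(rr := Suc (\<sigma>' rr), rp := x) = \<sigma>(rr := length (filter (\<lambda>p. I ! p \<notin> set os) (ps @ [q])), rp := x)" for x
            using s False by (subst ps(4)) (auto simp: fun_eq_iff)
          then show ?thesis using 4 False a a' ps(1-3,5) s2 u base(3) small(2)
            by (auto simp: wp_simps K_def intro!: exI[of _ "ps @ [q]"])
        qed
      next
        case (5 \<sigma>' \<alpha>' os' t')
        have "length (filter (\<lambda>p. I ! p \<notin> set os) (A v)) = r"
          using card_filter_A(2)[OF v, of "A v" "[]" "\<lambda>u. u \<notin> set os"] by (simp add: r_def set_diff_eq)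
        with 5 show ?case by (auto simp: K_def)
      qed
      have dn: "deg v \<le> n" by (rule deg_le_n)
      have rn': "r \<le> n" unfolding r_def using deg_le_n[of v] card_mono[of "neighbours E v" "neighbours E v - set os"]
          finite_neighbours[OF graph, of v] by (auto simp: deg_def degree_def)
      have pe: "r \<le> d \<Longrightarrow> peel d {..<n} E (os @ [v])"
        using peel_snoc[of d "{..<n}" E os v] 2(1) v False by (auto simp: J_def r_def)
      have lt: "r \<le> d \<Longrightarrow> length os < n"
        using pe card_mono[of "{..<n}" "set (os @ [v])"] distinct_card[of "os @ [v]"] by (auto simp: peel_def)
      have n1: "c * (length os * k + v) + c \<le> c * (k + length os * k)"
        unfolding next_v[symmetric] using v by (intro mult_le_mono2) (simp add: k_def algebra_simps)
      show ?thesis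
        using 2(1,2) False v four small(2) I2
        apply (simp add: J_def wp_simps base v_def[symmetric] array_ok_def)
        apply (rule wp_mono[OF wp_r])
        using tb next_v n1 dn rn' pe lt c_ge small(1)
        apply (auto simp: wp_simps base array_ok_def v_def[symmetric] put_def less_Suc r_def[symmetric])
        done
    qed
  next
    case (3 \<sigma> \<alpha> os t)
    then show ?case by (auto simp: J_def)
  qed
  have J0: "J (\<sigma>0(rn := n, rd := d, 120 := 0, 121 := 1, rv := 0, rcnt := 0)) \<alpha>0 [] (t0 + 6)"
    using assms(4) by (simp add: J_def array_ok_def base peel_Nil)
  have len_I: "1 < length I" using header by simp
  have J0': "wp (While (Var rv [<] Var rn)
      (Cond (Get 10 (Var rv)) (rv ::= Var rv [+] Lit 1)
        (rr ::= Lit 0 ;; rp ::= Inp (Lit 2 [+] Var rv) ;;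
         walk rp (Cond (Get 10 (Inp (Var rp))) Skip (rr ::= Var rr [+] Lit 1)) ;;
         Cond (Var rd [<] Var rr) (rv ::= Var rv [+] Lit 1)
           (Out (Var rv) ;; Put 10 (Var rv) (Lit 1) ;; rcnt ::= Var rcnt [+] Lit 1 ;; rv ::= Lit 0))))
      (wp (res ::= (Var rcnt [=] Var rn)) (\<lambda>\<sigma> \<alpha> os t. t \<le> t0 + (4 * n + 20) * (n + 1) * (n + 1) + 20 \<and>
     (\<sigma> res \<noteq> 0 \<longleftrightarrow> degenerate d {..<n} E) \<and> (\<sigma> res \<noteq> 0 \<longrightarrow> degenerate_order d {..<n} E os)))
      (\<sigma>0(rn := n, rd := d, 120 := 0, 121 := 1, rv := 0, rcnt := 0)) \<alpha>0 [] (t0 + 6)"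
  proof (rule wp_mono[OF wp_loop[OF J0]], goal_cases)
    case (1 \<sigma> \<alpha> os t)
    then have J: "J \<sigma> \<alpha> os (t - 1)" and tv: "0 < t" "\<sigma> rv = n" by auto
    have "length os * k + \<sigma> rv \<le> n * k + n" using len_os[OF J] tv by (intro add_mono mult_right_mono) auto
    also have "\<dots> \<le> k * k" by (simp add: k_def algebra_simps)
    finally have "c * (length os * k + \<sigma> rv) \<le> c * (k * k)" by (rule mult_le_mono2)
    moreover have "t - 1 \<le> t0 + 6 + c * (length os * k + \<sigma> rv)" using J by (simp add: J_def)
    ultimately have "t \<le> t0 + 7 + c * (k * k)" using tv by linarith
    then have "t \<le> t0 + 7 + (4 * n + 20) * (n + 1) * (n + 1)" by (simp only: c_def k_def mult.assoc)
    moreover have p: "peel d {..<n} E os" using J by (simp add: J_def)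
    have "set os = {..<n} \<longleftrightarrow> length os = n"
      using p distinct_card[of os] card_subset_eq[of "{..<n}" "set os"] by (auto simp: peel_def)
    moreover have "\<not> degenerate d {..<n} E" if "set os \<noteq> {..<n}"
      using J tv by (intro peel_stuck[OF graph p that]) (auto simp: J_def)
    moreover note peel_complete[OF graph p]
    ultimately show ?case using J by (auto simp: wp_simps J_def)
  qed
  have six: "t0 + 6 = Suc (Suc (Suc (Suc (Suc (Suc t0)))))" by simp
  have "I \<noteq> []" using len_I by auto
  then show ?thesis
    using J0'[unfolded six] len_I small header
    unfolding naive_def by (simp add: wp_simps)
qed

end

section \<open>Bit counts\<close>

fun bit_length :: "nat \<Rightarrow> nat" where
  "bit_length x = (if x = 0 then 0 else Suc (bit_length (x div 2)))"

fun pop_count :: "nat \<Rightarrow> nat" where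
  "pop_count x = (if x = 0 then 0 else pop_count (x div 2) + x mod 2)"

declare bit_length.simps [simp del] pop_count.simps [simp del]

lemma bit_length_le_iff: "bit_length x \<le> j \<longleftrightarrow> x < 2 ^ j"
proof (induction x arbitrary: j rule: bit_length.induct)
  case (1 x)
  show ?case
  proof (cases "x = 0")
    case True
    then show ?thesis by (simp add: bit_length.simps)
  next
    case False
    show ?thesis
    proof (cases j)
      case 0
      then show ?thesis using False by (simp add: bit_length.simps)
    next
      case (Suc i)
      have "bit_length (x div 2) \<le> i \<longleftrightarrow> x div 2 < 2 ^ i" using 1 False by blast
      then show ?thesis using Suc False by (subst bit_length.simps) (auto simp: less_mult_imp_div_less)
    qed
  qed
qed

lemma less_bit_length: "x < 2 ^ bit_length x"
  using bit_length_le_iff by blast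

lemma bit_length_mono: "x \<le> y \<Longrightarrow> bit_length x \<le> bit_length y"
  using less_bit_length[of y] by (simp add: bit_length_le_iff)

lemma bit_length_less: "bit_length x < 2 ^ bit_length x" "bit_length x \<le> x"
proof -
  show "bit_length x < 2 ^ bit_length x" by simp
  show "bit_length x \<le> x" by (simp add: bit_length_le_iff)
qed

lemma div_pow_zero_iff: "x div 2 ^ j = 0 \<longleftrightarrow> bit_length x \<le> j"
  by (simp add: bit_length_le_iff div_eq_0_iff)

lemma bit_length_0: "bit_length x = 0 \<longleftrightarrow> x = 0"
  by (subst bit_length.simps) simp

lemma bit_top:
  assumes "x \<noteq> 0"
  shows "bit x (bit_length x - 1)" and "2 ^ (bit_length x - 1) \<le> x"
proof -
  have p: "0 < bit_length x" using assms bit_length_0[of x] by simp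
  have "\<not> bit_length x \<le> bit_length x - 1" using p by linarith
  then have le: "2 ^ (bit_length x - 1) \<le> x" by (simp add: bit_length_le_iff)
  then show "2 ^ (bit_length x - 1) \<le> x" .
  have "x < 2 * 2 ^ (bit_length x - 1)"
    using less_bit_length[of x] p by (metis Suc_diff_1 power_Suc)
  with le have "x div 2 ^ (bit_length x - 1) = 1"
    by (intro div_nat_eqI) auto
  then show "bit x (bit_length x - 1)" by (simp add: bit_iff_odd)
qed

lemma pop_count_mod: "pop_count (x mod 2 ^ j) = card {i. i < j \<and> bit x i}"
proof (induction j arbitrary: x)
  case 0
  then show ?case by (simp add: pop_count.simps[of 0])
next
  case (Suc j)
  have e: "x mod 2 ^ Suc j = 2 * (x div 2 mod 2 ^ j) + x mod 2"
    by (metis add.commute mod_mult2_eq mult.commute power_Suc)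
  have "pop_count (x mod 2 ^ Suc j) = pop_count (x div 2 mod 2 ^ j) + x mod 2"
    unfolding e by (subst pop_count.simps) (auto simp: pop_count.simps[of 0])
  also have "\<dots> = card {i. i < j \<and> bit (x div 2) i} + of_bool (bit x 0)"
    by (simp add: Suc.IH bit_0 odd_iff_mod_2_eq_one)
  also have "\<dots> = card ((if bit x 0 then {0} else {}) \<union> Suc ` {i. i < j \<and> bit (x div 2) i})"
    by (auto simp: card_image card_insert_if image_iff)
  also have "(if bit x 0 then {0} else {}) \<union> Suc ` {i. i < j \<and> bit (x div 2) i} = {i. i < Suc j \<and> bit x i}"
    by (auto simp: bit_Suc[symmetric] image_iff less_Suc_eq_0_disj)
  finally show ?case .
qed

lemma pop_count_card: "x < 2 ^ s \<Longrightarrow> pop_count x = card {i. i < s \<and> bit x i}"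
  using pop_count_mod[of x s] by simp

lemma pop_count_le: "x < 2 ^ s \<Longrightarrow> pop_count x \<le> s"
  using pop_count_card[of x s] card_mono[of "{..<s}" "{i. i < s \<and> bit x i}"] by (auto simp: subset_iff)

text \<open>Adding a power of two to a clear position causes no carry, so addition replaces a
  bitwise operation.\<close>

lemma bit_add:
  fixes x :: nat
  assumes "\<not> bit x i"
  shows "bit (x + 2 ^ i) j \<longleftrightarrow> bit x j \<or> j = i" "x < 2 ^ s \<Longrightarrow> i < s \<Longrightarrow> x + 2 ^ i < 2 ^ s"
proof -
  have e: "x + 2 ^ i = set_bit i x" using assms by (simp add: set_bit_eq)
  show "bit (x + 2 ^ i) j \<longleftrightarrow> bit x j \<or> j = i" unfolding e by (auto simp: bit_set_bit_iff)
  show "x + 2 ^ i < 2 ^ s" if x: "x < 2 ^ s" and i: "i < s"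
  proof (rule ccontr)
    assume "\<not> x + 2 ^ i < 2 ^ s"
    then have s: "s < bit_length (x + 2 ^ i)" using bit_length_le_iff[of "x + 2 ^ i" s] by linarith
    then have "bit (x + 2 ^ i) (bit_length (x + 2 ^ i) - 1)" by (intro bit_top) auto
    then have "bit x (bit_length (x + 2 ^ i) - 1) \<or> bit_length (x + 2 ^ i) - 1 = i"
      unfolding e by (auto simp: bit_set_bit_iff)
    then show False
    proof
      assume b: "bit x (bit_length (x + 2 ^ i) - 1)"
      have "x < 2 ^ (bit_length (x + 2 ^ i) - 1)"
        using x power_increasing[of s "bit_length (x + 2 ^ i) - 1" "2 :: nat"] s by linarith
      then show False using b by (simp add: bit_iff_odd)
    qed (use s i in linarith)
  qed
qed

text \<open>The counterpart for clearing a set bit: no borrow occurs.\<close>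

lemma bit_diff:
  fixes x :: nat
  assumes "bit x i"
  shows "bit (x - 2 ^ i) j \<longleftrightarrow> bit x j \<and> j \<noteq> i" "2 ^ i \<le> x"
proof -
  have "set_bit i (unset_bit i x) = x"
    using assms by (auto intro!: bit_eqI simp: bit_set_bit_iff bit_unset_bit_iff)
  then have "unset_bit i x + 2 ^ i = x" by (simp add: set_bit_eq bit_unset_bit_iff)
  then have "x - 2 ^ i = unset_bit i x" by simp
  then show "bit (x - 2 ^ i) j \<longleftrightarrow> bit x j \<and> j \<noteq> i" by (auto simp: bit_unset_bit_iff)
  show "2 ^ i \<le> x"
    using assms by (metis bit_iff_odd div_less even_zero leI)
qed

lemma zero_iff_bits: "x < 2 ^ s \<Longrightarrow> x = 0 \<longleftrightarrow> (\<forall>i<s. \<not> bit (x :: nat) i)"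
proof
  assume x: "x < 2 ^ s" "\<forall>i<s. \<not> bit x i"
  show "x = 0"
  proof (rule ccontr)
    assume nz: "x \<noteq> 0"
    have "bit_length x \<le> s" "0 < bit_length x" using x nz bit_length_le_iff[of x s] bit_length_0[of x] by auto
    then show False using bit_top(1)[OF nz] x(2) by simp
  qed
qed simp

section \<open>The counter levels of groups of vertices\<close>

context input
begin

definition groups :: nat where "groups = (n + 255) div 256"

definition group_deg :: "nat \<Rightarrow> nat" where
  "group_deg g = (\<Sum>v | v < n \<and> v div 256 = g. deg v)"

definition level :: "nat \<Rightarrow> nat" where "level g = bit_length (group_deg g div 1024)"

text \<open>Every group has one node on each of its levels \<open>0, \<dots>, level g\<close>; the nodes are numbered level
  by level, so that the child of a node is found by counting the nodes with a child before it.\<close>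

definition nodes :: "(nat \<times> nat) set" where "nodes = {(j, g). g < groups \<and> j \<le> level g}"

definition before :: "nat \<Rightarrow> nat \<Rightarrow> (nat \<times> nat) set" where
  "before j g = {(j', g') \<in> nodes. j' < j \<or> j' = j \<and> g' < g}"

text \<open>The definition also covers pairs that are no nodes: \<open>pos j 0\<close> is where
  level \<open>j\<close> starts and \<open>pos j groups\<close> is where it ends.\<close>

definition pos :: "nat \<Rightarrow> nat \<Rightarrow> nat" where "pos j g = card (before j g)"

definition num_nodes :: nat where "num_nodes = card nodes"

definition parents :: "nat set" where "parents = {p. \<exists>j g. g < groups \<and> j < level g \<and> p = pos j g}"

lemma finite_nodes: "finite nodes" and card_nodes: "num_nodes = (\<Sum>g<groups. Suc (level g))"
proof -
  have e: "nodes = (\<lambda>(g, j). (j, g)) ` (SIGMA g:{..<groups}. {..level g})"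
    by (force simp: nodes_def)
  show "finite nodes" unfolding e by auto
  have "inj_on (\<lambda>(g, j). (j, g)) (SIGMA g:{..<groups}. {..level g})" by (auto simp: inj_on_def)
  then show "num_nodes = (\<Sum>g<groups. Suc (level g))"
    unfolding num_nodes_def e by (simp add: card_image card_SigmaI)
qed

lemma finite_before: "finite (before j g)"
  using finite_nodes by (rule finite_subset[rotated]) (auto simp: before_def)

lemma pos_less:
  assumes "g < groups" "j \<le> level g" "j < j' \<or> j = j' \<and> g < g'"
  shows "pos j g < pos j' g'"
  unfolding pos_def by (rule psubset_card_mono[OF finite_before]) (use assms in \<open>auto simp: before_def nodes_def\<close>)

lemma pos_less_num: "g < groups \<Longrightarrow> j \<le> level g \<Longrightarrow> pos j g < num_nodes"
  unfolding pos_def num_nodes_def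
  by (rule psubset_card_mono[OF finite_nodes]) (auto simp: before_def nodes_def)

lemma pos_le_num: "pos j g \<le> num_nodes"
  unfolding pos_def num_nodes_def by (rule card_mono[OF finite_nodes]) (auto simp: before_def)

lemma pos_inject:
  assumes "g < groups" "j \<le> level g" "g' < groups" "j' \<le> level g'"
  shows "pos j g = pos j' g' \<longleftrightarrow> j = j' \<and> g = g'"
  using pos_less[OF assms(1,2), of j' g'] pos_less[OF assms(3,4), of j g] by (metis nat_neq_iff)

lemma pos_less_iff:
  assumes "g < groups" "j \<le> level g" "g' < groups" "j' \<le> level g'"
  shows "pos j g < pos j' g' \<longleftrightarrow> j < j' \<or> j = j' \<and> g < g'"
  using pos_less[OF assms(1,2), of j' g'] pos_less[OF assms(3,4), of j g] by (metis nat_neq_iff less_asym)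

lemma pos_0: "g \<le> groups \<Longrightarrow> pos 0 g = g"
proof -
  assume "g \<le> groups"
  then have "before 0 g = {0} \<times> {..<g}" by (auto simp: before_def nodes_def)
  then show ?thesis by (simp add: pos_def card_cartesian_product)
qed

lemma pos_Suc_0: "pos (j + 1) 0 = pos j groups"
proof -
  have "before (j + 1) 0 = before j groups" by (auto simp: before_def nodes_def less_Suc_eq)
  then show ?thesis by (simp add: pos_def)
qed

lemma pos_Suc:
  assumes "g < groups"
  shows "pos j (g + 1) = pos j g + of_bool (j \<le> level g)"
proof -
  have less: "x < g + 1 \<longleftrightarrow> x < g \<or> x = g" for x :: nat by auto
  show ?thesis
proof (cases "j \<le> level g")
  case True
  then have "before j (g + 1) = insert (j, g) (before j g)" "(j, g) \<notin> before j g"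
    using assms by (auto simp: before_def nodes_def less)
  then show ?thesis using True finite_before by (simp add: pos_def)
next
  case False
  then have "before j (g + 1) = before j g" by (auto simp: before_def nodes_def less)
  then show ?thesis using False by (simp add: pos_def)
qed
qed

lemma pos_top: "(\<And>g. g < groups \<Longrightarrow> level g < j) \<Longrightarrow> pos j 0 = num_nodes"
  unfolding pos_def num_nodes_def by (rule arg_cong[where f = card]) (force simp: before_def nodes_def)

lemma parents_iff: "g < groups \<Longrightarrow> j \<le> level g \<Longrightarrow> pos j g \<in> parents \<longleftrightarrow> j < level g"
proof
  assume g: "g < groups" "j \<le> level g" and "pos j g \<in> parents"
  then obtain j' g' where p: "g' < groups" "j' < level g'" "pos j g = pos j' g'" by (auto simp: parents_def)
  then have "j = j' \<and> g = g'" using pos_inject[OF g p(1), of j'] by simp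
  then show "j < level g" using p(2) by simp
qed (auto simp: parents_def)

lemma finite_parents: "finite parents" "p \<in> parents \<Longrightarrow> p < num_nodes"
proof -
  show "p \<in> parents \<Longrightarrow> p < num_nodes" for p using pos_less_num by (auto simp: parents_def)
  then show "finite parents" by (meson finite_nat_set_iff_bounded)
qed

text \<open>Going from a parent to its child is an order isomorphism onto the nodes above level 0.
  So the nodes before a child are the \<open>groups\<close> roots and the children of the parents
  before its own parent, the usual rank navigation in level order.\<close>

lemma pos_child:
  assumes "g < groups" "j < level g"
  shows "groups + card {p \<in> parents. p < pos j g} = pos (j + 1) g"
proof -
  define B where "B = {(j', g'). g' < groups \<and> j' < level g' \<and> (j' < j \<or> j' = j \<and> g' < g)}"
  have fB: "finite B"
    by (rule finite_subset[OF _ finite_before[of j g]]) (auto simp: B_def before_def nodes_def)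
  have "{p \<in> parents. p < pos j g} = (\<lambda>(j', g'). pos j' g') ` B"
  proof (intro equalityI subsetI)
    fix p assume "p \<in> {p \<in> parents. p < pos j g}"
    then obtain j' g' where p: "g' < groups" "j' < level g'" "p = pos j' g'" "pos j' g' < pos j g"
      by (auto simp: parents_def)
    then have "(j', g') \<in> B" using assms pos_less_iff[of g' j' g j] by (simp add: B_def)
    then show "p \<in> (\<lambda>(j', g'). pos j' g') ` B" using p(3) by force
  next
    fix p assume "p \<in> (\<lambda>(j', g'). pos j' g') ` B"
    then obtain j' g' where p: "(j', g') \<in> B" "p = pos j' g'" by auto
    then show "p \<in> {p \<in> parents. p < pos j g}"
      using assms pos_less_iff[of g' j' g j] by (auto simp: parents_def B_def)
  qed
  moreover have "inj_on (\<lambda>(j', g'). pos j' g') B"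
    using pos_inject by (intro inj_onI) (auto simp: B_def)
  ultimately have 1: "card {p \<in> parents. p < pos j g} = card B" by (simp add: card_image)
  have "before (j + 1) g = {0} \<times> {..<groups} \<union> (\<lambda>(j', g'). (j' + 1, g')) ` B"
  proof (intro equalityI subsetI)
    fix x assume "x \<in> before (j + 1) g"
    then obtain j' g' where x: "x = (j', g')" "g' < groups" "j' \<le> level g'" "j' < j + 1 \<or> j' = j + 1 \<and> g' < g"
      by (auto simp: before_def nodes_def)
    show "x \<in> {0} \<times> {..<groups} \<union> (\<lambda>(j', g'). (j' + 1, g')) ` B"
    proof (cases j')
      case 0
      then show ?thesis using x by auto
    next
      case (Suc i)
      then have "(i, g') \<in> B" using x by (auto simp: B_def)
      then show ?thesis using x Suc by (force)
    qed
  qed (auto simp: before_def nodes_def B_def)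
  moreover have "card ({0 :: nat} \<times> {..<groups} \<union> (\<lambda>(j', g'). (j' + 1, g')) ` B) = groups + card B"
  proof (subst card_Un_disjoint)
    have "inj_on (\<lambda>(j', g'). (j' + 1, g')) B" by (auto simp: inj_on_def)
    then show "card ({0 :: nat} \<times> {..<groups}) + card ((\<lambda>(j', g'). (j' + 1, g')) ` B) = groups + card B"
      by (simp add: card_cartesian_product card_image)
  qed (use fB in auto)
  ultimately show ?thesis using 1 by (simp add: pos_def)
qed

section \<open>Bounds for groups, levels and nodes\<close>

lemma groups_bounds: "n \<le> 256 * groups" "256 * groups \<le> n + 255" "groups \<le> n"
  unfolding groups_def by linarith+

lemma group_less: "v < n \<Longrightarrow> v div 256 < groups"
  using groups_bounds(1) by (simp add: div_less_iff_less_mult)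

lemma sum_group_deg: "(\<Sum>g<groups. group_deg g) = 2 * m"
proof -
  have "(\<Sum>g<groups. group_deg g) = (\<Sum>g<groups. \<Sum>v | v \<in> {..<n} \<and> v div 256 = g. deg v)"
    by (simp add: group_deg_def)
  also have "\<dots> = (\<Sum>v<n. deg v)" by (rule sum.group) (auto simp: group_less)
  finally show ?thesis by (simp add: sum_deg)
qed

lemma group_deg_le: "group_deg g \<le> 2 * m"
proof -
  have "group_deg g \<le> (\<Sum>v<n. deg v)" unfolding group_deg_def by (intro sum_mono2) auto
  then show ?thesis by (simp add: sum_deg)
qed

lemma deg_le_group: "v < n \<Longrightarrow> deg v \<le> group_deg (v div 256)"
  unfolding group_deg_def by (rule member_le_sum) auto

text \<open>This allows the potential released by a borrow out of the highest bit to pay for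
  scanning the whole adjacency list.\<close>

lemma deg_less_level: "v < n \<Longrightarrow> deg v < 1024 * 2 ^ level (v div 256)"
  using deg_le_group[of v] less_bit_length[of "group_deg (v div 256) div 1024"]
  unfolding level_def by (simp add: div_less_iff_less_mult mult.commute)

text \<open>Already the crude bound of a bit length by the number itself suffices. A group spends
  256 bits per level, so the counters occupy at most \<open>256 * (2 * m) / 1024 = m / 2\<close>
  bits.\<close>

lemma sum_level: "1024 * (\<Sum>g<groups. level g) \<le> 2 * m"
proof -
  have "1024 * level g \<le> group_deg g" for g
    using bit_length_less(2)[of "group_deg g div 1024"] unfolding level_def by linarith
  then have "(\<Sum>g<groups. 1024 * level g) \<le> (\<Sum>g<groups. group_deg g)" by (rule sum_mono)
  then show ?thesis by (simp add: sum_group_deg sum_distrib_left)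
qed

lemma num_nodes_eq: "num_nodes = groups + (\<Sum>g<groups. level g)"
  by (simp add: card_nodes sum.distrib Suc_eq_plus1 del: One_nat_def)

lemma num_nodes_bound: "1024 * (num_nodes - groups) \<le> 2 * m" "groups \<le> num_nodes" "num_nodes \<le> n + m"
  using sum_level groups_bounds unfolding num_nodes_eq by linarith+

definition lg :: nat where "lg = bit_length (2 * m + n + 1)"
text \<open>Fields of about a sixteenth of \<open>lg\<close> bits. They are short enough for tables
  over all field values to take o(m + n) bits and for rounding to whole words to lose at most one
  eighth when \<open>256 <= w\<close>, yet long enough for one sample of \<open>lg\<close> bits per
  field to cost only a constant number of bits per position.\<close>

definition sz :: nat where "sz = lg div 16 + 1"

lemma level_le: "level g \<le> lg"
  unfolding level_def lg_def using group_deg_le[of g] by (intro bit_length_mono) linarith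

lemma lg_bounds: "0 < lg" "lg \<le> w" "2 * m + n + 1 < 2 ^ lg"
proof -
  show "2 * m + n + 1 < 2 ^ lg" unfolding lg_def by (rule less_bit_length)
  show "0 < lg" using bit_length_0[of "2 * m + n + 1"] unfolding lg_def by simp
  show "lg \<le> w" unfolding lg_def bit_length_le_iff using size_bound by linarith
qed

lemma sz_bounds: "0 < sz" "sz \<le> lg" "256 \<le> w \<Longrightarrow> 8 * sz \<le> w"
proof -
  show "0 < sz" by (simp add: sz_def)
  show "sz \<le> lg" using lg_bounds(1) unfolding sz_def by linarith
  show "8 * sz \<le> w" if "256 \<le> w"
  proof -
    define q where "q = lg div 16"
    have "16 * q \<le> lg" by (simp add: q_def)
    then show ?thesis using lg_bounds(2) that unfolding sz_def q_def[symmetric] by simp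
  qed
qed

lemma pow_lg: "2 ^ lg \<le> 4 * m + 2 * n + 2" "lg \<le> 2 * m + n + 1" "2 ^ sz \<le> 4 * m + 2 * n + 2"
proof -
  have "2 ^ (lg - 1) \<le> 2 * m + n + 1" unfolding lg_def by (rule bit_top(2)) simp
  moreover have "(2::nat) ^ lg = 2 * 2 ^ (lg - 1)" using lg_bounds(1) by (metis Suc_diff_1 power_Suc)
  ultimately show p: "2 ^ lg \<le> 4 * m + 2 * n + 2" by linarith
  show "lg \<le> 2 * m + n + 1" unfolding lg_def by (rule bit_length_less)
  have "(2 :: nat) ^ sz \<le> 2 ^ lg" using sz_bounds(2) by (intro power_increasing) auto
  then show "2 ^ sz \<le> 4 * m + 2 * n + 2" using p by linarith
qed

text \<open>Bit \<open>j\<close> belongs to the node of the group on level \<open>j + 1\<close>.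
  Nodes of level 0 carry no bits, so their \<open>groups\<close> positions are subtracted; each
  other node owns a block of 256 bits, one for each vertex of the group.\<close>

definition counter_cell :: "nat \<Rightarrow> nat \<Rightarrow> nat" where
  "counter_cell v j = (pos (j + 1) (v div 256) - groups) * 256 + v mod 256"

lemma pos_ge_groups: "g < groups \<Longrightarrow> j < level g \<Longrightarrow> groups \<le> pos (j + 1) g"
  using pos_child by (metis le_add1)

lemma counter_cell_less:
  assumes "v < n" "j < level (v div 256)"
  shows "counter_cell v j < 256 * (num_nodes - groups)"
proof -
  have "pos (j + 1) (v div 256) - groups < num_nodes - groups"
    using pos_less_num[of "v div 256" "j + 1"] pos_ge_groups[of "v div 256" j] assms group_less by simp
  then have "pos (j + 1) (v div 256) - groups + 1 \<le> num_nodes - groups" by simp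
  then have "(pos (j + 1) (v div 256) - groups + 1) * 256 \<le> (num_nodes - groups) * 256" by (rule mult_right_mono) simp
  then show ?thesis unfolding counter_cell_def by simp
qed

text \<open>Quotient and remainder by 256 recover the node and the vertex within its group; distinct
  vertices therefore have disjoint counters.\<close>

lemma counter_cell_inject:
  assumes "v < n" "j < level (v div 256)" "v' < n" "j' < level (v' div 256)"
  shows "counter_cell v j = counter_cell v' j' \<longleftrightarrow> v = v' \<and> j = j'"
proof
  assume e: "counter_cell v j = counter_cell v' j'"
  have "counter_cell v j div 256 = counter_cell v' j' div 256" "counter_cell v j mod 256 = counter_cell v' j' mod 256"
    using e by simp_all
  then have "pos (j + 1) (v div 256) - groups = pos (j' + 1) (v' div 256) - groups" and r: "v mod 256 = v' mod 256"
    unfolding counter_cell_def by simp_all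
  then have "pos (j + 1) (v div 256) = pos (j' + 1) (v' div 256)"
    using pos_ge_groups[of "v div 256" j] pos_ge_groups[of "v' div 256" j'] assms group_less by (metis eq_diff_iff)
  then have "j + 1 = j' + 1 \<and> v div 256 = v' div 256"
    using assms group_less by (subst (asm) pos_inject) auto
  then show "v = v' \<and> j = j'" using r by (metis add_right_cancel div_mult_mod_eq)
qed simp

end

section \<open>The program for large words\<close>

definition heap_base :: nat where "heap_base = reg_base + 300"

text \<open>Array 0 holds the first node of every level, arrays 1 and 2 tabulate population counts and bit lengths,
  array 3 marks the vertices neither removed nor pending, arrays 4 to 6 hold the pending vertices, array 7
  marks the nodes with a child, array 8 has its rank samples, and array 9 holds the counter bits.\<close>

definition alloc :: "nat \<Rightarrow> exp \<Rightarrow> exp \<Rightarrow> com" where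
  "alloc k b l = ((100 + 2 * k) ::= Var rtop ;; (101 + 2 * k) ::= b ;;
     rtop ::= Var rtop [+] l [div] (Wsz [div] b) [+] Lit 1)"

definition get_deg :: com where
  "get_deg = (rp ::= Inp (Lit 2 [+] Var rv) ;; rx ::= Lit 0 ;; walk rp (rx ::= Var rx [+] Lit 1))"

definition read_params :: com where
  "read_params = (
     rn ::= Inp (Lit 0) ;; rd ::= Inp (Lit 1) ;; rm ::= Lit 0 ;; rv ::= Lit 0 ;;
     While (Var rv [<] Var rn) (get_deg ;; rm ::= Var rm [+] Var rx ;; rv ::= Var rv [+] Lit 1) ;;
     ry ::= Var rm [+] Var rn [+] Lit 1 ;; rl ::= Lit 0 ;;
     While (Var ry) (ry ::= Var ry [div] Lit 2 ;; rl ::= Var rl [+] Lit 1) ;;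
     rs ::= Var rl [div] Lit 16 [+] Lit 1)"

definition alloc1 :: com where
  "alloc1 = (
     rtop ::= Lit heap_base ;;
     alloc 0 (Var rl) (Var rl [+] Lit 1) ;;
     alloc 1 (Var rs) (Lit 1 [<<] Var rs) ;;
     alloc 2 (Var rs) (Lit 1 [<<] Var rs) ;;
     alloc 3 (Lit 1) (Var rn) ;;
     alloc 4 (Var rs) (Var rn [div] Var rs [+] Lit 1) ;;
     alloc 5 (Var rs) (Var rn [div] Var rs [div] Var rs [+] Lit 1) ;;
     alloc 6 (Var rl) (Var rn [div] Var rs [div] Var rs [+] Lit 1))"

definition tables :: com where
  "tables = (
     ri ::= Lit 1 ;; rlim ::= Lit 1 [<<] Var rs ;;
     While (Var ri [<] Var rlim)
       (Put 1 (Var ri) (Get 1 (Var ri [div] Lit 2) [+] Var ri [mod] Lit 2) ;;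
        Put 2 (Var ri) (Get 2 (Var ri [div] Lit 2) [+] Lit 1) ;;
        ri ::= Var ri [+] Lit 1))"

definition group_sum :: com where
  "group_sum = (
     rX ::= Lit 0 ;; ri ::= Lit 0 ;;
     While ((Var ri [<] Lit 256) [*] (Var rv [<] Var rn))
       (get_deg ;; rX ::= Var rX [+] Var rx ;; rv ::= Var rv [+] Lit 1 ;; ri ::= Var ri [+] Lit 1))"

definition count_levels :: com where
  "count_levels = (
     rv ::= Lit 0 ;;
     While (Var rv [<] Var rn)
       (group_sum ;; ry ::= Var rX [div] Lit 1024 ;; rj ::= Lit 0 ;;
        Put 0 (Var rj) (Get 0 (Var rj) [+] Lit 1) ;;
        While (Var ry)
          (rj ::= Var rj [+] Lit 1 ;; Put 0 (Var rj) (Get 0 (Var rj) [+] Lit 1) ;;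
           ry ::= Var ry [div] Lit 2)))"

text \<open>Exclusive prefix sums, as in counting sort. The start of level 1 is at the same time the
  number of groups, as every group has one node on level 0.\<close>

definition level_starts :: com where
  "level_starts = (
     racc ::= Lit 0 ;; rj ::= Lit 0 ;;
     While (Var rj [<] (Var rl [+] Lit 1))
       (rt ::= Get 0 (Var rj) ;; Put 0 (Var rj) (Var racc) ;; racc ::= Var racc [+] Var rt ;;
        rj ::= Var rj [+] Lit 1) ;;
     rnf ::= Var racc ;; rg ::= Get 0 (Lit 1))"

text \<open>These sizes depend on the number of nodes, which is known only after the levels have
  been counted; hence the second round of allocation.\<close>

definition alloc2 :: com where
  "alloc2 = (
     alloc 7 (Var rs) (Var rnf [div] Var rs [+] Lit 1) ;;
     alloc 8 (Var rl) (Var rnf [div] Var rs [+] Lit 1) ;;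
     alloc 9 (Lit 1) (Lit 256 [*] (Var rnf [-] Var rg)))"

text \<open>Groups are visited in order and array 0 is consumed: its entry \<open>j\<close> is the
  position of the next node on level \<open>j\<close>. The final \<open>Put\<close> advances past
  the leaf of the group, which stays unmarked.\<close>

definition mark_parents :: com where
  "mark_parents = (
     rv ::= Lit 0 ;;
     While (Var rv [<] Var rn)
       (group_sum ;; ry ::= Var rX [div] Lit 1024 ;; rj ::= Lit 0 ;;
        While (Var ry)
          (rt ::= Get 0 (Var rj) ;; Put 0 (Var rj) (Var rt [+] Lit 1) ;;
           Put 7 (Var rt [div] Var rs) (Get 7 (Var rt [div] Var rs) [+] Lit 1 [<<] (Var rt [mod] Var rs)) ;;
           ry ::= Var ry [div] Lit 2 ;; rj ::= Var rj [+] Lit 1) ;;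
        Put 0 (Var rj) (Get 0 (Var rj) [+] Lit 1)))"

definition sample_ranks :: com where
  "sample_ranks = (
     racc ::= Lit 0 ;; ri ::= Lit 0 ;; rlim ::= Var rnf [div] Var rs [+] Lit 1 ;;
     While (Var ri [<] Var rlim)
       (Put 8 (Var ri) (Var racc) ;; racc ::= Var racc [+] Get 1 (Get 7 (Var ri)) ;;
        ri ::= Var ri [+] Lit 1))"

lemma sum_lessThan_plus1 [simp]: "sum f {..<x + 1 :: nat} = sum f {..<x} + (f x :: nat)"
  using sum.lessThan_Suc[of f x] by (simp only: Suc_eq_plus1)

context machine
begin

lemma array_ok_upd [simp]: "r < 100 \<Longrightarrow> array_ok k (\<sigma>(r := v)) = array_ok k \<sigma>"
  by (auto simp: array_ok_def)

lemma put_apply [simp]: "put \<alpha> k i v k' = (if k' = k then (\<alpha> k)(i := v) else \<alpha> k')"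
  by (simp add: put_def)

end

section \<open>Framing and the layout of the arrays\<close>

definition frame :: "nat set \<Rightarrow> (nat \<Rightarrow> 'a) \<Rightarrow> (nat \<Rightarrow> 'a) \<Rightarrow> bool" where
  "frame R f g \<longleftrightarrow> (\<forall>r. r \<notin> R \<longrightarrow> g r = f r)"

lemma frameD: "frame R f g \<Longrightarrow> r \<notin> R \<Longrightarrow> g r = f r"
  by (simp add: frame_def)

lemma frame_refl: "frame R f f"
  by (simp add: frame_def)

lemma frame_upd: "frame R f g \<Longrightarrow> r \<in> R \<Longrightarrow> frame R f (g(r := v))"
  by (auto simp: frame_def)

lemma frame_trans: "frame R f g \<Longrightarrow> frame R g h \<Longrightarrow> frame R f h"
  by (auto simp: frame_def)

lemma frame_mono: "frame R f g \<Longrightarrow> R \<subseteq> R' \<Longrightarrow> frame R' f g"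
  by (auto simp: frame_def)

lemma (in machine) frame_array_ok: "frame R \<sigma> \<sigma>' \<Longrightarrow> R \<subseteq> {..<100} \<Longrightarrow> array_ok k \<sigma>' = array_ok k \<sigma>"
proof -
  assume "frame R \<sigma> \<sigma>'" "R \<subseteq> {..<100}"
  then have "\<sigma>' r = \<sigma> r" if "100 \<le> r" for r using that by (intro frameD) auto
  then show ?thesis by (simp add: array_ok_def)
qed

context input
begin

definition entry_width :: "nat \<Rightarrow> nat" where
  "entry_width k = (if k \<in> {0, 6, 8} then lg else if k \<in> {1, 2, 4, 5, 7} then sz else 1)"

definition array_len :: "nat \<Rightarrow> nat" where
  "array_len k =
    (if k = 0 then lg + 1 else if k \<in> {1, 2} then 2 ^ sz else if k = 3 then n
     else if k = 4 then n div sz + 1 else if k \<in> {5, 6} then n div sz div sz + 1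
     else if k \<in> {7, 8} then num_nodes div sz + 1
     else if k = 9 then 256 * (num_nodes - groups) else 0)"

text \<open>The additional word covers a last word that is only partly filled, and makes the
  expression agree with the one computed by \<open>alloc\<close>.\<close>

fun array_base :: "nat \<Rightarrow> nat" where
  "array_base 0 = heap_base"
| "array_base (Suc k) = array_base k + (array_len k div (w div entry_width k) + 1)"

lemma array_base_mono: "k \<le> k' \<Longrightarrow> array_base k \<le> array_base k'"
  by (rule lift_Suc_mono_le) auto

end

locale main_run = run +
  assumes big: "256 \<le> w"
    and width_eq: "width k = entry_width k"
    and len_eq: "len k = array_len k"
    and base_eq: "k < 10 \<Longrightarrow> base k = array_base k"
    and S_less: "array_base 10 < 2 ^ w"
begin

lemma pow_w: "2 ^ 256 \<le> (2 :: nat) ^ w"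
  using big by (intro power_increasing) auto

lemma lits: "1 < (2 :: nat) ^ w" "2 < (2 :: nat) ^ w" "16 < (2 :: nat) ^ w" "256 < (2 :: nat) ^ w"
    "1024 < (2 :: nat) ^ w" "0 < (2 :: nat) ^ w"
  using pow_w by simp_all

lemma nm: "n + 4 * m + 2 \<le> 2 ^ w"
  using size_bound by simp

lemma lens: "len 0 = lg + 1" "len 1 = 2 ^ sz" "len 2 = 2 ^ sz" "len 3 = n" "len 4 = n div sz + 1"
    "len 5 = n div sz div sz + 1" "len 6 = n div sz div sz + 1" "len 7 = num_nodes div sz + 1"
    "len 8 = num_nodes div sz + 1" "len 9 = 256 * (num_nodes - groups)"
  by (simp_all add: len_eq array_len_def)

lemma widths: "width 0 = lg" "width 1 = sz" "width 2 = sz" "width 3 = 1" "width 4 = sz"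
    "width 5 = sz" "width 6 = lg" "width 7 = sz" "width 8 = lg" "width 9 = 1"
  by (simp_all add: width_eq entry_width_def)

lemma sz_w: "sz < w" "sz \<le> w"
  using sz_bounds(1,3) big by linarith+

lemma pow_sz: "(2 :: nat) ^ sz < 2 ^ w" "(2::nat) ^ sz + 1 < 2 ^ w" "sz < 2 ^ sz"
proof -
  show l: "(2 :: nat) ^ sz < 2 ^ w" using sz_w by simp
  have "(2::nat) ^ sz * 2 \<le> 2 ^ w" using sz_w power_increasing[of "sz + 1" w "2::nat"] by (simp add: power_add)
  moreover have "1 < (2::nat) ^ sz" using sz_bounds(1) by (intro one_less_power) auto
  ultimately show "(2::nat) ^ sz + 1 < 2 ^ w" by linarith
  show "sz < 2 ^ sz" by simp
qed

lemma lg_w: "lg < 2 ^ w" "lg + 1 < 2 ^ w"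
proof -
  obtain k where k: "w = Suc k" using big by (cases w) auto
  have "k < 2 ^ k" by (rule less_exp)
  moreover have "1 < (2::nat) ^ k" using big k by (intro one_less_power) auto
  ultimately have "w + 1 < 2 ^ w" unfolding k power_Suc by linarith
  then show "lg < 2 ^ w" "lg + 1 < 2 ^ w" using lg_bounds(2) by linarith+
qed

lemma num_w: "num_nodes < 2 ^ lg" "num_nodes < 2 ^ w"
  using num_nodes_bound(3) lg_bounds(3) nm by linarith+

lemma wp_get_deg:
  assumes v: "\<sigma> rv = v" "v < n"
    and Q: "Q (\<sigma>(rp := 0, rx := deg v)) \<alpha> os (t + 3 + 3 * deg v)"
  shows "wp get_deg Q \<sigma> \<alpha> os t"
proof -
  have b: "v + 2 < length I" using v header by simp
  have b': "2 + v < 2 ^ w" using b length_I by linarith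
  define J where "J = (\<lambda>qs \<sigma>' \<alpha>' os' t'. \<exists>ps p. A v = ps @ qs \<and> \<alpha>' = \<alpha> \<and> os' = os \<and>
         \<sigma>' = \<sigma>(rx := length ps, rp := p) \<and> t' = t + 2 + 3 * length ps)"
  have "wp (walk rp (rx ::= Var rx [+] Lit 1)) Q (\<sigma>(rp := I ! (2 + v), rx := 0)) \<alpha> os (Suc (Suc t))"
  proof (rule wp_walk[where J = J and ps = "A v"], goal_cases)
    case 1
    show ?case unfolding J_def by (intro exI[of _ "[]"] exI[of _ "I ! (2 + v)"]) (auto simp: fun_eq_iff)
  next
    case 2
    then show ?case using list_A[OF v(2)] by simp
  next
    case 3
    show ?case by simp
  next
    case (4 q qs \<sigma>' \<alpha>' os' t')
    then obtain ps where ps: "A v = ps @ q # qs" "\<alpha>' = \<alpha>" "os' = os"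
      "\<sigma>' = \<sigma>(rx := length ps, rp := q)" "t' = t + 2 + 3 * length ps"
      by (auto simp: J_def)
    have "length ps + 1 \<le> deg v" using length_A[OF v(2)] ps(1) by simp
    then have l: "length ps + 1 < 2 ^ w" using deg_le_n[of v] nm by linarith
    have J': "J qs (\<sigma>'(rx := length ps + 1, rp := I ! (q + 1))) \<alpha> os (Suc (Suc (Suc t')))"
      unfolding J_def ps(4) by (intro exI[of _ "ps @ [q]"] exI[of _ "I ! (q + 1)"]) (auto simp: fun_eq_iff ps)
    have "\<sigma>' rx = length ps" "\<sigma>' rp = q" by (simp_all add: ps(4))
    then show ?case using l lits(1) J' by (simp add: wp_Asg ps(2,3))
  next
    case (5 \<sigma>' \<alpha>' os' t')
    then have e: "\<sigma>' = \<sigma>(rp := 0, rx := deg v)" "\<alpha>' = \<alpha>" "os' = os" "Suc t' = t + 3 + 3 * deg v"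
      using length_A[OF v(2)] by (auto simp: J_def fun_eq_iff)
    show ?case unfolding e by (rule Q)
  qed
  then show ?thesis using v b b' lits by (simp add: get_deg_def wp_simps add.commute[of 2])
qed

lemma array_base_step:
  "array_base (k + 1) = array_base k + array_len k div (w div entry_width k) + 1"
  by (simp add: Suc_eq_plus1[symmetric])

lemma array_base_steps:
  "array_base 0 = heap_base"
  "array_base 0 + (lg + 1) div (w div lg) + 1 = array_base 1"
  "array_base 1 + 2 ^ sz div (w div sz) + 1 = array_base 2"
  "array_base 2 + 2 ^ sz div (w div sz) + 1 = array_base 3"
  "array_base 3 + n div w + 1 = array_base 4"
  "array_base 4 + (n div sz + 1) div (w div sz) + 1 = array_base 5"
  "array_base 5 + (n div sz div sz + 1) div (w div sz) + 1 = array_base 6"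
  "array_base 6 + (n div sz div sz + 1) div (w div lg) + 1 = array_base 7"
  "array_base 7 + (num_nodes div sz + 1) div (w div sz) + 1 = array_base 8"
  "array_base 8 + (num_nodes div sz + 1) div (w div lg) + 1 = array_base 9"
  "array_base 9 + 256 * (num_nodes - groups) div w + 1 = array_base 10"
  using array_base_step[of 0] array_base_step[of 1] array_base_step[of 2] array_base_step[of 3]
    array_base_step[of 4] array_base_step[of 5] array_base_step[of 6] array_base_step[of 7]
    array_base_step[of 8] array_base_step[of 9]
  by (simp_all add: array_len_def entry_width_def)

lemma array_base_less: "k \<le> 10 \<Longrightarrow> array_base k < 2 ^ w"
  using array_base_mono[of k 10] S_less by simp

lemma wp_read_params:
  assumes Q: "\<And>\<sigma>' t'. frame {rn, rd, rm, rv, rp, rx, ry, rl, rs} \<sigma> \<sigma>' \<Longrightarrow> \<sigma>' rn = n \<Longrightarrow> \<sigma>' rd = d \<Longrightarrow>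
      \<sigma>' rl = lg \<Longrightarrow> \<sigma>' rs = sz \<Longrightarrow> t' \<le> t + 20 + 12 * n + 20 * m \<Longrightarrow> Q \<sigma>' \<alpha> os t'"
  shows "wp read_params Q \<sigma> \<alpha> os t"
proof -
  let ?R = "{rn, rd, rm, rv, rp, rx, ry, rl, rs}"
  define M where "M = 2 * m + n + 1"
  define J1 where "J1 = (\<lambda>\<sigma>' \<alpha>' os' t'. frame ?R \<sigma> \<sigma>' \<and> \<sigma>' rn = n \<and> \<sigma>' rd = d \<and> \<sigma>' rv \<le> n \<and>
     \<sigma>' rm = (\<Sum>u<\<sigma>' rv. deg u) \<and> \<alpha>' = \<alpha> \<and> os' = os \<and> t' \<le> t + 4 + 6 * \<sigma>' rv + 3 * \<sigma>' rm)"
  define J2 where "J2 = (\<lambda>\<sigma>' \<alpha>' os' t'. frame ?R \<sigma> \<sigma>' \<and> \<sigma>' rn = n \<and> \<sigma>' rd = d \<and>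
     \<sigma>' rl \<le> lg \<and> \<sigma>' ry = M div 2 ^ \<sigma>' rl \<and> \<alpha>' = \<alpha> \<and> os' = os \<and>
     t' \<le> t + 8 + 6 * n + 6 * m + 3 * \<sigma>' rl)"
  have lgM: "lg = bit_length M" by (simp add: lg_def M_def)
  have lg_le: "lg \<le> M" unfolding lgM by (rule bit_length_less)
  have part: "(\<Sum>u<v. deg u) \<le> 2 * m" if "v \<le> n" for v
    unfolding sum_deg[symmetric] using that by (intro sum_mono2) auto
  have l16: "lg div 16 + 1 < 2 ^ w" using lg_w by (meson add_le_mono1 div_le_dividend le_less_trans)
  have after2: "wp (rs ::= Var rl [div] Lit 16 [+] Lit 1) Q \<sigma>1 \<alpha>1 os1 (Suc t1)"
    if "J2 \<sigma>1 \<alpha>1 os1 t1" "\<sigma>1 ry = 0" for \<sigma>1 \<alpha>1 os1 t1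
  proof -
    have "lg \<le> \<sigma>1 rl" using that unfolding lgM J2_def by (simp flip: div_pow_zero_iff)
    then have l: "\<sigma>1 rl = lg" using that by (simp add: J2_def)
    have "Q (\<sigma>1(rs := sz)) \<alpha> os (Suc (Suc t1))"
    proof (rule Q)
      show "Suc (Suc t1) \<le> t + 20 + 12 * n + 20 * m"
        using that lg_le unfolding J2_def l M_def by linarith
    qed (use that l in \<open>auto simp: J2_def intro: frame_upd\<close>)
    then show ?thesis using that lits l l16 by (simp add: J2_def wp_simps sz_def)
  qed
  have after1: "wp (ry ::= Var rm [+] Var rn [+] Lit 1 ;; rl ::= Lit 0 ;;
     While (Var ry) (ry ::= Var ry [div] Lit 2 ;; rl ::= Var rl [+] Lit 1) ;;
     rs ::= Var rl [div] Lit 16 [+] Lit 1) Q \<sigma>1 \<alpha>1 os1 (Suc t1)"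
    if "J1 \<sigma>1 \<alpha>1 os1 t1" "\<not> \<sigma>1 rv < n" for \<sigma>1 \<alpha>1 os1 t1
  proof -
    have m2: "\<sigma>1 rm = 2 * m" "\<sigma>1 rn = n" "\<sigma>1 rv = n" using that by (auto simp: J1_def sum_deg)
    have lt: "2 * m + n < 2 ^ w" "2 * m + n + 1 < 2 ^ w" using nm by linarith+
    have "wp (While (Var ry) (ry ::= Var ry [div] Lit 2 ;; rl ::= Var rl [+] Lit 1))
       (wp (rs ::= Var rl [div] Lit 16 [+] Lit 1) Q) (\<sigma>1(ry := M, rl := 0)) \<alpha>1 os1 (Suc (Suc (Suc t1)))"
    proof (rule wp_While_invariant[where J = J2 and T = "t + 8 + 6 * n + 6 * m + 3 * lg"], goal_cases)
      case 1
      have "Suc (Suc (Suc t1)) \<le> t + 8 + 6 * n + 6 * m" using that m2 unfolding J1_def by linarith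
      then show ?case using that by (auto simp: J2_def J1_def intro!: frame_upd)
    next
      case (2 \<sigma>2 \<alpha>2 os2 t2)
      then show ?case unfolding J2_def by auto
    next
      case (3 \<sigma>2 \<alpha>2 os2 t2)
      then have "M div 2 ^ \<sigma>2 rl \<noteq> 0" by (simp add: J2_def)
      then have "\<sigma>2 rl < lg" unfolding lgM div_pow_zero_iff by simp
      then have "\<sigma>2 rl + 1 \<le> lg" by simp
      moreover from this have "\<sigma>2 rl + 1 < 2 ^ w" using lg_w by linarith
      ultimately show ?case using 3 lits
        by (auto simp: wp_simps J2_def power_add div_mult2_eq intro!: frame_upd)
    next
      case (4 \<sigma>2 \<alpha>2 os2 t2)
      then show ?case using after2 by simp
    qed
    then show ?thesis using m2 lt lits by (simp add: wp_simps M_def)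
  qed
  have loop1: "wp (While (Var rv [<] Var rn) (get_deg ;; rm ::= Var rm [+] Var rx ;; rv ::= Var rv [+] Lit 1))
     (wp (ry ::= Var rm [+] Var rn [+] Lit 1 ;; rl ::= Lit 0 ;;
     While (Var ry) (ry ::= Var ry [div] Lit 2 ;; rl ::= Var rl [+] Lit 1) ;;
     rs ::= Var rl [div] Lit 16 [+] Lit 1) Q) (\<sigma>(rn := n, rd := d, rm := 0, rv := 0)) \<alpha> os (Suc (Suc (Suc (Suc t))))"
  proof (rule wp_While_invariant[where J = J1 and T = "t + 4 + 6 * n + 6 * m"], goal_cases)
    case 1
    show ?case by (auto simp: J1_def intro!: frame_upd frame_refl)
  next
    case (2 \<sigma>1 \<alpha>1 os1 t1)
    then have "\<sigma>1 rm \<le> 2 * m" "\<sigma>1 rv \<le> n" "t1 \<le> t + 4 + 6 * \<sigma>1 rv + 3 * \<sigma>1 rm" using part by (auto simp: J1_def)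
    then have "t1 \<le> t + 4 + 6 * n + 6 * m" by linarith
    then show ?case by simp
  next
    case (3 \<sigma>1 \<alpha>1 os1 t1)
    define v where "v = \<sigma>1 rv"
    have v: "\<sigma>1 rv = v" "v < n" using 3 by (auto simp: v_def J1_def)
    have lt: "(\<Sum>u<v. deg u) + deg v < 2 ^ w" "v + 1 < 2 ^ w" using part[of "Suc v"] v nm by auto
    show ?case
      by (subst wp_Seq, rule wp_get_deg[where v = v], rule v(1), rule v(2))
         (use 3 v lt lits in \<open>auto simp: wp_simps J1_def intro!: frame_upd\<close>)
  next
    case (4 \<sigma>1 \<alpha>1 os1 t1)
    then show ?case by (intro after1) (auto simp: J1_def)
  qed
  have "1 < length I" using header by simp
  then show ?thesis using loop1 header lits
    by (auto simp: read_params_def wp_simps)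
qed

lemma wp_alloc1:
  assumes "\<sigma> rn = n" "\<sigma> rl = lg" "\<sigma> rs = sz"
    and Q: "\<And>\<sigma>' t'. frame ({rtop} \<union> {100..<114}) \<sigma> \<sigma>' \<Longrightarrow> \<sigma>' rtop = array_base 7 \<Longrightarrow>
      (\<And>k. k < 7 \<Longrightarrow> array_ok k \<sigma>') \<Longrightarrow> t' \<le> t + 22 \<Longrightarrow> Q \<sigma>' \<alpha> os t'"
  shows "wp alloc1 Q \<sigma> \<alpha> os t"
proof -
  define \<sigma>' where "\<sigma>' = \<sigma>(100 := array_base 0, 101 := lg, 102 := array_base 1, 103 := sz,
      104 := array_base 2, 105 := sz, 106 := array_base 3, 107 := 1, 108 := array_base 4, 109 := sz,
      110 := array_base 5, 111 := sz, 112 := array_base 6, 113 := lg, rtop := array_base 7)"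
  have a: "array_ok k \<sigma>'" if "k < 7" for k
  proof -
    from that consider "k = 0" | "k = 1" | "k = 2" | "k = 3" | "k = 4" | "k = 5" | "k = 6" by linarith
    then show ?thesis by cases (simp_all add: array_ok_def \<sigma>'_def base_eq widths del: array_base.simps)
  qed
  have f: "frame ({rtop} \<union> {100..<114}) \<sigma> \<sigma>'" unfolding \<sigma>'_def by (intro frame_upd frame_refl) auto
  have q: "Q \<sigma>' \<alpha> os (Suc (Suc (Suc (Suc (Suc (Suc (Suc (Suc (Suc (Suc (Suc (Suc (Suc (Suc (Suc (Suc (Suc (Suc (Suc (Suc (Suc (Suc t))))))))))))))))))))))"
    by (rule Q[OF f _ a]) (simp_all add: \<sigma>'_def del: array_base.simps)
  note b = array_base_less[of 0] array_base_less[of 1] array_base_less[of 2] array_base_less[of 3]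
    array_base_less[of 4] array_base_less[of 5] array_base_less[of 6] array_base_less[of 7]
  have c: "array_base 0 + (lg + 1) div (w div lg) < 2 ^ w" "array_base 1 + 2 ^ sz div (w div sz) < 2 ^ w"
    "array_base 2 + 2 ^ sz div (w div sz) < 2 ^ w" "array_base 3 + n div w < 2 ^ w"
    "array_base 4 + (n div sz + 1) div (w div sz) < 2 ^ w"
    "array_base 5 + (n div sz div sz + 1) div (w div sz) < 2 ^ w"
    "array_base 6 + (n div sz div sz + 1) div (w div lg) < 2 ^ w"
    using b array_base_steps by linarith+
  have "n div sz \<le> n" "n div sz div sz \<le> n" by (meson div_le_dividend le_trans)+
  then have c': "n div sz + 1 < 2 ^ w" "n div sz div sz + 1 < 2 ^ w" using nm by linarith+
  show ?thesis
    using q[unfolded \<sigma>'_def]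
    by (simp add: c c' alloc1_def alloc_def wp_simps assms(1-3) lits lg_w pow_sz array_base_steps(1)[symmetric] array_base_steps(2-) b del: array_base.simps)
qed

end

context main_run
begin

section \<open>Sets stored in arrays of bit fields\<close>

lemma frame_put: "frame R \<alpha> \<alpha>' \<Longrightarrow> k \<in> R \<Longrightarrow> frame R \<alpha> (put \<alpha>' k i v)"
  by (auto simp: frame_def)

text \<open>The characteristic vector is cut into entries of \<open>sz\<close> bits, so that a whole
  entry can be used as an index into the tables of population counts and bit lengths.\<close>

definition bitset :: "nat \<Rightarrow> nat \<Rightarrow> (nat \<Rightarrow> nat \<Rightarrow> nat) \<Rightarrow> nat set \<Rightarrow> bool" where
  "bitset k N \<alpha> P \<longleftrightarrow> (\<forall>i\<le>N. \<alpha> k i < 2 ^ sz \<and> (\<forall>b<sz. bit (\<alpha> k i) b \<longleftrightarrow> i * sz + b \<in> P))"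

lemma bitset_cong: "\<alpha>' k = \<alpha> k \<Longrightarrow> bitset k N \<alpha>' P = bitset k N \<alpha> P"
  by (simp add: bitset_def)

lemma bitset_bit:
  assumes "bitset k N \<alpha> P" "p div sz \<le> N"
  shows "bit (\<alpha> k (p div sz)) (p mod sz) \<longleftrightarrow> p \<in> P" "\<alpha> k (p div sz) < 2 ^ sz"
proof -
  have "p mod sz < sz" using sz_bounds(1) by simp
  then have "bit (\<alpha> k (p div sz)) (p mod sz) \<longleftrightarrow> p div sz * sz + p mod sz \<in> P"
    using assms unfolding bitset_def by blast
  then show "bit (\<alpha> k (p div sz)) (p mod sz) \<longleftrightarrow> p \<in> P" by (simp add: div_mult_mod_eq)
  show "\<alpha> k (p div sz) < 2 ^ sz" using assms by (simp add: bitset_def)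
qed

lemma bitset_test:
  assumes "bitset k N \<alpha> P" "p div sz \<le> N"
  shows "\<alpha> k (p div sz) div 2 ^ (p mod sz) mod 2 = of_bool (p \<in> P)"
  using bitset_bit(1)[OF assms] by (auto simp: bit_iff_odd mod2_eq_if)

lemma field_index: "i * sz + b = p \<and> b < sz \<longleftrightarrow> i = p div sz \<and> b = p mod sz"
  using sz_bounds(1) by (auto simp: div_mult_mod_eq)

lemma bitset_insert:
  assumes B: "bitset k N \<alpha> P" and p: "p div sz \<le> N" "p \<notin> P"
  shows "bitset k N (put \<alpha> k (p div sz) (\<alpha> k (p div sz) + 2 ^ (p mod sz))) (insert p P)"
    and "\<alpha> k (p div sz) + 2 ^ (p mod sz) < 2 ^ sz"
proof -
  note b = bitset_bit[OF B p(1)]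
  have s: "p mod sz < sz" using sz_bounds(1) by simp
  have nb: "\<not> bit (\<alpha> k (p div sz)) (p mod sz)" using b p(2) by simp
  show less: "\<alpha> k (p div sz) + 2 ^ (p mod sz) < 2 ^ sz" by (rule bit_add(2)[OF nb b(2) s])
  show "bitset k N (put \<alpha> k (p div sz) (\<alpha> k (p div sz) + 2 ^ (p mod sz))) (insert p P)"
    unfolding bitset_def
  proof (intro allI impI conjI)
    fix i assume i: "i \<le> N"
    show "put \<alpha> k (p div sz) (\<alpha> k (p div sz) + 2 ^ (p mod sz)) k i < 2 ^ sz"
      using B i less by (simp add: bitset_def)
    fix b assume b: "b < sz"
    show "bit (put \<alpha> k (p div sz) (\<alpha> k (p div sz) + 2 ^ (p mod sz)) k i) b \<longleftrightarrow> i * sz + b \<in> insert p P"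
      using B i b field_index[of i b p] by (auto simp: bitset_def bit_add(1)[OF nb])
  qed
qed

lemma bitset_remove:
  assumes B: "bitset k N \<alpha> P" and p: "p div sz \<le> N" "p \<in> P"
  shows "bitset k N (put \<alpha> k (p div sz) (\<alpha> k (p div sz) - 2 ^ (p mod sz))) (P - {p})"
    and "2 ^ (p mod sz) \<le> \<alpha> k (p div sz)"
proof -
  note b = bitset_bit[OF B p(1)]
  have nb: "bit (\<alpha> k (p div sz)) (p mod sz)" using b p(2) by simp
  show "2 ^ (p mod sz) \<le> \<alpha> k (p div sz)" by (rule bit_diff(2)[OF nb])
  show "bitset k N (put \<alpha> k (p div sz) (\<alpha> k (p div sz) - 2 ^ (p mod sz))) (P - {p})"
    unfolding bitset_def
  proof (intro allI impI conjI)
    fix i assume i: "i \<le> N"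
    show "put \<alpha> k (p div sz) (\<alpha> k (p div sz) - 2 ^ (p mod sz)) k i < 2 ^ sz"
      using B i b(2) by (auto simp: bitset_def)
    fix b assume b: "b < sz"
    show "bit (put \<alpha> k (p div sz) (\<alpha> k (p div sz) - 2 ^ (p mod sz)) k i) b \<longleftrightarrow> i * sz + b \<in> P - {p}"
      using B i b field_index[of i b p] by (auto simp: bitset_def bit_diff(1)[OF nb])
  qed
qed

lemma bitset_zero:
  assumes "bitset k N \<alpha> P" "i \<le> N"
  shows "\<alpha> k i = 0 \<longleftrightarrow> i \<notin> (\<lambda>p. p div sz) ` P"
proof -
  have "\<alpha> k i < 2 ^ sz" using assms by (simp add: bitset_def)
  then have "\<alpha> k i = 0 \<longleftrightarrow> (\<forall>b<sz. \<not> bit (\<alpha> k i) b)" by (rule zero_iff_bits)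
  also have "\<dots> \<longleftrightarrow> (\<forall>b<sz. i * sz + b \<notin> P)" using assms by (simp add: bitset_def)
  also have "\<dots> \<longleftrightarrow> i \<notin> (\<lambda>p. p div sz) ` P"
    using field_index by (auto simp: image_iff) metis
  finally show ?thesis .
qed

text \<open>The highest bit of a nonempty field names a member of the set; with the table of bit
  lengths it is found by a single lookup.\<close>

lemma bitset_top:
  assumes "bitset k N \<alpha> P" "i \<le> N" "\<alpha> k i \<noteq> 0"
  shows "i * sz + (bit_length (\<alpha> k i) - 1) \<in> P" "bit_length (\<alpha> k i) - 1 < sz" "0 < bit_length (\<alpha> k i)"
    "bit_length (\<alpha> k i) \<le> sz"
proof -
  show p: "0 < bit_length (\<alpha> k i)" using bit_length_0[of "\<alpha> k i"] assms(3) by simp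
  show l: "bit_length (\<alpha> k i) \<le> sz" using assms by (simp add: bitset_def bit_length_le_iff)
  show "bit_length (\<alpha> k i) - 1 < sz" using p l by linarith
  then show "i * sz + (bit_length (\<alpha> k i) - 1) \<in> P"
    using bit_top(1)[OF assms(3)] assms(1,2) by (simp add: bitset_def)
qed

text \<open>For \<open>j = p mod sz\<close> this is the share of the rank of \<open>p\<close> that
  lies inside its own field; for \<open>j = sz\<close> it is the increment between two
  samples.\<close>

lemma bitset_pop_count:
  assumes "bitset k N \<alpha> P" "i \<le> N" "j \<le> sz"
  shows "pop_count (\<alpha> k i mod 2 ^ j) = card {p \<in> P. i * sz \<le> p \<and> p < i * sz + j}"
proof -
  have "pop_count (\<alpha> k i mod 2 ^ j) = card {b. b < j \<and> bit (\<alpha> k i) b}" by (rule pop_count_mod)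
  also have "{b. b < j \<and> bit (\<alpha> k i) b} = {b. b < j \<and> i * sz + b \<in> P}"
    using assms by (auto simp: bitset_def)
  also have "card \<dots> = card ((\<lambda>b. i * sz + b) ` {b. b < j \<and> i * sz + b \<in> P})"
    by (rule card_image[symmetric]) (simp add: inj_on_def)
  also have "(\<lambda>b. i * sz + b) ` {b. b < j \<and> i * sz + b \<in> P} = {p \<in> P. i * sz \<le> p \<and> p < i * sz + j}"
    by (auto simp: image_iff) (metis le_add_diff_inverse nat_add_left_cancel_less)
  finally show ?thesis .
qed

lemma bitset_empty: "(\<forall>i\<le>N. \<alpha> k i = 0) \<Longrightarrow> bitset k N \<alpha> {}"
  by (simp add: bitset_def)

section \<open>Building the tables and the counter levels\<close>

lemma wp_tables:
  assumes "\<sigma> rs = sz" "array_ok 1 \<sigma>" "array_ok 2 \<sigma>" "\<alpha> 1 0 = 0" "\<alpha> 2 0 = 0"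
    and Q: "\<And>\<sigma>' \<alpha>' t'. frame {ri, rlim} \<sigma> \<sigma>' \<Longrightarrow> frame {1, 2} \<alpha> \<alpha>' \<Longrightarrow>
      (\<And>x. x < 2 ^ sz \<Longrightarrow> \<alpha>' 1 x = pop_count x \<and> \<alpha>' 2 x = bit_length x) \<Longrightarrow>
      t' \<le> t + 3 + 4 * 2 ^ sz \<Longrightarrow> Q \<sigma>' \<alpha>' os t'"
  shows "wp tables Q \<sigma> \<alpha> os t"
proof -
  define J where "J = (\<lambda>\<sigma>' \<alpha>' os' t'. frame {ri, rlim} \<sigma> \<sigma>' \<and> frame {1, 2 :: nat} \<alpha> \<alpha>' \<and> \<sigma>' rlim = 2 ^ sz \<and>
    1 \<le> \<sigma>' ri \<and> \<sigma>' ri \<le> 2 ^ sz \<and> (\<forall>x<\<sigma>' ri. \<alpha>' 1 x = pop_count x \<and> \<alpha>' 2 x = bit_length x) \<and>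
    os' = os \<and> t' \<le> t + 2 + 4 * \<sigma>' ri)"
  have "wp (While (Var ri [<] Var rlim)
       (Put 1 (Var ri) (Get 1 (Var ri [div] Lit 2) [+] Var ri [mod] Lit 2) ;;
        Put 2 (Var ri) (Get 2 (Var ri [div] Lit 2) [+] Lit 1) ;;
        ri ::= Var ri [+] Lit 1)) Q (\<sigma>(ri := 1, rlim := 2 ^ sz)) \<alpha> os (Suc (Suc t))"
  proof (rule wp_While_invariant[where J = J and T = "t + 2 + 4 * 2 ^ sz"], goal_cases)
    case 1
    show ?case using assms(4,5)
      by (auto simp: J_def pop_count.simps[of 0] bit_length.simps[of 0] intro!: frame_upd frame_refl frame_put)
  next
    case (2 \<sigma>1 \<alpha>1 os1 t1)
    then show ?case unfolding J_def by auto
  next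
    case (3 \<sigma>1 \<alpha>1 os1 t1)
    define i where "i = \<sigma>1 ri"
    have i: "1 \<le> i" "i < 2 ^ sz" using 3 by (auto simp: J_def i_def)
    have ok: "array_ok 1 \<sigma>1" "array_ok 2 \<sigma>1"
      using 3 assms(2,3) by (auto simp: J_def frame_array_ok)
    have d: "i div 2 < i" using i by simp
    have h: "\<alpha>1 1 (i div 2) = pop_count (i div 2)" "\<alpha>1 2 (i div 2) = bit_length (i div 2)"
      using 3 d by (auto simp: J_def i_def)
    have p: "pop_count i = pop_count (i div 2) + i mod 2" "bit_length i = bit_length (i div 2) + 1"
      using i pop_count.simps[of i] bit_length.simps[of i] by auto
    have le: "pop_count i < 2 ^ sz" "bit_length i < 2 ^ sz"
      using pop_count_le[OF i(2)] bit_length_le_iff[of i sz] i(2) pow_sz(3) by linarith+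
    have less: "x < i + 1 \<longleftrightarrow> x < i \<or> x = i" for x by auto
    show ?case
      using 3 ok i d h le pow_sz lits p(1)[symmetric] p(2)[symmetric]
      by (auto simp: J_def wp_simps lens widths i_def[symmetric] less intro!: frame_upd frame_put)
  next
    case (4 \<sigma>1 \<alpha>1 os1 t1)
    then have e: "os1 = os" and r: "\<sigma>1 ri = 2 ^ sz" by (auto simp: J_def split: if_splits)
    show ?case unfolding e by (rule Q) (use 4 r in \<open>auto simp: J_def\<close>)
  qed
  then show ?thesis using assms(1) lits pow_sz by (simp add: tables_def wp_simps)
qed

section \<open>Counting and placing the nodes of each level\<close>

lemma group_interval:
  assumes "g < groups"
  shows "256 * g < n" "group_deg g = (\<Sum>u\<in>{256 * g..<min n (256 * (g + 1))}. deg u)"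
proof -
  show "256 * g < n" using assms groups_bounds(2) by linarith
  have "{v. v < n \<and> v div 256 = g} = {256 * g..<min n (256 * (g + 1))}"
    by auto
  then show "group_deg g = (\<Sum>u\<in>{256 * g..<min n (256 * (g + 1))}. deg u)"
    by (simp add: group_deg_def)
qed

lemma wp_group_sum:
  assumes "\<sigma> rn = n" "\<sigma> rv = 256 * g" "g < groups"
    and Q: "\<And>\<sigma>' t'. frame {rX, ri, rv, rp, rx} \<sigma> \<sigma>' \<Longrightarrow> \<sigma>' rX = group_deg g \<Longrightarrow>
      \<sigma>' rv = min n (256 * (g + 1)) \<Longrightarrow> t' \<le> t + 3 + 7 * 256 + 3 * group_deg g \<Longrightarrow> Q \<sigma>' \<alpha> os t'"
  shows "wp group_sum Q \<sigma> \<alpha> os t"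
proof -
  note gi = group_interval[OF assms(3)]
  define J where "J = (\<lambda>\<sigma>' \<alpha>' os' t'. frame {rX, ri, rv, rp, rx} \<sigma> \<sigma>' \<and> \<sigma>' ri \<le> 256 \<and>
     \<sigma>' rv = 256 * g + \<sigma>' ri \<and> \<sigma>' rv \<le> n \<and> \<sigma>' rX = (\<Sum>u\<in>{256 * g..<\<sigma>' rv}. deg u) \<and>
     \<alpha>' = \<alpha> \<and> os' = os \<and> t' \<le> t + 2 + 7 * \<sigma>' ri + 3 * \<sigma>' rX)"
  have part: "(\<Sum>u\<in>{a..<b}. deg u) \<le> 2 * m" if "b \<le> n" for a b
    unfolding sum_deg[symmetric] using that by (intro sum_mono2) auto
  have part_g: "(\<Sum>u\<in>{256 * g..<b}. deg u) \<le> group_deg g" if "b \<le> n" "b \<le> 256 * (g + 1)" for b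
    unfolding gi(2) using that by (intro sum_mono2) auto
  have "wp (While ((Var ri [<] Lit 256) [*] (Var rv [<] Var rn))
       (get_deg ;; rX ::= Var rX [+] Var rx ;; rv ::= Var rv [+] Lit 1 ;; ri ::= Var ri [+] Lit 1))
       Q (\<sigma>(rX := 0, ri := 0)) \<alpha> os (Suc (Suc t))"
  proof (rule wp_While_invariant[where J = J and T = "t + 2 + 7 * 256 + 3 * group_deg g"], goal_cases)
    case 1
    show ?case using assms gi(1) by (auto simp: J_def intro!: frame_upd frame_refl frame_put)
  next
    case (2 \<sigma>1 \<alpha>1 os1 t1)
    then have "t1 \<le> t + 2 + 7 * \<sigma>1 ri + 3 * \<sigma>1 rX" "\<sigma>1 ri \<le> 256" "\<sigma>1 rX \<le> group_deg g"
      using part_g by (auto simp: J_def)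
    then have "t1 \<le> t + 2 + 7 * 256 + 3 * group_deg g" by linarith
    then show ?case using lits by (auto simp: of_bool_def)
  next
    case (3 \<sigma>1 \<alpha>1 os1 t1)
    define v where "v = \<sigma>1 rv"
    have rn1: "\<sigma>1 rn = n" using 3 assms(1) frameD[of _ \<sigma> \<sigma>1 rn] by (auto simp: J_def)
    have v: "\<sigma>1 rv = v" "v < n" "\<sigma>1 ri < 256" using 3 rn1 by (auto simp: v_def split: if_splits)
    have s: "{256 * g..<v + 1} = insert v {256 * g..<v}" using 3 v by (auto simp: J_def)
    have e: "(\<Sum>u\<in>{256 * g..<v + 1}. deg u) = (\<Sum>u\<in>{256 * g..<v}. deg u) + deg v" unfolding s by simp
    have lt: "(\<Sum>u\<in>{256 * g..<v}. deg u) + deg v < 2 ^ w" "v + 1 < 2 ^ w" "\<sigma>1 ri + 1 < 2 ^ w"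
      using part[of "v + 1" "256 * g"] v e nm lits by linarith+
    show ?case
      by (subst wp_Seq, rule wp_get_deg[where v = v], rule v(1), rule v(2))
         (use 3 v lt lits e in \<open>auto simp: wp_simps J_def intro!: frame_upd\<close>)
  next
    case (4 \<sigma>1 \<alpha>1 os1 t1)
    have rn1: "\<sigma>1 rn = n" using 4 assms(1) frameD[of _ \<sigma> \<sigma>1 rn] by (auto simp: J_def)
    have v: "\<sigma>1 rv = min n (256 * (g + 1))" using 4 rn1 by (auto simp: J_def of_bool_def min_def split: if_splits)
    then have X: "\<sigma>1 rX = group_deg g" using 4 unfolding gi(2) by (simp add: J_def)
    have "Suc t1 \<le> t + 3 + 7 * 256 + 3 * group_deg g" using 4 X unfolding J_def by linarith
    then show ?case using 4 v X Q[of \<sigma>1 "Suc t1"] by (simp add: J_def)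
  qed
  then show ?thesis using lits by (simp add: group_sum_def wp_simps)
qed

lemma pos_mono: "g \<le> g' \<Longrightarrow> pos j g \<le> pos j g'"
  unfolding pos_def by (rule card_mono[OF finite_before]) (auto simp: before_def)

text \<open>The number of nodes on level \<open>j\<close> that belong to groups before
  \<open>g\<close>; as a difference of positions it telescopes to the starts of the levels.\<close>

definition level_count :: "nat \<Rightarrow> nat \<Rightarrow> nat" where "level_count j g = pos j g - pos j 0"

lemma level_count_Suc: "g < groups \<Longrightarrow> level_count j (g + 1) = level_count j g + of_bool (j \<le> level g)"
  using pos_Suc[of g j] pos_mono[of 0 g j] by (simp add: level_count_def)

lemma level_count_le: "level_count j g \<le> num_nodes"
  using pos_le_num[of j g] by (simp add: level_count_def)

lemma div_level: "group_deg g div 1024 div 2 ^ j = 0 \<longleftrightarrow> level g \<le> j"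
  by (simp add: div_pow_zero_iff level_def)

lemma level_le_deg: "level g \<le> group_deg g"
  using bit_length_less(2)[of "group_deg g div 1024"] unfolding level_def by linarith

lemma group_at:
  assumes "v = min n (256 * g)" "g \<le> groups" "v < n"
  shows "g < groups" "v = 256 * g"
  using assms groups_bounds by (auto simp: min_def split: if_splits)

lemma wp_count_levels:
  assumes \<sigma>: "\<sigma> rn = n" "array_ok 0 \<sigma>" and z: "\<And>j. j \<le> lg \<Longrightarrow> \<alpha> 0 j = 0"
    and Q: "\<And>\<sigma>' \<alpha>' t'. frame {rX, ri, rv, rp, rx, ry, rj} \<sigma> \<sigma>' \<Longrightarrow> frame {0} \<alpha> \<alpha>' \<Longrightarrow>
      (\<And>j. j \<le> lg \<Longrightarrow> \<alpha>' 0 j = level_count j groups) \<Longrightarrow> t' \<le> t + 2 + 2000 * n + 20 * m \<Longrightarrow> Q \<sigma>' \<alpha>' os t'"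
  shows "wp count_levels Q \<sigma> \<alpha> os t"
proof -
  let ?R = "{rX, ri, rv, rp, rx, ry, rj}"
  \<comment> \<open>The 2000 ticks per group cover at most 256 vertices at 7 ticks each and the
    fixed overhead. List nodes and levels are charged to the degree sum of the group.\<close>
  define J where "J = (\<lambda>\<sigma>' \<alpha>' os' t'. \<exists>g. frame ?R \<sigma> \<sigma>' \<and> frame {0 :: nat} \<alpha> \<alpha>' \<and> g \<le> groups \<and>
     \<sigma>' rv = min n (256 * g) \<and> (\<forall>j\<le>lg. \<alpha>' 0 j = level_count j g) \<and> os' = os \<and>
     t' \<le> t + 1 + 2000 * g + 10 * (\<Sum>g'<g. group_deg g'))"
  have part: "(\<Sum>g'<g. group_deg g') \<le> 2 * m" if "g \<le> groups" for g
    unfolding sum_group_deg[symmetric] using that by (intro sum_mono2) auto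
  have "wp (While (Var rv [<] Var rn)
       (group_sum ;; ry ::= Var rX [div] Lit 1024 ;; rj ::= Lit 0 ;;
        Put 0 (Var rj) (Get 0 (Var rj) [+] Lit 1) ;;
        While (Var ry)
          (rj ::= Var rj [+] Lit 1 ;; Put 0 (Var rj) (Get 0 (Var rj) [+] Lit 1) ;;
           ry ::= Var ry [div] Lit 2))) Q (\<sigma>(rv := 0)) \<alpha> os (Suc t)"
  proof (rule wp_While_invariant[where J = J and T = "t + 1 + 2000 * groups + 20 * m"], goal_cases)
    case 1
    show ?case unfolding J_def using z
      by (intro exI[of _ 0]) (auto simp: level_count_def intro!: frame_upd frame_refl frame_put)
  next
    case (2 \<sigma>1 \<alpha>1 os1 t1)
    then obtain g where "g \<le> groups" "t1 \<le> t + 1 + 2000 * g + 10 * (\<Sum>g'<g. group_deg g')"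
      by (auto simp: J_def)
    then have "t1 \<le> t + 1 + 2000 * groups + 20 * m" using part[of g] by linarith
    then show ?case by simp
  next
    case (3 \<sigma>1 \<alpha>1 os1 t1)
    then obtain g where g: "frame ?R \<sigma> \<sigma>1" "frame {0} \<alpha> \<alpha>1" "g \<le> groups"
     "\<sigma>1 rv = min n (256 * g)" "\<And>j. j \<le> lg \<Longrightarrow> \<alpha>1 0 j = level_count j g" "os1 = os"
     "t1 \<le> t + 1 + 2000 * g + 10 * (\<Sum>g'<g. group_deg g')"
      by (auto simp: J_def)
    have rn1: "\<sigma>1 rn = n" using g(1) \<sigma>(1) frameD[of _ \<sigma> \<sigma>1 rn] by auto
    then have "\<sigma>1 rv < n" using 3 by auto
    from group_at[OF g(4,3) this] have gg: "g < groups" and rv1: "\<sigma>1 rv = 256 * g" by auto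
    have cw: "level_count j g + 1 < 2 ^ lg" "level_count j g + 1 < 2 ^ w" for j
      using level_count_le[of j g] num_nodes_bound(3) lg_bounds(3) nm by linarith+
    show ?case
    proof (subst wp_Seq, rule wp_group_sum[where \<sigma> = \<sigma>1 and g = g, OF rn1 rv1 gg])
      fix \<sigma>2 t2
      assume f: "frame {rX, ri, rv, rp, rx} \<sigma>1 \<sigma>2" and X: "\<sigma>2 rX = group_deg g"
        and v2: "\<sigma>2 rv = min n (256 * (g + 1))" and t2: "t2 \<le> Suc t1 + 3 + 7 * 256 + 3 * group_deg g"
      have f2: "frame ?R \<sigma> \<sigma>2" by (rule frame_trans[OF g(1) frame_mono[OF f]]) auto
      have ok2: "array_ok 0 \<sigma>2" using f2 \<sigma>(2) by (auto simp: frame_array_ok)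
      define K where "K = (\<lambda>\<sigma>3 \<alpha>3 os3 t3. frame ?R \<sigma> \<sigma>3 \<and> frame {0 :: nat} \<alpha> \<alpha>3 \<and> \<sigma>3 rv = min n (256 * (g + 1)) \<and>
         \<sigma>3 rj \<le> level g \<and> \<sigma>3 ry = group_deg g div 1024 div 2 ^ \<sigma>3 rj \<and>
         (\<forall>j\<le>lg. \<alpha>3 0 j = level_count j g + of_bool (j \<le> \<sigma>3 rj)) \<and> os3 = os \<and> t3 \<le> t2 + 3 + 4 * \<sigma>3 rj)"
      have "wp (While (Var ry)
          (rj ::= Var rj [+] Lit 1 ;; Put 0 (Var rj) (Get 0 (Var rj) [+] Lit 1) ;;
           ry ::= Var ry [div] Lit 2)) J (\<sigma>2(ry := group_deg g div 1024, rj := 0)) (put \<alpha>1 0 0 (level_count 0 g + 1)) os (Suc (Suc (Suc t2)))"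
      proof (rule wp_While_invariant[where J = K and T = "t2 + 3 + 4 * level g"], goal_cases)
        case 1
        show ?case using g f2 v2 by (auto simp: K_def intro!: frame_upd frame_put)
      next
        case (2 \<sigma>3 \<alpha>3 os3 t3)
        then show ?case by (auto simp: K_def)
      next
        case (3 \<sigma>3 \<alpha>3 os3 t3)
        then have lt: "\<sigma>3 rj < level g" using div_level[of g "\<sigma>3 rj"] by (auto simp: K_def)
        then have jl: "\<sigma>3 rj + 1 \<le> level g" "\<sigma>3 rj + 1 \<le> lg" using level_le[of g] by linarith+
        have jw: "\<sigma>3 rj + 1 < 2 ^ w" using jl lg_w by linarith
        have ok3: "array_ok 0 \<sigma>3" using 3 \<sigma>(2) by (auto simp: K_def frame_array_ok)
        show ?case using 3 jl jw ok3 lits cw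
          by (auto simp: K_def wp_simps lens widths power_add div_mult2_eq intro!: frame_upd frame_put)
      next
        case (4 \<sigma>3 \<alpha>3 os3 t3)
        then have "level g \<le> \<sigma>3 rj" using div_level[of g "\<sigma>3 rj"] by (auto simp: K_def)
        then have l: "\<sigma>3 rj = level g" using 4 by (auto simp: K_def)
        have "Suc t3 \<le> t + 1 + 2000 * (g + 1) + 10 * (\<Sum>g'<g + 1. group_deg g')"
        proof -
          have "t3 \<le> t2 + 3 + 4 * level g" using 4 l by (simp add: K_def)
          then show ?thesis using g(7) t2 level_le_deg[of g] unfolding sum_lessThan_plus1 distrib_left mult_1_right by linarith
        qed
        then show ?case unfolding J_def using 4 gg l level_count_Suc[OF gg]
          by (intro exI[of _ "g + 1"]) (auto simp: K_def)
      qed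
      then show "wp (ry ::= Var rX [div] Lit 1024 ;; rj ::= Lit 0 ;;
        Put 0 (Var rj) (Get 0 (Var rj) [+] Lit 1) ;;
        While (Var ry)
          (rj ::= Var rj [+] Lit 1 ;; Put 0 (Var rj) (Get 0 (Var rj) [+] Lit 1) ;;
           ry ::= Var ry [div] Lit 2)) J \<sigma>2 \<alpha>1 os1 t2"
        using X ok2 lits cw g(5)[of 0] g(6) by (simp add: wp_simps lens widths)
    qed
  next
    case (4 \<sigma>1 \<alpha>1 os1 t1)
    then obtain g where g: "frame ?R \<sigma> \<sigma>1" "frame {0} \<alpha> \<alpha>1" "g \<le> groups"
     "\<sigma>1 rv = min n (256 * g)" "\<And>j. j \<le> lg \<Longrightarrow> \<alpha>1 0 j = level_count j g" "os1 = os"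
     "t1 \<le> t + 1 + 2000 * g + 10 * (\<Sum>g'<g. group_deg g')"
      by (auto simp: J_def)
    have rn1: "\<sigma>1 rn = n" using g(1) \<sigma>(1) frameD[of _ \<sigma> \<sigma>1 rn] by auto
    then have "n \<le> 256 * g" using 4 g(4) by (auto simp: min_def split: if_splits)
    then have gg: "g = groups" using g(3) groups_bounds(2) by linarith
    have "Suc t1 \<le> t + 2 + 2000 * n + 20 * m" using g(7) groups_bounds(3) unfolding gg sum_group_deg by linarith
    then show ?case unfolding g(6) using g(5) unfolding gg by (intro Q[OF g(1,2)]) auto
  qed
  then show ?thesis using lits by (simp add: count_levels_def wp_simps)
qed

lemma wp_level_starts:
  assumes \<sigma>: "\<sigma> rl = lg" "array_ok 0 \<sigma>" and z: "\<And>j. j \<le> lg \<Longrightarrow> \<alpha> 0 j = level_count j groups"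
    and Q: "\<And>\<sigma>' \<alpha>' t'. frame {racc, rj, rt, rnf, rg} \<sigma> \<sigma>' \<Longrightarrow> frame {0} \<alpha> \<alpha>' \<Longrightarrow> \<sigma>' rnf = num_nodes \<Longrightarrow>
      \<sigma>' rg = groups \<Longrightarrow>
      (\<And>j. j \<le> lg \<Longrightarrow> \<alpha>' 0 j = pos j 0) \<Longrightarrow> t' \<le> t + 10 + 5 * lg + 5 \<Longrightarrow> Q \<sigma>' \<alpha>' os t'"
  shows "wp level_starts Q \<sigma> \<alpha> os t"
proof -
  let ?R = "{racc, rj, rt, rnf, rg}"
  define J where "J = (\<lambda>\<sigma>' \<alpha>' os' t'. frame ?R \<sigma> \<sigma>' \<and> frame {0 :: nat} \<alpha> \<alpha>' \<and> \<sigma>' rj \<le> lg + 1 \<and>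
     \<sigma>' racc = pos (\<sigma>' rj) 0 \<and> (\<forall>j\<le>lg. \<alpha>' 0 j = (if j < \<sigma>' rj then pos j 0 else level_count j groups)) \<and> os' = os \<and>
     t' \<le> t + 2 + 5 * \<sigma>' rj)"
  have "wp (While (Var rj [<] (Var rl [+] Lit 1))
       (rt ::= Get 0 (Var rj) ;; Put 0 (Var rj) (Var racc) ;; racc ::= Var racc [+] Var rt ;;
        rj ::= Var rj [+] Lit 1))
        (wp (rnf ::= Var racc ;; rg ::= Get 0 (Lit 1)) Q) (\<sigma>(racc := 0, rj := 0)) \<alpha> os (Suc (Suc t))"
  proof (rule wp_While_invariant[where J = J and T = "t + 2 + 5 * (lg + 1)"], goal_cases)
    case 1
    show ?case using z by (auto simp: J_def pos_0 intro!: frame_upd frame_refl frame_put)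
  next
    case (2 \<sigma>1 \<alpha>1 os1 t1)
    then have "\<sigma>1 rl = lg" using \<sigma>(1) frameD[of _ \<sigma> \<sigma>1 rl] by (auto simp: J_def)
    then show ?case using 2 lits lg_w unfolding J_def by auto
  next
    case (3 \<sigma>1 \<alpha>1 os1 t1)
    have l: "\<sigma>1 rl = lg" using 3 \<sigma>(1) frameD[of _ \<sigma> \<sigma>1 rl] by (auto simp: J_def)
    have ok: "array_ok 0 \<sigma>1" using 3 \<sigma>(2) by (auto simp: J_def frame_array_ok)
    define j where "j = \<sigma>1 rj"
    have j: "j \<le> lg" "j + 1 < 2 ^ w" using 3 l lg_w by (auto simp: j_def)
    have e: "pos j 0 + level_count j groups = pos (j + 1) 0"
      using pos_mono[of 0 groups j] by (simp add: level_count_def pos_Suc_0)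
    have b: "pos j 0 < 2 ^ lg" "pos (j + 1) 0 < 2 ^ w"
      using pos_le_num[of j 0] pos_le_num[of "j + 1" 0] num_w by linarith+
    show ?case using 3 ok j e b lits
      by (auto simp: J_def wp_simps lens widths j_def[symmetric] intro!: frame_upd frame_put)
  next
    case (4 \<sigma>1 \<alpha>1 os1 t1)
    have l: "\<sigma>1 rl = lg" using 4 \<sigma>(1) frameD[of _ \<sigma> \<sigma>1 rl] by (auto simp: J_def)
    have ok: "array_ok 0 \<sigma>1" using 4 \<sigma>(2) by (auto simp: J_def frame_array_ok)
    have j: "\<sigma>1 rj = lg + 1" using 4 l by (auto simp: J_def)
    have acc: "\<sigma>1 racc = num_nodes" using 4 j pos_top[of "lg + 1"] level_le by (auto simp: J_def less_Suc_eq_le simp flip: Suc_eq_plus1)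
    \<comment> \<open>Entry 1 exists because \<open>lg\<close> is positive; it is the end of level
      0, where each group has exactly one node.\<close>
    have one: "\<alpha>1 0 1 = groups" using 4 lg_bounds(1) j pos_Suc_0[of 0] by (auto simp: J_def pos_0)
    have "Q (\<sigma>1(rnf := num_nodes, rg := groups)) \<alpha>1 os (Suc (Suc (Suc t1)))"
      using 4 j by (intro Q) (auto simp: J_def intro!: frame_upd frame_put)
    then show ?case using 4 acc one ok lits lg_bounds(1) by (simp add: wp_simps J_def lens)
  qed
  then show ?thesis using lits by (simp add: level_starts_def wp_simps)
qed

end

abbreviation (input) branch :: exp where
  "branch \<equiv> (Get 7 (Var rpp [div] Var rs) [>>] (Var rpp [mod] Var rs)) [mod] Lit 2"

text \<open>The formula of \<open>pos_child\<close>: the roots, the sampled rank at the start of the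
  field, and the population count of the lower bits inside the field.\<close>

abbreviation (input) child :: exp where
  "child \<equiv> Var rg [+] Get 8 (Var rpp [div] Var rs) [+]
     Get 1 (Get 7 (Var rpp [div] Var rs) [mod] (Lit 1 [<<] (Var rpp [mod] Var rs)))"

abbreviation (input) counter_exp :: "nat \<Rightarrow> exp" where
  "counter_exp u \<equiv> (Var rpp [-] Var rg) [*] Lit 256 [+] (Var u [mod] Lit 256)"

context main_run
begin

lemma wp_alloc2:
  assumes "\<sigma> rnf = num_nodes" "\<sigma> rg = groups" "\<sigma> rl = lg" "\<sigma> rs = sz" "\<sigma> rtop = array_base 7"
    and Q: "\<And>\<sigma>' t'. frame ({rtop} \<union> {114..<120}) \<sigma> \<sigma>' \<Longrightarrow>
      array_ok 7 \<sigma>' \<Longrightarrow> array_ok 8 \<sigma>' \<Longrightarrow> array_ok 9 \<sigma>' \<Longrightarrow> t' \<le> t + 10 \<Longrightarrow> Q \<sigma>' \<alpha> os t'"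
  shows "wp alloc2 Q \<sigma> \<alpha> os t"
proof -
  define \<sigma>' where "\<sigma>' = \<sigma>(114 := array_base 7, 115 := sz, 116 := array_base 8, 117 := lg,
      118 := array_base 9, 119 := 1, rtop := array_base 10)"
  have a: "array_ok 7 \<sigma>'" "array_ok 8 \<sigma>'" "array_ok 9 \<sigma>'"
    by (simp_all add: array_ok_def \<sigma>'_def base_eq widths del: array_base.simps)
  have f: "frame ({rtop} \<union> {114..<120}) \<sigma> \<sigma>'" unfolding \<sigma>'_def by (intro frame_upd frame_refl) auto
  have q: "Q \<sigma>' \<alpha> os (Suc (Suc (Suc (Suc (Suc (Suc (Suc (Suc (Suc t)))))))))"
    by (rule Q[OF f a]) simp
  have c: "array_base 7 + (num_nodes div sz + 1) div (w div sz) < 2 ^ w"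
    "array_base 8 + (num_nodes div sz + 1) div (w div lg) < 2 ^ w"
    "array_base 9 + 256 * (num_nodes - groups) div w < 2 ^ w"
    using array_base_less[of 8] array_base_less[of 9] array_base_less[of 10] array_base_steps by linarith+
  have "num_nodes div sz \<le> num_nodes" by simp
  then have c': "num_nodes div sz + 1 < 2 ^ w" "256 * (num_nodes - groups) < 2 ^ w"
    using num_nodes_bound nm by linarith+
  show ?thesis
    using q[unfolded \<sigma>'_def] array_base_less[of 8] array_base_less[of 9] array_base_less[of 10]
    by (simp add: c c' alloc2_def alloc_def wp_simps assms(1-5) lits lg_w pow_sz array_base_steps(2-)
      num_nodes_bound(2) del: array_base.simps)
qed

lemma wp_mark_parents:
  assumes \<sigma>: "\<sigma> rn = n" "\<sigma> rs = sz" "array_ok 0 \<sigma>" "array_ok 7 \<sigma>"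
    and z: "\<And>j. j \<le> lg \<Longrightarrow> \<alpha> 0 j = pos j 0" "\<And>i. \<alpha> 7 i = 0"
    and Q: "\<And>\<sigma>' \<alpha>' t'. frame {rX, ri, rv, rp, rx, ry, rj, rt} \<sigma> \<sigma>' \<Longrightarrow> frame {0, 7} \<alpha> \<alpha>' \<Longrightarrow>
      bitset 7 (num_nodes div sz) \<alpha>' parents \<Longrightarrow> t' \<le> t + 2 + 2000 * n + 40 * m \<Longrightarrow> Q \<sigma>' \<alpha>' os t'"
  shows "wp mark_parents Q \<sigma> \<alpha> os t"
proof -
  let ?R = "{rX, ri, rv, rp, rx, ry, rj, rt}" and ?N = "num_nodes div sz"
  define F where "F g = {pos j g' |j g'. g' < g \<and> j < level g'}" for g
  define J where "J = (\<lambda>\<sigma>' \<alpha>' os' t'. \<exists>g. frame ?R \<sigma> \<sigma>' \<and> frame {0 :: nat, 7} \<alpha> \<alpha>' \<and> g \<le> groups \<and>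
     \<sigma>' rv = min n (256 * g) \<and> (\<forall>j\<le>lg. \<alpha>' 0 j = pos j g) \<and> bitset 7 ?N \<alpha>' (F g) \<and> os' = os \<and>
     t' \<le> t + 1 + 2000 * g + 20 * (\<Sum>g'<g. group_deg g'))"
  have part: "(\<Sum>g'<g. group_deg g') \<le> 2 * m" if "g \<le> groups" for g
    unfolding sum_group_deg[symmetric] using that by (intro sum_mono2) auto
  have "wp (While (Var rv [<] Var rn)
       (group_sum ;; ry ::= Var rX [div] Lit 1024 ;; rj ::= Lit 0 ;;
        While (Var ry)
          (rt ::= Get 0 (Var rj) ;; Put 0 (Var rj) (Var rt [+] Lit 1) ;;
           Put 7 (Var rt [div] Var rs) (Get 7 (Var rt [div] Var rs) [+] Lit 1 [<<] (Var rt [mod] Var rs)) ;;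
           ry ::= Var ry [div] Lit 2 ;; rj ::= Var rj [+] Lit 1) ;;
        Put 0 (Var rj) (Get 0 (Var rj) [+] Lit 1))) Q (\<sigma>(rv := 0)) \<alpha> os (Suc t)"
  proof (rule wp_While_invariant[where J = J and T = "t + 1 + 2000 * groups + 40 * m"], goal_cases)
    case 1
    show ?case unfolding J_def using z
      by (intro exI[of _ 0]) (auto simp: F_def intro!: frame_upd frame_refl bitset_empty)
  next
    case (2 \<sigma>1 \<alpha>1 os1 t1)
    then obtain g where "g \<le> groups" "t1 \<le> t + 1 + 2000 * g + 20 * (\<Sum>g'<g. group_deg g')"
      by (auto simp: J_def)
    then have "t1 \<le> t + 1 + 2000 * groups + 40 * m" using part[of g] by linarith
    then show ?case by simp
  next
    case (3 \<sigma>1 \<alpha>1 os1 t1)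
    then obtain g where g: "frame ?R \<sigma> \<sigma>1" "frame {0, 7} \<alpha> \<alpha>1" "g \<le> groups"
     "\<sigma>1 rv = min n (256 * g)" "\<And>j. j \<le> lg \<Longrightarrow> \<alpha>1 0 j = pos j g" "bitset 7 ?N \<alpha>1 (F g)" "os1 = os"
     "t1 \<le> t + 1 + 2000 * g + 20 * (\<Sum>g'<g. group_deg g')"
      by (auto simp: J_def)
    have rn1: "\<sigma>1 rn = n" using g(1) \<sigma>(1) frameD[of _ \<sigma> \<sigma>1 rn] by auto
    then have "\<sigma>1 rv < n" using 3 by auto
    from group_at[OF g(4,3) this] have gg: "g < groups" and rv1: "\<sigma>1 rv = 256 * g" by auto
    have pw: "pos j g + 1 < 2 ^ lg" "pos j g + 1 < 2 ^ w" for j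
      using pos_le_num[of j g] num_nodes_bound(3) lg_bounds(3) nm by linarith+
    show ?case
    proof (subst wp_Seq, rule wp_group_sum[where \<sigma> = \<sigma>1 and g = g, OF rn1 rv1 gg])
      fix \<sigma>2 t2
      assume f: "frame {rX, ri, rv, rp, rx} \<sigma>1 \<sigma>2" and X: "\<sigma>2 rX = group_deg g"
        and v2: "\<sigma>2 rv = min n (256 * (g + 1))" and t2: "t2 \<le> Suc t1 + 3 + 7 * 256 + 3 * group_deg g"
      have f2: "frame ?R \<sigma> \<sigma>2" by (rule frame_trans[OF g(1) frame_mono[OF f]]) auto
      define K where "K = (\<lambda>\<sigma>3 \<alpha>3 os3 t3. frame ?R \<sigma> \<sigma>3 \<and> frame {0 :: nat, 7} \<alpha> \<alpha>3 \<and> \<sigma>3 rv = min n (256 * (g + 1)) \<and>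
         \<sigma>3 rj \<le> level g \<and> \<sigma>3 ry = group_deg g div 1024 div 2 ^ \<sigma>3 rj \<and>
         (\<forall>j\<le>lg. \<alpha>3 0 j = pos j g + of_bool (j < \<sigma>3 rj)) \<and>
         bitset 7 ?N \<alpha>3 (F g \<union> {pos j g |j. j < \<sigma>3 rj}) \<and> os3 = os \<and> t3 \<le> t2 + 2 + 6 * \<sigma>3 rj)"
      have "wp (While (Var ry)
          (rt ::= Get 0 (Var rj) ;; Put 0 (Var rj) (Var rt [+] Lit 1) ;;
           Put 7 (Var rt [div] Var rs) (Get 7 (Var rt [div] Var rs) [+] Lit 1 [<<] (Var rt [mod] Var rs)) ;;
           ry ::= Var ry [div] Lit 2 ;; rj ::= Var rj [+] Lit 1))
          (wp (Put 0 (Var rj) (Get 0 (Var rj) [+] Lit 1)) J) (\<sigma>2(ry := group_deg g div 1024, rj := 0)) \<alpha>1 os (Suc (Suc t2))"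
      proof (rule wp_While_invariant[where J = K and T = "t2 + 2 + 6 * level g"], goal_cases)
        case 1
        show ?case using g f2 v2 by (auto simp: K_def intro!: frame_upd frame_put)
      next
        case (2 \<sigma>3 \<alpha>3 os3 t3)
        then show ?case by (auto simp: K_def)
      next
        case (3 \<sigma>3 \<alpha>3 os3 t3)
        then have lt: "\<sigma>3 rj < level g" using div_level[of g "\<sigma>3 rj"] by (auto simp: K_def)
        define j where "j = \<sigma>3 rj"
        have jl: "j < level g" "j + 1 \<le> level g" "j \<le> lg" "j + 1 \<le> lg" using lt level_le[of g] unfolding j_def by linarith+
        have jw: "j + 1 < 2 ^ w" using jl lg_w by linarith
        have ok3: "array_ok 0 \<sigma>3" "array_ok 7 \<sigma>3" using 3 \<sigma>(3,4) by (auto simp: K_def frame_array_ok)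
        have s3: "\<sigma>3 rs = sz" using 3 \<sigma>(2) frameD[of _ \<sigma> \<sigma>3 rs] by (auto simp: K_def)
        have pN: "pos j g < num_nodes" using pos_less_num[OF gg, of j] jl by simp
        then have pD: "pos j g div sz \<le> ?N" by (intro div_le_mono) simp
        have B: "bitset 7 ?N \<alpha>3 (F g \<union> {pos j' g |j'. j' < j})" using 3 by (simp add: K_def j_def)
        \<comment> \<open>The bit is set by addition, so the position must not have been marked
          before.\<close>
        have new: "pos j g \<notin> F g \<union> {pos j' g |j'. j' < j}"
        proof
          assume "pos j g \<in> F g \<union> {pos j' g |j'. j' < j}"
          then obtain j' g' where q: "pos j g = pos j' g'" "g' < g \<and> j' < level g' \<or> g' = g \<and> j' < j"
            by (auto simp: F_def)
          then have "j = j' \<and> g = g'"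
            using pos_inject[OF gg _ _, of j g' j'] gg jl by (metis less_imp_le less_trans)
          then show False using q by auto
        qed
        note ins = bitset_insert[OF B pD new]
        have ins_eq: "insert (pos j g) (F g \<union> {pos j' g |j'. j' < j}) = F g \<union> {pos j' g |j'. j' < j + 1}"
        proof -
          have "j' < j + 1 \<longleftrightarrow> j' < j \<or> j' = j" for j' by auto
          then show ?thesis by auto
        qed
        have v7: "\<alpha>3 7 (pos j g div sz) + 2 ^ (pos j g mod sz) < 2 ^ w" using ins(2) pow_sz(1) by linarith
        have p2: "2 ^ (pos j g mod sz) < (2::nat) ^ w" using v7 by linarith
        have c7: "bitset 7 ?N (put (put \<alpha>3 0 j (pos j g + 1)) 7 (pos j g div sz) (\<alpha>3 7 (pos j g div sz) + 2 ^ (pos j g mod sz)))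
           (F g \<union> {pos j' g |j'. j' < j + 1})"
          using ins(1) unfolding ins_eq by (subst bitset_cong[where \<alpha> = "put \<alpha>3 7 (pos j g div sz) (\<alpha>3 7 (pos j g div sz) + 2 ^ (pos j g mod sz))"]) auto
        have p3: "\<alpha>3 0 j = pos j g" using 3 jl by (auto simp: K_def j_def)
        have less: "j' < j + 1 \<longleftrightarrow> j' < j \<or> j' = j" for j' by auto
        have N1: "pos j g div sz < ?N + 1" using pD by simp
        show ?case
          using 3 jl jw ok3 s3 lits pw p2 p3 v7 ins(2) N1 c7
          by (auto simp: K_def wp_simps lens widths power_add div_mult2_eq j_def[symmetric] less intro!: frame_upd frame_put)
      next
        case (4 \<sigma>3 \<alpha>3 os3 t3)
        then have "level g \<le> \<sigma>3 rj" using div_level[of g "\<sigma>3 rj"] by (auto simp: K_def)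
        then have l: "\<sigma>3 rj = level g" using 4 by (auto simp: K_def)
        have ok3: "array_ok 0 \<sigma>3" using 4 \<sigma>(3,4) by (auto simp: K_def frame_array_ok)
        have tt: "Suc (Suc t3) \<le> t + 1 + 2000 * (g + 1) + 20 * (\<Sum>g'<g + 1. group_deg g')"
        proof -
          have "t3 \<le> t2 + 2 + 6 * level g" using 4 l by (simp add: K_def)
          then show ?thesis using g(8) t2 level_le_deg[of g] unfolding sum_lessThan_plus1 distrib_left mult_1_right by linarith
        qed
        have F1: "F g \<union> {pos j g |j. j < level g} = F (g + 1)"
        proof -
          have "g' < g + 1 \<longleftrightarrow> g' < g \<or> g' = g" for g' by auto
          then show ?thesis unfolding F_def by blast
        qed
        have B: "bitset 7 ?N \<alpha>3 (F (g + 1))" using 4 l unfolding K_def F1[symmetric] by simp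
        have Jn: "J \<sigma>3 (put \<alpha>3 0 (level g) (pos (level g) g + 1)) os3 (Suc (Suc t3))"
          unfolding J_def using 4 gg l pos_Suc[OF gg] tt bitset_cong[of "put \<alpha>3 0 (level g) (pos (level g) g + 1)" 7 \<alpha>3] B
          by (intro exI[of _ "g + 1"]) (auto simp: K_def intro!: frame_put)
        have "\<alpha>3 0 (level g) = pos (level g) g" using 4 l level_le[of g] by (auto simp: K_def)
        then show ?case using Jn l ok3 lits pw level_le[of g] by (simp add: wp_simps lens widths less_Suc_eq_le flip: Suc_eq_plus1)
      qed
      then show "wp (ry ::= Var rX [div] Lit 1024 ;; rj ::= Lit 0 ;;
        While (Var ry)
          (rt ::= Get 0 (Var rj) ;; Put 0 (Var rj) (Var rt [+] Lit 1) ;;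
           Put 7 (Var rt [div] Var rs) (Get 7 (Var rt [div] Var rs) [+] Lit 1 [<<] (Var rt [mod] Var rs)) ;;
           ry ::= Var ry [div] Lit 2 ;; rj ::= Var rj [+] Lit 1) ;;
        Put 0 (Var rj) (Get 0 (Var rj) [+] Lit 1)) J \<sigma>2 \<alpha>1 os1 t2"
        using X lits g(7) by (simp add: wp_simps)
    qed
  next
    case (4 \<sigma>1 \<alpha>1 os1 t1)
    then obtain g where g: "frame ?R \<sigma> \<sigma>1" "frame {0, 7} \<alpha> \<alpha>1" "g \<le> groups"
     "\<sigma>1 rv = min n (256 * g)" "bitset 7 ?N \<alpha>1 (F g)" "os1 = os"
     "t1 \<le> t + 1 + 2000 * g + 20 * (\<Sum>g'<g. group_deg g')"
      by (auto simp: J_def)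
    have rn1: "\<sigma>1 rn = n" using g(1) \<sigma>(1) frameD[of _ \<sigma> \<sigma>1 rn] by auto
    then have "n \<le> 256 * g" using 4 g(4) by (auto simp: min_def split: if_splits)
    then have gg: "g = groups" using g(3) groups_bounds(2) by linarith
    have "F groups = parents" by (auto simp: F_def parents_def)
    moreover have "Suc t1 \<le> t + 2 + 2000 * n + 40 * m" using g(7) groups_bounds(3) unfolding gg sum_group_deg by linarith
    ultimately show ?case unfolding g(6) using g(5) unfolding gg by (intro Q[OF g(1,2)]) auto
  qed
  then show ?thesis using lits by (simp add: mark_parents_def wp_simps)
qed

section \<open>Rank samples\<close>

definition ranks_ok :: "(nat \<Rightarrow> nat \<Rightarrow> nat) \<Rightarrow> bool" where
  "ranks_ok \<alpha> \<longleftrightarrow> (\<forall>i\<le>num_nodes div sz. \<alpha> 8 i = card {p \<in> parents. p < i * sz})"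

definition tables_ok :: "(nat \<Rightarrow> nat \<Rightarrow> nat) \<Rightarrow> bool" where
  "tables_ok \<alpha> \<longleftrightarrow> (\<forall>x<2 ^ sz. \<alpha> 1 x = pop_count x \<and> \<alpha> 2 x = bit_length x)"

lemma card_parents: "card {p \<in> parents. Q p} \<le> num_nodes"
proof -
  have "card {p \<in> parents. Q p} \<le> card {..<num_nodes}"
    using finite_parents(2) by (intro card_mono) auto
  then show ?thesis by simp
qed

lemma card_split:
  assumes "a \<le> b"
  shows "card {p \<in> parents. p < b} = card {p \<in> parents. p < a} + card {p \<in> parents. a \<le> p \<and> p < b}"
proof -
  have e: "{p \<in> parents. p < b} = {p \<in> parents. p < a} \<union> {p \<in> parents. a \<le> p \<and> p < b}" using assms by auto
  show ?thesis unfolding e by (rule card_Un_disjoint) (use finite_parents(1) in auto)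
qed

lemma wp_sample_ranks:
  assumes \<sigma>: "\<sigma> rs = sz" "\<sigma> rnf = num_nodes" "array_ok 1 \<sigma>" "array_ok 7 \<sigma>" "array_ok 8 \<sigma>"
    and B: "bitset 7 (num_nodes div sz) \<alpha> parents" and T: "tables_ok \<alpha>"
    and Q: "\<And>\<sigma>' \<alpha>' t'. frame {racc, ri, rlim} \<sigma> \<sigma>' \<Longrightarrow> frame {8} \<alpha> \<alpha>' \<Longrightarrow>
      ranks_ok \<alpha>' \<Longrightarrow> t' \<le> t + 8 + 4 * num_nodes \<Longrightarrow> Q \<sigma>' \<alpha>' os t'"
  shows "wp sample_ranks Q \<sigma> \<alpha> os t"
proof -
  let ?N = "num_nodes div sz"
  define J where "J = (\<lambda>\<sigma>' \<alpha>' os' t'. frame {racc, ri, rlim} \<sigma> \<sigma>' \<and> frame {8 :: nat} \<alpha> \<alpha>' \<and> \<sigma>' rlim = ?N + 1 \<and>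
     \<sigma>' ri \<le> ?N + 1 \<and> \<sigma>' racc = card {p \<in> parents. p < \<sigma>' ri * sz} \<and>
     (\<forall>i<\<sigma>' ri. \<alpha>' 8 i = card {p \<in> parents. p < i * sz}) \<and> os' = os \<and> t' \<le> t + 3 + 4 * \<sigma>' ri)"
  have N: "?N \<le> num_nodes" by simp
  have "wp (While (Var ri [<] Var rlim)
       (Put 8 (Var ri) (Var racc) ;; racc ::= Var racc [+] Get 1 (Get 7 (Var ri)) ;;
        ri ::= Var ri [+] Lit 1)) Q (\<sigma>(racc := 0, ri := 0, rlim := ?N + 1)) \<alpha> os (Suc (Suc (Suc t)))"
  proof (rule wp_While_invariant[where J = J and T = "t + 3 + 4 * (?N + 1)"], goal_cases)
    case 1
    show ?case by (auto simp: J_def intro!: frame_upd frame_refl)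
  next
    case (2 \<sigma>1 \<alpha>1 os1 t1)
    then show ?case by (auto simp: J_def)
  next
    case (3 \<sigma>1 \<alpha>1 os1 t1)
    define i where "i = \<sigma>1 ri"
    have i: "i < ?N + 1" "i \<le> ?N" using 3 by (auto simp: J_def i_def)
    have ok: "array_ok 1 \<sigma>1" "array_ok 7 \<sigma>1" "array_ok 8 \<sigma>1"
      using 3 \<sigma> by (auto simp: J_def frame_array_ok)
    have a: "\<alpha>1 7 = \<alpha> 7" "\<alpha>1 1 = \<alpha> 1" using 3 frameD[of _ \<alpha> \<alpha>1] by (auto simp: J_def)
    have s: "\<alpha> 7 i < 2 ^ sz" using B i by (simp add: bitset_def)
    have "pop_count (\<alpha> 7 i mod 2 ^ sz) = card {p \<in> parents. i * sz \<le> p \<and> p < i * sz + sz}"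
      using bitset_pop_count[OF B i(2)] by simp
    then have e: "card {p \<in> parents. p < i * sz} + pop_count (\<alpha> 7 i) = card {p \<in> parents. p < (i + 1) * sz}"
      using card_split[of "i * sz" "(i + 1) * sz"] s by (simp add: algebra_simps)
    have t: "\<alpha> 1 (\<alpha> 7 i) = pop_count (\<alpha> 7 i)" using T s by (simp add: tables_ok_def)
    have b: "card {p \<in> parents. p < i * sz} < 2 ^ lg" "card {p \<in> parents. p < (i + 1) * sz} < 2 ^ w" "i + 1 < 2 ^ w"
      using card_parents[of "\<lambda>p. p < i * sz"] card_parents[of "\<lambda>p. p < (i + 1) * sz"] num_w i N num_nodes_bound(3) nm
      by linarith+
    have less: "j < i + 1 \<longleftrightarrow> j < i \<or> j = i" for j by auto
    show ?case using 3 i ok a s e t b lits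
      by (auto simp: J_def wp_simps lens widths i_def[symmetric] less intro!: frame_upd frame_put)
  next
    case (4 \<sigma>1 \<alpha>1 os1 t1)
    then have i: "\<sigma>1 ri = ?N + 1" and os: "os1 = os" by (auto simp: J_def split: if_splits)
    show ?case unfolding os
    proof (rule Q)
      have "t1 \<le> t + 3 + 4 * (?N + 1)" using 4 i by (simp add: J_def)
      then show "Suc t1 \<le> t + 8 + 4 * num_nodes" using N unfolding distrib_left mult_1_right by linarith
      show "ranks_ok \<alpha>1" using 4 i by (auto simp: J_def ranks_ok_def)
    qed (use 4 in \<open>auto simp: J_def\<close>)
  qed
  moreover have "?N + 1 < 2 ^ w" using N num_nodes_bound(3) nm by linarith
  ultimately show ?thesis using lits \<sigma>(1,2) by (simp add: sample_ranks_def wp_simps)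
qed

section \<open>Descending the counter levels\<close>

text \<open>Collects what the preprocessing establishes and the later phases preserve. Arrays 3 to 6
  and 9 do not occur in it, so updates of the vertex state leave it intact.\<close>

definition static :: "(nat \<Rightarrow> nat) \<Rightarrow> (nat \<Rightarrow> nat \<Rightarrow> nat) \<Rightarrow> bool" where
  "static \<sigma> \<alpha> \<longleftrightarrow> \<sigma> rn = n \<and> \<sigma> rd = d \<and> \<sigma> rs = sz \<and> \<sigma> rg = groups \<and> (\<forall>k<10. array_ok k \<sigma>) \<and>
     bitset 7 (num_nodes div sz) \<alpha> parents \<and> ranks_ok \<alpha> \<and> tables_ok \<alpha>"

lemma static_frame:
  assumes "static \<sigma> \<alpha>" "frame R \<sigma> \<sigma>'" "R \<subseteq> {..<100} - {rn, rd, rs, rg}"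
    "frame K \<alpha> \<alpha>'" "K \<subseteq> {3, 4, 5, 6, 9}"
  shows "static \<sigma>' \<alpha>'"
proof -
  have r: "\<sigma>' rn = \<sigma> rn" "\<sigma>' rd = \<sigma> rd" "\<sigma>' rs = \<sigma> rs" "\<sigma>' rg = \<sigma> rg"
    using assms(3) frameD[OF assms(2)] by blast+
  have k: "\<alpha>' 1 = \<alpha> 1" "\<alpha>' 2 = \<alpha> 2" "\<alpha>' 7 = \<alpha> 7" "\<alpha>' 8 = \<alpha> 8"
    using assms(5) by (intro frameD[OF assms(4)]; force)+
  have "array_ok k \<sigma>' = array_ok k \<sigma>" for k using assms(3) by (intro frame_array_ok[OF assms(2)]) auto
  then show ?thesis
    using assms(1) r k bitset_cong[of \<alpha>' 7 \<alpha>] by (simp add: static_def ranks_ok_def tables_ok_def)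
qed

lemma static_upd [simp]: "r < 100 \<Longrightarrow> r \<noteq> rn \<Longrightarrow> r \<noteq> rd \<Longrightarrow> r \<noteq> rs \<Longrightarrow> r \<noteq> rg \<Longrightarrow> static (\<sigma>(r := v)) \<alpha> = static \<sigma> \<alpha>"
  by (simp add: static_def)

lemma static_put [simp]: "k \<in> {3, 4, 5, 6, 9} \<Longrightarrow> static \<sigma> (put \<alpha> k i v) = static \<sigma> \<alpha>"
proof -
  assume "k \<in> {3, 4, 5, 6, 9}"
  then have "put \<alpha> k i v 1 = \<alpha> 1" "put \<alpha> k i v 2 = \<alpha> 2" "put \<alpha> k i v 7 = \<alpha> 7" "put \<alpha> k i v 8 = \<alpha> 8"
    by auto
  then show ?thesis by (simp only: static_def ranks_ok_def tables_ok_def bitset_def)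
qed

lemma staticD:
  assumes "static \<sigma> \<alpha>"
  shows "\<sigma> rn = n" "\<sigma> rd = d" "\<sigma> rs = sz" "\<sigma> rg = groups" "k < 10 \<Longrightarrow> array_ok k \<sigma>"
    "bitset 7 (num_nodes div sz) \<alpha> parents" "ranks_ok \<alpha>" "tables_ok \<alpha>"
  using assms by (auto simp: static_def)

lemma ev_branch:
  assumes "static \<sigma> \<alpha>" "\<sigma> rpp = p" "p < num_nodes"
  shows "ok branch \<sigma> \<alpha>" "ev branch \<sigma> \<alpha> = of_bool (p \<in> parents)"
proof -
  have d: "p div sz \<le> num_nodes div sz" using assms(3) by (intro div_le_mono) simp
  then have d': "p div sz < num_nodes div sz + 1" by simp
  show "ok branch \<sigma> \<alpha>" "ev branch \<sigma> \<alpha> = of_bool (p \<in> parents)"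
    using staticD[OF assms(1)] assms(2) bitset_test[OF staticD(6)[OF assms(1)] d] d' lits
    by (simp_all add: lens)
qed

lemma ev_child:
  assumes "static \<sigma> \<alpha>" "\<sigma> rpp = pos j g" "g < groups" "j < level g"
  shows "ok child \<sigma> \<alpha>" "ev child \<sigma> \<alpha> = pos (j + 1) g"
proof -
  define p where "p = pos j g"
  have p: "p < num_nodes" unfolding p_def using pos_less_num[OF assms(3)] assms(4) by simp
  have d: "p div sz \<le> num_nodes div sz" using p by (intro div_le_mono) simp
  then have d': "p div sz < num_nodes div sz + 1" by simp
  have ms: "p mod sz < sz" using sz_bounds(1) by simp
  note st = staticD[OF assms(1)]
  have s: "\<alpha> 7 (p div sz) < 2 ^ sz" using st(6) d by (simp add: bitset_def)
  have s': "\<alpha> 7 (p div sz) mod 2 ^ (p mod sz) < 2 ^ sz" using s by (meson le_less_trans mod_less_eq_dividend)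
  have T: "\<alpha> 1 (\<alpha> 7 (p div sz) mod 2 ^ (p mod sz)) = pop_count (\<alpha> 7 (p div sz) mod 2 ^ (p mod sz))"
    using st(8) s' by (simp add: tables_ok_def)
  have "pop_count (\<alpha> 7 (p div sz) mod 2 ^ (p mod sz)) =
     card {p' \<in> parents. p div sz * sz \<le> p' \<and> p' < p div sz * sz + p mod sz}"
    using ms by (intro bitset_pop_count[OF st(6) d]) simp
  then have "card {p' \<in> parents. p' < p div sz * sz} + pop_count (\<alpha> 7 (p div sz) mod 2 ^ (p mod sz)) = card {p' \<in> parents. p' < p}"
    using card_split[of "p div sz * sz" p] by (simp add: div_mult_mod_eq)
  then have e: "groups + \<alpha> 8 (p div sz) + \<alpha> 1 (\<alpha> 7 (p div sz) mod 2 ^ (p mod sz)) = pos (j + 1) g"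
    using st(7) d pos_child[OF assms(3,4)] T by (simp add: ranks_ok_def p_def)
  have b: "pos (j + 1) g < 2 ^ w" using pos_le_num[of "j + 1" g] num_w by linarith
  have b': "groups + \<alpha> 8 (p div sz) < 2 ^ w" using e b by linarith
  have p2: "2 ^ (p mod sz) < (2::nat) ^ w" using ms sz_w by (intro power_strict_increasing) linarith+
  show "ok child \<sigma> \<alpha>" "ev child \<sigma> \<alpha> = pos (j + 1) g"
    using st assms(2) d' s' e b b' lits p2 by (simp_all add: lens p_def[symmetric])
qed

lemma ev_counter:
  assumes "static \<sigma> \<alpha>" "\<sigma> rpp = pos (j + 1) (u div 256)" "\<sigma> r = u" "r < 200" "u < n" "j < level (u div 256)"
  shows "ok (counter_exp r) \<sigma> \<alpha>" "ev (counter_exp r) \<sigma> \<alpha> = counter_cell u j" "counter_cell u j < len 9"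
proof -
  show l: "counter_cell u j < len 9" using counter_cell_less[OF assms(5,6)] by (simp add: lens)
  have l': "counter_cell u j < 2 ^ w" using l num_nodes_bound(1) nm unfolding lens by linarith
  then have l2: "(pos (j + 1) (u div 256) - groups) * 256 < 2 ^ w" unfolding counter_cell_def by linarith
  show "ok (counter_exp r) \<sigma> \<alpha>" "ev (counter_exp r) \<sigma> \<alpha> = counter_cell u j"
    using staticD[OF assms(1)] assms l' l2 lits pos_ge_groups[OF group_less[OF assms(5)] assms(6)]
    by (simp_all add: counter_cell_def)
qed

end

section \<open>The set of pending vertices\<close>

text \<open>A higher level is touched only when an entry below it becomes nonempty, so the time is
  constant. The space is about \<open>n\<close> bits for array 4, \<open>n / sz\<close> for array 5
  and \<open>lg * n / sz ^ 2 <= 16 * n / sz\<close> for the stack of blocks.\<close>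

definition insert_pending :: "nat \<Rightarrow> com" where
  "insert_pending r = (
     rf ::= Var r [div] Var rs ;; rz ::= Get 4 (Var rf) ;;
     Put 4 (Var rf) (Var rz [+] Lit 1 [<<] (Var r [mod] Var rs)) ;;
     Cond (Var rz) Skip
       (rb ::= Var rf [div] Var rs ;; rz ::= Get 5 (Var rb) ;;
        Put 5 (Var rb) (Var rz [+] Lit 1 [<<] (Var rf [mod] Var rs)) ;;
        Cond (Var rz) Skip (Put 6 (Var rh) (Var rb) ;; rh ::= Var rh [+] Lit 1)))"

definition pop_pending :: com where
  "pop_pending = (
     rb ::= Get 6 (Var rh [-] Lit 1) ;; rz ::= Get 5 (Var rb) ;;
     rt ::= Get 2 (Var rz) [-] Lit 1 ;; rf ::= Var rb [*] Var rs [+] Var rt ;;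
     rx ::= Get 4 (Var rf) ;; rj ::= Get 2 (Var rx) [-] Lit 1 ;;
     rv ::= Var rf [*] Var rs [+] Var rj ;; rx ::= Var rx [-] Lit 1 [<<] Var rj ;;
     Put 4 (Var rf) (Var rx) ;;
     Cond (Var rx) Skip
       (rz ::= Var rz [-] Lit 1 [<<] Var rt ;; Put 5 (Var rb) (Var rz) ;;
        Cond (Var rz) Skip (rh ::= Var rh [-] Lit 1)))"

definition init_state :: com where
  "init_state = (
     rh ::= Lit 0 ;; rv ::= Lit 0 ;;
     While (Var rv [<] Var rn)
       (get_deg ;;
        Cond (Var rd [<] Var rx)
          (Put 3 (Var rv) (Lit 1) ;; re ::= Var rx [-] Var rd [-] Lit 1 ;; rpp ::= Var rv [div] Lit 256 ;;
           While branch
             (rpp ::= child ;; Put 9 (counter_exp rv) (Var re [mod] Lit 2) ;; re ::= Var re [div] Lit 2))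
          (insert_pending rv) ;;
        rv ::= Var rv [+] Lit 1))"

context main_run
begin

definition field_of :: "nat \<Rightarrow> nat" where "field_of v = v div sz"
definition block_of :: "nat \<Rightarrow> nat" where "block_of v = v div sz div sz"

lemma block_of_image: "(\<lambda>f. f div sz) ` field_of ` P = block_of ` P"
  by (auto simp: field_of_def block_of_def image_image)

lemma div_bounds: "v < n \<Longrightarrow> field_of v \<le> n div sz" "v < n \<Longrightarrow> block_of v \<le> n div sz div sz"
  by (auto simp: field_of_def block_of_def intro!: div_le_mono)

text \<open>Array 4 holds the characteristic vector of \<open>P\<close>, array 5 marks its nonempty fields, and the first
  \<open>h\<close> entries of array 6 are a stack of the nonempty fields of array 5.\<close>

definition pending :: "nat \<Rightarrow> (nat \<Rightarrow> nat \<Rightarrow> nat) \<Rightarrow> nat set \<Rightarrow> bool" where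
  "pending h \<alpha> P \<longleftrightarrow> P \<subseteq> {..<n} \<and> bitset 4 (n div sz) \<alpha> P \<and>
     bitset 5 (n div sz div sz) \<alpha> (field_of ` P) \<and>
     distinct (map (\<alpha> 6) [0..<h]) \<and> set (map (\<alpha> 6) [0..<h]) = block_of ` P"

lemma pending_cong: "\<alpha>' 4 = \<alpha> 4 \<Longrightarrow> \<alpha>' 5 = \<alpha> 5 \<Longrightarrow> \<alpha>' 6 = \<alpha> 6 \<Longrightarrow> pending h \<alpha>' P = pending h \<alpha> P"
  by (simp add: pending_def bitset_def)

text \<open>Since the stack entries are distinct, its height is the number of nonempty blocks; this
  rules out overflow and makes the height a test for emptiness.\<close>

lemma pending_height:
  assumes "pending h \<alpha> P"
  shows "h \<le> n div sz div sz + 1" "h = 0 \<longleftrightarrow> P = {}" "h = card (block_of ` P)"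
proof -
  have f: "finite P" using assms finite_subset[of P "{..<n}"] by (auto simp: pending_def)
  have "card (set (map (\<alpha> 6) [0..<h])) = length (map (\<alpha> 6) [0..<h])"
    using assms unfolding pending_def by (intro distinct_card) blast
  then show h: "h = card (block_of ` P)" using assms by (simp add: pending_def)
  show "h = 0 \<longleftrightarrow> P = {}" unfolding h using f by simp
  have "block_of ` P \<subseteq> {..n div sz div sz}" using assms div_bounds(2) by (auto simp: pending_def)
  then have "card (block_of ` P) \<le> card {..n div sz div sz}" by (intro card_mono) auto
  then show "h \<le> n div sz div sz + 1" unfolding h by simp
qed

lemma wp_insert_pending:
  assumes st: "static \<sigma> \<alpha>" and P: "pending (\<sigma> rh) \<alpha> P" and v: "\<sigma> r = v" "v < n" "v \<notin> P"
    and r: "r < 100" "r \<notin> {rf, rz, rb, rh}"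
    and Q: "\<And>\<sigma>' \<alpha>' t'. frame {rf, rz, rb, rh} \<sigma> \<sigma>' \<Longrightarrow> frame {4, 5, 6} \<alpha> \<alpha>' \<Longrightarrow>
      pending (\<sigma>' rh) \<alpha>' (insert v P) \<Longrightarrow> t' \<le> t + 10 \<Longrightarrow> Q \<sigma>' \<alpha>' os t'"
  shows "wp (insert_pending r) Q \<sigma> \<alpha> os t"
proof -
  define f b where "f = v div sz" and "b = f div sz"
  have fN: "f \<le> n div sz" "b \<le> n div sz div sz" using div_bounds[OF v(2)] by (simp_all add: f_def b_def field_of_def block_of_def)
  note s = staticD(1-4)[OF st] staticD(5)[OF st, of 4] staticD(5)[OF st, of 5] staticD(5)[OF st, of 6]
  have B4: "bitset 4 (n div sz) \<alpha> P" and B5: "bitset 5 (n div sz div sz) \<alpha> (field_of ` P)"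
    and Pn: "P \<subseteq> {..<n}" using P by (auto simp: pending_def)
  note i4 = bitset_insert[OF B4 fN(1)[unfolded f_def] v(3), folded f_def]
  define \<alpha>4 where "\<alpha>4 = put \<alpha> 4 f (\<alpha> 4 f + 2 ^ (v mod sz))"
  have w4: "\<alpha> 4 f + 2 ^ (v mod sz) < 2 ^ w" "2 ^ (v mod sz) < (2::nat) ^ w" using i4(2) pow_sz(1) by linarith+
  have z4: "\<alpha> 4 f = 0 \<longleftrightarrow> f \<notin> field_of ` P"
    using bitset_zero[OF B4 fN(1)] unfolding field_of_def[abs_def] .
  have fv: "field_of v = f" "block_of v = b" by (simp_all add: field_of_def block_of_def f_def b_def)
  have l: "f < len 4" "b < len 5" using fN by (simp_all add: lens)
  show ?thesis
  proof (cases "\<alpha> 4 f = 0")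
    case False
    have "pending (\<sigma> rh) \<alpha>4 (insert v P)"
      using False z4 i4(1) P v(2) B5 fv unfolding pending_def \<alpha>4_def[symmetric]
      by (auto simp: bitset_def \<alpha>4_def insert_absorb block_of_def field_of_def b_def)
    then have "Q (\<sigma>(rf := f, rz := \<alpha> 4 f)) \<alpha>4 os (Suc (Suc (Suc (Suc t))))"
      by (intro Q) (auto simp: \<alpha>4_def intro!: frame_upd frame_refl frame_put)
    then show ?thesis
      using False s l v r lits w4 i4(2) by (simp add: insert_pending_def wp_simps \<alpha>4_def widths f_def[symmetric])
  next
    case True
    note True4 = True
    have f: "f \<notin> field_of ` P" using z4 True by simp
    note i5 = bitset_insert[OF B5 fN(2)[unfolded b_def] f, folded b_def]
    define \<alpha>5 where "\<alpha>5 = put \<alpha>4 5 b (\<alpha> 5 b + 2 ^ (f mod sz))"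
    have w5: "\<alpha> 5 b + 2 ^ (f mod sz) < 2 ^ w" "2 ^ (f mod sz) < (2::nat) ^ w" using i5(2) pow_sz(1) by linarith+
    have z5: "\<alpha> 5 b = 0 \<longleftrightarrow> b \<notin> block_of ` P"
      using bitset_zero[OF B5 fN(2)] unfolding block_of_image .
    have c4: "bitset 4 (n div sz) \<alpha>5 (insert v P)" using i4(1) by (simp add: bitset_def \<alpha>5_def \<alpha>4_def)
    have c5: "bitset 5 (n div sz div sz) \<alpha>5 (field_of ` insert v P)"
      using i5(1) fv by (simp add: bitset_def \<alpha>5_def \<alpha>4_def)
    show ?thesis
    proof (cases "\<alpha> 5 b = 0")
      case False
      have "pending (\<sigma> rh) \<alpha>5 (insert v P)"
        using False z5 c4 c5 P v(2) fv unfolding pending_def by (auto simp: \<alpha>5_def \<alpha>4_def insert_absorb)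
      then have "Q (\<sigma>(rf := f, rb := b, rz := \<alpha> 5 b)) \<alpha>5 os (Suc (Suc (Suc (Suc (Suc (Suc (Suc (Suc t))))))))"
        by (intro Q) (auto simp: \<alpha>4_def \<alpha>5_def intro!: frame_upd frame_refl frame_put)
      then show ?thesis
        using False True4 s l v r lits w4 i4(2) w5 i5(2)
        by (simp add: insert_pending_def wp_simps \<alpha>4_def \<alpha>5_def widths f_def[symmetric] b_def[symmetric] fun_upd_twist[of rz rb])
    next
      case True
      note bz = True
      have bn: "b \<notin> block_of ` P" using z5 True by simp
      define h where "h = \<sigma> rh"
      have "b \<in> block_of ` insert v P" using fv by auto
      \<comment> \<open>A new block is pushed only if it was absent, so counting the blocks after
        insertion shows that the stack still has room.\<close>
      have "card (block_of ` insert v P) = Suc h"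
        using bn fv pending_height(3)[OF P] finite_subset[OF Pn] by (simp add: h_def)
      moreover have "block_of ` insert v P \<subseteq> {..n div sz div sz}" using div_bounds(2) Pn v(2) by auto
      then have "card (block_of ` insert v P) \<le> card {..n div sz div sz}" by (intro card_mono) auto
      ultimately have h: "h < n div sz div sz + 1" by simp
      have "n div sz div sz \<le> n" by (meson div_le_dividend le_trans)
      then have bl: "b < 2 ^ lg" "h + 1 < 2 ^ w" using fN(2) lg_bounds(3) h nm by linarith+
      define \<alpha>6 where "\<alpha>6 = put \<alpha>5 6 h b"
      have c6: "bitset 4 (n div sz) \<alpha>6 (insert v P)" "bitset 5 (n div sz div sz) \<alpha>6 (field_of ` insert v P)"
        using c4 c5 by (simp_all add: bitset_def \<alpha>6_def)
      have mp: "map (\<alpha>6 6) [0..<h + 1] = map (\<alpha> 6) [0..<h] @ [b]"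
        by (simp add: \<alpha>6_def \<alpha>5_def \<alpha>4_def flip: Suc_eq_plus1)
      have "pending (h + 1) \<alpha>6 (insert v P)"
        using c6 P v(2) fv bn unfolding pending_def h_def[symmetric] mp by simp
      then have "Q (\<sigma>(rf := f, rb := b, rz := \<alpha> 5 b, rh := h + 1)) \<alpha>6 os (Suc (Suc (Suc (Suc (Suc (Suc (Suc (Suc (Suc (Suc t))))))))))"
        by (intro Q) (auto simp: \<alpha>4_def \<alpha>5_def \<alpha>6_def intro!: frame_upd frame_refl frame_put)
      then show ?thesis
        using bz True4 s l v r lits w4 i4(2) w5 i5(2) h bl
        by (simp add: insert_pending_def wp_simps \<alpha>4_def \<alpha>5_def \<alpha>6_def lens widths f_def[symmetric] b_def[symmetric]
          h_def[symmetric] fun_upd_twist[of rz rb])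
    qed
  qed
qed

lemma image_remove:
  assumes "v \<in> P" "g v = f"
  shows "g ` (P - {v}) = (if f \<in> g ` (P - {v}) then g ` P else g ` P - {f})"
proof -
  have "g ` P = insert f (g ` (P - {v}))" using assms by blast
  then show ?thesis by auto
qed

text \<open>Which member is delivered is left open, because any pending vertex may be removed next.
  The top of the stack leads to a nonempty block, its highest bit to a nonempty field, and the
  highest bit there to a vertex.\<close>

lemma wp_pop_pending:
  assumes st: "static \<sigma> \<alpha>" and P: "pending (\<sigma> rh) \<alpha> P" and ne: "\<sigma> rh \<noteq> 0"
    and Q: "\<And>\<sigma>' \<alpha>' t' v. v \<in> P \<Longrightarrow> frame {rb, rz, rt, rf, rx, rj, rv, rh} \<sigma> \<sigma>' \<Longrightarrow> \<sigma>' rv = v \<Longrightarrow>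
      frame {4, 5} \<alpha> \<alpha>' \<Longrightarrow> pending (\<sigma>' rh) \<alpha>' (P - {v}) \<Longrightarrow> t' \<le> t + 14 \<Longrightarrow> Q \<sigma>' \<alpha>' os t'"
  shows "wp pop_pending Q \<sigma> \<alpha> os t"
proof -
  define h where "h = \<sigma> rh - 1"
  define b where "b = \<alpha> 6 h"
  have h: "\<sigma> rh = h + 1" using ne by (simp add: h_def)
  have mp: "map (\<alpha> 6) [0..<h + 1] = map (\<alpha> 6) [0..<h] @ [b]" by (simp add: b_def flip: Suc_eq_plus1)
  have dist: "distinct (map (\<alpha> 6) [0..<h] @ [b])" and im: "insert b (\<alpha> 6 ` {0..<h}) = block_of ` P"
    using P unfolding pending_def h mp by auto
  have B4: "bitset 4 (n div sz) \<alpha> P" and B5: "bitset 5 (n div sz div sz) \<alpha> (field_of ` P)"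
    and Pn: "P \<subseteq> {..<n}" using P by (auto simp: pending_def)
  have hl: "h < len 6" using pending_height(1)[OF P] unfolding h lens by simp
  have bP: "b \<in> block_of ` P" using im by auto
  then have bN: "b \<le> n div sz div sz" using Pn div_bounds(2) by auto
  have zb: "\<alpha> 5 b \<noteq> 0" using bitset_zero[OF B5 bN] bP unfolding block_of_image by simp
  define i where "i = bit_length (\<alpha> 5 b) - 1"
  note t5 = bitset_top[OF B5 bN zb, folded i_def]
  define f where "f = b * sz + i"
  have fi: "f div sz = b" "f mod sz = i" using field_index[of b i f] t5(2) by (auto simp: f_def)
  have fP: "f \<in> field_of ` P" using t5(1) by (simp add: f_def)
  then have fN: "f \<le> n div sz" using Pn div_bounds(1) by auto
  have zf: "\<alpha> 4 f \<noteq> 0" using bitset_zero[OF B4 fN] fP unfolding field_of_def[abs_def] by simp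
  define j where "j = bit_length (\<alpha> 4 f) - 1"
  note t4 = bitset_top[OF B4 fN zf, folded j_def]
  define v where "v = f * sz + j"
  have vi: "v div sz = f" "v mod sz = j" using field_index[of f j v] t4(2) by (auto simp: v_def)
  have vP: "v \<in> P" using t4(1) by (simp add: v_def)
  then have vn: "v < n" using Pn by auto
  have fv: "field_of v = f" "block_of v = b" by (simp_all add: field_of_def block_of_def vi fi)
  have vf: "v div sz \<le> n div sz" using fN vi by simp
  have fb: "f div sz \<le> n div sz div sz" using bN fi by simp
  note r4 = bitset_remove[OF B4 vf vP, unfolded vi]
  note r5 = bitset_remove[OF B5 fb fP, unfolded fi]
  have x4: "\<alpha> 4 f < 2 ^ sz" using B4 fN by (simp add: bitset_def)
  have x5: "\<alpha> 5 b < 2 ^ sz" using B5 bN by (simp add: bitset_def)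
  define \<alpha>4 where "\<alpha>4 = put \<alpha> 4 f (\<alpha> 4 f - 2 ^ j)"
  have T: "\<alpha> 2 (\<alpha> 5 b) = i + 1" "\<alpha> 2 (\<alpha> 4 f) = j + 1"
    using staticD(8)[OF st] x4 x5 t4(3) t5(3) by (simp_all add: tables_ok_def i_def j_def)
  note s = staticD(1-4)[OF st] staticD(5)[OF st, of 4] staticD(5)[OF st, of 5] staticD(5)[OF st, of 6]
    staticD(5)[OF st, of 2]
  have sm: "b * sz + i < 2 ^ w" "b * sz < 2 ^ w" "f * sz + j < 2 ^ w" "f * sz < 2 ^ w"
  proof -
    have "f \<le> n" using fN by (meson div_le_dividend le_trans)
    then show "b * sz + i < 2 ^ w" "b * sz < 2 ^ w" "f * sz + j < 2 ^ w" "f * sz < 2 ^ w"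
      using vn nm unfolding v_def f_def by linarith+
  qed
  have pw: "2 ^ i < (2::nat) ^ w" "2 ^ j < (2::nat) ^ w"
    using t4(2) t5(2) sz_w by (auto intro!: power_strict_increasing)
  have l: "f < len 4" "b < len 5" using fN bN by (simp_all add: lens)
  have z4: "\<alpha> 4 f - 2 ^ j = 0 \<longleftrightarrow> f \<notin> field_of ` (P - {v})"
    using bitset_zero[OF r4(1) fN] unfolding field_of_def[abs_def] by simp
  have imf: "field_of ` (P - {v}) = (if \<alpha> 4 f - 2 ^ j \<noteq> 0 then field_of ` P else field_of ` P - {f})"
    using image_remove[of v P field_of f, OF vP fv(1)] z4 by simp
  define y4 where "y4 = \<alpha> 4 f - 2 ^ j"
  define y5 where "y5 = \<alpha> 5 b - 2 ^ i"
  have y4: "y4 < 2 ^ sz" and y5: "y5 < 2 ^ sz" using x4 x5 by (simp_all add: y4_def y5_def)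
  \<comment> \<open>The straight-line prefix is executed once for all three cases, which differ in
    how many summary levels become empty.\<close>
  have start: "wp pop_pending Q \<sigma> \<alpha> os t"
    if "wp (Cond (Var rx) Skip
       (rz ::= Var rz [-] Lit 1 [<<] Var rt ;; Put 5 (Var rb) (Var rz) ;;
        Cond (Var rz) Skip (rh ::= Var rh [-] Lit 1))) Q
        (\<sigma>(rb := b, rz := \<alpha> 5 b, rt := i, rf := f, rj := j, rv := v, rx := y4)) \<alpha>4 os
        (Suc (Suc (Suc (Suc (Suc (Suc (Suc (Suc (Suc t)))))))))"
    using that s h hl l lits sm pw r4(2) x4 x5 y4
    by (simp add: pop_pending_def wp_Asg wp_Put wp_Seq T widths lens(3) y4_def[symmetric] b_def[symmetric] f_def[symmetric] v_def[symmetric] \<alpha>4_def)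
  show ?thesis
  proof (cases "y4 = 0")
    case False
    have "pending (\<sigma> rh) \<alpha>4 (P - {v})"
    proof -
      have "bitset 4 (n div sz) \<alpha>4 (P - {v})" using r4(1) by (simp add: \<alpha>4_def)
      moreover have e: "field_of ` (P - {v}) = field_of ` P" using imf False by (simp add: y4_def)
      moreover have "bitset 5 (n div sz div sz) \<alpha>4 (field_of ` P)" using B5 by (simp add: bitset_def \<alpha>4_def)
      moreover have "block_of ` (P - {v}) = block_of ` P" using e block_of_image by metis
      moreover have "\<alpha>4 6 = \<alpha> 6" by (simp add: \<alpha>4_def)
      ultimately show ?thesis using P unfolding pending_def by auto
    qed
    then have "Q (\<sigma>(rb := b, rz := \<alpha> 5 b, rt := i, rf := f, rj := j, rv := v, rx := y4)) \<alpha>4 os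
        (Suc (Suc (Suc (Suc (Suc (Suc (Suc (Suc (Suc (Suc t))))))))))"
      by (intro Q[OF vP]) (auto simp: \<alpha>4_def intro!: frame_upd frame_refl frame_put)
    then show ?thesis using False by (intro start) (simp add: wp_simps)
  next
    case True
    note z = True
    define \<alpha>5 where "\<alpha>5 = put \<alpha>4 5 b (y5)"
    have f_eq: "field_of ` (P - {v}) = field_of ` P - {f}" using imf True by (simp add: y4_def)
    have c4: "bitset 4 (n div sz) \<alpha>5 (P - {v})" using r4(1) by (simp add: bitset_def \<alpha>5_def \<alpha>4_def)
    have c5: "bitset 5 (n div sz div sz) \<alpha>5 (field_of ` (P - {v}))"
      unfolding f_eq using r5(1) by (simp add: bitset_def \<alpha>5_def \<alpha>4_def y5_def)
    have c6: "\<alpha>5 6 = \<alpha> 6" by (simp add: \<alpha>5_def \<alpha>4_def)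
    have z5: "y5 = 0 \<longleftrightarrow> b \<notin> block_of ` (P - {v})"
      using bitset_zero[OF c5 bN] unfolding block_of_image by (simp add: \<alpha>5_def)
    have imb: "block_of ` (P - {v}) = (if y5 \<noteq> 0 then block_of ` P else block_of ` P - {b})"
      using image_remove[of v P block_of b, OF vP fv(2)] z5 by simp
    show ?thesis
    proof (cases "y5 = 0")
      case False
      have "pending (\<sigma> rh) \<alpha>5 (P - {v})"
        using P c4 c5 c6 imb False unfolding pending_def by auto
      then have "Q (\<sigma>(rb := b, rt := i, rf := f, rj := j, rv := v, rx := y4, rz := y5)) \<alpha>5 os
          (Suc (Suc (Suc (Suc (Suc (Suc (Suc (Suc (Suc (Suc (Suc (Suc (Suc t)))))))))))))"
        by (intro Q[OF vP]) (auto simp: \<alpha>4_def \<alpha>5_def intro!: frame_upd frame_refl frame_put)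
      then show ?thesis using False z s l lits pw r5(2) x5 y5
        by (intro start) (simp add: wp_simps widths y5_def[symmetric] \<alpha>5_def fun_upd_twist[of rz])
    next
      case True
      note z' = True
      have "pending h \<alpha>5 (P - {v})"
        using P c4 c5 c6 imb True dist im unfolding pending_def by auto
      then have "Q (\<sigma>(rb := b, rt := i, rf := f, rj := j, rv := v, rx := y4, rz := y5, rh := h)) \<alpha>5 os
          (Suc (Suc (Suc (Suc (Suc (Suc (Suc (Suc (Suc (Suc (Suc (Suc (Suc (Suc t))))))))))))))"
        by (intro Q[OF vP]) (auto simp: \<alpha>4_def \<alpha>5_def intro!: frame_upd frame_refl frame_put)
      then show ?thesis using z' z s h l lits pw r5(2) x5 y5
        by (intro start) (simp add: wp_simps widths y5_def[symmetric] \<alpha>5_def fun_upd_twist[of rz])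
    qed
  qed
qed

end

context input
begin

lemma sum_groups: "(\<Sum>u<n. f (u div 256)) \<le> 256 * (\<Sum>g<groups. f g :: nat)"
proof -
  have "(\<Sum>u<n. f (u div 256)) = (\<Sum>g<groups. \<Sum>u | u \<in> {..<n} \<and> u div 256 = g. f (u div 256))"
    by (rule sum.group[symmetric]) (auto simp: group_less)
  also have "\<dots> \<le> (\<Sum>g<groups. 256 * f g)"
  proof (rule sum_mono)
    fix g
    have "{u. u \<in> {..<n} \<and> u div 256 = g} \<subseteq> {256 * g..<256 * g + 256}" by auto
    then have "card {u. u \<in> {..<n} \<and> u div 256 = g} \<le> card {256 * g..<256 * g + 256}" by (intro card_mono) auto
    then have c: "card {u. u \<in> {..<n} \<and> u div 256 = g} \<le> 256" by simp
    have "(\<Sum>u | u \<in> {..<n} \<and> u div 256 = g. f (u div 256)) = card {u. u \<in> {..<n} \<and> u div 256 = g} * f g"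
      by simp
    also have "\<dots> \<le> 256 * f g" using c by (rule mult_right_mono) simp
    finally show "(\<Sum>u | u \<in> {..<n} \<and> u div 256 = g. f (u div 256)) \<le> 256 * f g" .
  qed
  finally show ?thesis by (simp add: sum_distrib_left)
qed

text \<open>Bounds the cost of descending from every vertex through all levels when the counters are
  initialised.\<close>

lemma sum_levels: "(\<Sum>u<n. level (u div 256)) \<le> m"
  using sum_groups[of level] sum_level by linarith

end

context main_run
begin

lemma wp_init_state:
  assumes st: "static \<sigma> \<alpha>" and z: "\<And>k i. k \<in> {3, 4, 5} \<Longrightarrow> \<alpha> k i = 0"
    and Q: "\<And>\<sigma>' \<alpha>' t'. frame {rh, rv, rp, rx, re, rpp, rf, rz, rb} \<sigma> \<sigma>' \<Longrightarrow> frame {3, 4, 5, 6, 9} \<alpha> \<alpha>' \<Longrightarrow>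
      pending (\<sigma>' rh) \<alpha>' {u. u < n \<and> deg u \<le> d} \<Longrightarrow> (\<And>u. u < n \<Longrightarrow> \<alpha>' 3 u = of_bool (d < deg u)) \<Longrightarrow>
      (\<And>u j. u < n \<Longrightarrow> d < deg u \<Longrightarrow> j < level (u div 256) \<Longrightarrow>
         \<alpha>' 9 (counter_cell u j) = (deg u - d - 1) div 2 ^ j mod 2) \<Longrightarrow>
      t' \<le> t + 3 + 20 * n + 10 * m \<Longrightarrow> Q \<sigma>' \<alpha>' os t'"
  shows "wp init_state Q \<sigma> \<alpha> os t"
proof -
  let ?R = "{rh, rv, rp, rx, re, rpp, rf, rz, rb}" and ?K = "{3 :: nat, 4, 5, 6, 9}"
  define cost where "cost v = (\<Sum>u<v. 20 + 3 * deg u + 4 * level (u div 256))" for v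
  define J where "J = (\<lambda>\<sigma>' \<alpha>' os' t'. frame ?R \<sigma> \<sigma>' \<and> frame ?K \<alpha> \<alpha>' \<and> \<sigma>' rv \<le> n \<and>
     pending (\<sigma>' rh) \<alpha>' {u. u < \<sigma>' rv \<and> deg u \<le> d} \<and> (\<forall>u<n. \<alpha>' 3 u = of_bool (u < \<sigma>' rv \<and> d < deg u)) \<and>
     (\<forall>u<\<sigma>' rv. d < deg u \<longrightarrow> (\<forall>j<level (u div 256). \<alpha>' 9 (counter_cell u j) = (deg u - d - 1) div 2 ^ j mod 2)) \<and>
     os' = os \<and> t' \<le> t + 2 + cost (\<sigma>' rv))"
  have cost_n: "cost n \<le> 20 * n + 10 * m"
    using sum_levels sum_deg unfolding cost_def by (simp add: sum.distrib flip: sum_distrib_left)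
  have cost_mono: "cost v \<le> cost n" if "v \<le> n" for v
    unfolding cost_def using that by (intro sum_mono2) auto
  have less: "u < v + 1 \<longleftrightarrow> u < v \<or> u = v" for u v :: nat by auto
  have "wp (While (Var rv [<] Var rn)
       (get_deg ;;
        Cond (Var rd [<] Var rx)
          (Put 3 (Var rv) (Lit 1) ;; re ::= Var rx [-] Var rd [-] Lit 1 ;; rpp ::= Var rv [div] Lit 256 ;;
           While branch
             (rpp ::= child ;; Put 9 (counter_exp rv) (Var re [mod] Lit 2) ;; re ::= Var re [div] Lit 2))
          (insert_pending rv) ;;
        rv ::= Var rv [+] Lit 1)) Q (\<sigma>(rh := 0, rv := 0)) \<alpha> os (Suc (Suc t))"
  proof (rule wp_While_invariant[where J = J and T = "t + 2 + cost n"], goal_cases)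
    case 1
    have "pending 0 \<alpha> {}" using z by (simp add: pending_def bitset_empty)
    then show ?case using z by (auto simp: J_def intro!: frame_upd frame_refl)
  next
    case (2 \<sigma>1 \<alpha>1 os1 t1)
    then show ?case using cost_mono[of "\<sigma>1 rv"] by (auto simp: J_def)
  next
    case (3 \<sigma>1 \<alpha>1 os1 t1)
    then have J: "J \<sigma>1 \<alpha>1 os1 t1" by simp
    define v where "v = \<sigma>1 rv"
    define g where "g = v div 256"
    have f1: "frame ?R \<sigma> \<sigma>1" "frame ?K \<alpha> \<alpha>1" using J by (auto simp: J_def)
    have st1: "static \<sigma>1 \<alpha>1" by (rule static_frame[OF st f1(1) _ f1(2)]) auto
    note s1 = staticD[OF st1]
    have v: "\<sigma>1 rv = v" "v < n" using 3 s1(1) by (auto simp: v_def)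
    have g: "g < groups" using group_less[OF v(2)] by (simp add: g_def)
    have vw: "v + 1 < 2 ^ w" using v(2) nm by linarith
    have c1: "cost (v + 1) = cost v + (20 + 3 * deg v + 4 * level g)" by (simp add: cost_def g_def)
    have tJ: "t1 \<le> t + 2 + cost v" and os1: "os1 = os" using J v(1) by (simp_all add: J_def)
    show ?case
    proof (subst wp_Seq, rule wp_get_deg[where v = v], rule v(1), rule v(2))
      let ?\<sigma> = "\<sigma>1(rp := 0, rx := deg v)"
      let ?t = "Suc t1 + 3 + 3 * deg v"
      have fr: "frame ?R \<sigma> ?\<sigma>" using f1(1) by (intro frame_upd) auto
      have last: "wp (rv ::= Var rv [+] Lit 1) J \<sigma>2 \<alpha>2 os2 t2"
        if "J (\<sigma>2(rv := v + 1)) \<alpha>2 os2 (Suc t2)" "\<sigma>2 rv = v" for \<sigma>2 \<alpha>2 os2 t2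
        using that vw lits by (simp add: wp_simps)
      show "wp (Cond (Var rd [<] Var rx)
          (Put 3 (Var rv) (Lit 1) ;; re ::= Var rx [-] Var rd [-] Lit 1 ;; rpp ::= Var rv [div] Lit 256 ;;
           While branch
             (rpp ::= child ;; Put 9 (counter_exp rv) (Var re [mod] Lit 2) ;; re ::= Var re [div] Lit 2))
          (insert_pending rv) ;;
        rv ::= Var rv [+] Lit 1) J ?\<sigma> \<alpha>1 os1 ?t"
      proof (cases "d < deg v")
        case False
        have ins: "wp (insert_pending rv) (wp (rv ::= Var rv [+] Lit 1) J) ?\<sigma> \<alpha>1 os1 (Suc ?t)"
        proof (rule wp_insert_pending[where P = "{u. u < v \<and> deg u \<le> d}" and v = v])
          show "static ?\<sigma> \<alpha>1" using st1 by simp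
          show "pending (?\<sigma> rh) \<alpha>1 {u. u < v \<and> deg u \<le> d}" using J v(1) by (simp add: J_def)
          fix \<sigma>2 \<alpha>2 t2
          assume a: "frame {rf, rz, rb, rh} ?\<sigma> \<sigma>2" "frame {4, 5, 6} \<alpha>1 \<alpha>2"
            "pending (\<sigma>2 rh) \<alpha>2 (insert v {u. u < v \<and> deg u \<le> d})" "t2 \<le> Suc ?t + 10"
          have f2: "frame ?R \<sigma> \<sigma>2" by (rule frame_trans[OF fr frame_mono[OF a(1)]]) auto
          have f3: "frame ?K \<alpha> \<alpha>2" by (rule frame_trans[OF f1(2) frame_mono[OF a(2)]]) auto
          have e: "insert v {u. u < v \<and> deg u \<le> d} = {u. u < v + 1 \<and> deg u \<le> d}" using False less by auto
          have a3: "\<alpha>2 3 = \<alpha>1 3" "\<alpha>2 9 = \<alpha>1 9" using frameD[OF a(2)] by auto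
          have r: "\<sigma>2 rv = v" using frameD[OF a(1), of rv] v(1) by simp
          show "wp (rv ::= Var rv [+] Lit 1) J \<sigma>2 \<alpha>2 os1 t2"
          proof (rule last)
            show "\<sigma>2 rv = v" by (rule r)
            have "Suc t2 \<le> t + 2 + cost (v + 1)" using a(4) tJ c1 by linarith
            then show "J (\<sigma>2(rv := v + 1)) \<alpha>2 os1 (Suc t2)"
              using J a(3) a3 f2 f3 v False unfolding e by (auto simp: J_def less intro!: frame_upd)
          qed
        qed (use v in auto)
        show ?thesis using ins False s1 by (simp add: wp_simps)
      next
        case True
        define e where "e = deg v - d - 1"
        define \<alpha>2 where "\<alpha>2 = put \<alpha>1 3 v 1"
        define \<sigma>2 where "\<sigma>2 = ?\<sigma>(re := e, rpp := g)"
        \<comment> \<open>The level \<open>j\<close> is in no register; it is determined by the node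
          in \<open>rpp\<close>, hence the existential quantifier. Bits of \<open>e\<close> that are
          left when the leaf is reached are dropped.\<close>
        define K where "K = (\<lambda>\<sigma>3 \<alpha>3 os3 t3. \<exists>j. frame {re, rpp} \<sigma>2 \<sigma>3 \<and> frame {9} \<alpha>2 \<alpha>3 \<and> j \<le> level g \<and>
           \<sigma>3 rpp = pos j g \<and> \<sigma>3 re = e div 2 ^ j \<and> (\<forall>i<j. \<alpha>3 9 (counter_cell v i) = e div 2 ^ i mod 2) \<and>
           (\<forall>x. (\<forall>i<level g. x \<noteq> counter_cell v i) \<longrightarrow> \<alpha>3 9 x = \<alpha>1 9 x) \<and> os3 = os1 \<and> t3 \<le> ?t + 4 + 4 * j)"
        have st2: "static \<sigma>3 \<alpha>3" if "frame {re, rpp} \<sigma>2 \<sigma>3" "frame {9} \<alpha>2 \<alpha>3" for \<sigma>3 \<alpha>3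
          by (rule static_frame[OF _ that(1) _ that(2)]) (use st1 in \<open>auto simp: \<sigma>2_def \<alpha>2_def\<close>)
        have loop: "wp (While branch
             (rpp ::= child ;; Put 9 (counter_exp rv) (Var re [mod] Lit 2) ;; re ::= Var re [div] Lit 2))
             (wp (rv ::= Var rv [+] Lit 1) J) \<sigma>2 \<alpha>2 os1 (Suc (Suc (Suc (Suc ?t))))"
        proof (rule wp_While_invariant[where J = K and T = "?t + 4 + 4 * level g"], goal_cases)
          case 1
          show ?case unfolding K_def using g
            by (intro exI[of _ 0]) (auto simp: \<sigma>2_def \<alpha>2_def pos_0 intro!: frame_refl)
        next
          case (2 \<sigma>3 \<alpha>3 os3 t3)
          then obtain j where j: "frame {re, rpp} \<sigma>2 \<sigma>3" "frame {9} \<alpha>2 \<alpha>3" "j \<le> level g"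
            "\<sigma>3 rpp = pos j g" "t3 \<le> ?t + 4 + 4 * j" by (auto simp: K_def)
          from ev_branch(1)[OF st2[OF j(1,2)] j(4)] pos_less_num[OF g j(3)] j(3,5) show ?case by auto
        next
          case (3 \<sigma>3 \<alpha>3 os3 t3)
          then obtain j where j: "frame {re, rpp} \<sigma>2 \<sigma>3" "frame {9} \<alpha>2 \<alpha>3" "j \<le> level g"
            "\<sigma>3 rpp = pos j g" "t3 \<le> ?t + 4 + 4 * j" "\<sigma>3 re = e div 2 ^ j"
            "\<forall>i<j. \<alpha>3 9 (counter_cell v i) = e div 2 ^ i mod 2"
            "\<forall>x. (\<forall>i<level g. x \<noteq> counter_cell v i) \<longrightarrow> \<alpha>3 9 x = \<alpha>1 9 x" "os3 = os1"
            by (auto simp: K_def)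
          note st3 = st2[OF j(1,2)]
          have jl: "j < level g"
            using 3(2) ev_branch(2)[OF st3 j(4) pos_less_num[OF g j(3)]] parents_iff[OF g j(3)] by auto
          have rv3: "\<sigma>3 rv = v" using frameD[OF j(1), of rv] v(1) by (simp add: \<sigma>2_def)
          note ch = ev_child[OF st3 j(4) g jl]
          let ?\<sigma>4 = "\<sigma>3(rpp := pos (j + 1) g)"
          have st4: "static ?\<sigma>4 \<alpha>3" using st3 by simp
          note ce = ev_counter[where \<sigma> = ?\<sigma>4 and \<alpha> = \<alpha>3 and r = rv and u = v and j = j, folded g_def,
            OF st4 _ _ _ v(2) jl]
          have ce': "ok (counter_exp rv) ?\<sigma>4 \<alpha>3" "ev (counter_exp rv) ?\<sigma>4 \<alpha>3 = counter_cell v j" "counter_cell v j < len 9"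
            using ce rv3 by auto
          have inj: "i \<le> j \<Longrightarrow> counter_cell v i = counter_cell v j \<longleftrightarrow> i = j" for i
            using counter_cell_inject[of v i v j] v(2) jl by (simp add: g_def)
          have K4: "K (\<sigma>3(rpp := pos (j + 1) g, re := e div 2 ^ j div 2)) (put \<alpha>3 9 (counter_cell v j) (e div 2 ^ j mod 2)) os1
             (Suc (Suc (Suc (Suc t3))))"
            unfolding K_def using j jl inj
            by (intro exI[of _ "j + 1"])
               (auto simp: less power_add div_mult2_eq intro!: frame_upd frame_put)
          show ?case using ch ce' K4 lits j(6,9) staticD(5)[OF st4, of 9]
            by (simp add: wp_Seq wp_Asg wp_Put widths del: ok.simps(4) ev.simps(4))
               (simp add: wp_simps)
        next
          case (4 \<sigma>3 \<alpha>3 os3 t3)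
          then obtain j where j: "frame {re, rpp} \<sigma>2 \<sigma>3" "frame {9} \<alpha>2 \<alpha>3" "j \<le> level g"
            "\<sigma>3 rpp = pos j g" "t3 \<le> ?t + 4 + 4 * j"
            "\<forall>i<j. \<alpha>3 9 (counter_cell v i) = e div 2 ^ i mod 2"
            "\<forall>x. (\<forall>i<level g. x \<noteq> counter_cell v i) \<longrightarrow> \<alpha>3 9 x = \<alpha>1 9 x" "os3 = os1"
            by (auto simp: K_def)
          note st3 = st2[OF j(1,2)]
          have jl: "j = level g"
            using 4(2) ev_branch(2)[OF st3 j(4) pos_less_num[OF g j(3)]] parents_iff[OF g j(3)] j(3) by auto
          have f2: "frame ?R \<sigma> \<sigma>3"
            by (rule frame_trans[OF _ frame_mono[OF j(1)]]) (use fr in \<open>auto simp: \<sigma>2_def intro!: frame_upd\<close>)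
          have f3: "frame ?K \<alpha> \<alpha>3"
            by (rule frame_trans[OF _ frame_mono[OF j(2)]]) (use f1(2) in \<open>auto simp: \<alpha>2_def intro!: frame_put\<close>)
          have rv3: "\<sigma>3 rv = v" "\<sigma>3 rh = \<sigma>1 rh" using frameD[OF j(1), of rv] frameD[OF j(1), of rh] v(1) by (simp_all add: \<sigma>2_def)
          have a: "\<alpha>3 3 = (\<alpha>1 3)(v := 1)" "\<alpha>3 4 = \<alpha>1 4" "\<alpha>3 5 = \<alpha>1 5" "\<alpha>3 6 = \<alpha>1 6"
            using frameD[OF j(2)] by (auto simp: \<alpha>2_def)
          have p: "{u. u < v + 1 \<and> deg u \<le> d} = {u. u < v \<and> deg u \<le> d}" using True less by auto
          have pd: "pending (\<sigma>3 rh) \<alpha>3 {u. u < v + 1 \<and> deg u \<le> d}"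
            unfolding p using J v(1) pending_cong[OF a(2-4)] rv3 by (simp add: J_def)
          \<comment> \<open>Counters of different vertices share no cell, so those written earlier
            survive.\<close>
          have old: "\<alpha>3 9 (counter_cell u i) = \<alpha>1 9 (counter_cell u i)" if "u < v" "i < level (u div 256)" for u i
            using j(7) counter_cell_inject[of u i v] that v(2) by (force simp: g_def)
          have act: "\<forall>u<n. \<alpha>3 3 u = of_bool (u < v + 1 \<and> d < deg u)"
            using J True v(1) unfolding a by (auto simp: J_def less)
          have cnt: "\<forall>u<v + 1. d < deg u \<longrightarrow> (\<forall>j<level (u div 256). \<alpha>3 9 (counter_cell u j) = (deg u - d - 1) div 2 ^ j mod 2)"
            using J old j(6) v(1) unfolding jl by (auto simp: J_def less e_def g_def)
          have "Suc (Suc t3) \<le> t + 2 + cost (v + 1)" using j(5) tJ c1 unfolding jl by linarith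
          then show ?case
            using f2 f3 pd act cnt v(2) os1 j(8) rv3(1)
            by (intro last) (auto simp: J_def intro!: frame_upd)
        qed
        have dn: "deg v < 2 ^ w" using deg_le_n[of v] nm by linarith
        show ?thesis using loop True s1 v lits dn
          by (simp add: wp_Seq wp_Cond wp_Put wp_Asg lens widths \<sigma>2_def \<alpha>2_def e_def g_def)
      qed
    qed
  next
    case (4 \<sigma>1 \<alpha>1 os1 t1)
    have f1: "frame ?R \<sigma> \<sigma>1" "frame ?K \<alpha> \<alpha>1" using 4 by (auto simp: J_def)
    have "\<sigma>1 rn = n" using frameD[OF f1(1), of rn] staticD(1)[OF st] by auto
    then have v: "\<sigma>1 rv = n" and os: "os1 = os" using 4 by (auto simp: J_def split: if_splits)
    show ?case unfolding os
    proof (rule Q[OF f1])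
      show "Suc t1 \<le> t + 3 + 20 * n + 10 * m" using 4 v cost_n by (auto simp: J_def)
    qed (use 4 v in \<open>auto simp: J_def\<close>)
  qed
  then show ?thesis using lits by (simp add: init_state_def wp_simps)
qed

end

section \<open>Removing vertices\<close>

text \<open>Counts the neighbours that are active or pending. A pending vertex has not been output
  yet, so it still contributes to the current degree.\<close>

definition recount :: com where
  "recount = (
     rr ::= Lit 0 ;; rq ::= Inp (Lit 2 [+] Var ru) ;;
     walk rq
       (Cond (Get 3 (Inp (Var rq)) [+]
           (Get 4 (Inp (Var rq) [div] Var rs) [>>] (Inp (Var rq) [mod] Var rs)) [mod] Lit 2)
         (rr ::= Var rr [+] Lit 1) Skip))"

text \<open>Binary decrement from the lowest bit: every visited bit is flipped, and the borrow
  continues only past a 0. A borrow that remains at a leaf is the underflow; in a group without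
  levels this happens at every decrement, but there all degrees are below 1024.\<close>

definition borrow :: com where
  "borrow = (
     rpp ::= Var ru [div] Lit 256 ;; rbo ::= Lit 1 ;;
     While (Var rbo [*] branch)
       (rpp ::= child ;; rc ::= Get 9 (counter_exp ru) ;;
        Put 9 (counter_exp ru) (Lit 1 [-] Var rc) ;; rbo ::= Lit 1 [-] Var rc))"

definition touch :: com where
  "touch = (
     borrow ;;
     Cond (Var rbo)
       (recount ;; Cond (Var rd [<] Var rr) Skip (Put 3 (Var ru) (Lit 0) ;; insert_pending ru))
       Skip)"

definition peel_loop :: com where
  "peel_loop = (
     rcnt ::= Lit 0 ;;
     While (Var rh)
       (pop_pending ;; Out (Var rv) ;; rcnt ::= Var rcnt [+] Lit 1 ;;
        rp ::= Inp (Lit 2 [+] Var rv) ;;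
        walk rp (ru ::= Inp (Var rp) ;; Cond (Get 3 (Var ru)) touch Skip)) ;;
     res ::= (Var rcnt [=] Var rn))"

lemma sum_update:
  fixes f :: "nat \<Rightarrow> nat"
  assumes "finite A" "j \<in> A"
  shows "(\<Sum>i\<in>A. if i = j then x else f i) + f j = (\<Sum>i\<in>A. f i) + x"
proof -
  have "(\<Sum>i\<in>A. if i = j then x else f i) = x + (\<Sum>i\<in>A - {j}. f i)"
    by (subst sum.remove[OF assms]) (auto intro: sum.cong)
  moreover have "(\<Sum>i\<in>A. f i) = f j + (\<Sum>i\<in>A - {j}. f i)" by (rule sum.remove[OF assms])
  ultimately show ?thesis by simp
qed

lemma sum_bits: "(\<Sum>j<k. x div 2 ^ j mod 2 * 2 ^ j) = x mod 2 ^ k" for x k :: nat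
proof (induction k)
  case (Suc k)
  have "x mod (2 ^ k * 2) = 2 ^ k * (x div 2 ^ k mod 2) + x mod 2 ^ k" by (rule mod_mult2_eq)
  then show ?case using Suc by (simp add: algebra_simps)
qed simp

lemma sum_bits_less: "(\<And>j. j < k \<Longrightarrow> f j \<le> 1) \<Longrightarrow> (\<Sum>j<k. f j * 2 ^ j) < (2 :: nat) ^ k"
proof (induction k)
  case (Suc k)
  have "f k * 2 ^ k \<le> 1 * 2 ^ k" using Suc.prems[of k] by (intro mult_right_mono) auto
  moreover have "(\<Sum>j<k. f j * 2 ^ j) < 2 ^ k" using Suc by simp
  ultimately show ?case unfolding sum.lessThan_Suc power_Suc by linarith
qed simp

context main_run
begin

section \<open>Counter values and their potential\<close>

definition lv :: "nat \<Rightarrow> nat" where "lv u = level (u div 256)"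

definition counter :: "(nat \<Rightarrow> nat \<Rightarrow> nat) \<Rightarrow> nat \<Rightarrow> nat" where
  "counter \<alpha> u = (\<Sum>j<lv u. \<alpha> 9 (counter_cell u j) * 2 ^ j)"

definition binary :: "(nat \<Rightarrow> nat \<Rightarrow> nat) \<Rightarrow> nat \<Rightarrow> bool" where
  "binary \<alpha> u \<longleftrightarrow> (\<forall>j<lv u. \<alpha> 9 (counter_cell u j) \<le> 1)"

text \<open>The summand \<open>1\<close> pays for flipping a bit, the summand \<open>1024 * 2 ^ j\<close> for the recount that follows
  a borrow out of the highest bit.\<close>

definition vertex_potential :: "(nat \<Rightarrow> nat \<Rightarrow> nat) \<Rightarrow> nat \<Rightarrow> nat" where
  "vertex_potential \<alpha> u = (\<Sum>j<lv u. (1 - \<alpha> 9 (counter_cell u j)) * (1024 * 2 ^ j + 1))"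

definition potential :: "(nat \<Rightarrow> nat \<Rightarrow> nat) \<Rightarrow> nat" where
  "potential \<alpha> = (\<Sum>u<n. vertex_potential \<alpha> u)"

lemma counter_less: "binary \<alpha> u \<Longrightarrow> counter \<alpha> u < 2 ^ lv u"
  unfolding counter_def binary_def by (rule sum_bits_less) auto

text \<open>Each vertex has potential at most three times the degree sum of its group. With at most
  256 vertices in a group and degree sums adding up to \<open>2 * m\<close>, the total is
  \<open>3 * 256 * 2 * m\<close>.\<close>

lemma potential_bound: "potential \<alpha> \<le> 1536 * m"
proof -
  have "vertex_potential \<alpha> u \<le> 3 * group_deg (u div 256)" for u
  proof -
    define y where "y = group_deg (u div 256) div 1024"
    have geo: "(\<Sum>j<k. 1024 * 2 ^ j + 1) + 1024 = 1024 * 2 ^ k + k" for k :: nat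
      by (induction k) auto
    have "vertex_potential \<alpha> u \<le> (\<Sum>j<lv u. 1 * (1024 * 2 ^ j + 1))"
      unfolding vertex_potential_def by (intro sum_mono mult_right_mono) auto
    \<comment> \<open>A geometric series together with \<open>2 ^ lv u <= 2 * y\<close>. That
      estimate fails for \<open>y = 0\<close>, where the sum is empty.\<close>
    also have "\<dots> \<le> 2048 * y + y"
    proof (cases "y = 0")
      case True
      then have "lv u = 0" by (simp add: lv_def level_def y_def[symmetric] bit_length_0)
      then show ?thesis by simp
    next
      case False
      have "2 ^ (bit_length y - 1) \<le> y" by (rule bit_top(2)[OF False])
      moreover have "0 < bit_length y" using bit_length_0[of y] False by simp
      then have "2 * 2 ^ (bit_length y - 1) = (2::nat) ^ bit_length y" by (metis Suc_diff_1 power_Suc)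
      ultimately have "2 ^ lv u \<le> 2 * y" by (simp add: lv_def level_def y_def[symmetric])
      moreover have "lv u \<le> y" using bit_length_less(2)[of y] by (simp add: lv_def level_def y_def[symmetric])
      ultimately show ?thesis using geo[of "lv u"] by simp
    qed
    also have "\<dots> \<le> 3 * group_deg (u div 256)"
    proof -
      have "1024 * y \<le> group_deg (u div 256)" by (simp add: y_def)
      then show ?thesis by linarith
    qed
    finally show ?thesis .
  qed
  then have "potential \<alpha> \<le> (\<Sum>u<n. 3 * group_deg (u div 256))" unfolding potential_def by (intro sum_mono)
  also have "\<dots> \<le> 256 * (\<Sum>g<groups. 3 * group_deg g)" by (rule sum_groups)
  also have "\<dots> = 1536 * m" by (simp add: sum_group_deg flip: sum_distrib_left)
  finally show ?thesis .
qed

text \<open>Old and new contributions of bit \<open>j\<close> stand on opposite sides, so that no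
  truncated subtraction appears.\<close>

lemma counter_update:
  fixes \<alpha> :: "nat \<Rightarrow> nat \<Rightarrow> nat" and b :: nat
  assumes "u < n" "j < lv u"
  defines "\<alpha>' \<equiv> put \<alpha> 9 (counter_cell u j) b"
  shows "counter \<alpha>' u + \<alpha> 9 (counter_cell u j) * 2 ^ j = counter \<alpha> u + b * 2 ^ j"
    and "vertex_potential \<alpha>' u + (1 - \<alpha> 9 (counter_cell u j)) * (1024 * 2 ^ j + 1) =
      vertex_potential \<alpha> u + (1 - b) * (1024 * 2 ^ j + 1)"
    and "binary \<alpha> u \<Longrightarrow> b \<le> 1 \<Longrightarrow> binary \<alpha>' u"
proof -
  have e: "\<alpha>' 9 (counter_cell u i) = (if i = j then b else \<alpha> 9 (counter_cell u i))" if "i < lv u" for i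
    using counter_cell_inject[of u i u j] assms(1,2) that by (auto simp: \<alpha>'_def lv_def)
  show "counter \<alpha>' u + \<alpha> 9 (counter_cell u j) * 2 ^ j = counter \<alpha> u + b * 2 ^ j"
    using sum_update[of "{..<lv u}" j "b * 2 ^ j" "\<lambda>i. \<alpha> 9 (counter_cell u i) * 2 ^ i"] assms(2) e
    unfolding counter_def by (simp add: if_distrib[of "\<lambda>x. x * _"] cong: if_cong)
  show "vertex_potential \<alpha>' u + (1 - \<alpha> 9 (counter_cell u j)) * (1024 * 2 ^ j + 1) =
      vertex_potential \<alpha> u + (1 - b) * (1024 * 2 ^ j + 1)"
  proof -
    have "vertex_potential \<alpha>' u = (\<Sum>i<lv u. if i = j then (1 - b) * (1024 * 2 ^ j + 1) else (1 - \<alpha> 9 (counter_cell u i)) * (1024 * 2 ^ i + 1))"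
      unfolding vertex_potential_def by (intro sum.cong) (auto simp: e)
    then show ?thesis
      using sum_update[of "{..<lv u}" j "(1 - b) * (1024 * 2 ^ j + 1)" "\<lambda>i. (1 - \<alpha> 9 (counter_cell u i)) * (1024 * 2 ^ i + 1)"] assms(2)
      unfolding vertex_potential_def by simp
  qed
  show "binary \<alpha> u \<Longrightarrow> b \<le> 1 \<Longrightarrow> binary \<alpha>' u" by (auto simp: binary_def e)
qed

definition same_others :: "nat \<Rightarrow> (nat \<Rightarrow> nat \<Rightarrow> nat) \<Rightarrow> (nat \<Rightarrow> nat \<Rightarrow> nat) \<Rightarrow> bool" where
  "same_others u \<alpha> \<alpha>' \<longleftrightarrow> (\<forall>x. (\<forall>i<lv u. x \<noteq> counter_cell u i) \<longrightarrow> \<alpha>' 9 x = \<alpha> 9 x)"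

lemma same_others:
  assumes "same_others u \<alpha> \<alpha>'" "u < n" "u' < n" "u' \<noteq> u"
  shows "counter \<alpha>' u' = counter \<alpha> u'" "binary \<alpha>' u' = binary \<alpha> u'"
    "vertex_potential \<alpha>' u' = vertex_potential \<alpha> u'"
proof -
  have "\<alpha>' 9 (counter_cell u' j) = \<alpha> 9 (counter_cell u' j)" if "j < lv u'" for j
    using assms counter_cell_inject[of u' j u] that by (auto simp: same_others_def lv_def)
  then show "counter \<alpha>' u' = counter \<alpha> u'" "binary \<alpha>' u' = binary \<alpha> u'"
    "vertex_potential \<alpha>' u' = vertex_potential \<alpha> u'"
    by (auto simp: counter_def binary_def vertex_potential_def)
qed

lemma potential_change:
  assumes "same_others u \<alpha> \<alpha>'" "u < n"
  shows "potential \<alpha>' + vertex_potential \<alpha> u = potential \<alpha> + vertex_potential \<alpha>' u"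
proof -
  have "potential \<alpha>' = (\<Sum>v<n. if v = u then vertex_potential \<alpha>' u else vertex_potential \<alpha> v)"
    unfolding potential_def using same_others(3)[OF assms(1,2)] by (intro sum.cong) auto
  then show ?thesis
    using sum_update[of "{..<n}" u "vertex_potential \<alpha>' u" "vertex_potential \<alpha>"] assms(2)
    unfolding potential_def by simp
qed

text \<open>Every 0 that becomes 1 releases its potential, and the single 1 that becomes 0 consumes
  \<open>1024 * 2 ^ j + 1\<close>. Since the earlier releases add up to
  \<open>1024 * (2 ^ j - 1) + j\<close>, a decrement costs an amortised constant; an underflow
  leaves about \<open>1024 * 2 ^ lv u\<close> units for the recount. The factor 5 is the number of
  ticks per round.\<close>

lemma wp_borrow:
  assumes st: "static \<sigma> \<alpha>" and u: "\<sigma> ru = u" "u < n" and bin: "binary \<alpha> u"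
    and Q: "\<And>\<sigma>' \<alpha>' t'. frame {rpp, rbo, rc} \<sigma> \<sigma>' \<Longrightarrow> frame {9} \<alpha> \<alpha>' \<Longrightarrow> same_others u \<alpha> \<alpha>' \<Longrightarrow>
      binary \<alpha>' u \<Longrightarrow> \<sigma>' rbo \<le> 1 \<Longrightarrow> counter \<alpha>' u + 1 = counter \<alpha> u + \<sigma>' rbo * 2 ^ lv u \<Longrightarrow>
      t' + 5 * (vertex_potential \<alpha>' u + 1024 * (\<sigma>' rbo * 2 ^ lv u)) \<le> t + 5 * vertex_potential \<alpha> u + 5200 \<Longrightarrow>
      Q \<sigma>' \<alpha>' os t'"
  shows "wp borrow Q \<sigma> \<alpha> os t"
proof -
  define g where "g = u div 256"
  have g: "g < groups" using group_less[OF u(2)] by (simp add: g_def)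
  have lg: "lv u = level g" by (simp add: lv_def g_def)
  \<comment> \<open>The unfinished borrow at level \<open>j\<close> carries a credit of
    \<open>1024 * 2 ^ j + 2\<close>. At level 0 this is the constant 1026 on the right.\<close>
  define K where "K = (\<lambda>\<sigma>' \<alpha>' os' t'. \<exists>j. frame {rpp, rbo, rc} \<sigma> \<sigma>' \<and> frame {9} \<alpha> \<alpha>' \<and> same_others u \<alpha> \<alpha>' \<and>
     binary \<alpha>' u \<and> \<sigma>' rbo \<le> 1 \<and> j \<le> lv u \<and> \<sigma>' rpp = pos j g \<and> counter \<alpha>' u + 1 = counter \<alpha> u + \<sigma>' rbo * 2 ^ j \<and>
     vertex_potential \<alpha>' u + 1024 * (\<sigma>' rbo * 2 ^ j) + j + 2 * \<sigma>' rbo \<le> vertex_potential \<alpha> u + 1026 \<and>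
     os' = os \<and> t' \<le> t + 2 + 5 * j)"
  have st': "static \<sigma>' \<alpha>'" if "frame {rpp, rbo, rc} \<sigma> \<sigma>'" "frame {9} \<alpha> \<alpha>'" for \<sigma>' \<alpha>'
    by (rule static_frame[OF st that(1) _ that(2)]) auto
  have "wp (While (Var rbo [*] branch)
       (rpp ::= child ;; rc ::= Get 9 (counter_exp ru) ;;
        Put 9 (counter_exp ru) (Lit 1 [-] Var rc) ;; rbo ::= Lit 1 [-] Var rc))
       Q (\<sigma>(rpp := g, rbo := 1)) \<alpha> os (Suc (Suc t))"
  proof (rule wp_While_invariant[where J = K and T = "t + 2 + 5 * lv u"], goal_cases)
    case 1
    show ?case unfolding K_def using g bin
      by (intro exI[of _ 0]) (auto simp: pos_0 same_others_def intro!: frame_upd frame_refl)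
  next
    case (2 \<sigma>' \<alpha>' os' t')
    then obtain j where j: "frame {rpp, rbo, rc} \<sigma> \<sigma>'" "frame {9} \<alpha> \<alpha>'" "j \<le> lv u" "\<sigma>' rpp = pos j g" "\<sigma>' rbo \<le> 1"
      "t' \<le> t + 2 + 5 * j" by (auto simp: K_def)
    have p: "pos j g < num_nodes" using pos_less_num[OF g] j(3) lg by simp
    note b = ev_branch[OF st'[OF j(1,2)] j(4) p]
    have "\<sigma>' rbo * of_bool (pos j g \<in> parents) \<le> 1" using j(5) by simp
    then have "\<sigma>' rbo * of_bool (pos j g \<in> parents) < 2 ^ w" using lits(1) by linarith
    then show ?case using b j(3,6) by (simp del: ok.simps(4) ev.simps(4) add: ok.simps(4)[of Mul] ev.simps(4)[of Mul])
  next
    case (3 \<sigma>' \<alpha>' os' t')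
    then obtain j where j: "frame {rpp, rbo, rc} \<sigma> \<sigma>'" "frame {9} \<alpha> \<alpha>'" "same_others u \<alpha> \<alpha>'"
     "binary \<alpha>' u" "\<sigma>' rbo \<le> 1" "j \<le> lv u" "\<sigma>' rpp = pos j g" "counter \<alpha>' u + 1 = counter \<alpha> u + \<sigma>' rbo * 2 ^ j"
     "vertex_potential \<alpha>' u + 1024 * (\<sigma>' rbo * 2 ^ j) + j + 2 * \<sigma>' rbo \<le> vertex_potential \<alpha> u + 1026"
     "os' = os" "t' \<le> t + 2 + 5 * j" by (auto simp: K_def)
    have p: "pos j g < num_nodes" using pos_less_num[OF g] j(6) lg by simp
    note s' = st'[OF j(1,2)]
    note b = ev_branch[OF s' j(7) p]
    have "ev (Var rbo [*] branch) \<sigma>' \<alpha>' = \<sigma>' rbo * of_bool (pos j g \<in> parents)"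
      using b(2) by (simp only: ev.simps(4)[of Mul] ev.simps(1) exact.simps)
    then have bo: "\<sigma>' rbo = 1" and "pos j g \<in> parents" using 3(2) j(5) by auto
    then have jl: "j < level g" "j < lv u" using parents_iff[OF g, of j] j(6) lg by auto
    note ch = ev_child[OF s' j(7) g jl(1)]
    define c where "c = \<alpha>' 9 (counter_cell u j)"
    have c: "c \<le> 1" using j(4) jl by (simp add: binary_def c_def)
    let ?\<sigma>1 = "\<sigma>'(rpp := pos (j + 1) g)"
    let ?\<sigma>2 = "\<sigma>'(rpp := pos (j + 1) g, rc := c)"
    have ru': "\<sigma>' ru = u" using frameD[OF j(1), of ru] u(1) by simp
    have s1: "static ?\<sigma>1 \<alpha>'" "static ?\<sigma>2 \<alpha>'" using s' by simp_all
    have ce: "ok (counter_exp ru) \<tau> \<alpha>'" "ev (counter_exp ru) \<tau> \<alpha>' = counter_cell u j" "counter_cell u j < len 9"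
      if "\<tau> \<in> {?\<sigma>1, ?\<sigma>2}" for \<tau>
      using ev_counter[of \<tau> \<alpha>' j u ru] that s1 ru' u(2) jl by (auto simp: g_def)
    define \<alpha>2 where "\<alpha>2 = put \<alpha>' 9 (counter_cell u j) (1 - c)"
    note up = counter_update[OF u(2) jl(2), of \<alpha>' "1 - c", folded \<alpha>2_def c_def]
    have so: "same_others u \<alpha> \<alpha>2" using j(3) jl by (auto simp: same_others_def \<alpha>2_def)
    have cnt: "counter \<alpha>2 u + 1 = counter \<alpha> u + (1 - c) * 2 ^ (j + 1)"
    proof (cases "c = 0")
      case True
      then show ?thesis using up(1) j(8) bo by (simp add: power_add)
    next
      case False
      then have "c = 1" using c by simp
      then show ?thesis using up(1) j(8) bo by simp
    qed
    \<comment> \<open>In both cases the changes balance exactly: a 0 doubles the credit of the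
      borrow using the released potential, and a 1 turns the credit into potential of the new
      0.\<close>
    have pot: "vertex_potential \<alpha>2 u + 1024 * ((1 - c) * 2 ^ (j + 1)) + (j + 1) + 2 * (1 - c) \<le> vertex_potential \<alpha> u + 1026"
    proof (cases "c = 0")
      case True
      then show ?thesis using up(2) j(9) bo by (simp add: power_add)
    next
      case False
      then have "c = 1" using c by simp
      then show ?thesis using up(2) j(9) bo by simp
    qed
    have K2: "K (\<sigma>'(rpp := pos (j + 1) g, rc := c, rbo := 1 - c)) \<alpha>2 os (Suc (Suc (Suc (Suc (Suc t')))))"
      unfolding K_def using j jl so cnt pot up(3)
      by (intro exI[of _ "j + 1"]) (auto simp: \<alpha>2_def intro!: frame_upd frame_put)
    have ce': "ok (counter_exp ru) ?\<sigma>1 \<alpha>'" "ev (counter_exp ru) ?\<sigma>1 \<alpha>' = counter_cell u j"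
      "ok (counter_exp ru) ?\<sigma>2 \<alpha>'" "ev (counter_exp ru) ?\<sigma>2 \<alpha>' = counter_cell u j" "counter_cell u j < len 9"
      by (rule ce; blast)+
    show ?case
      using K2 ch ce' c staticD(5)[OF s1(2), of 9] staticD(5)[OF s1(1), of 9] lits j(10)
      by (simp add: wp_Seq wp_Asg wp_Put widths c_def[symmetric] \<alpha>2_def del: ok.simps(4) ev.simps(4))
         (simp add: \<alpha>2_def)
  next
    case (4 \<sigma>' \<alpha>' os' t')
    then obtain j where j: "frame {rpp, rbo, rc} \<sigma> \<sigma>'" "frame {9} \<alpha> \<alpha>'" "same_others u \<alpha> \<alpha>'"
     "binary \<alpha>' u" "\<sigma>' rbo \<le> 1" "j \<le> lv u" "\<sigma>' rpp = pos j g" "counter \<alpha>' u + 1 = counter \<alpha> u + \<sigma>' rbo * 2 ^ j"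
     "vertex_potential \<alpha>' u + 1024 * (\<sigma>' rbo * 2 ^ j) + j + 2 * \<sigma>' rbo \<le> vertex_potential \<alpha> u + 1026"
     "os' = os" "t' \<le> t + 2 + 5 * j" by (auto simp: K_def)
    have p: "pos j g < num_nodes" using pos_less_num[OF g] j(6) lg by simp
    note b = ev_branch[OF st'[OF j(1,2)] j(7) p]
    have "ev (Var rbo [*] branch) \<sigma>' \<alpha>' = \<sigma>' rbo * of_bool (pos j g \<in> parents)"
      using b(2) by (simp only: ev.simps(4)[of Mul] ev.simps(1) exact.simps)
    then have "\<sigma>' rbo = 0 \<or> pos j g \<notin> parents" using 4(2) by auto
    \<comment> \<open>Either the borrow is gone and both sides vanish, or the node is a leaf and
      \<open>j\<close> is the full counter length.\<close>
    then have e: "\<sigma>' rbo * 2 ^ j = \<sigma>' rbo * 2 ^ lv u"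
      using parents_iff[OF g, of j] j(6) lg by auto
    show ?case unfolding j(10)
    proof (rule Q[OF j(1-5)])
      show "counter \<alpha>' u + 1 = counter \<alpha> u + \<sigma>' rbo * 2 ^ lv u" using j(8) e by simp
      show "Suc t' + 5 * (vertex_potential \<alpha>' u + 1024 * (\<sigma>' rbo * 2 ^ lv u)) \<le> t + 5 * vertex_potential \<alpha> u + 5200"
      proof -
        define B where "B = \<sigma>' rbo * 2 ^ lv u"
        show ?thesis using j(9,11) unfolding e B_def[symmetric] distrib_left by linarith
      qed
    qed
  qed
  then show ?thesis using u lits g_def by (simp add: borrow_def wp_simps)
qed

lemma wp_recount:
  assumes st: "static \<sigma> \<alpha>" and u: "\<sigma> ru = u" "u < n" and P: "pending h \<alpha> P"
    and act: "\<And>u. u < n \<Longrightarrow> \<alpha> 3 u = of_bool (u \<in> Act)"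
    and Q: "\<And>t'. t' \<le> t + 3 + 4 * deg u \<Longrightarrow> Q (\<sigma>(rr := card {x \<in> neighbours E u. x \<in> Act \<or> x \<in> P}, rq := 0)) \<alpha> os t'"
  shows "wp recount Q \<sigma> \<alpha> os t"
proof -
  let ?S = "\<lambda>x. x \<in> Act \<or> x \<in> P"
  have I2: "2 + u < length I" "2 + u < 2 ^ w" using u(2) header length_I by linarith+
  define J where "J = (\<lambda>qs \<sigma>' \<alpha>' os' t'. \<exists>ps p. A u = ps @ qs \<and> \<alpha>' = \<alpha> \<and> os' = os \<and>
     \<sigma>' = \<sigma>(rr := length (filter (\<lambda>p. ?S (I ! p)) ps), rq := p) \<and> t' + 4 * length qs \<le> t + 2 + 4 * deg u)"
  have B4: "bitset 4 (n div sz) \<alpha> P" using P by (simp add: pending_def)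
  have "wp (walk rq
       (Cond (Get 3 (Inp (Var rq)) [+]
           (Get 4 (Inp (Var rq) [div] Var rs) [>>] (Inp (Var rq) [mod] Var rs)) [mod] Lit 2)
         (rr ::= Var rr [+] Lit 1) Skip)) Q (\<sigma>(rr := 0, rq := I ! (2 + u))) \<alpha> os (Suc (Suc t))"
  proof (rule wp_walk[where J = J and ps = "A u"], goal_cases)
    case 1
    show ?case unfolding J_def using length_A[OF u(2)]
      by (intro exI[of _ "[]"] exI[of _ "I ! (2 + u)"]) auto
  next
    case 2
    show ?case using list_A[OF u(2)] by simp
  next
    case 3
    show ?case by simp
  next
    case (4 q qs \<sigma>' \<alpha>' os' t')
    then obtain ps where ps: "A u = ps @ q # qs" "\<alpha>' = \<alpha>" "os' = os"
     "\<sigma>' = \<sigma>(rr := length (filter (\<lambda>p. ?S (I ! p)) ps), rq := q)" "t' + 4 * length (q # qs) \<le> t + 2 + 4 * deg u"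
      by (auto simp: J_def)
    have x: "I ! q < n" using vertex_A[OF u(2) 4(4)] .
    have l: "I ! q < len 3" "I ! q div sz < len 4" using x by (auto simp: lens intro!: div_le_mono le_imp_less_Suc simp flip: Suc_eq_plus1)
    have d: "I ! q div sz \<le> n div sz" using x by (intro div_le_mono) simp
    note tst = bitset_test[OF B4 d] act[OF x]
    have s': "static \<sigma>' \<alpha>" using st unfolding ps(4) by simp
    note sd = staticD(1-4)[OF s'] staticD(5)[OF s', of 3] staticD(5)[OF s', of 4]
    have "length (filter (\<lambda>p. ?S (I ! p)) ps) \<le> n"
      using card_filter_A(1)[OF u(2) ps(1), of ?S] deg_le_n[of u] by linarith
    then have rw: "\<sigma>' rr + 1 < 2 ^ w" using nm ps(4) by simp
    have "of_bool (I ! q \<in> Act) + of_bool (I ! q \<in> P) \<le> (2::nat)" by simp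
    then have ow: "of_bool (I ! q \<in> Act) + of_bool (I ! q \<in> P) < (2::nat) ^ w" using lits(2) by linarith
    have r: "\<sigma>' rq = q" by (simp add: ps(4))
    let ?\<tau> = "if ?S (I ! q) then \<sigma>'(rr := \<sigma>' rr + 1) else \<sigma>'"
    have J1: "J qs (?\<tau>(rq := I ! (q + 1))) \<alpha> os t1" if "t1 \<le> t' + 4" for t1
      unfolding J_def using ps that
      by (intro exI[of _ "ps @ [q]"] exI[of _ "I ! (q + 1)"]) (auto simp: fun_eq_iff)
    have c: "(of_bool (I ! q \<in> Act) + of_bool (I ! q \<in> P) :: nat) = 0 \<longleftrightarrow> \<not> ?S (I ! q)" by simp
    show ?case
      using J1 sd tst l rw r ow lits 4(3) c
      by (auto simp: wp_simps ps(2,3) split: if_splits)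
  next
    case (5 \<sigma>' \<alpha>' os' t')
    then have "\<sigma>' = \<sigma>(rr := card {x \<in> neighbours E u. ?S x}, rq := 0)" "\<alpha>' = \<alpha>" "os' = os" "Suc t' \<le> t + 3 + 4 * deg u"
      using card_filter_A(2)[OF u(2), of "A u" "[]" ?S] by (auto simp: J_def)
    then show ?case using Q by simp
  qed
  then show ?thesis using u(1) I2 lits by (simp add: recount_def wp_simps)
qed

end

section \<open>The invariant of the removal phase\<close>

context main_run
begin

text \<open>The degrees \<open>\<rho>\<close> of active vertices are a parameter and need not be the
  true current degrees: while the list of a removed vertex is walked, the counters of neighbours not
  visited yet lag behind by one. Pending vertices satisfy the bound with respect to the true output,
  so they may be removed at any time.\<close>

definition invariant ::
  "(nat \<Rightarrow> nat) \<Rightarrow> (nat \<Rightarrow> nat) \<Rightarrow> (nat \<Rightarrow> nat \<Rightarrow> nat) \<Rightarrow> nat list \<Rightarrow> nat set \<Rightarrow> nat set \<Rightarrow> bool" where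
  "invariant \<rho> \<sigma> \<alpha> os P Act \<longleftrightarrow> static \<sigma> \<alpha> \<and> pending (\<sigma> rh) \<alpha> P \<and> (\<forall>u<n. \<alpha> 3 u = of_bool (u \<in> Act)) \<and>
     {..<n} = Act \<union> P \<union> set os \<and> Act \<inter> P = {} \<and> Act \<inter> set os = {} \<and> P \<inter> set os = {} \<and>
     peel d {..<n} E os \<and> \<sigma> rcnt = length os \<and> (\<forall>u\<in>P. card (neighbours E u - set os) \<le> d) \<and>
     (\<forall>u\<in>Act. d < \<rho> u \<and> binary \<alpha> u \<and> counter \<alpha> u = (\<rho> u - d - 1) mod 2 ^ lv u)"

lemma counter_cong:
  assumes "\<alpha>' 9 = \<alpha> 9"
  shows "counter \<alpha>' = counter \<alpha>" "binary \<alpha>' = binary \<alpha>" "vertex_potential \<alpha>' = vertex_potential \<alpha>"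
    "potential \<alpha>' = potential \<alpha>"
proof -
  show e: "counter \<alpha>' = counter \<alpha>" "binary \<alpha>' = binary \<alpha>" "vertex_potential \<alpha>' = vertex_potential \<alpha>"
    using assms by (auto simp: fun_eq_iff counter_def binary_def vertex_potential_def)
  show "potential \<alpha>' = potential \<alpha>" by (simp add: potential_def e)
qed

text \<open>The counter knows only a residue. Without a borrow the residue was positive, so the true
  value was positive as well and its predecessor is represented. A borrow alone decides nothing;
  only if the true value is known to be positive is the wrapped residue again correct.\<close>

lemma pred_mod:
  fixes a c c' k :: nat
  assumes "c = a mod 2 ^ k" "c' + 1 = c + r * 2 ^ k" "c' < 2 ^ k" "r \<le> 1"
  shows "r = 0 \<Longrightarrow> 0 < a \<and> c' = (a - 1) mod 2 ^ k" and "r = 1 \<Longrightarrow> 0 < a \<Longrightarrow> c' = (a - 1) mod 2 ^ k"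
proof -
  have c: "c < 2 ^ k" using assms(1) by simp
  have a: "a = a div 2 ^ k * 2 ^ k + c" using assms(1) by (simp add: div_mult_mod_eq)
  show "0 < a \<and> c' = (a - 1) mod 2 ^ k" if "r = 0"
  proof -
    have "c = c' + 1" using assms(2) that by simp
    then have "a - 1 = a div 2 ^ k * 2 ^ k + c'" "0 < a" using a by linarith+
    then show ?thesis using assms(3) by simp
  qed
  show "c' = (a - 1) mod 2 ^ k" if "r = 1" "0 < a"
  proof -
    have c': "c = 0" "c' + 1 = 2 ^ k" using assms(2,3) that(1) by auto
    then have a': "a = a div 2 ^ k * 2 ^ k" using a by simp
    have "a div 2 ^ k \<noteq> 0" using a' that(2) by (metis mult_zero_left less_irrefl)
    then obtain q where "a div 2 ^ k = q + 1" by (metis Suc_eq_plus1 not0_implies_Suc)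
    then have "a - 1 = q * 2 ^ k + c'" using a' c'(2) by (simp add: algebra_simps)
    then show ?thesis using assms(3) by simp
  qed
qed

text \<open>An underflow may be spurious, as higher bits are not stored; the recount finds the true
  degree \<open>\<rho> u - 1\<close> and decides whether \<open>u\<close> becomes pending.
  Conversely, when the degree reaches \<open>d\<close> the stored residue is 0, so this moment is
  never missed.\<close>

lemma wp_touch:
  assumes inv: "invariant \<rho> \<sigma> \<alpha> os P Act" and u: "\<sigma> ru = u" "u \<in> Act"
    and rem: "card (neighbours E u - set os) = \<rho> u - 1"
    and Q: "\<And>\<sigma>' \<alpha>' t' P' Act'. invariant (\<rho>(u := \<rho> u - 1)) \<sigma>' \<alpha>' os P' Act' \<Longrightarrow>
      frame {rpp, rbo, rc, rr, rq, rf, rz, rb, rh} \<sigma> \<sigma>' \<Longrightarrow>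
      t' + 5 * potential \<alpha>' \<le> t + 5 * potential \<alpha> + 5230 \<Longrightarrow> Q \<sigma>' \<alpha>' os t'"
  shows "wp touch Q \<sigma> \<alpha> os t"
proof -
  let ?R = "{rpp, rbo, rc, rr, rq, rf, rz, rb, rh}"
  have sub_eq: "\<rho> u - d - 1 - 1 = \<rho> u - 1 - d - 1" by simp
  have un: "u < n" using inv u(2) by (auto simp: invariant_def)
  have st: "static \<sigma> \<alpha>" and bin: "binary \<alpha> u" and rho: "d < \<rho> u"
    and cnt: "counter \<alpha> u = (\<rho> u - d - 1) mod 2 ^ lv u"
    using inv u(2) by (auto simp: invariant_def)
  show ?thesis unfolding touch_def wp_Seq[of borrow]
  proof (rule wp_borrow[OF st u(1) un bin])
    fix \<sigma>1 \<alpha>1 t1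
    assume f: "frame {rpp, rbo, rc} \<sigma> \<sigma>1" "frame {9} \<alpha> \<alpha>1" and so: "same_others u \<alpha> \<alpha>1"
      and bin1: "binary \<alpha>1 u" and bo: "\<sigma>1 rbo \<le> 1"
      and cnt1: "counter \<alpha>1 u + 1 = counter \<alpha> u + \<sigma>1 rbo * 2 ^ lv u"
      and t1: "t1 + 5 * (vertex_potential \<alpha>1 u + 1024 * (\<sigma>1 rbo * 2 ^ lv u)) \<le> t + 5 * vertex_potential \<alpha> u + 5200"
    have st1: "static \<sigma>1 \<alpha>1" by (rule static_frame[OF st f(1) _ f(2)]) auto
    have a: "\<alpha>1 3 = \<alpha> 3" "\<alpha>1 4 = \<alpha> 4" "\<alpha>1 5 = \<alpha> 5" "\<alpha>1 6 = \<alpha> 6" using frameD[OF f(2)] by auto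
    have r1: "\<sigma>1 rh = \<sigma> rh" "\<sigma>1 rcnt = \<sigma> rcnt" "\<sigma>1 ru = u" using frameD[OF f(1)] u(1) by auto
    have pd: "pending (\<sigma>1 rh) \<alpha>1 P" using inv pending_cong[OF a(2-4)] r1 by (simp add: invariant_def)
    have pot: "potential \<alpha>1 + vertex_potential \<alpha> u = potential \<alpha> + vertex_potential \<alpha>1 u"
      by (rule potential_change[OF so un])
    have f': "frame ?R \<sigma> \<sigma>1" by (rule frame_mono[OF f(1)]) auto
    note pm = pred_mod[OF cnt cnt1 counter_less[OF bin1] bo]
    have others: "d < (\<rho>(u := \<rho> u - 1)) x \<and> binary \<alpha>1 x \<and> counter \<alpha>1 x = ((\<rho>(u := \<rho> u - 1)) x - d - 1) mod 2 ^ lv x"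
      if "x \<in> Act" "x \<noteq> u" for x
    proof -
      have "x < n" using inv that by (auto simp: invariant_def)
      from same_others[OF so un this that(2)] show ?thesis using inv that by (simp add: invariant_def)
    qed
    have active: "invariant (\<rho>(u := \<rho> u - 1)) \<sigma>2 \<alpha>1 os P Act"
      if "d < \<rho> u - 1" "counter \<alpha>1 u = (\<rho> u - 1 - d - 1) mod 2 ^ lv u" "static \<sigma>2 \<alpha>1" "\<sigma>2 rh = \<sigma>1 rh" "\<sigma>2 rcnt = \<sigma>1 rcnt" for \<sigma>2
      unfolding invariant_def
    proof (intro conjI ballI)
      fix x assume x: "x \<in> Act"
      show "d < (\<rho>(u := \<rho> u - 1)) x" "binary \<alpha>1 x" "counter \<alpha>1 x = ((\<rho>(u := \<rho> u - 1)) x - d - 1) mod 2 ^ lv x"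
        using others[OF x] that bin1 by (cases "x = u"; simp)+
    qed (use inv that pd r1 a in \<open>auto simp: invariant_def\<close>)
    show "wp (Cond (Var rbo)
       (recount ;; Cond (Var rd [<] Var rr) Skip (Put 3 (Var ru) (Lit 0) ;; insert_pending ru))
       Skip) Q \<sigma>1 \<alpha>1 os t1"
    proof (cases "\<sigma>1 rbo = 0")
      case True
      have rr: "0 < \<rho> u - d - 1" "counter \<alpha>1 u = (\<rho> u - d - 1 - 1) mod 2 ^ lv u" using pm(1)[OF True] by auto
      have "invariant (\<rho>(u := \<rho> u - 1)) \<sigma>1 \<alpha>1 os P Act"
        by (rule active) (use rr(1) rr(2)[unfolded sub_eq] st1 in \<open>simp_all\<close>)
      moreover have "Suc t1 + 5 * potential \<alpha>1 \<le> t + 5 * potential \<alpha> + 5230"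
        using t1 pot True unfolding distrib_left by simp
      ultimately have "Q \<sigma>1 \<alpha>1 os (Suc t1)" using f' by (intro Q)
      then show ?thesis using True by (simp add: wp_simps)
    next
      case False
      then have bo1: "\<sigma>1 rbo = 1" using bo by simp
      \<comment> \<open>Active, pending and output vertices partition the vertex set, so counting
        the first two kinds counts the neighbours that remain.\<close>
      have c1: "{x \<in> neighbours E u. x \<in> Act \<or> x \<in> P} = neighbours E u - set os"
        using neighbours_subset[OF graph, of u] inv by (auto simp: invariant_def)
      have act1: "\<alpha>1 3 x = of_bool (x \<in> Act)" if "x < n" for x using inv that a(1) by (simp add: invariant_def)
      \<comment> \<open>The underflow has released potential \<open>1024 * 2 ^ lv u\<close>, more
        than \<open>deg u\<close>; multiplied by 5 it covers the 4 ticks per list node of the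
        recount.\<close>
      have tb: "t1 + 4 * deg u + 5 * potential \<alpha>1 \<le> t + 5 * potential \<alpha> + 5200"
        using t1 pot deg_less_level[OF un] bo1 unfolding distrib_left lv_def by simp
      have "wp recount (wp (Cond (Var rd [<] Var rr) Skip (Put 3 (Var ru) (Lit 0) ;; insert_pending ru)) Q) \<sigma>1 \<alpha>1 os (Suc t1)"
      proof (rule wp_recount[OF st1 r1(3) un pd act1])
        fix t2 assume t2: "t2 \<le> Suc t1 + 3 + 4 * deg u"
        let ?\<sigma>2 = "\<sigma>1(rr := card {x \<in> neighbours E u. x \<in> Act \<or> x \<in> P}, rq := 0)"
        have e: "?\<sigma>2 = \<sigma>1(rr := \<rho> u - 1, rq := 0)" unfolding c1 rem ..
        have f2: "frame ?R \<sigma> (\<sigma>1(rr := \<rho> u - 1, rq := 0))" using f' by (intro frame_upd) auto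
        have st2: "static (\<sigma>1(rr := \<rho> u - 1, rq := 0)) \<alpha>1" using st1 by simp
        show "wp (Cond (Var rd [<] Var rr) Skip (Put 3 (Var ru) (Lit 0) ;; insert_pending ru)) Q ?\<sigma>2 \<alpha>1 os t2"
          unfolding e
        proof (cases "d < \<rho> u - 1")
          case True
          then have "counter \<alpha>1 u = (\<rho> u - d - 1 - 1) mod 2 ^ lv u" using pm(2)[OF bo1] by simp
          note c2 = this[unfolded sub_eq]
          have "invariant (\<rho>(u := \<rho> u - 1)) (\<sigma>1(rr := \<rho> u - 1, rq := 0)) \<alpha>1 os P Act"
            by (intro active) (use True c2 st2 in \<open>simp_all\<close>)
          moreover have "Suc t2 + 5 * potential \<alpha>1 \<le> t + 5 * potential \<alpha> + 5230" using t2 tb by linarith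
          ultimately have "Q (\<sigma>1(rr := \<rho> u - 1, rq := 0)) \<alpha>1 os (Suc t2)" using f2 by (intro Q)
          then show "wp (Cond (Var rd [<] Var rr) Skip (Put 3 (Var ru) (Lit 0) ;; insert_pending ru)) Q (\<sigma>1(rr := \<rho> u - 1, rq := 0)) \<alpha>1 os t2"
            using True staticD(2)[OF st1] by (simp add: wp_simps)
        next
          case low: False
          have uP: "u \<notin> P" using inv u(2) by (auto simp: invariant_def)
          have "wp (insert_pending ru) Q (\<sigma>1(rr := \<rho> u - 1, rq := 0)) (put \<alpha>1 3 u 0) os (Suc (Suc t2))"
          proof (rule wp_insert_pending[where P = P and v = u])
            show "static (\<sigma>1(rr := \<rho> u - 1, rq := 0)) (put \<alpha>1 3 u 0)" using st1 by simp
            show "pending ((\<sigma>1(rr := \<rho> u - 1, rq := 0)) rh) (put \<alpha>1 3 u 0) P"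
              using pd pending_cong[of "put \<alpha>1 3 u 0" \<alpha>1] by simp
            fix \<sigma>3 \<alpha>3 t3
            assume f3: "frame {rf, rz, rb, rh} (\<sigma>1(rr := \<rho> u - 1, rq := 0)) \<sigma>3" "frame {4, 5, 6} (put \<alpha>1 3 u 0) \<alpha>3"
              and pd3: "pending (\<sigma>3 rh) \<alpha>3 (insert u P)" and t3: "t3 \<le> Suc (Suc t2) + 10"
            have a3: "\<alpha>3 3 = (\<alpha>1 3)(u := 0)" "\<alpha>3 9 = \<alpha>1 9" using frameD[OF f3(2)] by auto
            have st3: "static \<sigma>3 \<alpha>3"
              by (rule static_frame[OF _ f3(1) _ f3(2)]) (use st1 in auto)
            have r3: "\<sigma>3 rcnt = \<sigma> rcnt" using frameD[OF f3(1), of rcnt] r1 by simp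
            have "invariant (\<rho>(u := \<rho> u - 1)) \<sigma>3 \<alpha>3 os (insert u P) (Act - {u})"
              unfolding invariant_def
            proof (intro conjI ballI)
              fix x assume x: "x \<in> Act - {u}"
              then show "d < (\<rho>(u := \<rho> u - 1)) x" "binary \<alpha>3 x" "counter \<alpha>3 x = ((\<rho>(u := \<rho> u - 1)) x - d - 1) mod 2 ^ lv x"
                using others[of x] counter_cong[of \<alpha>3 \<alpha>1, OF a3(2)] by auto
            next
              fix x assume "x \<in> insert u P"
              then show "card (neighbours E x - set os) \<le> d" using inv rem low by (auto simp: invariant_def)
            next
              show "\<forall>x<n. \<alpha>3 3 x = of_bool (x \<in> Act - {u})" using act1 a3(1) by auto
            qed (use inv st3 pd3 r3 u(2) in \<open>auto simp: invariant_def\<close>)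
            moreover have "frame ?R \<sigma> \<sigma>3" by (rule frame_trans[OF f2 frame_mono[OF f3(1)]]) auto
            moreover have "t3 + 5 * potential \<alpha>3 \<le> t + 5 * potential \<alpha> + 5230"
              using t3 t2 tb unfolding counter_cong(4)[of \<alpha>3 \<alpha>1, OF a3(2)] by linarith
            ultimately show "Q \<sigma>3 \<alpha>3 os t3" by (intro Q)
          qed (use un uP r1 in auto)
          then show "wp (Cond (Var rd [<] Var rr) Skip (Put 3 (Var ru) (Lit 0) ;; insert_pending ru)) Q (\<sigma>1(rr := \<rho> u - 1, rq := 0)) \<alpha>1 os t2"
            using low staticD(2)[OF st1] staticD(5)[OF st1, of 3] r1 un lits by (simp add: wp_simps lens widths)
        qed
      qed
      then show ?thesis using bo1 by (simp add: wp_simps)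
    qed
  qed
qed

lemma invariant_cong:
  assumes "invariant \<rho> \<sigma> \<alpha> os P Act" "\<And>u. u \<in> Act \<Longrightarrow> \<rho>' u = \<rho> u" "frame R \<sigma> \<sigma>'"
    "R \<subseteq> {..<100} - {rn, rd, rs, rg, rh, rcnt}"
  shows "invariant \<rho>' \<sigma>' \<alpha> os P Act"
proof -
  have "static \<sigma>' \<alpha>"
    by (rule static_frame[OF _ assms(3) _ frame_refl[of "{}"]]) (use assms(1,4) in \<open>auto simp: invariant_def\<close>)
  moreover have r: "\<sigma>' rh = \<sigma> rh" "\<sigma>' rcnt = \<sigma> rcnt" using assms(4) frameD[OF assms(3)] by blast+
  moreover have "\<forall>u\<in>Act. d < \<rho>' u \<and> binary \<alpha> u \<and> counter \<alpha> u = (\<rho>' u - d - 1) mod 2 ^ lv u"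
    using assms(1,2) by (simp add: invariant_def)
  ultimately show ?thesis using assms(1) unfolding invariant_def r by blast
qed

lemma wp_peel_loop:
  assumes st: "static \<sigma> \<alpha>" and P: "pending (\<sigma> rh) \<alpha> {u. u < n \<and> deg u \<le> d}"
    and act: "\<And>u. u < n \<Longrightarrow> \<alpha> 3 u = of_bool (d < deg u)"
    and cnt: "\<And>u j. u < n \<Longrightarrow> d < deg u \<Longrightarrow> j < level (u div 256) \<Longrightarrow>
         \<alpha> 9 (counter_cell u j) = (deg u - d - 1) div 2 ^ j mod 2"
    and Q: "\<And>\<sigma>' \<alpha>' os' t'. t' \<le> t + 10 + 40 * n + 5300 * 2 * m + 7680 * m \<Longrightarrow>
      (\<sigma>' res \<noteq> 0 \<longleftrightarrow> degenerate d {..<n} E) \<Longrightarrow> (\<sigma>' res \<noteq> 0 \<Longrightarrow> degenerate_order d {..<n} E os') \<Longrightarrow>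
      Q \<sigma>' \<alpha>' os' t'"
  shows "wp peel_loop Q \<sigma> \<alpha> [] t"
proof -
  define rem where "rem os u = card (neighbours E u - set os)" for os u
  \<comment> \<open>The time budget of vertices not yet output: 40 ticks for taking one from the
    pending set and starting its list, and 5300 per list node, which cover the 5230 of
    \<open>touch\<close> and the step of the walk.\<close>
  define todo where "todo os = (\<Sum>u\<in>{..<n} - set os. 40 + 5300 * deg u)" for os
  define J where "J = (\<lambda>\<sigma>' \<alpha>' os' t'. (\<exists>P Act. invariant (rem os') \<sigma>' \<alpha>' os' P Act) \<and>
     t' + 5 * potential \<alpha>' + todo os' \<le> t + 1 + 5 * potential \<alpha> + todo [])"
  have rem_nil: "rem [] u = deg u" for u by (simp add: rem_def deg_def degree_def)
  have todo_nil: "todo [] = 40 * n + 5300 * (2 * m)"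
    unfolding todo_def by (simp add: sum.distrib sum_deg flip: sum_distrib_left)
  have inv0: "invariant (rem []) (\<sigma>(rcnt := 0)) \<alpha> [] {u. u < n \<and> deg u \<le> d} {u. u < n \<and> d < deg u}"
    unfolding invariant_def
  proof (intro conjI ballI)
    fix u assume u: "u \<in> {u. u < n \<and> d < deg u}"
    have "counter \<alpha> u = (\<Sum>j<lv u. (deg u - d - 1) div 2 ^ j mod 2 * 2 ^ j)"
      unfolding counter_def using u by (intro sum.cong) (auto simp: cnt lv_def)
    then show "counter \<alpha> u = (rem [] u - d - 1) mod 2 ^ lv u" by (simp add: rem_nil sum_bits)
    show "d < rem [] u" using u by (simp add: rem_nil)
    show "binary \<alpha> u" using u cnt by (auto simp: binary_def lv_def)
  next
    fix u assume "u \<in> {u. u < n \<and> deg u \<le> d}"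
    then show "card (neighbours E u - set []) \<le> d" using rem_nil by (simp add: rem_def)
  qed (use st P act peel_Nil in auto)
  have "wp (While (Var rh)
       (pop_pending ;; Out (Var rv) ;; rcnt ::= Var rcnt [+] Lit 1 ;;
        rp ::= Inp (Lit 2 [+] Var rv) ;;
        walk rp (ru ::= Inp (Var rp) ;; Cond (Get 3 (Var ru)) touch Skip)))
       (wp (res ::= (Var rcnt [=] Var rn)) Q) (\<sigma>(rcnt := 0)) \<alpha> [] (Suc t)"
  proof (rule wp_While_invariant[where J = J and T = "t + 1 + 5 * potential \<alpha> + todo []"], goal_cases)
    case 1
    show ?case using inv0 by (auto simp: J_def)
  next
    case (2 \<sigma>1 \<alpha>1 os1 t1)
    then show ?case by (auto simp: J_def)
  next
    case (3 \<sigma>1 \<alpha>1 os1 t1)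
    then obtain P Act where inv: "invariant (rem os1) \<sigma>1 \<alpha>1 os1 P Act"
      and tb: "t1 + 5 * potential \<alpha>1 + todo os1 \<le> t + 1 + 5 * potential \<alpha> + todo []" by (auto simp: J_def)
    have st1: "static \<sigma>1 \<alpha>1" and pd: "pending (\<sigma>1 rh) \<alpha>1 P" using inv by (auto simp: invariant_def)
    have ne: "\<sigma>1 rh \<noteq> 0" using 3(2) by simp
    show ?case unfolding wp_Seq[of pop_pending]
    proof (rule wp_pop_pending[OF st1 pd ne])
      fix \<sigma>2 \<alpha>2 t2 v
      assume v: "v \<in> P" and f: "frame {rb, rz, rt, rf, rx, rj, rv, rh} \<sigma>1 \<sigma>2" and rv2: "\<sigma>2 rv = v"
        and fa: "frame {4, 5} \<alpha>1 \<alpha>2" and pd2: "pending (\<sigma>2 rh) \<alpha>2 (P - {v})" and t2: "t2 \<le> Suc t1 + 14"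
      define os where "os = os1 @ [v]"
      have vn: "v < n" and vos: "v \<notin> set os1" "v \<notin> Act" using v inv by (auto simp: invariant_def)
      have st2: "static \<sigma>2 \<alpha>2" by (rule static_frame[OF st1 f _ fa]) auto
      have a2: "\<alpha>2 3 = \<alpha>1 3" "\<alpha>2 9 = \<alpha>1 9" using frameD[OF fa] by auto
      have r2: "\<sigma>2 rcnt = length os1" using frameD[OF f, of rcnt] inv by (simp add: invariant_def)
      \<comment> \<open>The lagging degrees during the walk: \<open>v\<close> counts as output
        already, but a neighbour in the remaining list \<open>qs\<close> is credited one
        more.\<close>
      define rho where "rho qs u = card (neighbours E u - set os) + of_bool (u \<in> (!) I ` set qs)" for qs u
      have imA: "(!) I ` set (A v) = neighbours E v" using set_A[OF vn] by simp
      have rho_A: "rho (A v) u = rem os1 u" if "u \<in> Act" for u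
      proof (cases "v \<in> neighbours E u")
        case True
        then have "u \<in> neighbours E v" by (simp add: neighbours_sym)
        moreover have "neighbours E u - set os1 = insert v (neighbours E u - set os)" using True vos by (auto simp: os_def)
        moreover have "finite (neighbours E u - set os)" "v \<notin> neighbours E u - set os"
          using finite_neighbours[OF graph] by (simp_all add: os_def)
        ultimately show ?thesis by (simp only: rho_def imA rem_def card_insert_disjoint of_bool_eq Suc_eq_plus1 simp_thms)
      next
        case False
        then have "u \<notin> neighbours E v" by (simp add: neighbours_sym)
        moreover have "neighbours E u - set os1 = neighbours E u - set os" using False by (auto simp: os_def)
        ultimately show ?thesis by (simp add: rho_def imA rem_def)
      qed
      have pe: "peel d {..<n} E os" unfolding os_def
        using inv v vn vos by (intro peel_snoc) (auto simp: invariant_def)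
      have decr: "card (neighbours E u - set os) \<le> card (neighbours E u - set os1)" for u
        using finite_neighbours[OF graph, of u] by (intro card_mono) (auto simp: os_def)
      have inv2: "invariant (rho (A v)) (\<sigma>2(rcnt := length os)) \<alpha>2 os (P - {v}) Act"
        unfolding invariant_def
      proof (intro conjI ballI)
        fix u assume u: "u \<in> Act"
        show "d < rho (A v) u" "binary \<alpha>2 u" "counter \<alpha>2 u = (rho (A v) u - d - 1) mod 2 ^ lv u"
          using inv u rho_A[OF u] counter_cong[of \<alpha>2 \<alpha>1, OF a2(2)] by (auto simp: invariant_def)
      next
        fix u assume "u \<in> P - {v}"
        then have "card (neighbours E u - set os1) \<le> d" using inv by (auto simp: invariant_def)
        then show "card (neighbours E u - set os) \<le> d" using decr[of u] by linarith
      next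
        show "{..<n} = Act \<union> (P - {v}) \<union> set os" using inv v by (auto simp: invariant_def os_def)
      qed (use inv st2 pd2 a2 pe vos in \<open>auto simp: invariant_def os_def\<close>)
      have todo1: "todo os1 = todo os + (40 + 5300 * deg v)"
      proof -
        have "{..<n} - set os1 = insert v ({..<n} - set os)" using vn vos by (auto simp: os_def)
        moreover have "v \<notin> {..<n} - set os" by (simp add: os_def)
        ultimately show ?thesis by (simp add: todo_def)
      qed
      have len_os: "length os \<le> n"
        using pe card_mono[of "{..<n}" "set os"] distinct_card[of os] by (auto simp: peel_def)
      have lo: "length os = length os1 + 1" by (simp add: os_def)
      have lw: "length os < 2 ^ w" using len_os nm by linarith
      have I2: "2 + v < length I" "2 + v < 2 ^ w" using vn header length_I by linarith+
      define t3 where "t3 = Suc (Suc (Suc t2))"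
      define K where "K = (\<lambda>qs \<sigma>' \<alpha>' os' t'. \<exists>ps P Act. A v = ps @ qs \<and> os' = os \<and> invariant (rho qs) \<sigma>' \<alpha>' os P Act \<and>
        t' + 5 * potential \<alpha>' + 5300 * length qs \<le> t3 + 5 * potential \<alpha>2 + 5300 * deg v)"
      have "wp (walk rp (ru ::= Inp (Var rp) ;; Cond (Get 3 (Var ru)) touch Skip)) J
         (\<sigma>2(rcnt := length os, rp := I ! (2 + v))) \<alpha>2 os t3"
      proof (rule wp_walk[where J = K and ps = "A v"], goal_cases)
        case 1
        have "invariant (rho (A v)) (\<sigma>2(rcnt := length os, rp := I ! (2 + v))) \<alpha>2 os (P - {v}) Act"
          by (rule invariant_cong[OF inv2, where R = "{rp}"]) (auto intro!: frame_upd frame_refl)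
        then show ?case using length_A[OF vn] unfolding K_def by (intro exI[of _ "[]"]) auto
      next
        case 2
        show ?case using list_A[OF vn] by simp
      next
        case 3
        show ?case by simp
      next
        case (4 q qs \<sigma>' \<alpha>' os' t')
        then obtain ps P' Act' where ps: "A v = ps @ q # qs" "os' = os" and inv': "invariant (rho (q # qs)) \<sigma>' \<alpha>' os P' Act'"
          and tb': "t' + 5 * potential \<alpha>' + 5300 * length (q # qs) \<le> t3 + 5 * potential \<alpha>2 + 5300 * deg v"
          by (auto simp: K_def)
        define u where "u = I ! q"
        have un: "u < n" using vertex_A[OF vn 4(4)] by (simp add: u_def)
        have st': "static \<sigma>' \<alpha>'" using inv' by (simp add: invariant_def)
        \<comment> \<open>A neighbour occurs only once in the list, so each counter is decremented
          exactly once.\<close>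
        have dist: "u \<notin> (!) I ` set qs" using distinct_A[OF vn] unfolding ps(1) by (auto simp: u_def)
        have rho_step: "rho qs x = (if x = u then rho (q # qs) u - 1 else rho (q # qs) x)" for x
          using dist by (auto simp: rho_def u_def)
        have rho_u: "card (neighbours E u - set os) = rho (q # qs) u - 1" using dist by (simp add: rho_def u_def)
        let ?\<sigma> = "\<sigma>'(ru := u)"
        have inv'': "invariant (rho (q # qs)) ?\<sigma> \<alpha>' os P' Act'"
          by (rule invariant_cong[OF inv', where R = "{ru}"]) (auto intro!: frame_upd frame_refl)
        have a3: "\<alpha>' 3 u = of_bool (u \<in> Act')" using inv' un by (simp add: invariant_def)
        have fin: "K qs (\<sigma>3(rp := x)) \<alpha>3 os (Suc t4)"
          if "invariant (rho qs) \<sigma>3 \<alpha>3 os P3 Act3" "t4 + 5 * potential \<alpha>3 \<le> t' + 3 + 5 * potential \<alpha>' + 5230"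
          for \<sigma>3 \<alpha>3 t4 P3 Act3 x
        proof -
          have "invariant (rho qs) (\<sigma>3(rp := x)) \<alpha>3 os P3 Act3"
            by (rule invariant_cong[OF that(1), where R = "{rp}"]) (auto intro!: frame_upd frame_refl)
          moreover have "Suc t4 + 5 * potential \<alpha>3 + 5300 * length qs \<le> t3 + 5 * potential \<alpha>2 + 5300 * deg v"
            using tb' that(2) by simp
          ultimately show ?thesis unfolding K_def using ps(1) by (intro exI[of _ "ps @ [q]"]) auto
        qed
        show ?case
        proof (cases "u \<in> Act'")
          case False
          have "invariant (rho qs) ?\<sigma> \<alpha>' os P' Act'"
            by (rule invariant_cong[OF inv'', where R = "{}"]) (use False in \<open>auto simp: rho_step intro!: frame_refl\<close>)
          from fin[OF this, of "Suc (Suc (Suc t'))" "I ! (q + 1)"] show ?thesis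
            using False 4(2,3) st' staticD(5)[OF st', of 3] un a3 ps(2) lits by (simp add: wp_simps lens u_def)
        next
          case True
          have "wp touch (\<lambda>\<sigma>3 \<alpha>3 os3 t4. \<sigma>3 rp = q \<and> K qs (\<sigma>3(rp := I ! (q + 1))) \<alpha>3 os3 (Suc t4)) ?\<sigma> \<alpha>' os (Suc (Suc (Suc t')))"
          proof (rule wp_touch[OF inv'' _ True rho_u])
            show "?\<sigma> ru = u" by simp
            fix \<sigma>3 \<alpha>3 t4 P3 Act3
            assume i3: "invariant ((rho (q # qs))(u := rho (q # qs) u - 1)) \<sigma>3 \<alpha>3 os P3 Act3"
              and f3: "frame {rpp, rbo, rc, rr, rq, rf, rz, rb, rh} ?\<sigma> \<sigma>3"
              and t4: "t4 + 5 * potential \<alpha>3 \<le> Suc (Suc (Suc t')) + 5 * potential \<alpha>' + 5230"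
            have "invariant (rho qs) \<sigma>3 \<alpha>3 os P3 Act3"
              by (rule invariant_cong[OF i3, where R = "{}"]) (auto simp: rho_step intro!: frame_refl)
            from fin[OF this, of t4] t4 have "K qs (\<sigma>3(rp := I ! (q + 1))) \<alpha>3 os (Suc t4)" by simp
            moreover have "\<sigma>3 rp = q" using frameD[OF f3, of rp] 4(2) by simp
            ultimately show "\<sigma>3 rp = q \<and> K qs (\<sigma>3(rp := I ! (q + 1))) \<alpha>3 os (Suc t4)" by simp
          qed
          then show ?thesis
            using True 4(2,3) st' staticD(5)[OF st', of 3] un a3 ps(2) lits by (simp add: wp_simps lens u_def)
        qed
      next
        case (5 \<sigma>' \<alpha>' os' t')
        then obtain P' Act' where inv': "invariant (rho []) \<sigma>' \<alpha>' os P' Act'" and os': "os' = os"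
          and tb': "t' + 5 * potential \<alpha>' \<le> t3 + 5 * potential \<alpha>2 + 5300 * deg v"
          by (auto simp: K_def)
        have "rho [] = rem os" by (auto simp: rho_def rem_def)
        moreover have "Suc t' + 5 * potential \<alpha>' + todo os \<le> t + 1 + 5 * potential \<alpha> + todo []"
          using tb' tb t2 todo1 counter_cong(4)[of \<alpha>2 \<alpha>1, OF a2(2)] unfolding t3_def by simp
        ultimately show ?case using inv' unfolding J_def os' by auto
      qed
      then show "wp (Out (Var rv) ;; rcnt ::= Var rcnt [+] Lit 1 ;;
        rp ::= Inp (Lit 2 [+] Var rv) ;;
        walk rp (ru ::= Inp (Var rp) ;; Cond (Get 3 (Var ru)) touch Skip)) J \<sigma>2 \<alpha>2 os1 t2"
        using rv2 r2 lw[unfolded lo] I2 lits unfolding t3_def lo by (simp add: wp_simps os_def[symmetric])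
    qed
  next
    case (4 \<sigma>1 \<alpha>1 os1 t1)
    then obtain P Act where inv: "invariant (rem os1) \<sigma>1 \<alpha>1 os1 P Act"
      and tb: "t1 + 5 * potential \<alpha>1 + todo os1 \<le> t + 1 + 5 * potential \<alpha> + todo []" by (auto simp: J_def)
    have "\<sigma>1 rh = 0" using 4(2) by simp
    \<comment> \<open>Nothing is pending, so every vertex that was not output is active and has more
      than \<open>d\<close> remaining neighbours.\<close>
    then have "P = {}" using pending_height(2) inv by (metis invariant_def)
    have p: "peel d {..<n} E os1" using inv unfolding invariant_def by blast
    have all: "set os1 = {..<n} \<longleftrightarrow> length os1 = n"
      using p distinct_card[of os1] card_subset_eq[of "{..<n}" "set os1"] by (auto simp: peel_def)
    have "\<not> degenerate d {..<n} E" if "set os1 \<noteq> {..<n}"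
    proof (rule peel_stuck[OF graph p that])
      fix u assume "u \<in> {..<n}" "u \<notin> set os1"
      then have "u \<in> Act" using inv \<open>P = {}\<close> by (auto simp: invariant_def)
      then show "d < card (neighbours E u - set os1)" using inv by (auto simp: invariant_def rem_def)
    qed
    then have res: "length os1 = n \<longleftrightarrow> degenerate d {..<n} E" "length os1 = n \<Longrightarrow> degenerate_order d {..<n} E os1"
      using all peel_complete[OF graph p] by auto
    \<comment> \<open>The initial potential enters with factor 5, and
      \<open>5 * 1536 = 7680\<close>.\<close>
    have "Suc (Suc t1) \<le> t + 10 + 40 * n + 5300 * 2 * m + 7680 * m"
      using tb potential_bound[of \<alpha>] unfolding todo_nil by simp
    then have "Q (\<sigma>1(res := of_bool (length os1 = n))) \<alpha>1 os1 (Suc (Suc t1))"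
      using res by (intro Q) auto
    moreover have "\<sigma>1 rcnt = length os1" "\<sigma>1 rn = n" using inv by (auto simp: invariant_def static_def)
    ultimately show ?case by (simp add: wp_simps)
  qed
  then show ?thesis using lits by (simp add: peel_loop_def wp_simps)
qed

end

section \<open>The whole program\<close>

definition main_part :: com where
  "main_part = (read_params ;; alloc1 ;; tables ;; count_levels ;; level_starts ;; alloc2 ;;
     mark_parents ;; sample_ranks ;; init_state ;; peel_loop)"

text \<open>The condition is \<open>w div 256\<close>, computed by single shifts because the literal \<open>256\<close> does not fit
  into small words.\<close>

definition program :: com where
  "program =
     Cond (Wsz [>>] Lit 1 [>>] Lit 1 [>>] Lit 1 [>>] Lit 1 [>>] Lit 1 [>>] Lit 1 [>>] Lit 1 [>>] Lit 1)
       main_part naive"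

lemma shallow_program: "shallow program"
  by (simp add: program_def main_part_def read_params_def alloc1_def alloc_def tables_def count_levels_def
    group_sum_def get_deg_def walk_def level_starts_def alloc2_def mark_parents_def sample_ranks_def
    init_state_def insert_pending_def peel_loop_def pop_pending_def touch_def borrow_def recount_def naive_def)

context main_run
begin

lemma wp_main_part:
  "wp main_part (\<lambda>\<sigma> \<alpha> os t. t \<le> 20000 * (n + m + 1) \<and>
     (\<sigma> res \<noteq> 0 \<longleftrightarrow> degenerate d {..<n} E) \<and> (\<sigma> res \<noteq> 0 \<longrightarrow> degenerate_order d {..<n} E os))
     (\<lambda>_. 0) (\<lambda>_ _. 0) [] 1"
  unfolding main_part_def wp_Seq
proof (rule wp_read_params)
  fix \<sigma>1 t1
  assume r1: "\<sigma>1 rn = n" "\<sigma>1 rd = d" "\<sigma>1 rl = lg" "\<sigma>1 rs = sz" and t1: "t1 \<le> 1 + 20 + 12 * n + 20 * m"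
  let ?Q = "\<lambda>\<sigma> \<alpha> os t. t \<le> 20000 * (n + m + 1) \<and>
     (\<sigma> res \<noteq> 0 \<longleftrightarrow> degenerate d {..<n} E) \<and> (\<sigma> res \<noteq> 0 \<longrightarrow> degenerate_order d {..<n} E os)"
  show "wp alloc1 (wp tables (wp count_levels (wp level_starts (wp alloc2 (wp mark_parents (wp sample_ranks
     (wp init_state (wp peel_loop ?Q)))))))) \<sigma>1 (\<lambda>_ _. 0) [] t1"
  proof (rule wp_alloc1[where \<sigma> = \<sigma>1, OF r1(1,3,4)])
    fix \<sigma>2 t2
    assume f2: "frame ({rtop} \<union> {100..<114}) \<sigma>1 \<sigma>2" and top2: "\<sigma>2 rtop = array_base 7"
      and ok2: "\<And>k. k < 7 \<Longrightarrow> array_ok k \<sigma>2" and t2: "t2 \<le> t1 + 22"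
    have r2: "\<sigma>2 rn = n" "\<sigma>2 rd = d" "\<sigma>2 rl = lg" "\<sigma>2 rs = sz"
      using r1 frameD[OF f2, of rn] frameD[OF f2, of rd] frameD[OF f2, of rl] frameD[OF f2, of rs] by simp_all
    show "wp tables (wp count_levels (wp level_starts (wp alloc2 (wp mark_parents (wp sample_ranks
     (wp init_state (wp peel_loop ?Q))))))) \<sigma>2 (\<lambda>_ _. 0) [] t2"
    proof (rule wp_tables[where \<sigma> = \<sigma>2, OF r2(4) ok2 ok2])
      fix \<sigma>3 \<alpha>3 t3
      assume f3: "frame {ri, rlim} \<sigma>2 \<sigma>3" and a3: "frame {1, 2} (\<lambda>_ _. 0) \<alpha>3"
        and T3: "\<And>x. x < 2 ^ sz \<Longrightarrow> \<alpha>3 1 x = pop_count x \<and> \<alpha>3 2 x = bit_length x"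
        and t3: "t3 \<le> t2 + 3 + 4 * 2 ^ sz"
      have r3: "\<sigma>3 rn = n" "\<sigma>3 rd = d" "\<sigma>3 rl = lg" "\<sigma>3 rs = sz" "\<sigma>3 rtop = array_base 7"
        using r2 top2 frameD[OF f3, of rn] frameD[OF f3, of rd] frameD[OF f3, of rl] frameD[OF f3, of rs]
          frameD[OF f3, of rtop] by simp_all
      have ok3: "array_ok k \<sigma>3" if "k < 7" for k using ok2[OF that] frame_array_ok[OF f3] by auto
      have z3: "\<alpha>3 k = (\<lambda>_. 0)" if "k \<noteq> 1" "k \<noteq> 2" for k using frameD[OF a3, of k] that by simp
      have tab3: "tables_ok \<alpha>3" using T3 by (simp add: tables_ok_def)
      show "wp count_levels (wp level_starts (wp alloc2 (wp mark_parents (wp sample_ranks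
       (wp init_state (wp peel_loop ?Q)))))) \<sigma>3 \<alpha>3 [] t3"
      proof (rule wp_count_levels[where \<sigma> = \<sigma>3 and \<alpha> = \<alpha>3, OF r3(1) ok3])
        fix \<sigma>4 \<alpha>4 t4
        assume f4: "frame {rX, ri, rv, rp, rx, ry, rj} \<sigma>3 \<sigma>4" and a4: "frame {0} \<alpha>3 \<alpha>4"
          and c4: "\<And>j. j \<le> lg \<Longrightarrow> \<alpha>4 0 j = level_count j groups" and t4: "t4 \<le> t3 + 2 + 2000 * n + 20 * m"
        have r4: "\<sigma>4 rn = n" "\<sigma>4 rd = d" "\<sigma>4 rl = lg" "\<sigma>4 rs = sz" "\<sigma>4 rtop = array_base 7"
          using r3 frameD[OF f4, of rn] frameD[OF f4, of rd] frameD[OF f4, of rl] frameD[OF f4, of rs]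
            frameD[OF f4, of rtop] by simp_all
        have ok4: "array_ok k \<sigma>4" if "k < 7" for k using ok3[OF that] frame_array_ok[OF f4] by auto
        show "wp level_starts (wp alloc2 (wp mark_parents (wp sample_ranks
          (wp init_state (wp peel_loop ?Q))))) \<sigma>4 \<alpha>4 [] t4"
        proof (rule wp_level_starts[where \<sigma> = \<sigma>4 and \<alpha> = \<alpha>4, OF r4(3) ok4 c4])
          fix \<sigma>5 \<alpha>5 t5
          assume f5: "frame {racc, rj, rt, rnf, rg} \<sigma>4 \<sigma>5" and a5: "frame {0} \<alpha>4 \<alpha>5"
            and nf5: "\<sigma>5 rnf = num_nodes" "\<sigma>5 rg = groups"
            and p5: "\<And>j. j \<le> lg \<Longrightarrow> \<alpha>5 0 j = pos j 0" and t5: "t5 \<le> t4 + 10 + 5 * lg + 5"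
          have r5: "\<sigma>5 rn = n" "\<sigma>5 rd = d" "\<sigma>5 rl = lg" "\<sigma>5 rs = sz" "\<sigma>5 rtop = array_base 7"
            using r4 frameD[OF f5, of rn] frameD[OF f5, of rd] frameD[OF f5, of rl] frameD[OF f5, of rs]
              frameD[OF f5, of rtop] by simp_all
          have ok5: "array_ok k \<sigma>5" if "k < 7" for k using ok4[OF that] frame_array_ok[OF f5] by auto
          show "wp alloc2 (wp mark_parents (wp sample_ranks (wp init_state (wp peel_loop ?Q)))) \<sigma>5 \<alpha>5 [] t5"
          proof (rule wp_alloc2[where \<sigma> = \<sigma>5, OF nf5 r5(3,4,5)])
            fix \<sigma>6 t6
            assume f6: "frame ({rtop} \<union> {114..<120}) \<sigma>5 \<sigma>6"
              and ok6': "array_ok 7 \<sigma>6" "array_ok 8 \<sigma>6" "array_ok 9 \<sigma>6" and t6: "t6 \<le> t5 + 10"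
            have r6: "\<sigma>6 rn = n" "\<sigma>6 rd = d" "\<sigma>6 rs = sz" "\<sigma>6 rnf = num_nodes" "\<sigma>6 rg = groups"
              using r5 nf5 frameD[OF f6, of rn] frameD[OF f6, of rd] frameD[OF f6, of rs]
                frameD[OF f6, of rnf] frameD[OF f6, of rg] by simp_all
            have ok6: "array_ok k \<sigma>6" if k: "k < 10" for k
            proof (cases "k < 7")
              case True
              then show ?thesis using ok5[OF True] frameD[OF f6, of "100 + 2 * k"] frameD[OF f6, of "101 + 2 * k"]
                by (simp add: array_ok_def)
            next
              case False
              then consider "k = 7" | "k = 8" | "k = 9" using k by linarith
              then show ?thesis using ok6' by cases simp_all
            qed
            have e5: "\<alpha>5 k = \<alpha>3 k" if "k \<noteq> 0" for k
              using frameD[OF a5, of k] frameD[OF a4, of k] that by simp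
            show "wp mark_parents (wp sample_ranks (wp init_state (wp peel_loop ?Q))) \<sigma>6 \<alpha>5 [] t6"
            proof (rule wp_mark_parents[where \<sigma> = \<sigma>6 and \<alpha> = \<alpha>5, OF r6(1,3) ok6 ok6 p5])
              show "\<alpha>5 7 i = 0" for i using e5[of 7] z3[of 7] by simp
              fix \<sigma>7 \<alpha>7 t7
              assume f7: "frame {rX, ri, rv, rp, rx, ry, rj, rt} \<sigma>6 \<sigma>7" and a7: "frame {0, 7} \<alpha>5 \<alpha>7"
                and b7: "bitset 7 (num_nodes div sz) \<alpha>7 parents" and t7: "t7 \<le> t6 + 2 + 2000 * n + 40 * m"
              have r7: "\<sigma>7 rn = n" "\<sigma>7 rd = d" "\<sigma>7 rs = sz" "\<sigma>7 rnf = num_nodes" "\<sigma>7 rg = groups"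
                using r6 frameD[OF f7, of rn] frameD[OF f7, of rd] frameD[OF f7, of rs]
                  frameD[OF f7, of rnf] frameD[OF f7, of rg] by simp_all
              have ok7: "array_ok k \<sigma>7" if "k < 10" for k using ok6[OF that] frame_array_ok[OF f7] by auto
              have e7: "\<alpha>7 k = \<alpha>3 k" if "k \<noteq> 0" "k \<noteq> 7" for k
                using frameD[OF a7, of k] e5[of k] that by simp
              have tab7: "tables_ok \<alpha>7" using tab3 e7 by (simp add: tables_ok_def)
              show "wp sample_ranks (wp init_state (wp peel_loop ?Q)) \<sigma>7 \<alpha>7 [] t7"
              proof (rule wp_sample_ranks[where \<sigma> = \<sigma>7 and \<alpha> = \<alpha>7, OF r7(3,4) ok7 ok7 ok7 b7 tab7])
                fix \<sigma>8 \<alpha>8 t8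
                assume f8: "frame {racc, ri, rlim} \<sigma>7 \<sigma>8" and a8: "frame {8} \<alpha>7 \<alpha>8" and rk: "ranks_ok \<alpha>8"
                  and t8: "t8 \<le> t7 + 8 + 4 * num_nodes"
                have e8: "\<alpha>8 k = \<alpha>7 k" if "k \<noteq> 8" for k using frameD[OF a8, of k] that by simp
                have st: "static \<sigma>8 \<alpha>8"
                  using r7 ok7 frame_array_ok[OF f8] frameD[OF f8, of rn] frameD[OF f8, of rd] frameD[OF f8, of rs]
                    frameD[OF f8, of rg] rk tab7 b7 e8 bitset_cong[of \<alpha>8 7 \<alpha>7]
                  by (simp add: static_def tables_ok_def)
                show "wp init_state (wp peel_loop ?Q) \<sigma>8 \<alpha>8 [] t8"
                proof (rule wp_init_state[OF st])
                  show "\<alpha>8 k i = 0" if "k \<in> {3, 4, 5}" for k i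
                    using e8[of k] e7[of k] z3[of k] that by auto
                  fix \<sigma>9 \<alpha>9 t9
                  assume f9: "frame {rh, rv, rp, rx, re, rpp, rf, rz, rb} \<sigma>8 \<sigma>9" and a9: "frame {3, 4, 5, 6, 9} \<alpha>8 \<alpha>9"
                    and pd: "pending (\<sigma>9 rh) \<alpha>9 {u. u < n \<and> deg u \<le> d}"
                    and act: "\<And>u. u < n \<Longrightarrow> \<alpha>9 3 u = of_bool (d < deg u)"
                    and cnt: "\<And>u j. u < n \<Longrightarrow> d < deg u \<Longrightarrow> j < level (u div 256) \<Longrightarrow>
                       \<alpha>9 9 (counter_cell u j) = (deg u - d - 1) div 2 ^ j mod 2"
                    and t9: "t9 \<le> t8 + 3 + 20 * n + 10 * m"
                  have st9: "static \<sigma>9 \<alpha>9" by (rule static_frame[OF st f9 _ a9]) auto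
                  \<comment> \<open>The removal phase dominates with 18280 ticks per edge; the two
                    passes over the groups dominate the term in \<open>n\<close>.\<close>
                  have "t9 + 10 + 40 * n + 5300 * 2 * m + 7680 * m \<le> 20000 * (n + m + 1)"
                    using t1 t2 t3 t4 t5 t6 t7 t8 t9 pow_lg num_nodes_bound(3) unfolding distrib_left mult_1_right
                    by linarith
                  then show "wp peel_loop ?Q \<sigma>9 \<alpha>9 [] t9"
                    by (intro wp_peel_loop[OF st9 pd act cnt]) auto
                qed
              qed auto
            qed auto
          qed
        qed auto
      qed (use z3 in auto)
    qed auto
  qed
qed

end

section \<open>The size of the workspace\<close>

text \<open>A word with \<open>q\<close> fields wastes less than one further field, a loss by a
  factor below \<open>(q + 1) / q\<close>. This is at most 2 in general and at most 9 / 8 if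
  \<open>q >= 8\<close>.\<close>

lemma words_bound:
  fixes b w L :: nat
  assumes "0 < b" "b \<le> w"
  shows "w * (L div (w div b)) \<le> 2 * (b * L)" and "8 * b \<le> w \<Longrightarrow> 8 * (w * (L div (w div b))) \<le> 9 * (b * L)"
proof -
  define q where "q = w div b"
  have q: "0 < q" using assms by (simp add: q_def div_greater_zero_iff)
  have qL: "q * (L div q) \<le> L" by simp
  have w: "w < (q + 1) * b" using dividend_less_div_times[OF assms(1), of w] by (simp add: q_def algebra_simps)
  have "1 * b \<le> q * b" using q by (intro mult_right_mono) auto
  then have "w \<le> 2 * (q * b)" using w unfolding distrib_right mult_1_left by linarith
  then have "w * (L div q) \<le> 2 * (q * b) * (L div q)" by (rule mult_right_mono) simp
  also have "\<dots> = 2 * (b * (q * (L div q)))" by (simp add: algebra_simps)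
  also have "\<dots> \<le> 2 * (b * L)" using qL by (intro mult_left_mono) auto
  finally show "w * (L div (w div b)) \<le> 2 * (b * L)" by (simp add: q_def)
  show "8 * (w * (L div (w div b))) \<le> 9 * (b * L)" if "8 * b \<le> w"
  proof -
    have "8 \<le> q" unfolding q_def using that assms(1) by (simp add: less_eq_div_iff_mult_less_eq)
    then have "8 * b \<le> q * b" by (rule mult_right_mono) simp
    then have "8 * w \<le> 9 * (q * b)" using w unfolding distrib_right mult_1_left by linarith
    then have "8 * w * (L div q) \<le> 9 * (q * b) * (L div q)" by (rule mult_right_mono) simp
    also have "\<dots> = 9 * (b * (q * (L div q)))" by (simp add: algebra_simps)
    also have "\<dots> \<le> 9 * (b * L)" using qL by (intro mult_left_mono) auto
    finally show ?thesis by (simp add: q_def mult.assoc)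
  qed
qed

definition machine_code :: "instr list" where
  "machine_code = comp 0 program @ [JumpIfZero (reg res) (csize program + 2), Halt True, Halt False]"

text \<open>For words of fewer than 256 bits the input size forces \<open>n <= reg_base\<close>, so
  the polynomial bound of the naive algorithm becomes a constant.\<close>

definition small_time :: nat where
  "small_time = 1 + (4 * reg_base + 20) * (reg_base + 1) * (reg_base + 1) + 20"

context input
begin

definition data_words :: nat where
  "data_words = (\<Sum>k<10. array_len k div (w div entry_width k))"

text \<open>The 310 words are the registers with the temporaries and one spare word for each of the
  ten arrays.\<close>

lemma array_base_10: "array_base 10 = reg_base + 310 + data_words"
proof -
  have "array_base k = reg_base + 300 + k + (\<Sum>i<k. array_len i div (w div entry_width i))" for k
    by (induction k) (auto simp: heap_base_def)
  from this[of 10] show ?thesis by (simp add: data_words_def)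
qed

lemma entry_width: "0 < entry_width k" "entry_width k \<le> w"
  using sz_bounds(1,2) lg_bounds w_positive by (auto simp: entry_width_def)

lemma lg_sz: "lg \<le> 16 * sz" "sz * sz \<le> 4 ^ sz" "sz \<le> 4 ^ sz" "sz * 2 ^ sz \<le> 4 ^ sz" "1 \<le> (4 :: nat) ^ sz"
proof -
  have "lg < 16 * (lg div 16) + 16" by linarith
  then show "lg \<le> 16 * sz" by (simp add: sz_def)
  have l: "sz \<le> 2 ^ sz" by (rule less_imp_le) (rule less_exp)
  have e: "(4::nat) ^ sz = 2 ^ sz * 2 ^ sz" by (simp flip: power_mult_distrib)
  show "sz * sz \<le> 4 ^ sz" unfolding e using l by (intro mult_le_mono)
  show "sz * 2 ^ sz \<le> 4 ^ sz" unfolding e using l by (intro mult_right_mono) auto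
  show "1 \<le> (4 :: nat) ^ sz" by simp
  have "sz * 1 \<le> sz * 2 ^ sz" by (intro mult_left_mono) auto
  then show "sz \<le> 4 ^ sz" using \<open>sz * 2 ^ sz \<le> 4 ^ sz\<close> by simp
qed

text \<open>Hence \<open>4 ^ sz\<close>, which dominates the tables and all rounding terms, is of
  the order of a square root. The estimate by \<open>2 ^ lg\<close> is very generous, as the
  exponent is about \<open>lg / 4\<close>.\<close>

lemma sixteen_sz: "(4 ^ sz) ^ 2 \<le> 16 * (4 * m + 2 * n + 2)"
proof -
  have "((4::nat) ^ sz) ^ 2 = 16 * 2 ^ (4 * (lg div 16))"
    by (simp add: sz_def power_mult flip: power_mult_distrib power2_eq_square)
       (simp add: power_add power2_eq_square flip: power_mult_distrib)
  also have "\<dots> \<le> 16 * 2 ^ lg" by (intro mult_left_mono power_increasing) auto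
  also have "\<dots> \<le> 16 * (4 * m + 2 * n + 2)" using pow_lg(1) by simp
  finally show ?thesis .
qed

text \<open>The factor 8 keeps the rounding loss 9 / 8 integral. In the coefficient 19, the active
  bits take 8, the pending bits 9, and the rank structure somewhat more than 1. In the coefficient
  5, the counters take 4 and the rank structure the rest. The summary and the stack give
  \<open>8 * (2 + 32) = 272\<close>.\<close>

lemma data_words_bound:
  assumes "256 \<le> w"
  shows "8 * (w * data_words) \<le> 19 * n + 5 * m + 272 * (n div sz) + 6000 * 4 ^ sz"
proof -
  have wb: "w * (L div (w div entry_width k)) \<le> 2 * (entry_width k * L)" for k L
    by (rule words_bound(1)[OF entry_width])
  note sz = sz_bounds(1) sz_bounds(3)[OF assms]
  let ?W = "\<lambda>k. w * (array_len k div (w div entry_width k))"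
  have lgx: "lg * x \<le> 16 * (sz * x)" for x using mult_le_mono1[OF lg_sz(1), of x] by (simp add: mult.assoc)
  have ds: "sz * (x div sz) \<le> x" for x by simp
  have b0: "?W 0 \<le> 8704 * 4 ^ sz div 16"
  proof -
    have "?W 0 \<le> 2 * (lg * (lg + 1))" using wb[where k = 0 and L = "array_len 0"] by (simp add: array_len_def entry_width_def)
    moreover have "lg * (lg + 1) \<le> 16 * (sz * (16 * sz + 1))"
      unfolding mult.assoc[symmetric] by (intro mult_le_mono add_mono lg_sz(1) order_refl)
    moreover have "16 * (sz * (16 * sz + 1)) \<le> 272 * 4 ^ sz"
    proof -
      have "16 * (sz * (16 * sz + 1)) = 256 * (sz * sz) + 16 * sz" by (simp add: algebra_simps)
      then show ?thesis using lg_sz(2,3) by linarith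
    qed
    ultimately show ?thesis by simp
  qed
  have b1: "?W 1 \<le> 2 * 4 ^ sz" "?W 2 \<le> 2 * 4 ^ sz"
    using wb[where k = 1 and L = "array_len 1"] wb[where k = 2 and L = "array_len 2"] lg_sz(4)
    by (simp_all add: array_len_def entry_width_def)
  have b3: "?W 3 \<le> n" by (simp add: array_len_def entry_width_def)
  have b4: "8 * ?W 4 \<le> 9 * n + 9 * 4 ^ sz"
  proof -
    have "8 * ?W 4 \<le> 9 * (sz * (n div sz + 1))"
      using words_bound(2)[of sz w "n div sz + 1"] sz by (simp add: array_len_def entry_width_def)
    also have "\<dots> \<le> 9 * n + 9 * 4 ^ sz" using ds[of n] lg_sz(3) unfolding distrib_left mult_1_right by linarith
    finally show ?thesis .
  qed
  have b5: "?W 5 \<le> 2 * (n div sz) + 2 * 4 ^ sz"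
  proof -
    have "?W 5 \<le> 2 * (sz * (n div sz div sz + 1))" using wb[where k = 5 and L = "array_len 5"] by (simp add: array_len_def entry_width_def)
    also have "\<dots> \<le> 2 * (n div sz) + 2 * 4 ^ sz" using ds[of "n div sz"] lg_sz(3) unfolding distrib_left mult_1_right by linarith
    finally show ?thesis .
  qed
  have b6: "?W 6 \<le> 32 * (n div sz) + 32 * 4 ^ sz"
  proof -
    have "?W 6 \<le> 2 * (lg * (n div sz div sz + 1))" using wb[where k = 6 and L = "array_len 6"] by (simp add: array_len_def entry_width_def)
    also have "\<dots> \<le> 32 * (sz * (n div sz div sz + 1))" using lgx[of "n div sz div sz + 1"] by simp
    also have "\<dots> \<le> 32 * (n div sz) + 32 * 4 ^ sz" using ds[of "n div sz"] lg_sz(3) unfolding distrib_left mult_1_right by linarith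
    finally show ?thesis .
  qed
  have b7: "?W 7 \<le> 2 * num_nodes + 2 * 4 ^ sz"
  proof -
    have "?W 7 \<le> 2 * (sz * (num_nodes div sz + 1))" using wb[where k = 7 and L = "array_len 7"] by (simp add: array_len_def entry_width_def)
    also have "\<dots> \<le> 2 * num_nodes + 2 * 4 ^ sz" using ds[of num_nodes] lg_sz(3) unfolding distrib_left mult_1_right by linarith
    finally show ?thesis .
  qed
  have b8: "?W 8 \<le> 32 * num_nodes + 32 * 4 ^ sz"
  proof -
    have "?W 8 \<le> 2 * (lg * (num_nodes div sz + 1))" using wb[where k = 8 and L = "array_len 8"] by (simp add: array_len_def entry_width_def)
    also have "\<dots> \<le> 32 * (sz * (num_nodes div sz + 1))" using lgx[of "num_nodes div sz + 1"] by simp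
    also have "\<dots> \<le> 32 * num_nodes + 32 * 4 ^ sz" using ds[of num_nodes] lg_sz(3) unfolding distrib_left mult_1_right by linarith
    finally show ?thesis .
  qed
  have b9: "?W 9 \<le> 256 * (num_nodes - groups)" by (simp add: array_len_def entry_width_def)
  have nn: "1024 * num_nodes \<le> 4 * n + 1020 + 2 * m" "2 * (256 * (num_nodes - groups)) \<le> m"
    using num_nodes_bound(1,2) groups_bounds(2) by linarith+
  have "{..<10::nat} = {0,1,2,3,4,5,6,7,8,9}" by auto
  then have "w * data_words = ?W 0 + ?W 1 + ?W 2 + ?W 3 + ?W 4 + ?W 5 + ?W 6 + ?W 7 + ?W 8 + ?W 9"
    unfolding data_words_def by (simp add: sum_distrib_left algebra_simps)
  then show ?thesis using b0 b1 b3 b4 b5 b6 b7 b8 b9 nn lg_sz(5) by linarith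
qed

lemma data_words_crude:
  assumes "256 \<le> w"
  shows "w * data_words \<le> 40 * (n + m) + 750 * 4 ^ sz"
proof -
  have "n div sz \<le> n" by simp
  then show ?thesis using data_words_bound[OF assms] unfolding distrib_left by linarith
qed

text \<open>From \<open>2 ^ 3200\<close> on, \<open>sz\<close> is at least 200, so
  \<open>272 * (n div sz)\<close> is below \<open>2 * n\<close> and fits into the gap between 19 and
  \<open>8 * 3\<close>.\<close>

lemma data_words_sharp:
  assumes "256 \<le> w" "2 ^ 3200 \<le> n + m"
  shows "w * data_words \<le> 3 * n + m + 750 * 4 ^ sz"
proof -
  have "n + m < 2 ^ lg" using lg_bounds(3) by linarith
  then have "(2::nat) ^ 3200 < 2 ^ lg" using assms(2) by linarith
  then have "3200 < lg" by (simp only: power_strict_increasing_iff one_less_numeral_iff semiring_norm)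
  then have "200 \<le> sz" unfolding sz_def by linarith
  then have "200 * (n div sz) \<le> sz * (n div sz)" by (rule mult_right_mono) simp
  also have "\<dots> \<le> n" by simp
  finally show ?thesis using data_words_bound[OF assms(1)] by linarith
qed

lemma array_base_less_word:
  assumes "256 \<le> w"
  shows "array_base 10 < 2 ^ w"
proof -
  have "256 * data_words \<le> w * data_words" using assms by (rule mult_right_mono) simp
  then have 1: "256 * data_words \<le> 40 * (n + m) + 750 * 4 ^ sz" using data_words_crude[OF assms] by linarith
  have "(4::nat) ^ sz = 2 ^ (2 * sz)" by (simp add: power_mult)
  then have "1024 * (4::nat) ^ sz = 2 ^ (10 + 2 * sz)" by (simp add: power_add)
  also have "\<dots> \<le> 2 ^ w" using sz_bounds(3)[OF assms] assms by (intro power_increasing) linarith+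
  finally have 2: "1024 * (4::nat) ^ sz \<le> 2 ^ w" .
  \<comment> \<open>The cells below the registers use at most half of the addresses; registers and
    arrays together fit into the other half.\<close>
  have "2 * reg_base = 2 ^ 256" by (simp add: reg_base_def flip: power_Suc)
  also have "\<dots> \<le> (2::nat) ^ w" using assms by (intro power_increasing) auto
  finally have 3: "2 * reg_base \<le> 2 ^ w" .
  have "(2::nat) ^ 17 \<le> 2 ^ w" using assms by (intro power_increasing) auto
  then have 4: "131072 \<le> (2::nat) ^ w" by simp
  show ?thesis unfolding array_base_10 using 1 2 3 4 size_bound unfolding distrib_left by linarith
qed

section \<open>Addresses for long and for short words\<close>

lemma entry_address:
  assumes "i < array_len k"
  shows "k < 10" "array_base k + i div (w div entry_width k) < array_base (k + 1)"
proof -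
  show "k < 10" using assms by (rule contrapos_pp) (simp add: array_len_def)
  have "i div (w div entry_width k) \<le> array_len k div (w div entry_width k)"
    using assms by (intro div_le_mono) simp
  then show "array_base k + i div (w div entry_width k) < array_base (k + 1)"
    by (simp add: Suc_eq_plus1[symmetric])
qed

lemma layout_large:
  assumes "256 \<le> w"
  shows "layout w I (array_base 10) array_base entry_width array_len"
proof (unfold_locales, goal_cases)
  case 1
  show ?case by (rule w_positive)
next
  case 2
  show ?case by (rule cells_I)
next
  case 3
  show ?case using array_base_mono[of 0 10] by (simp add: heap_base_def del: array_base.simps(2))
next
  case (4 k)
  show ?case by (rule entry_width)
next
  case (5 k)
  show ?case by (rule entry_width)
next
  case (6 i k)
  then show ?case using entry_address[OF 6] array_base_mono[of "k + 1" 10] by (simp add: machine.adr_def)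
next
  case (7 i k)
  then show ?case using entry_address[OF 7] array_base_mono[of "k + 1" 10] array_base_less_word[OF assms]
    by (simp add: machine.adr_def)
next
  case (8 i k)
  then show ?case using array_base_mono[of 0 k] by (simp add: machine.adr_def heap_base_def)
next
  case (9 i k i' k')
  then consider "k < k'" | "k' < k" by linarith
  then show ?case
  proof cases
    case 1
    then show ?thesis using entry_address(2)[OF 9(1)] array_base_mono[of "k + 1" k'] by (simp add: machine.adr_def)
  next
    case 2
    then show ?thesis using entry_address(2)[OF 9(2)] array_base_mono[of "k' + 1" k] by (simp add: machine.adr_def)
  qed
qed

text \<open>One bit per vertex, starting at cell 0: since \<open>n < 2 ^ w <= reg_base\<close>, the
  array is addressable with short words and cannot reach the registers.\<close>

lemma layout_small:
  assumes "w < 256"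
  shows "layout w I (reg_base + 300) (\<lambda>_. 0) (\<lambda>_. 1) (\<lambda>k. if k = 10 then n else 0)"
proof -
  have p: "(2::nat) ^ w \<le> reg_base" unfolding reg_base_def using assms by (intro power_increasing) auto
  have i: "i div w < 2 ^ w" if "i < n" for i
  proof -
    have "i div w \<le> i" by simp
    then show ?thesis using that size_bound by linarith
  qed
  show ?thesis
    by unfold_locales (use w_positive cells_I i p in \<open>fastforce simp: machine.adr_def split: if_splits\<close>)+
qed

section \<open>Runs of the compiled program\<close>

definition answers :: "nat list \<Rightarrow> bool \<Rightarrow> bool" where
  "answers out b \<longleftrightarrow> (b \<longleftrightarrow> degenerate d {..<n} E) \<and> (b \<longrightarrow> degenerate_order d {..<n} E out)"

lemma eight_halves: "w div 2 div 2 div 2 div 2 div 2 div 2 div 2 div 2 = w div 256"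
  by (simp flip: div_mult2_eq)

lemma one_less_pow_w: "1 < (2 :: nat) ^ w"
  using w_positive by (intro one_less_power) auto

lemma runs_small:
  assumes "w < 256"
  shows "\<exists>t out b. runs_in machine_code w I (reg_base + 300) t out b \<and>
    t \<le> csize program * small_time + 2 \<and> answers out b"
proof -
  interpret layout w I "reg_base + 300" "\<lambda>_. 0" "\<lambda>_. 1" "\<lambda>k. if k = 10 then n else 0"
    by (rule layout_small[OF assms])
  interpret run w d n m E I A "reg_base + 300" "\<lambda>_. 0" "\<lambda>_. 1" "\<lambda>k. if k = 10 then n else 0" ..
  let ?T = "(4 * n + 20) * (n + 1) * (n + 1)"
  let ?Q = "\<lambda>\<sigma> (\<alpha> :: nat \<Rightarrow> nat \<Rightarrow> nat) os t. t \<le> Suc 0 + ?T + 20 \<and>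
     (\<sigma> res \<noteq> 0 \<longleftrightarrow> degenerate d {..<n} E) \<and> (\<sigma> res \<noteq> (0 :: nat) \<longrightarrow> degenerate_order d {..<n} E os)"
  have z: "w div 2 div 2 div 2 div 2 div 2 div 2 div 2 div 2 = 0" using eight_halves assms by simp
  have "wp naive ?Q (\<lambda>_. 0) (\<lambda>_ _. 0) [] (Suc 0)" by (rule wp_naive) auto
  then have w: "wp program ?Q (\<lambda>_. 0) (\<lambda>_ _. 0) [] 0"
    unfolding program_def wp_Cond using z one_less_pow_w by auto
  have p: "(2::nat) ^ w \<le> reg_base" unfolding reg_base_def using assms by (intro power_increasing) auto
  then have n: "n \<le> reg_base" using size_bound by linarith
  have "?T \<le> (4 * reg_base + 20) * (reg_base + 1) * (reg_base + 1)"
    using n by (intro mult_le_mono add_mono) auto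
  then have T: "1 + ?T + 20 \<le> small_time" by (simp add: small_time_def)
  show ?thesis unfolding machine_code_def
    by (rule run_comp[OF w shallow_program, where r = res and T = small_time and R = answers])
       (use T in \<open>auto simp: answers_def\<close>)
qed

lemma runs_large:
  assumes "256 \<le> w"
  shows "\<exists>t out b. runs_in machine_code w I (array_base 10) t out b \<and>
    t \<le> csize program * (20000 * (n + m + 1)) + 2 \<and> answers out b"
proof -
  interpret layout w I "array_base 10" array_base entry_width array_len
    by (rule layout_large[OF assms])
  interpret run w d n m E I A "array_base 10" array_base entry_width array_len ..
  interpret main_run w d n m E I A "array_base 10" array_base entry_width array_len
    by unfold_locales (use assms array_base_less_word[OF assms] in auto)
  have z: "w div 2 div 2 div 2 div 2 div 2 div 2 div 2 div 2 \<noteq> 0"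
    unfolding eight_halves using assms by (simp add: div_greater_zero_iff)
  have w: "wp program (\<lambda>\<sigma> \<alpha> os t. t \<le> 20000 * (n + m + 1) \<and>
     (\<sigma> res \<noteq> 0 \<longleftrightarrow> degenerate d {..<n} E) \<and> (\<sigma> res \<noteq> 0 \<longrightarrow> degenerate_order d {..<n} E os))
     (\<lambda>_. 0) (\<lambda>_ _. 0) [] 0"
    unfolding program_def wp_Cond using z one_less_pow_w wp_main_part by (simp add: One_nat_def)
  show ?thesis unfolding machine_code_def
    by (rule run_comp[OF w shallow_program, where r = res and R = answers]) (auto simp: answers_def)
qed

lemma four_pow_sz: "real (4 ^ sz) \<le> 4 * sqrt (4 * real (m + n) + 2)"
proof -
  have "(4 ^ sz) ^ 2 \<le> 16 * (4 * (m + n) + 2)" by (rule order_trans[OF sixteen_sz]) simp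
  then have "real ((4 ^ sz) ^ 2) \<le> real (16 * (4 * (m + n) + 2))" by (simp only: of_nat_le_iff)
  then have "(real (4 ^ sz)) ^ 2 \<le> 16 * (4 * real (m + n) + 2)" by simp
  then have "real (4 ^ sz) \<le> sqrt (16 * (4 * real (m + n) + 2))" by (rule real_le_rsqrt)
  moreover have "sqrt 16 = (4 :: real)" by (rule real_sqrt_unique) auto
  ultimately show ?thesis by (simp only: real_sqrt_mult)
qed

end

lemma sqrt_smallo: "(\<lambda>s. sqrt (4 * real s + 2)) \<in> o(\<lambda>s. real s)"
proof (rule landau_o.smallI)
  fix c :: real assume c: "c > 0"
  show "\<forall>\<^sub>F s in sequentially. norm (sqrt (4 * real s + 2)) \<le> c * norm (real s)"
    \<comment> \<open>For \<open>s >= 1\<close> the radicand is at most \<open>6 * s\<close>, and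
      this is at most the square of \<open>c * s\<close> as soon as \<open>s\<close> is at least 6
      divided by the square of \<open>c\<close>.\<close>
    using eventually_ge_at_top[of "nat \<lceil>6 / c\<^sup>2\<rceil> + 1"]
  proof eventually_elim
    case (elim s)
    then have s: "6 / c\<^sup>2 \<le> real s" "1 \<le> real s" by linarith+
    then have "6 \<le> c\<^sup>2 * real s" using c by (simp add: field_simps)
    then have "6 * real s \<le> c\<^sup>2 * real s * real s" using s(2) by (intro mult_right_mono) auto
    moreover have "c\<^sup>2 * real s * real s = (c * real s)\<^sup>2" by (simp add: power2_eq_square)
    ultimately have "4 * real s + 2 \<le> (c * real s)\<^sup>2" using s(2) by linarith
    then have "sqrt (4 * real s + 2) \<le> c * real s" using c by (intro real_le_lsqrt) auto
    then show ?case by simp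
  qed
qed

theorem theorem13:
  shows "\<exists>(P :: instr list) (g :: nat \<Rightarrow> real). g \<in> O(\<lambda>s. real s) \<and>
    (\<forall>W :: nat \<Rightarrow> real. W \<in> o(\<lambda>s. real s) \<longrightarrow>
      (\<exists>f :: nat \<Rightarrow> real. f \<in> o(\<lambda>s. real s) \<and>
        (\<forall>(d :: nat) (n :: nat) (m :: nat) (E :: nat set set) (w :: nat) (I :: nat list).
          simple_graph {..<n} E \<and> m = card E \<and>
          adjacency_list_input w d n E I \<and> real w \<le> W (m + n) \<longrightarrow>
          (\<exists>(S :: nat) (t :: nat) (out :: nat list) (b :: bool).
            runs_in P w I S t out b \<and>
            real (S * w) \<le> real m + 3 * real n + f (m + n) \<and>
            real t \<le> g (m + n) \<and>
            (b \<longleftrightarrow> degenerate d {..<n} E) \<and>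
            (b \<longrightarrow> degenerate_order d {..<n} E out)))))"
proof -
  define g :: "nat \<Rightarrow> real" where
    "g s = real (csize program * (20000 * (s + 1) + small_time) + 2)" for s
  \<comment> \<open>The three terms are a constant number of words of at most \<open>W s\<close>
    bits, the lower-order term \<open>750 * 4 ^ sz\<close> with \<open>4 ^ sz\<close> at most four
    times the square root, and a correction for the finitely many sizes below
    \<open>2 ^ 3200\<close>, where only the crude bound holds.\<close>
  define f :: "(nat \<Rightarrow> real) \<Rightarrow> nat \<Rightarrow> real" where
    "f W s = real (reg_base + 310) * W s + 3000 * sqrt (4 * real s + 2) + (if s < 2 ^ 3200 then 40 * real s else 0)" for W s
  have g: "g \<in> O(\<lambda>s. real s)"
  proof (rule landau_o.bigI[where c = "real (csize program * (40000 + small_time) + 2)"])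
    show "\<forall>\<^sub>F s in sequentially. norm (g s) \<le> real (csize program * (40000 + small_time) + 2) * norm (real s)"
      using eventually_ge_at_top[of 1]
    proof eventually_elim
      case (elim s)
      have "20000 * (s + 1) + small_time \<le> (40000 + small_time) * s"
      proof -
        have "small_time * 1 \<le> small_time * s" using elim by (rule mult_left_mono) simp
        then show ?thesis using elim unfolding distrib_left distrib_right by linarith
      qed
      then have "csize program * (20000 * (s + 1) + small_time) \<le> csize program * ((40000 + small_time) * s)"
        by (rule mult_left_mono) simp
      then have "csize program * (20000 * (s + 1) + small_time) + 2 \<le> (csize program * (40000 + small_time) + 2) * s"
        using elim unfolding distrib_right mult.assoc by linarith
      then have "g s \<le> real ((csize program * (40000 + small_time) + 2) * s)" unfolding g_def by (simp only: of_nat_le_iff)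
      moreover have "0 \<le> g s" unfolding g_def by simp
      ultimately show ?case by simp
    qed
  qed (unfold of_nat_0_less_iff, rule add_nonneg_pos, simp_all)
  have f: "f W \<in> o(\<lambda>s. real s)" if "W \<in> o(\<lambda>s. real s)" for W
  proof -
    have "(\<lambda>s :: nat. if s < k then 40 * real s else 0) \<in> o(\<lambda>s. real s)" for k
    proof (rule landau_o.smallI)
      fix c :: real assume "c > 0"
      then show "\<forall>\<^sub>F s in sequentially. norm (if s < k then 40 * real s else 0) \<le> c * norm (real s)"
        by (intro eventually_mono[OF eventually_ge_at_top[of k]]) simp
    qed
    moreover have "(\<lambda>s. real (reg_base + 310) * W s) \<in> o(\<lambda>s. real s)" "(\<lambda>s. 3000 * sqrt (4 * real s + 2)) \<in> o(\<lambda>s. real s)"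
      using that sqrt_smallo by simp_all
    ultimately show ?thesis unfolding f_def[abs_def] by (intro sum_in_smallo)
  qed
  have main: "\<exists>S t out b. runs_in machine_code w I S t out b \<and> real (S * w) \<le> real m + 3 * real n + f W (m + n) \<and>
      real t \<le> g (m + n) \<and> (b \<longleftrightarrow> degenerate d {..<n} E) \<and> (b \<longrightarrow> degenerate_order d {..<n} E out)"
    if G: "simple_graph {..<n} E" "m = card E" "adjacency_list_input w d n E I" "real w \<le> W (m + n)"
    for W d n m E w I
  proof -
    from G(3) obtain A where A: "distinct ([0..<n + 2] @ concat (map (\<lambda>p. [p, p + 1]) (concat (map A [0..<n]))))"
       "\<forall>v<n. linked_list I (I ! (2 + v)) (A v) \<and> distinct (map ((!) I) (A v)) \<and> set (map ((!) I) (A v)) = neighbours E v"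
      unfolding adjacency_list_input_def by blast
    interpret input w d n m E I A
      by unfold_locales (use G A in \<open>auto simp: adjacency_list_input_def\<close>)
    have c0: "real (reg_base + 310) * real w \<le> real (reg_base + 310) * W (m + n)"
      using G(4) by (intro mult_left_mono) auto
    have sq: "0 \<le> sqrt (4 * real (m + n) + 2)" by simp
    show ?thesis
    proof (cases "w < 256")
      case True
      from runs_small[OF True] obtain t out b where
        r: "runs_in machine_code w I (reg_base + 300) t out b" "t \<le> csize program * small_time + 2" "answers out b"
        by blast
      have "(reg_base + 300) * w \<le> (reg_base + 310) * w" by (intro mult_right_mono) auto
      then have "real ((reg_base + 300) * w) \<le> real (reg_base + 310) * real w"
        by (simp only: of_nat_le_iff flip: of_nat_mult)
      moreover have "0 \<le> (if m + n < 2 ^ 3200 then 40 * real (m + n) else 0)" by simp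
      ultimately have "real ((reg_base + 300) * w) \<le> real m + 3 * real n + f W (m + n)"
        using c0 sq unfolding f_def by linarith
      moreover have "csize program * small_time \<le> csize program * (20000 * (m + n + 1) + small_time)"
        by (intro mult_left_mono) auto
      then have "t \<le> csize program * (20000 * (m + n + 1) + small_time) + 2" using r(2) by linarith
      then have "real t \<le> g (m + n)" unfolding g_def by (simp only: of_nat_le_iff)
      ultimately show ?thesis using r(1,3) unfolding answers_def by blast
    next
      case False
      then have large: "256 \<le> w" by simp
      from runs_large[OF large] obtain t out b where
        r: "runs_in machine_code w I (array_base 10) t out b" "t \<le> csize program * (20000 * (n + m + 1)) + 2" "answers out b"
        by blast
      have "w * data_words \<le> 3 * n + m + 750 * 4 ^ sz + (if m + n < 2 ^ 3200 then 40 * (m + n) else 0)"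
        using data_words_sharp[OF large] data_words_crude[OF large] by (auto simp: add.commute)
      then have "array_base 10 * w \<le> (reg_base + 310) * w + (3 * n + m + 750 * 4 ^ sz + (if m + n < 2 ^ 3200 then 40 * (m + n) else 0))"
        unfolding array_base_10 distrib_right by (simp add: mult.commute)
      then have "real (array_base 10 * w) \<le> real ((reg_base + 310) * w + (3 * n + m + 750 * 4 ^ sz + (if m + n < 2 ^ 3200 then 40 * (m + n) else 0)))"
        by (simp only: of_nat_le_iff)
      also have "\<dots> = real (reg_base + 310) * real w + 3 * real n + real m + 750 * real (4 ^ sz) + (if m + n < 2 ^ 3200 then 40 * real (m + n) else 0)"
        by simp
      also have "\<dots> \<le> real m + 3 * real n + f W (m + n)"
        using c0 four_pow_sz unfolding f_def by linarith
      finally have "real (array_base 10 * w) \<le> real m + 3 * real n + f W (m + n)" .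
      moreover have "csize program * (20000 * (n + m + 1)) \<le> csize program * (20000 * (m + n + 1) + small_time)"
        by (intro mult_left_mono) auto
      then have "t \<le> csize program * (20000 * (m + n + 1) + small_time) + 2" using r(2) by linarith
      then have "real t \<le> g (m + n)" unfolding g_def by (simp only: of_nat_le_iff)
      ultimately show ?thesis using r(1,3) unfolding answers_def by blast
    qed
  qed
  show ?thesis
    using g f main by blast
qed

end
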